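(* Let $q\ge4$, $\alpha\in W^{1,\infty}(\partial B(0,a))$, $\nabla f\in W^{1,\infty}(\Omega)$, $\nu a^{-1}+\alpha\ge0$ on $\partial B(0,a)$, and $(\mathbf{u}_0,\rho_0)\in H^2(\Omega)\times L^q(\Omega)$ with $\nabla\cdot\mathbf{u}_0=0$. Let $(\mathbf{u},\rho,P)$ be the solution of $$\partial_t\mathbf{u}+(\mathbf{u}\cdot\nabla)\mathbf{u}=\nu\Delta\mathbf{u}-\frac1{\rho^*}\nabla P-\frac{\rho}{\rho^*}\nabla f,\qquad \partial_t\rho+(\mathbf{u}\cdot\nabla)\rho=-\mathbf{u}\cdot\nabla\rho_s,\qquad\nabla\cdot\mathbf{u}=0\quad\text{in }\Omega,$$ with $\mathbf{u}|_{t=0}=\mathbf{u}_0$, $\rho|_{t=0}=\rho_0$, subject to the boundary conditions $$\mathbf{u}\cdot\mathbf{n}=0\ \text{ on } x^2+y^2=a^2,\qquad \mathbf{u}\cdot\mathbf{n}=\nabla\times\mathbf{u}=0\ \text{ on } x^2+y^2=b^2,$$ $$\Big[\Big(-\frac{P}{\rho^*}\mathbf{I}+\nu\big(\nabla\mathbf{u}+(\nabla\mathbf{u})^{T}\big)\Big)\mathbf{n}\Big]\cdot\boldsymbol{\tau}+\alpha\,\mathbf{u}\cdot\boldsymbol{\tau}=0\ \text{ on } x^2+y^2=a^2.$$ Then: (1) $\displaystyle\int_\Omega\rho f\,d\mathbf{x}\to0$ as $t\to\infty$ if and only if there exist $\gamma>0$ and $\beta\in\mathbb{R}$ such that $$\|\rho_0+\rho_s+\gamma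 f-\beta\|_{L^2}^2-\lim_{t\to+\infty}\|\rho(t)+\rho_s+\gamma f-\beta\|_{L^2}^2=2\gamma\int_\Omega\rho_0f\,d\mathbf{x}.$$ (2) For $\gamma>0$ and $\beta\in\mathbb{R}$, one has $$\|\rho(t)+\rho_s-(-\gamma f+\beta)\|_{L^2}\to0,\quad t\to\infty,$$ if and only if $\gamma$ and $\beta$ are such that $$\lim_{t\to\infty}2\gamma\int_\Omega(\rho_0-\rho(t))f\,d\mathbf{x}=\|\rho_0+\rho_s+\gamma f-\beta\|_{L^2}^2.$$
   Context: Let $0<a<b$, $B(0,r)$ the disc of radius $r$ centred at the origin, and $\Omega=\{(x,y)\in\mathbb{R}^2: a^2<x^2+y^2<b^2\}$. $\mathbf{n}$ is the outward unit normal to $\partial\Omega$, $\boldsymbol{\tau}$ a unit tangent vector, $\nu>0$ and $\rho^*>0$ constants, $\alpha$ a given real function on $\partial B(0,a)$, $f$ a given gravitational potential, and $\nabla\times\mathbf{u}=\partial_xu_2-\partial_yu_1$. $\rho_s$ is a given smooth hydrostatic density profile on $\overline\Omega$ (stable or unstable): there is $P_s$ with $\nabla P_s=-\rho_s\nabla f$. The unknowns $(\mathbf{u},\rho,P)$ are the perturbations of the steady state $(\mathbf{0},\rho_s,P_s)$, and solutions are global-in-time. The initial velocity $\mathbf{u}_0$ is assumed to satisfy the boundary conditions. *)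

theory Defs
  imports "HOL-Analysis.Analysis"
begin

section \<open>Smooth functions and weak derivatives\<close>

primrec C_k_on :: "nat \<Rightarrow> 'a::euclidean_space set \<Rightarrow> ('a \<Rightarrow> real) \<Rightarrow> bool" where
  "C_k_on 0 U g \<longleftrightarrow> continuous_on U g"
| "C_k_on (Suc k) U g \<longleftrightarrow>
     (\<forall>x\<in>U. g differentiable (at x)) \<and>
     (\<forall>b\<in>Basis. C_k_on k U (\<lambda>x. frechet_derivative g (at x) b))"

definition smooth :: "('a::euclidean_space \<Rightarrow> real) \<Rightarrow> bool" where
  "smooth g \<longleftrightarrow> (\<forall>k. C_k_on k UNIV g)"

definition smooth_up_to_boundary :: "'a::euclidean_space set \<Rightarrow> ('a \<Rightarrow> real) \<Rightarrow> bool" where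
  "smooth_up_to_boundary U g \<longleftrightarrow> (\<exists>h. smooth h \<and> (\<forall>x\<in>closure U. g x = h x))"

definition test_function :: "'a::euclidean_space set \<Rightarrow> ('a \<Rightarrow> real) \<Rightarrow> bool" where
  "test_function U \<phi> \<longleftrightarrow>
     smooth \<phi> \<and> compact (closure {x. \<phi> x \<noteq> 0}) \<and> closure {x. \<phi> x \<noteq> 0} \<subseteq> U"

definition loc_integrable :: "'a::euclidean_space set \<Rightarrow> ('a \<Rightarrow> real) \<Rightarrow> bool" where
  "loc_integrable U g \<longleftrightarrow> (\<forall>K. compact K \<and> K \<subseteq> U \<longrightarrow> integrable (lebesgue_on K) g)"

text \<open>\<open>has_weak_deriv U b g h\<close>: on the open set \<open>U\<close>, \<open>h\<close> is the distributional derivative of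
  \<open>g\<close> in the direction \<open>b\<close>.\<close>

definition has_weak_deriv ::
  "'a::euclidean_space set \<Rightarrow> 'a \<Rightarrow> ('a \<Rightarrow> real) \<Rightarrow> ('a \<Rightarrow> real) \<Rightarrow> bool" where
  "has_weak_deriv U b g h \<longleftrightarrow>
     loc_integrable U g \<and> loc_integrable U h \<and>
     (\<forall>\<phi>. test_function U \<phi> \<longrightarrow>
        (\<integral>x. g x * frechet_derivative \<phi> (at x) b \<partial>lebesgue_on U)
          = - (\<integral>x. h x * \<phi> x \<partial>lebesgue_on U))"

text \<open>A representative of the weak derivative, which is unique up to null sets.  It is only used
  where existence is required as well.\<close>

definition weak_deriv ::
  "'a::euclidean_space set \<Rightarrow> 'a \<Rightarrow> ('a \<Rightarrow> real) \<Rightarrow> 'a \<Rightarrow> real" where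
  "weak_deriv U b g = (SOME h. has_weak_deriv U b g h)"

section \<open>Lebesgue and Sobolev spaces\<close>

definition Lspace :: "ereal \<Rightarrow> 'a::euclidean_space set \<Rightarrow> ('a \<Rightarrow> real) set" where
  "Lspace p U = {g \<in> borel_measurable (lebesgue_on U).
     if p = \<infinity> then \<exists>C. AE x in lebesgue_on U. \<bar>g x\<bar> \<le> C
     else integrable (lebesgue_on U) (\<lambda>x. \<bar>g x\<bar> powr real_of_ereal p)}"

primrec Wspace :: "nat \<Rightarrow> ereal \<Rightarrow> 'a::euclidean_space set \<Rightarrow> ('a \<Rightarrow> real) set" where
  "Wspace 0 p U = Lspace p U"
| "Wspace (Suc k) p U =
     {g \<in> Lspace p U. \<forall>b\<in>Basis. \<exists>h \<in> Wspace k p U. has_weak_deriv U b g h}"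

definition L2norm :: "'a::euclidean_space set \<Rightarrow> ('a \<Rightarrow> real) \<Rightarrow> real" where
  "L2norm U g = sqrt (\<integral>x. (g x)\<^sup>2 \<partial>lebesgue_on U)"

text \<open>The square of a norm of \<open>W\<^bsup>k,2\<^esup>\<close>: mixed derivatives are counted with multiplicity, which
  gives a norm equivalent to the usual one.\<close>

primrec Hnorm_sq :: "nat \<Rightarrow> 'a::euclidean_space set \<Rightarrow> ('a \<Rightarrow> real) \<Rightarrow> real" where
  "Hnorm_sq 0 U g = (L2norm U g)\<^sup>2"
| "Hnorm_sq (Suc k) U g = (L2norm U g)\<^sup>2 + (\<Sum>b\<in>Basis. Hnorm_sq k U (weak_deriv U b g))"

definition jointly_measurable :: "'a::euclidean_space set \<Rightarrow> (real \<Rightarrow> 'a \<Rightarrow> real) \<Rightarrow> bool" where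
  "jointly_measurable U g \<longleftrightarrow>
     (\<lambda>(t, x). g t x) \<in> borel_measurable (lebesgue_on ({0<..} \<times> U))"

text \<open>\<open>g\<close> belongs to \<open>L\<^sup>\<infinity>(0,T; W\<^bsup>k,2\<^esup>(U))\<close> for every finite \<open>T\<close>.\<close>

definition Linf_loc_H :: "nat \<Rightarrow> 'a::euclidean_space set \<Rightarrow> (real \<Rightarrow> 'a \<Rightarrow> real) \<Rightarrow> bool" where
  "Linf_loc_H k U g \<longleftrightarrow> jointly_measurable U g \<and>
     (\<forall>T>0. \<exists>C. AE t in lebesgue_on {0<..<T}. g t \<in> Wspace k 2 U \<and> Hnorm_sq k U (g t) \<le> C)"

section \<open>Planar vector calculus\<close>

definition classical_grad :: "(real^2 \<Rightarrow> real) \<Rightarrow> real^2 \<Rightarrow> real^2" where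
  "classical_grad g x = (\<chi> j. frechet_derivative g (at x) (axis j 1))"

definition grad :: "(real^2) set \<Rightarrow> (real^2 \<Rightarrow> real) \<Rightarrow> real^2 \<Rightarrow> real^2" where
  "grad U g x = (\<chi> j. weak_deriv U (axis j 1) g x)"

definition jacobian :: "(real^2) set \<Rightarrow> (real^2 \<Rightarrow> real^2) \<Rightarrow> real^2 \<Rightarrow> real^2^2" where
  "jacobian U v x = (\<chi> i j. weak_deriv U (axis j 1) (\<lambda>y. v y $ i) x)"

definition divergence :: "(real^2) set \<Rightarrow> (real^2 \<Rightarrow> real^2) \<Rightarrow> real^2 \<Rightarrow> real" where
  "divergence U v x = (\<Sum>i\<in>UNIV. weak_deriv U (axis i 1) (\<lambda>y. v y $ i) x)"

definition laplacian :: "(real^2) set \<Rightarrow> (real^2 \<Rightarrow> real^2) \<Rightarrow> real^2 \<Rightarrow> real^2" where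
  "laplacian U v x =
     (\<chi> i. \<Sum>j\<in>UNIV. weak_deriv U (axis j 1) (weak_deriv U (axis j 1) (\<lambda>y. v y $ i)) x)"

text \<open>The velocity component \<open>u\<^sub>i\<close> is differentiated in time on the space-time cylinder.\<close>

definition time_deriv ::
  "(real^2) set \<Rightarrow> (real \<Rightarrow> real^2 \<Rightarrow> real^2) \<Rightarrow> real \<Rightarrow> real^2 \<Rightarrow> real^2" where
  "time_deriv U u t x =
     (\<chi> i. weak_deriv ({0<..} \<times> U) (1, 0) (\<lambda>(s, y). u s y $ i) (t, x))"

section \<open>The annulus, its boundary, and traces\<close>

definition annulus :: "real \<Rightarrow> real \<Rightarrow> (real^2) set" where
  "annulus a b = {x. a\<^sup>2 < (x$1)\<^sup>2 + (x$2)\<^sup>2 \<and> (x$1)\<^sup>2 + (x$2)\<^sup>2 < b\<^sup>2}"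

definition circ :: "real \<Rightarrow> real \<Rightarrow> real^2" where
  "circ r \<theta> = vector [r * cos \<theta>, r * sin \<theta>]"

definition AE_circle :: "real \<Rightarrow> (real^2 \<Rightarrow> bool) \<Rightarrow> bool" where
  "AE_circle r Q \<longleftrightarrow> (AE \<theta> in lebesgue_on {0..2*pi}. Q (circ r \<theta>))"

definition outward_normal :: "real \<Rightarrow> real^2 \<Rightarrow> real^2" where
  "outward_normal a x = (if norm x = a then - (x /\<^sub>R norm x) else x /\<^sub>R norm x)"

definition tangent :: "real \<Rightarrow> real^2 \<Rightarrow> real^2" where
  "tangent a x = vector [- (outward_normal a x $ 2), outward_normal a x $ 1]"

text \<open>\<open>W\<^bsup>1,\<infinity>\<^esup>\<close> of a circle, with respect to arc length: the derivative is taken on the universal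
  cover, so that no boundary point is created by the parametrisation.\<close>

definition W1inf_circle :: "real \<Rightarrow> (real^2 \<Rightarrow> real) \<Rightarrow> bool" where
  "W1inf_circle r h \<longleftrightarrow> (\<lambda>s. h (circ r (s / r))) \<in> Wspace 1 \<infinity> (UNIV :: real set)"

text \<open>\<open>h\<close> is the boundary trace of \<open>g \<in> H\<^sup>1\<close>: the limit in \<open>L\<^sup>2\<close> of both boundary circles
  of the boundary values of smooth functions that converge to \<open>g\<close> in \<open>H\<^sup>1\<close>.\<close>

definition has_trace ::
  "real \<Rightarrow> real \<Rightarrow> (real^2 \<Rightarrow> real) \<Rightarrow> (real^2 \<Rightarrow> real) \<Rightarrow> bool" where
  "has_trace a b g h \<longleftrightarrow>
     g \<in> Wspace 1 2 (annulus a b) \<and>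
     (\<forall>r\<in>{a, b}. (\<lambda>\<theta>. h (circ r \<theta>)) \<in> Lspace 2 {0..2*pi}) \<and>
     (\<exists>\<phi> :: nat \<Rightarrow> real^2 \<Rightarrow> real. (\<forall>k. smooth (\<phi> k)) \<and>
        (\<lambda>k. Hnorm_sq 1 (annulus a b) (\<lambda>x. \<phi> k x - g x)) \<longlonglongrightarrow> 0 \<and>
        (\<forall>r\<in>{a, b}.
           (\<lambda>k. L2norm {0..2*pi} (\<lambda>\<theta>. \<phi> k (circ r \<theta>) - h (circ r \<theta>))) \<longlonglongrightarrow> 0))"

section \<open>The boundary conditions and the Boussinesq system\<close>

text \<open>Here \<open>w\<close>, \<open>G\<close>, \<open>\<pi>\<close> are the boundary traces of the velocity \<open>v\<close>, of its Jacobian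
  (\<open>G $ i $ j\<close> belongs to \<open>\<partial>\<^sub>j v\<^sub>i\<close>) and of the pressure \<open>p\<close>, so \<open>G $ 2 $ 1 - G $ 1 $ 2\<close> is the
  boundary value of the vorticity.  The slip condition is insensitive to the orientation of the
  tangent, and \<open>p\<close> drops out of it because normal and tangent are orthogonal.\<close>

definition boundary_conditions ::
  "real \<Rightarrow> real \<Rightarrow> real \<Rightarrow> real \<Rightarrow> (real^2 \<Rightarrow> real)
     \<Rightarrow> (real^2 \<Rightarrow> real^2) \<Rightarrow> (real^2 \<Rightarrow> real) \<Rightarrow> bool" where
  "boundary_conditions a b \<nu> \<rho>star \<alpha> v p \<longleftrightarrow>
     (\<exists>(w :: real^2 \<Rightarrow> real^2) (G :: real^2 \<Rightarrow> real^2^2) (\<pi> :: real^2 \<Rightarrow> real).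
        (\<forall>i. has_trace a b (\<lambda>x. v x $ i) (\<lambda>x. w x $ i)) \<and>
        (\<forall>i j. has_trace a b (\<lambda>x. jacobian (annulus a b) v x $ i $ j) (\<lambda>x. G x $ i $ j)) \<and>
        has_trace a b p \<pi> \<and>
        AE_circle a (\<lambda>x. w x \<bullet> outward_normal a x = 0) \<and>
        AE_circle b (\<lambda>x. w x \<bullet> outward_normal a x = 0 \<and> G x $ 2 $ 1 - G x $ 1 $ 2 = 0) \<and>
        AE_circle a (\<lambda>x.
          ((- (\<pi> x / \<rho>star) *\<^sub>R mat 1 + \<nu> *\<^sub>R (G x + transpose (G x))) *v outward_normal a x)
              \<bullet> tangent a x
            + \<alpha> x * (w x \<bullet> tangent a x) = 0))"

definition momentum_equation ::
  "(real^2) set \<Rightarrow> real \<Rightarrow> real \<Rightarrow> (real^2 \<Rightarrow> real)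
     \<Rightarrow> (real \<Rightarrow> real^2 \<Rightarrow> real^2) \<Rightarrow> (real \<Rightarrow> real^2 \<Rightarrow> real) \<Rightarrow> (real \<Rightarrow> real^2 \<Rightarrow> real) \<Rightarrow> bool" where
  "momentum_equation U \<nu> \<rho>star f u \<rho> P \<longleftrightarrow>
     (AE t in lebesgue_on {0<..}. AE x in lebesgue_on U.
        time_deriv U u t x + jacobian U (u t) x *v u t x
          = \<nu> *\<^sub>R laplacian U (u t) x - (1 / \<rho>star) *\<^sub>R grad U (P t) x
            - (\<rho> t x / \<rho>star) *\<^sub>R grad U f x)"

definition density_equation ::
  "(real^2) set \<Rightarrow> (real^2 \<Rightarrow> real) \<Rightarrow> (real^2 \<Rightarrow> real)
     \<Rightarrow> (real \<Rightarrow> real^2 \<Rightarrow> real^2) \<Rightarrow> (real \<Rightarrow> real^2 \<Rightarrow> real) \<Rightarrow> bool" where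
  "density_equation U \<rho>s \<rho>0 u \<rho> \<longleftrightarrow>
     (\<forall>\<phi>. test_function U \<phi> \<longrightarrow> (\<forall>t\<ge>0.
        (\<integral>x. \<rho> t x * \<phi> x \<partial>lebesgue_on U) = (\<integral>x. \<rho>0 x * \<phi> x \<partial>lebesgue_on U)
          + (\<integral>s. (\<integral>x. \<rho> s x * (u s x \<bullet> classical_grad \<phi> x)
                     - (u s x \<bullet> classical_grad \<rho>s x) * \<phi> x \<partial>lebesgue_on U)
              \<partial>lebesgue_on {0..t})))"

text \<open>Global-in-time solutions for data \<open>u0 \<in> H\<^sup>2\<close>, \<open>\<rho>0 \<in> L\<^sup>q\<close>.  The momentum equation holds almost
  everywhere.  The density is merely \<open>L\<^sup>q\<close> in space, so its equation, in divergence form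
  (\<open>\<nabla> \<cdot> u = 0\<close>), holds in the sense of distributions; as usual, \<open>\<rho>(t)\<close> denotes the weakly continuous
  representative, for which the equation integrated over \<open>[0,t]\<close>, with the initial datum included,
  is valid for every \<open>t \<ge> 0\<close>.  The pressure is determined only up to a function of time, so no
  bound in time is imposed on it.\<close>

definition boussinesq_solution ::
  "real \<Rightarrow> real \<Rightarrow> real \<Rightarrow> real \<Rightarrow> (real^2 \<Rightarrow> real) \<Rightarrow> (real^2 \<Rightarrow> real) \<Rightarrow> (real^2 \<Rightarrow> real) \<Rightarrow> real
     \<Rightarrow> (real^2 \<Rightarrow> real^2) \<Rightarrow> (real^2 \<Rightarrow> real)
     \<Rightarrow> (real \<Rightarrow> real^2 \<Rightarrow> real^2) \<Rightarrow> (real \<Rightarrow> real^2 \<Rightarrow> real) \<Rightarrow> (real \<Rightarrow> real^2 \<Rightarrow> real) \<Rightarrow> bool" where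
  "boussinesq_solution a b \<nu> \<rho>star \<alpha> f \<rho>s q u0 \<rho>0 u \<rho> P \<longleftrightarrow>
     (let \<Omega> = annulus a b in
        (\<forall>i. Linf_loc_H 2 \<Omega> (\<lambda>t x. u t x $ i)) \<and>
        (\<forall>i. \<exists>h. has_weak_deriv ({0<..} \<times> \<Omega>) (1, 0) (\<lambda>(s, y). u s y $ i) h) \<and>
        (\<forall>i. Linf_loc_H 0 \<Omega> (\<lambda>t x. time_deriv \<Omega> u t x $ i)) \<and>
        (\<forall>t\<ge>0. \<forall>i. (\<lambda>x. u t x $ i) \<in> Lspace 2 \<Omega>) \<and>
        (\<forall>t\<ge>0. ((\<lambda>s. L2norm \<Omega> (\<lambda>x. norm (u s x - u t x))) \<longlongrightarrow> 0) (at t within {0..})) \<and>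
        jointly_measurable \<Omega> \<rho> \<and>
        (\<forall>t\<ge>0. \<rho> t \<in> Lspace (ereal q) \<Omega>) \<and>
        (\<forall>T>0. \<exists>C. \<forall>t\<in>{0..T}. (\<integral>x. \<bar>\<rho> t x\<bar> powr q \<partial>lebesgue_on \<Omega>) \<le> C) \<and>
        jointly_measurable \<Omega> P \<and>
        (AE t in lebesgue_on {0<..}. P t \<in> Wspace 1 2 \<Omega>) \<and>
        momentum_equation \<Omega> \<nu> \<rho>star f u \<rho> P \<and>
        density_equation \<Omega> \<rho>s \<rho>0 u \<rho> \<and>
        (AE t in lebesgue_on {0<..}. AE x in lebesgue_on \<Omega>. divergence \<Omega> (u t) x = 0) \<and>
        (AE x in lebesgue_on \<Omega>. u 0 x = u0 x) \<and>
        (AE x in lebesgue_on \<Omega>. \<rho> 0 x = \<rho>0 x) \<and>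
        (AE t in lebesgue_on {0<..}. boundary_conditions a b \<nu> \<rho>star \<alpha> (u t) (P t)))"

end

theory Submission imports Defs begin

text \<open>
The theorem rests on one conservation law: for every constant \<open>\<beta>\<close> the integral of
\<open>(\<rho>(t) + \<rho>\<^sub>s - \<beta>)^2\<close> over the annulus does not depend on \<open>t\<close> (\<open>density_L2_conserved\<close>).  Formally this
is immediate, because \<open>\<rho> + \<rho>\<^sub>s\<close> is transported by a divergence free velocity that is tangent to the
boundary.  Once it is known, expanding the square of \<open>\<rho> + \<rho>\<^sub>s - \<beta> + \<gamma> f\<close> gives
\<open>\<parallel>\<rho>\<^sub>0 + \<rho>\<^sub>s + \<gamma> f - \<beta>\<parallel>^2 - \<parallel>\<rho>(t) + \<rho>\<^sub>s + \<gamma> f - \<beta>\<parallel>^2 = 2 \<gamma> \<integral> (\<rho>\<^sub>0 - \<rho>(t)) f\<close>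
for every \<open>t \<ge> 0\<close>, and both equivalences follow by letting \<open>t\<close> tend to infinity.  

The work lies in proving the conservation law for densities that are merely in \<open>L\<^sup>4\<close>, when the
velocity is in \<open>H\<^sup>1\<close> at almost every time.  There are two sources of error: regularisation in the interior, and the boundary.

Regularisation.  Fix a cut-off \<open>\<zeta>\<close>, multiply the density \<open>\<Theta>\<close> by \<open>\<zeta>\<close> and convolve with a
mollifier \<open>\<eta>\<close> of radius \<open>\<epsilon>\<close>.  The rate of change of the energy of the regularised density is a double integral of
products of the density at two points.  Symmetrising it, and using that the velocity is divergence free,
turns it into an integral of \<open>|\<delta>\<^sub>h w|^2 \<delta>\<^sub>h v\<close> against a kernel of size \<open>\<epsilon>\<^sup>-\<^sup>3\<close> living on \<open>|h| < 2\<epsilon>\<close>, where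
\<open>\<delta>\<^sub>h\<close> is the increment under the translation by \<open>h\<close> and \<open>w = \<zeta>\<Theta>\<close> (\<open>commutator_bound\<close>).
An \<open>H\<^sup>1\<close> velocity has \<open>L\<^sup>2\<close> increments of order \<open>|h|\<close>, which compensates the kernel; the increments of the density
tend to zero in \<open>L\<^sup>4\<close> by continuity of translations.  This is the argument of DiPerna and Lions in the
form that Constantin, E and Titi gave it.  What remains in the limit is the flux of the energy through the cut-off, which is bounded in \<open>cutoff_balance\<close>.

Boundary.  The cut-offs are radial, equal to one up to a distance of order \<open>\<delta>\<close> from the boundary, with gradient of order \<open>1/\<delta>\<close>; so only the radial component of the velocity enters the flux.  It has zero trace, and a Hardy
inequality on the strip bounds its \<open>L\<^sup>2\<close> norm there by \<open>\<delta>\<close> times the \<open>L\<^sup>2\<close> norm of a gradient on the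
same strip (\<open>boundary_velocity_facts\<close>).  The two powers of \<open>\<delta>\<close> cancel and the integral over a shrinking strip tends to zero (\<open>transport_conserves_L2\<close>).

All spaces are defined with Lebesgue measurable functions on the annulus; the analysis is carried out on
the whole plane with Borel representatives that vanish outside the annulus.
\<close>

section \<open>Smooth functions and a smooth step\<close>

text \<open>Short names for notions that occur on nearly every line; \<open>pd i\<close> is the partial derivative in
the direction of the \<open>i\<close>-th coordinate.\<close>

abbreviation Borel where "Borel \<equiv> borel_measurable borel"

abbreviation L1 :: "('a::euclidean_space => real) => bool" where "L1 f \<equiv> integrable lborel f"

abbreviation (input) ind where "ind \<equiv> indicator"

abbreviation pd :: "'n::finite => (real^'n => real) => real^'n => real" where
 "pd i g x \<equiv> frechet_derivative g (at x) (axis i 1)"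

lemma C_k_on_Suc_imp: "C_k_on (Suc k) UNIV g ==> C_k_on k UNIV g"
proof (induction k arbitrary: g)
 case 0
 then show ?case
  by (auto simp: continuous_on_eq_continuous_at intro: differentiable_imp_continuous_within)
next
 case (Suc k)
 then show ?case by (metis C_k_on.simps(2))
qed

lemma C_k_on_const: "C_k_on k UNIV (\<lambda>x. c)"
 by (induction k arbitrary: c) auto

lemma C_k_on_inner: "C_k_on k UNIV (\<lambda>x. x \<bullet> c)"
proof (cases k)
 case (Suc n)
 have "frechet_derivative (\<lambda>x::'a. x \<bullet> c) (at x) = (\<lambda>h. h \<bullet> c)" for x
  by (rule frechet_derivative_at[symmetric]) (auto intro!: derivative_eq_intros)
 then show ?thesis unfolding Suc
  by (auto simp: C_k_on_const intro!: derivative_intros)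
qed (auto intro!: continuous_intros)

lemma C_k_on_add:
 "C_k_on k UNIV f ==> C_k_on k UNIV g ==> C_k_on k UNIV (\<lambda>x. f x + g x)"
proof (induction k arbitrary: f g)
 case (Suc k)
 have "frechet_derivative (\<lambda>x. f x + g x) (at x) =
   (\<lambda>h. frechet_derivative f (at x) h + frechet_derivative g (at x) h)" for x
  using Suc.prems by (intro frechet_derivative_at[symmetric] has_derivative_add)
   (auto simp: frechet_derivative_works)
 then show ?case using Suc by (auto intro: differentiable_add)
qed (auto intro!: continuous_intros)

lemma frechet_derivative_mult_real:
 fixes f g :: "'a::euclidean_space => real"
 assumes "f differentiable (at x)" "g differentiable (at x)"
 shows "frechet_derivative (\<lambda>x. f x * g x) (at x) =
   (\<lambda>h. f x * frechet_derivative g (at x) h + frechet_derivative f (at x) h * g x)"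
 using assms by (intro frechet_derivative_at[symmetric] has_derivative_mult)
   (auto simp: frechet_derivative_works)

lemma C_k_on_mult:
 "C_k_on k UNIV f ==> C_k_on k UNIV g ==> C_k_on k UNIV (\<lambda>x. f x * g x)"
proof (induction k arbitrary: f g)
 case (Suc k)
 have d: "f differentiable (at x)" "g differentiable (at x)" for x using Suc.prems by auto
 have "C_k_on k UNIV (\<lambda>x. frechet_derivative (\<lambda>x. f x * g x) (at x) b)" if "b \<in> Basis" for b
  unfolding frechet_derivative_mult_real[OF d]
  using Suc.prems C_k_on_Suc_imp[OF Suc.prems(1)] C_k_on_Suc_imp[OF Suc.prems(2)] that
  by (intro C_k_on_add Suc.IH) auto
 then show ?case using d by auto
qed (auto intro!: continuous_intros)

lemma frechet_derivative_compose_real: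
 fixes g :: "real => real" and s :: "'a::euclidean_space => real"
 assumes "g differentiable (at (s x))" "s differentiable (at x)"
 shows "frechet_derivative (\<lambda>x. g (s x)) (at x) =
   (\<lambda>h. frechet_derivative g (at (s x)) 1 * frechet_derivative s (at x) h)"
proof -
 have "((\<lambda>x. g (s x)) has_derivative
   (\<lambda>h. frechet_derivative g (at (s x)) (frechet_derivative s (at x) h))) (at x)"
  by (rule has_derivative_compose[OF assms(2)[unfolded frechet_derivative_works]
    assms(1)[unfolded frechet_derivative_works]])
 then have "frechet_derivative (\<lambda>x. g (s x)) (at x) =
   (\<lambda>h. frechet_derivative g (at (s x)) (frechet_derivative s (at x) h))"
  by (rule frechet_derivative_at[symmetric])
 moreover have "linear (frechet_derivative g (at (s x)))"
  using assms(1) by (rule linear_frechet_derivative)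
 then have "frechet_derivative g (at (s x)) h = frechet_derivative g (at (s x)) 1 * h" for h
  using linear_scale[of "frechet_derivative g (at (s x))" h 1] by (simp add: mult.commute)
 ultimately show ?thesis by metis
qed

lemma C_k_on_compose:
 fixes g :: "real => real" and s :: "'a::euclidean_space => real"
 shows "C_k_on k UNIV g ==> C_k_on k UNIV s ==> C_k_on k UNIV (\<lambda>x. g (s x))"
proof (induction k arbitrary: g)
 case 0
 then show ?case using continuous_on_compose2[of UNIV g UNIV s] by auto
next
 case (Suc k)
 have d1: "g differentiable (at y)" for y using Suc.prems(1) by simp
 have d2: "s differentiable (at x)" for x using Suc.prems(2) by simp
 note d = d1 d2
 have "(\<lambda>x. g (s x)) differentiable (at x)" for x
  using differentiable_chain_at[OF d(2) d(1)] by (simp add: o_def)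
 moreover have "C_k_on k UNIV (\<lambda>x. frechet_derivative (\<lambda>x. g (s x)) (at x) b)" if "b \<in> Basis" for b
 proof -
  have "C_k_on k UNIV (\<lambda>t. frechet_derivative g (at t) 1)" using Suc.prems(1) by simp
  from Suc.IH[OF this C_k_on_Suc_imp[OF Suc.prems(2)]]
  have "C_k_on k UNIV (\<lambda>x. frechet_derivative g (at (s x)) 1 * frechet_derivative s (at x) b)"
   using Suc.prems(2) that by (intro C_k_on_mult) auto
  then show ?thesis unfolding frechet_derivative_compose_real[OF d(1) d(2)] .
 qed
 ultimately show ?case unfolding C_k_on.simps by blast
qed

lemma smooth_const: "smooth (\<lambda>x. c)"
 unfolding smooth_def by (simp add: C_k_on_const)

lemma smooth_inner: "smooth (\<lambda>x. x \<bullet> v)"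
 unfolding smooth_def by (simp add: C_k_on_inner)

lemma smooth_add: "smooth f ==> smooth g ==> smooth (\<lambda>x. f x + g x)"
 unfolding smooth_def by (simp add: C_k_on_add)

lemma smooth_mult: "smooth f ==> smooth g ==> smooth (\<lambda>x. f x * g x)"
 unfolding smooth_def by (simp add: C_k_on_mult)

lemma smooth_compose:
 fixes h :: "real => real"
 shows "smooth h ==> smooth f ==> smooth (\<lambda>x. h (f x))"
 unfolding smooth_def using C_k_on_compose by blast

lemma smooth_diff: "smooth f ==> smooth g ==> smooth (\<lambda>x. f x - g x)"
 using smooth_add[OF _ smooth_mult[OF smooth_const[of "-1"]]] by fastforce

lemma smooth_sum: "(\<And>i. i \<in> I ==> smooth (f i)) ==> smooth (\<lambda>x. \<Sum>i\<in>I. f i x)"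
 by (induction I rule: infinite_finite_induct) (auto intro: smooth_const smooth_add)

lemma smooth_norm_sq: "smooth (\<lambda>x::'a::euclidean_space. x \<bullet> x)"
proof -
 have "smooth (\<lambda>x::'a. \<Sum>b\<in>Basis. (x \<bullet> b) * (x \<bullet> b))"
  by (intro smooth_sum smooth_mult smooth_inner)
 then show ?thesis by (simp add: euclidean_inner[symmetric])
qed

lemma smooth_differentiable: "smooth g ==> g differentiable (at x)"
 unfolding smooth_def by (drule spec[of _ "Suc 0"]) auto

lemma smooth_partial: "smooth g ==> b \<in> Basis ==> smooth (\<lambda>x. frechet_derivative g (at x) b)"
 unfolding smooth_def by (metis C_k_on.simps(2))

lemma smooth_continuous_on: "smooth g ==> continuous_on S g"
 unfolding smooth_def by (drule spec[of _ 0]) (auto intro: continuous_on_subset)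

lemma smooth_has_derivative: "smooth g ==> (g has_derivative frechet_derivative g (at x)) (at x)"
 using smooth_differentiable frechet_derivative_works by blast

lemma smooth_affine:
 assumes g: "smooth (g :: 'a::euclidean_space => real)"
 shows "smooth (\<lambda>y. g (x + c *\<^sub>R y))"
proof -
 have "C_k_on k UNIV g ==> C_k_on k UNIV (\<lambda>y. g (x + c *\<^sub>R y))" for k and g :: "'a => real"
 proof (induction k arbitrary: g)
  case 0
  then show ?case using continuous_on_compose2[of UNIV g UNIV "\<lambda>y. x + c *\<^sub>R y"]
   by (simp add: continuous_intros)
 next
  case (Suc k)
  have gd: "(g has_derivative frechet_derivative g (at y)) (at y)" for y
   using Suc.prems by (auto simp: frechet_derivative_works)
  have d: "((\<lambda>y. g (x + c *\<^sub>R y)) has_derivative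
    (\<lambda>h. frechet_derivative g (at (x + c *\<^sub>R y)) (c *\<^sub>R h))) (at y)" for y
   by (rule has_derivative_compose[OF _ gd]) (auto intro!: derivative_eq_intros)
  have lin: "linear (frechet_derivative g (at y))" for y
   using Suc.prems by (auto intro: linear_frechet_derivative)
  have eq: "frechet_derivative (\<lambda>y. g (x + c *\<^sub>R y)) (at y) b
    = c * frechet_derivative g (at (x + c *\<^sub>R y)) b" for y b
   unfolding frechet_derivative_at[OF d, symmetric] by (simp add: linear_scale[OF lin])
  have "C_k_on k UNIV (\<lambda>y. c * frechet_derivative g (at (x + c *\<^sub>R y)) b)" if "b \<in> Basis" for b
   using Suc.prems that
   by (intro C_k_on_mult C_k_on_const Suc.IH) auto
  then show ?case using d by (auto simp: eq differentiable_def)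
 qed
 then show ?thesis using g by (auto simp: smooth_def)
qed

lemma frechet_derivative_affine:
 assumes g: "smooth (g :: 'a::euclidean_space => real)"
 shows "frechet_derivative (\<lambda>y. g (x + c *\<^sub>R y)) (at y) b
    = c * frechet_derivative g (at (x + c *\<^sub>R y)) b"
proof -
 have d: "((\<lambda>y. g (x + c *\<^sub>R y)) has_derivative
    (\<lambda>h. frechet_derivative g (at (x + c *\<^sub>R y)) (c *\<^sub>R h))) (at y)"
  by (rule has_derivative_compose[OF _ smooth_has_derivative[OF g]]) (auto intro!: derivative_eq_intros)
 have lin: "linear (frechet_derivative g (at (x + c *\<^sub>R y)))"
  using smooth_differentiable[OF g] by (rule linear_frechet_derivative)
 show ?thesis
  unfolding frechet_derivative_at[OF d, symmetric] by (simp add: linear_scale[OF lin])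
qed

lemma smooth_realI:
 fixes g :: "real => real"
 assumes "\<And>x. (g has_real_derivative g' x) (at x)" "smooth g'"
 shows "smooth g"
proof -
 have d: "frechet_derivative g (at x) = (\<lambda>h. g' x * h)" for x
  using assms(1)[of x] unfolding has_field_derivative_def by (rule frechet_derivative_at[symmetric])
 have "g differentiable (at x)" for x using assms(1) real_differentiable_def by blast
 then have "C_k_on (Suc k) UNIV g" for k
  using assms(2) by (auto simp: d smooth_def)
 then show ?thesis unfolding smooth_def using C_k_on_Suc_imp by blast
qed

text \<open>The derivative of \<open>t\<^sup>-\<^sup>k exp(-1/t)\<close> is a combination of functions of the same family, so the whole family is handled in one induction.\<close>

definition flat_power :: "nat => real => real" where
 "flat_power k t = (if t > 0 then (1 / t) ^ k * exp (- (1 / t)) else 0)"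

lemma flat_power_tendsto_0: "((\<lambda>t. flat_power k t) \<longlongrightarrow> 0) (at_right 0)"
proof -
 have "((\<lambda>x::real. x ^ k / exp x) \<longlongrightarrow> 0) at_top" by (rule tendsto_power_div_exp_0)
 then have "((\<lambda>t::real. (inverse t) ^ k / exp (inverse t)) \<longlongrightarrow> 0) (at_right 0)"
  by (rule filterlim_compose) (rule filterlim_inverse_at_top_right)
 moreover have "eventually (\<lambda>t::real. (inverse t) ^ k / exp (inverse t) = flat_power k t) (at_right 0)"
  unfolding eventually_at_filter by (auto simp: flat_power_def exp_minus divide_simps)
 ultimately show ?thesis by (rule Lim_transform_eventually)
qed

lemma flat_power_deriv:
 "(flat_power k has_real_derivative
   (- real k * flat_power (Suc k) t + flat_power (Suc (Suc k)) t)) (at t)"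
proof -
 consider "t > 0" | "t < 0" | "t = 0" by linarith
 then show ?thesis
 proof cases
  case 1
  have "((\<lambda>t. (1 / t) ^ k * exp (- (1 / t))) has_real_derivative
    (- real k * flat_power (Suc k) t + flat_power (Suc (Suc k)) t)) (at t)"
  proof -
   have i: "((\<lambda>t. 1 / t) has_real_derivative - (1 / t) * (1 / t)) (at t)"
    using 1 by (auto intro!: derivative_eq_intros)
   have p: "((\<lambda>t. (1 / t) ^ k) has_real_derivative - real k * (1 / t) ^ Suc k) (at t)"
   proof (cases k)
    case (Suc m)
    have "(1 + real m) * (- v * v * v ^ m) = - real (Suc m) * v ^ Suc (Suc m)" for v :: real
     by (simp add: algebra_simps)
    then show ?thesis unfolding Suc
     by (rule DERIV_cong[OF DERIV_power_Suc[OF i, of m]])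
   qed simp
   show ?thesis
    by (rule DERIV_cong[OF DERIV_mult[OF p DERIV_fun_exp[OF DERIV_minus[OF i]]]])
     (use 1 in \<open>simp add: flat_power_def algebra_simps\<close>)
  qed
  then show ?thesis
   by (rule has_field_derivative_transform_within_open[where S = "{0<..}"])
    (use 1 in \<open>auto simp: flat_power_def\<close>)
 next
  case 2
  have "((\<lambda>t. 0) has_real_derivative 0) (at t)" by simp
  then have "(flat_power k has_real_derivative 0) (at t)"
   by (rule has_field_derivative_transform_within_open[where S = "{..<0}"])
    (use 2 in \<open>auto simp: flat_power_def\<close>)
  then show ?thesis using 2 by (simp add: flat_power_def)
 next
  case 3
  have r: "((\<lambda>h. (flat_power k (0 + h) - flat_power k 0) / h) \<longlongrightarrow> 0) (at_right 0)"
   using flat_power_tendsto_0[of "Suc k"]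
   by (rule Lim_transform_eventually) (auto simp: eventually_at_filter flat_power_def)
  have l: "((\<lambda>h. (flat_power k (0 + h) - flat_power k 0) / h) \<longlongrightarrow> 0) (at_left 0)"
   by (rule Lim_transform_eventually[OF tendsto_const[of 0]])
    (auto simp: eventually_at_filter flat_power_def)
  have "(flat_power k has_real_derivative 0) (at 0)"
   unfolding DERIV_def using filterlim_split_at[OF l r] by simp
  then show ?thesis using 3 by (simp add: flat_power_def)
 qed
qed

lemma smooth_flat_power: "smooth (flat_power k)"
proof -
 have fd: "frechet_derivative (flat_power k) (at t) =
   (\<lambda>h. (- real k * flat_power (Suc k) t + flat_power (Suc (Suc k)) t) * h)" for k t
  using flat_power_deriv[of k t] unfolding has_field_derivative_def by (rule frechet_derivative_at[symmetric])
 have diff: "flat_power k differentiable (at t)" for k t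
  using flat_power_deriv real_differentiable_def by blast
 have "C_k_on n UNIV (flat_power k)" for n k
 proof (induction n arbitrary: k)
  case 0
  then show ?case using diff
   by (auto simp: continuous_on_eq_continuous_at intro: differentiable_imp_continuous_within)
 next
  case (Suc n)
  have "C_k_on n UNIV (\<lambda>t. (- real k * flat_power (Suc k) t + flat_power (Suc (Suc k)) t) * 1)"
   by (intro C_k_on_mult C_k_on_add C_k_on_const Suc.IH)
  then show ?case by (auto simp: fd diff)
 qed
 then show ?thesis by (simp add: smooth_def)
qed

text \<open>The normalised primitive of the bump \<open>exp(-1/t) exp(-1/(1-t))\<close>.\<close>

lemma exists_smooth_step:
 obtains S :: "real => real" where "smooth S" "\<And>t. t \<le> 0 ==> S t = 0" "\<And>t. t \<ge> 1 ==> S t = 1"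
  "\<And>t. 0 \<le> S t" "\<And>t. S t \<le> 1"
proof -
 define b where "b t = flat_power 0 t * flat_power 0 (1 + (-1) *\<^sub>R t)" for t
 have sb: "smooth b" unfolding b_def by (intro smooth_mult smooth_affine smooth_flat_power)
 have b0: "b t \<ge> 0" and b00: "t \<le> 0 \<or> t \<ge> 1 ==> b t = 0" and bp: "0 < t ==> t < 1 ==> b t > 0" for t
  by (auto simp: b_def flat_power_def)
 have "\<exists>F. \<forall>x::real. -\<infinity> < ereal x --> ereal x < \<infinity> --> (F has_vector_derivative b x) (at x)"
  using smooth_continuous_on[OF sb, of UNIV]
  by (intro einterval_antiderivative) (auto simp: continuous_on_eq_continuous_at)
 then obtain F where "\<And>x. (F has_vector_derivative b x) (at x)" by auto
 then have F: "(F has_real_derivative b x) (at x)" for x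
  by (simp add: has_real_derivative_iff_has_vector_derivative)
 have mono: "F x \<le> F y" if "x \<le> y" for x y
  using DERIV_nonneg_imp_nondecreasing[OF that] F b0 by blast
 have F0: "F t = F 0" if "t \<le> 0" for t
 proof -
  have "F 0 \<le> F t"
   by (rule DERIV_nonpos_imp_nonincreasing[OF that, of F]) (metis F b00 order_refl)
  then show ?thesis using mono[OF that] by simp
 qed
 have F1: "F t = F 1" if "1 \<le> t" for t
 proof -
  have "F t \<le> F 1"
   by (rule DERIV_nonpos_imp_nonincreasing[OF that, of F]) (metis F b00 order_refl)
  then show ?thesis using mono[OF that] by simp
 qed
 have lt: "F 0 < F 1"
 proof (rule DERIV_pos_imp_increasing_open[of 0 1 F])
  show "continuous_on {0..1} F" using F by (intro continuous_at_imp_continuous_on) (auto intro: DERIV_isCont)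
 qed (use F bp in auto)
 define S where "S t = (1 / (F 1 - F 0)) * (F t - F 0)" for t
 show ?thesis
 proof
  have "smooth F" using F sb by (rule smooth_realI)
  then show "smooth S" unfolding S_def by (intro smooth_mult smooth_diff smooth_const)
  show "S t = 0" if "t \<le> 0" for t using F0[OF that] by (simp add: S_def)
  show "S t = 1" if "1 \<le> t" for t using F1[OF that] lt by (simp add: S_def)
  show "0 \<le> S t" for t using lt mono[of 0 t] F0[of t] by (cases "0 \<le> t") (auto simp: S_def)
  show "S t \<le> 1" for t using lt mono[of t 1] F1[of t]
   by (cases "t \<le> 1") (auto simp: S_def field_simps)
 qed
qed

section \<open>Mollifiers\<close>

lemma frechet_derivative_zero_open:
 fixes g :: "'a::euclidean_space => real"
 assumes "open S" "x \<in> S" "\<And>y. y \<in> S ==> g y = c"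
 shows "frechet_derivative g (at x) v = 0"
proof -
 have "((\<lambda>y. c) has_derivative (\<lambda>h. 0)) (at x)" by simp
 then have "(g has_derivative (\<lambda>h. 0)) (at x)"
  by (rule has_derivative_transform_within_open[OF _ assms(1,2)]) (use assms(3) in auto)
 from frechet_derivative_at[OF this] show ?thesis by metis
qed

lemma continuous_compact_support_bounded:
 fixes g :: "'a::euclidean_space => real"
 assumes "continuous_on UNIV g" "\<And>x. norm x \<ge> r ==> g x = 0"
 obtains C where "C > 0" "\<And>x. \<bar>g x\<bar> \<le> C"
proof -
 have "compact (g ` cball 0 r)"
  by (intro compact_continuous_image continuous_on_subset[OF assms(1)]) auto
 then obtain C where C: "\<And>y. y \<in> g ` cball 0 r ==> norm y \<le> C"
  using compact_imp_bounded bounded_iff by metis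
 have "\<bar>g x\<bar> \<le> max C 1" for x
  using C[of "g x"] assms(2)[of x] by (cases "norm x \<le> r") auto
 then show ?thesis using that[of "max C 1"] by auto
qed

lemma continuous_compact_support_integrable:
 fixes g :: "'a::euclidean_space => real"
 assumes "continuous_on UNIV g" "\<And>x. norm x \<ge> r ==> g x = 0"
 shows "L1 g"
proof -
 have "L1 (\<lambda>x. indicator (cball 0 r) x *\<^sub>R g x)"
  by (intro borel_integrable_compact continuous_on_subset[OF assms(1)]) auto
 also have "(\<lambda>x. indicator (cball 0 r) x *\<^sub>R g x) = g"
  using assms(2) by (force simp: indicator_def)
 finally show ?thesis .
qed

text \<open>The bound on the gradient has the scaling \<open>\<epsilon>\<^sup>-\<^sup>2 \<epsilon>\<^sup>-\<^sup>1\<close> of a rescaled bump in the plane, with the same constant \<open>C\<close> at every scale; evenness makes the symmetrisation in the commutator estimate possible.\<close>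

definition mollifier :: "real => real => (real^2 => real) => bool" where
 "mollifier C \<epsilon> \<eta> \<longleftrightarrow> smooth \<eta> \<and> (\<forall>x. 0 \<le> \<eta> x) \<and> (\<forall>x. \<eta> (- x) = \<eta> x) \<and>
   (\<forall>x. \<epsilon> \<le> norm x --> \<eta> x = 0) \<and> (LBINT x. \<eta> x) = 1 \<and>
   (\<forall>x i. \<bar>pd i \<eta> x\<bar> \<le> C / \<epsilon> ^ 3)"

lemma exists_mollifier: "\<exists>C>0. \<forall>\<epsilon>>0. \<exists>\<eta>. mollifier C \<epsilon> \<eta>"
proof -
 define B :: "real^2 => real" where "B x = flat_power 0 (1 - x \<bullet> x)" for x
 have sB: "smooth B" unfolding B_def
  by (intro smooth_compose[OF smooth_flat_power] smooth_diff smooth_const smooth_norm_sq)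
 have B0: "0 \<le> B x" and Bev: "B (- x) = B x" for x by (auto simp: B_def flat_power_def)
 have Bz: "B x = 0" if "norm x \<ge> 1" for x
 proof -
  have "x \<bullet> x \<ge> 1" using that power_mono[of 1 "norm x" 2] by (simp add: power2_norm_eq_inner)
  then show ?thesis by (simp add: B_def flat_power_def)
 qed
 have Bl: "B x \<ge> exp (-2)" if "norm x \<le> 1/2" for x
 proof -
  have le: "x \<bullet> x \<le> 1/4" using power_mono[OF that, of 2] by (simp add: power2_norm_eq_inner) (simp add: power2_eq_square)
  then have "1 / (1 - x \<bullet> x) \<le> 2" by (simp add: field_simps)
  then show ?thesis using le by (simp add: B_def flat_power_def)
 qed
 have "\<exists>c>0. \<forall>x. \<bar>pd i B x\<bar> \<le> c" for i
 proof -
  have "continuous_on UNIV (\<lambda>x. pd i B x)"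
   by (rule smooth_continuous_on[OF smooth_partial[OF sB]]) (auto simp: Basis_vec_def)
  moreover have "pd i B x = 0" if "norm x \<ge> 2" for x
   by (rule frechet_derivative_zero_open[of "- cball 0 1" _ _ 0]) (use that Bz in auto)
  ultimately show ?thesis
   by (rule continuous_compact_support_bounded[where r = 2 and thesis = "\<exists>c>0. \<forall>x. \<bar>pd i B x\<bar> \<le> c"]) auto
 qed
 then obtain c where c: "\<And>i. c i > 0" "\<And>i x. \<bar>pd i B x\<bar> \<le> c i"
  by metis
 define C0 where "C0 = (\<Sum>i\<in>UNIV. c i)"
 have C0: "\<bar>pd i B x\<bar> \<le> C0" for i x
  using c(2)[where i=i and x=x] member_le_sum[of i UNIV c] c(1) unfolding C0_def
  by (smt (verit) UNIV_I finite_class.finite_UNIV less_le)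
 have C0p: "C0 > 0" unfolding C0_def using c(1) by (intro sum_pos) auto
 define m where "m = exp (-2) * (unit_ball_vol 2 / 4)"
 have m: "m > 0" unfolding m_def by (simp add: unit_ball_vol_2)
 show ?thesis
 proof (intro exI[of _ "C0 / m"] conjI allI impI)
  show "C0 / m > 0" using C0p m by simp
  fix \<epsilon> :: real assume e: "\<epsilon> > 0"
  define Be where "Be x = B (0 + (1/\<epsilon>) *\<^sub>R x)" for x
  have sBe: "smooth Be" unfolding Be_def by (rule smooth_affine[OF sB])
  have Bez: "Be x = 0" if "norm x \<ge> \<epsilon>" for x
   unfolding Be_def by (rule Bz) (use e that in \<open>simp add: field_simps\<close>)
  have int: "L1 Be"
   by (rule continuous_compact_support_integrable[OF smooth_continuous_on[OF sBe] Bez])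
  define I where "I = (LBINT x. Be x)"
  have "m * \<epsilon>^2 = exp (-2) * measure lborel (ball (0::real^2) (\<epsilon>/2))"
   using e by (simp add: content_ball m_def power2_eq_square)
  also have "\<dots> = (LBINT x. exp (-2) * indicator (ball (0::real^2) (\<epsilon>/2)) x)"
   by simp
  also have "\<dots> \<le> I" unfolding I_def
  proof (intro integral_mono int)
   show "L1 (\<lambda>x. exp (- 2) * indicator (ball (0::real^2) (\<epsilon> / 2)) x :: real)"
    by (intro integrable_mult_right integrable_real_indicator) (use e in \<open>auto simp: emeasure_ball\<close>)
   show "exp (- 2) * indicator (ball 0 (\<epsilon> / 2)) x \<le> Be x" for x
    using B0[of "0 + (1/\<epsilon>) *\<^sub>R x"] Bl[of "0 + (1/\<epsilon>) *\<^sub>R x"] e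
    by (auto simp: Be_def indicator_def field_simps)
  qed
  finally have I: "m * \<epsilon>^2 \<le> I" .
  then have Ip: "I > 0" using m e by (smt (verit) mult_pos_pos zero_less_power)
  define \<eta> where "\<eta> x = (1 / I) * Be x" for x
  have fd: "frechet_derivative \<eta> (at x) v = (1 / I) * (1/\<epsilon>) * frechet_derivative B (at ((1/\<epsilon>) *\<^sub>R x)) v" for x v
  proof -
   have "frechet_derivative \<eta> (at x) v = (1/I) * frechet_derivative Be (at x) v"
    unfolding \<eta>_def
    by (subst frechet_derivative_mult_real) (use smooth_differentiable[OF sBe] in auto)
   then show ?thesis using frechet_derivative_affine[OF sB, of 0 "1/\<epsilon>" x v]
    unfolding Be_def by simp
  qed
  show "\<exists>\<eta>. mollifier (C0 / m) \<epsilon> \<eta>"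
   unfolding mollifier_def
  proof (intro exI[of _ \<eta>] conjI allI impI)
   show "smooth \<eta>" unfolding \<eta>_def by (intro smooth_mult smooth_const sBe)
   show "0 \<le> \<eta> x" for x using Ip B0 by (simp add: \<eta>_def Be_def)
   show "\<eta> (- x) = \<eta> x" for x
    using Bev[of "(1/\<epsilon>) *\<^sub>R x"] by (simp add: \<eta>_def Be_def scaleR_minus_right)
   show "\<eta> x = 0" if "\<epsilon> \<le> norm x" for x using Bez[OF that] by (simp add: \<eta>_def)
   show "(LBINT x. \<eta> x) = 1" using Ip by (simp add: \<eta>_def I_def)
   show "\<bar>pd i \<eta> x\<bar> \<le> C0 / m / \<epsilon> ^ 3" for x i
   proof -
    have "\<bar>pd i \<eta> x\<bar> \<le> (1/I) * (1/\<epsilon>) * C0"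
     unfolding fd abs_mult using Ip e C0[of "(1/\<epsilon>) *\<^sub>R x" i] by (intro mult_mono) auto
    also have "\<dots> \<le> (1/(m * \<epsilon>^2)) * (1/\<epsilon>) * C0"
     using I Ip m e C0p by (intro mult_right_mono divide_left_mono) auto
    also have "\<dots> = C0 / m / \<epsilon> ^ 3" by (simp add: power2_eq_square power3_eq_cube)
    finally show ?thesis .
   qed
  qed
 qed
qed

section \<open>Continuity of translations\<close>

lemma lborel_shift:
 fixes f :: "'a::euclidean_space => real"
 assumes [measurable]: "f \<in> Borel"
 shows "(LBINT x. f (c + x)) = (LBINT x. f x)"
  and "L1 (\<lambda>x. f (c + x)) \<longleftrightarrow> L1 f"
proof -
 have "(LBINT x. f x) = (\<integral>x. f x \<partial>distr lborel borel ((+) c))" by (simp only: lborel_distr_plus)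
 also have "\<dots> = (LBINT x. f (c + x))" by (rule integral_distr) auto
 finally show "(LBINT x. f (c + x)) = (LBINT x. f x)" by simp
 have "L1 f = integrable (distr lborel borel ((+) c)) f" by (simp only: lborel_distr_plus)
 also have "\<dots> = L1 (\<lambda>x. f (c + x))" by (rule integrable_distr_eq) auto
 finally show "L1 (\<lambda>x. f (c + x)) \<longleftrightarrow> L1 f" by simp
qed

lemma lborel_distr_reflect: "distr lborel borel (\<lambda>x::'a::euclidean_space. c - x) = lborel"
 using lborel_affine[of "-1" c] by (simp add: density_1)

lemma lborel_reflect:
 fixes f :: "'a::euclidean_space => real"
 assumes [measurable]: "f \<in> Borel"
 shows "(LBINT x. f (c - x)) = (LBINT x. f x)"
  and "L1 (\<lambda>x. f (c - x)) \<longleftrightarrow> L1 f"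
proof -
 have "(LBINT x. f x) = (\<integral>x. f x \<partial>distr lborel borel (\<lambda>x. c - x))" by (simp only: lborel_distr_reflect)
 also have "\<dots> = (LBINT x. f (c - x))" by (rule integral_distr) auto
 finally show "(LBINT x. f (c - x)) = (LBINT x. f x)" by simp
 have "L1 f = integrable (distr lborel borel (\<lambda>x. c - x)) f" by (simp only: lborel_distr_reflect)
 also have "\<dots> = L1 (\<lambda>x. f (c - x))" by (rule integrable_distr_eq) auto
 finally show "L1 (\<lambda>x. f (c - x)) \<longleftrightarrow> L1 f" by simp
qed

text \<open>Functions whose translations are continuous in the mean form a closed set.\<close>

lemma L1_translation_approx:
 fixes f :: "'a::euclidean_space => real"
 assumes f: "L1 f"
  and ap: "\<And>e. e > 0 ==> \<exists>g. L1 g \<and> (LBINT x. \<bar>f x - g x\<bar>) < e \<and>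
    ((\<lambda>h. LBINT x. \<bar>g (h + x) - g x\<bar>) \<longlongrightarrow> 0) (at 0)"
 shows "((\<lambda>h. LBINT x. \<bar>f (h + x) - f x\<bar>) \<longlongrightarrow> 0) (at 0)"
proof (rule tendstoI)
 fix e :: real assume e: "e > 0"
 obtain g where g: "L1 g" and lt: "(LBINT x. \<bar>f x - g x\<bar>) < e / 3"
  and lim: "((\<lambda>h. LBINT x. \<bar>g (h + x) - g x\<bar>) \<longlongrightarrow> 0) (at 0)"
  using ap[of "e/3"] e by auto
 have m[measurable]: "f \<in> Borel" "g \<in> Borel" using f g by auto
 have sh: "L1 (\<lambda>x. f (h + x))" "L1 (\<lambda>x. g (h + x))" for h
  using f g lborel_shift(2) m by blast+
 have "eventually (\<lambda>h. dist (LBINT x. \<bar>g (h + x) - g x\<bar>) 0 < e / 3) (at 0)"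
  using lim e by (intro tendstoD) auto
 then show "eventually (\<lambda>h. dist (LBINT x. \<bar>f (h + x) - f x\<bar>) 0 < e) (at 0)"
 proof eventually_elim
  case (elim h)
  have "(LBINT x. \<bar>f (h + x) - f x\<bar>) \<le>
   (LBINT x. \<bar>f (h + x) - g (h + x)\<bar> + \<bar>g (h + x) - g x\<bar> + \<bar>f x - g x\<bar>)"
   using sh f g by (intro integral_mono) auto
  also have "\<dots> = (LBINT x. \<bar>f (h + x) - g (h + x)\<bar>) + (LBINT x. \<bar>g (h + x) - g x\<bar>)
    + (LBINT x. \<bar>f x - g x\<bar>)"
   using sh f g by simp
  also have "(LBINT x. \<bar>f (h + x) - g (h + x)\<bar>) = (LBINT x. \<bar>f x - g x\<bar>)"
   by (rule lborel_shift(1)[of "\<lambda>x. \<bar>f x - g x\<bar>"]) auto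
  finally show ?case using elim lt by (simp add: dist_real_def)
 qed
qed

text \<open>The indicator of a translate of an open set converges pointwise on the set by openness; as the measures of the translates agree, convergence in the mean follows.\<close>

lemma L1_translation_open:
 fixes U :: "'a::euclidean_space set"
 assumes U: "open U" "emeasure lborel U < \<infinity>"
 shows "((\<lambda>h. LBINT x. \<bar>ind U (h + x) - ind U x :: real\<bar>) \<longlongrightarrow> 0) (at 0)"
proof -
 have [measurable]: "U \<in> sets borel" using U by auto
 have i: "L1 (ind U :: 'a => real)"
  using U by (intro integrable_real_indicator) auto
 have ih: "L1 (\<lambda>x. ind U (h + x) :: real)" for h
  using lborel_shift(2)[of "ind U :: 'a => real" h] i by simp
 have ip: "L1 (\<lambda>x. ind U x * ind U (h + x) :: real)" for h
  by (rule Bochner_Integration.integrable_bound[OF i]) (auto simp: indicator_def)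
 have eq: "(LBINT x. \<bar>ind U (h + x) - ind U x :: real\<bar>) =
   2 * measure lborel U - 2 * (LBINT x. ind U x * ind U (h + x))" for h
 proof -
  have "(LBINT x. \<bar>ind U (h + x) - ind U x :: real\<bar>) =
   (LBINT x. ind U (h + x) + ind U x - 2 * (ind U x * ind U (h + x)))"
   by (intro Bochner_Integration.integral_cong) (auto simp: indicator_def)
  also have "\<dots> = (LBINT x. ind U (h + x)) + (LBINT x. ind U x)
    - 2 * (LBINT x. ind U x * ind U (h + x))"
   using i ih ip by simp
  finally show ?thesis using lborel_shift(1)[of "ind U :: 'a => real" h] by simp
 qed
 have "((\<lambda>h. LBINT x. ind U x * ind U (h + x)) \<longlongrightarrow> measure lborel U) (at 0)"
  unfolding tendsto_at_iff_sequentially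
 proof (intro allI impI)
  fix X :: "nat => 'a" assume "X \<longlonglongrightarrow> 0"
  have "(\<lambda>n. LBINT x. ind U x * ind U (X n + x)) \<longlonglongrightarrow> (\<integral>x. ind U x \<partial>lborel :: real)"
  proof (rule integral_dominated_convergence[where w = "ind U"])
   show "AE x in lborel. (\<lambda>n. ind U x * ind U (X n + x) :: real) \<longlonglongrightarrow> ind U x"
   proof (intro AE_I2)
    fix x
    show "(\<lambda>n. ind U x * ind U (X n + x) :: real) \<longlonglongrightarrow> ind U x"
    proof (cases "x \<in> U")
     case True
     have "(\<lambda>n. X n + x) \<longlonglongrightarrow> 0 + x" using \<open>X \<longlonglongrightarrow> 0\<close> by (intro tendsto_intros)
     then have "eventually (\<lambda>n. X n + x \<in> U) sequentially"
      using U(1) True by (auto dest: topological_tendstoD)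
     then have "eventually (\<lambda>n. ind U x = (ind U x * ind U (X n + x) :: real)) sequentially"
      by eventually_elim (use True in auto)
     then show ?thesis by (rule Lim_transform_eventually[OF tendsto_const])
    qed auto
   qed
  qed (use i in \<open>auto simp: indicator_def\<close>)
  then show "((\<lambda>h. LBINT x. ind U x * ind U (h + x)) \<circ> X) \<longlonglongrightarrow> measure lborel U"
   by (simp add: o_def)
 qed
 then have "((\<lambda>h. 2 * measure lborel U - 2 * (LBINT x. ind U x * ind U (h + x))) \<longlongrightarrow>
   2 * measure lborel U - 2 * measure lborel U) (at 0)"
  by (intro tendsto_intros)
 then show ?thesis unfolding eq by simp
qed

theorem L1_translation_continuous:
 fixes f :: "'a::euclidean_space => real"
 assumes "L1 f"
 shows "((\<lambda>h. LBINT x. \<bar>f (h + x) - f x\<bar>) \<longlongrightarrow> 0) (at 0)"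
 using assms
proof (induction rule: integrable_induct)
 case (base A c)
 have A[measurable]: "A \<in> sets borel" using base by auto
 have ind: "((\<lambda>h. LBINT x. \<bar>ind A (h + x) - ind A x :: real\<bar>) \<longlongrightarrow> 0) (at 0)"
 proof (rule L1_translation_approx)
  show "L1 (ind A :: 'a => real)" using base by (intro integrable_real_indicator) auto
  fix e :: real assume "e > 0"
  obtain U where U: "open U" "A \<subseteq> U" "emeasure lborel (U - A) < ennreal e"
   by (rule outer_regular_lborel[OF A \<open>e > 0\<close>]) metis
  have [measurable]: "U \<in> sets borel" using U by auto
  have "emeasure lborel U \<le> emeasure lborel A + emeasure lborel (U - A)"
   using U(2) emeasure_subadditive[of A lborel "U - A"] by (simp add: Un_absorb1)
  also have "\<dots> < \<infinity>" using base(2) less_trans[OF U(3) ennreal_less_top] by simp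
  finally have fin: "emeasure lborel U < \<infinity>" .
  have "(LBINT x. \<bar>ind A x - ind U x :: real\<bar>) = (LBINT x. indicator (U - A) x)"
   using U(2) by (intro Bochner_Integration.integral_cong) (auto simp: indicator_def)
  also have "\<dots> = measure lborel (U - A)" by simp
  also have "\<dots> < e"
   using U(3) \<open>e > 0\<close> less_trans[OF U(3) ennreal_less_top] by (simp add: measure_def enn2real_less_iff)
  finally show "\<exists>g. L1 g \<and> (LBINT x. \<bar>ind A x - g x\<bar>) < e \<and>
    ((\<lambda>h. LBINT x. \<bar>g (h + x) - g x\<bar>) \<longlongrightarrow> 0) (at (0::'a))"
   using U fin L1_translation_open[OF U(1) fin]
   by (intro exI[of _ "ind U"]) (auto intro: integrable_real_indicator)
 qed
 have "(LBINT x. \<bar>ind A (h + x) *\<^sub>R c - ind A x *\<^sub>R c\<bar>)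
   = \<bar>c\<bar> * (LBINT x. \<bar>ind A (h + x) - ind A x :: real\<bar>)" for h
  by (subst integral_mult_right_zero[symmetric]) (simp add: abs_mult[symmetric] algebra_simps)
 then show ?case using tendsto_mult_left[OF ind, of "\<bar>c\<bar>"] by simp
next
 case (add f g)
 have [measurable]: "f \<in> Borel" "g \<in> Borel" using add by auto
 have sh: "L1 (\<lambda>x. f (h + x))" "L1 (\<lambda>x. g (h + x))" for h
  using add lborel_shift(2)[of f] lborel_shift(2)[of g] by auto
 show ?case
 proof (rule tendsto_sandwich[OF _ _ tendsto_const])
  show "\<forall>\<^sub>F h in at 0. (LBINT x. \<bar>f (h + x) + g (h + x) - (f x + g x)\<bar>) \<le>
    (LBINT x. \<bar>f (h + x) - f x\<bar>) + (LBINT x. \<bar>g (h + x) - g x\<bar>)"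
  proof (intro always_eventually allI)
   fix h
   have "(LBINT x. \<bar>f (h + x) + g (h + x) - (f x + g x)\<bar>) \<le>
    (LBINT x. \<bar>f (h + x) - f x\<bar> + \<bar>g (h + x) - g x\<bar>)"
    using sh add by (intro integral_mono) auto
   then show "(LBINT x. \<bar>f (h + x) + g (h + x) - (f x + g x)\<bar>) \<le>
    (LBINT x. \<bar>f (h + x) - f x\<bar>) + (LBINT x. \<bar>g (h + x) - g x\<bar>)"
    using sh add by simp
  qed
  show "((\<lambda>h. (LBINT x. \<bar>f (h + x) - f x\<bar>) + (LBINT x. \<bar>g (h + x) - g x\<bar>)) \<longlongrightarrow> 0) (at 0)"
   using tendsto_add[OF add(3,4)] by simp
 qed auto
next
 case (lim f s)
 have [measurable]: "f \<in> Borel" "s i \<in> Borel" for i using lim by auto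
 have "(\<lambda>i. LBINT x. \<bar>f x - s i x\<bar>) \<longlonglongrightarrow> (\<integral>x. 0 \<partial>(lborel::'a measure))"
 proof (rule integral_dominated_convergence[where w = "\<lambda>x. 3 * \<bar>f x\<bar>"])
  show "AE x in lborel. (\<lambda>i. \<bar>f x - s i x\<bar>) \<longlonglongrightarrow> 0"
  proof (intro AE_I2)
   fix x
   have "(\<lambda>i. \<bar>f x - s i x\<bar>) \<longlonglongrightarrow> \<bar>f x - f x\<bar>"
    using lim(2)[of x] by (intro tendsto_intros) auto
   then show "(\<lambda>i. \<bar>f x - s i x\<bar>) \<longlonglongrightarrow> 0" by simp
  qed
  show "AE x in lborel. norm \<bar>f x - s i x\<bar> \<le> 3 * \<bar>f x\<bar>" for i
   using lim(3)[of _ i] by (intro AE_I2) (fastforce simp: abs_if split: if_splits)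
 qed (use lim in auto)
 then have z: "(\<lambda>i. LBINT x. \<bar>f x - s i x\<bar>) \<longlonglongrightarrow> 0" by simp
 show ?case
 proof (rule L1_translation_approx[OF lim(4)])
  fix e :: real assume "e > 0"
  from order_tendstoD(2)[OF z this] obtain i where "(LBINT x. \<bar>f x - s i x\<bar>) < e"
   by (auto simp: eventually_sequentially)
  then show "\<exists>g. L1 g \<and> (LBINT x. \<bar>f x - g x\<bar>) < e \<and>
    ((\<lambda>h. LBINT x. \<bar>g (h + x) - g x\<bar>) \<longlongrightarrow> 0) (at 0)"
   using lim by (intro exI[of _ "s i"]) auto
 qed
qed

lemma nn_integral_le_imp_integral_le:
 assumes "f \<in> borel_measurable M" "\<And>x. 0 \<le> f x" "(\<integral>\<^sup>+x. ennreal (f x) \<partial>M) \<le> ennreal A" "0 \<le> A"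
 shows "integrable M f" "(\<integral>x. f x \<partial>M) \<le> A"
proof -
 show "integrable M f"
  using assms by (intro integrableI_bounded) (auto simp: less_top[symmetric] top_unique)
 then have "ennreal (\<integral>x. f x \<partial>M) \<le> ennreal A"
  using assms by (subst nn_integral_eq_integral[symmetric]) auto
 then show "(\<integral>x. f x \<partial>M) \<le> A" using assms by simp
qed

lemma fourth_power_triangle:
 fixes p q r :: real
 shows "(p + q + r) ^ 4 \<le> 27 * (p ^ 4 + q ^ 4 + r ^ 4)"
proof -
 have sq: "(x + y + z)^2 \<le> 3 * (x^2 + y^2 + z^2)" for x y z :: real
  using sum_squares_bound[of x y] sum_squares_bound[of y z] sum_squares_bound[of x z]
  by (simp add: power2_eq_square algebra_simps)
 have "(p + q + r) ^ 4 = ((p + q + r)^2)^2" by simp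
 also have "\<dots> \<le> (3 * (p^2 + q^2 + r^2))^2" by (intro power_mono sq) auto
 also have "\<dots> = 9 * (p^2 + q^2 + r^2)^2" by (simp only: power_mult_distrib) simp
 also have "\<dots> \<le> 9 * (3 * ((p^2)^2 + (q^2)^2 + (r^2)^2))" by (intro mult_left_mono sq) auto
 finally show ?thesis by simp
qed

text \<open>Truncate at height \<open>M\<close>.  The increments of the truncated function are bounded by \<open>2M\<close>, so their fourth powers are controlled by their absolute values, and continuity in the mean applies; the remainder is small in the fourth power.\<close>

theorem L4_translation_continuous:
 fixes f :: "'a::euclidean_space => real"
 assumes f: "L1 f" and f4: "L1 (\<lambda>x. f x ^ 4)"
 shows "((\<lambda>h. LBINT x. (f (h + x) - f x) ^ 4) \<longlongrightarrow> 0) (at 0)"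
proof (rule tendstoI)
 fix e :: real assume e: "e > 0"
 have [measurable]: "f \<in> Borel" using f by auto
 define T where "T M y = max (- real M) (min (real M) y)" for M y
 have [measurable]: "T M \<in> Borel" for M unfolding T_def by measurable
 have T1: "\<bar>T M y - T M z\<bar> \<le> \<bar>y - z\<bar>" and T2: "\<bar>T M y\<bar> \<le> real M" and T3: "\<bar>y - T M y\<bar> \<le> \<bar>y\<bar>" for M y z
  by (auto simp: T_def)
 have pw4: "x ^ 4 \<le> y ^ 4" if "\<bar>x\<bar> \<le> \<bar>y\<bar>" for x y :: real
  using power_mono[of "\<bar>x\<bar>" "\<bar>y\<bar>" 4] that by simp
 have "(\<lambda>M. LBINT x. (f x - T M (f x)) ^ 4) \<longlonglongrightarrow> (\<integral>x. 0 \<partial>(lborel::'a measure))"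
 proof (rule integral_dominated_convergence[where w = "\<lambda>x. f x ^ 4"])
  show "AE x in lborel. (\<lambda>M. (f x - T M (f x)) ^ 4) \<longlonglongrightarrow> 0"
  proof (intro AE_I2)
   fix x
   obtain N where N: "\<bar>f x\<bar> \<le> real N" using real_arch_simple by blast
   have "eventually (\<lambda>M. 0 = (f x - T M (f x)) ^ 4) sequentially"
    using eventually_ge_at_top[of N] by eventually_elim (use N in \<open>auto simp: T_def\<close>)
   then show "(\<lambda>M. (f x - T M (f x)) ^ 4) \<longlonglongrightarrow> 0" by (rule Lim_transform_eventually[OF tendsto_const])
  qed
  show "AE x in lborel. norm ((f x - T M (f x)) ^ 4) \<le> f x ^ 4" for M
   using pw4[OF T3] by (intro AE_I2) simp
 qed (use f4 in auto)
 then have "(\<lambda>M. LBINT x. (f x - T M (f x)) ^ 4) \<longlonglongrightarrow> 0" by simp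
 then obtain M where M: "(LBINT x. (f x - T M (f x)) ^ 4) < e / 108"
  using order_tendstoD(2)[of _ 0 sequentially "e / 108"] e by (auto simp: eventually_sequentially)
 have i4: "L1 (\<lambda>x. (f x - T M (f x)) ^ 4)"
  by (rule Bochner_Integration.integrable_bound[OF f4]) (use pw4[OF T3] in auto)
 have i4h: "L1 (\<lambda>x. (f (h + x) - T M (f (h + x))) ^ 4)"
  and eqh: "(LBINT x. (f (h + x) - T M (f (h + x))) ^ 4) = (LBINT x. (f x - T M (f x)) ^ 4)" for h
  using lborel_shift[of "\<lambda>x. (f x - T M (f x)) ^ 4" h] i4 by auto
 have id: "L1 (\<lambda>x. \<bar>f (h + x) - f x\<bar>)" for h
  using lborel_shift(2)[of f h] f by auto
 define K where "K = (2 * real M) ^ 3"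
 have K: "K \<ge> 0" by (simp add: K_def)
 have b4: "(T M y - T M z) ^ 4 \<le> K * \<bar>y - z\<bar>" for y z
 proof -
  have "(T M y - T M z) ^ 4 = \<bar>T M y - T M z\<bar> ^ 3 * \<bar>T M y - T M z\<bar>"
   using power_Suc2[of "\<bar>T M y - T M z\<bar>" 3] by (simp add: numeral_eq_Suc)
  also have "\<dots> \<le> (2 * real M) ^ 3 * \<bar>y - z\<bar>"
   using T1[of M y z] T2[of M y] T2[of M z] by (intro mult_mono power_mono) auto
  finally show ?thesis by (simp add: K_def)
 qed
 have iT: "L1 (\<lambda>x. (T M (f (h + x)) - T M (f x)) ^ 4)" for h
  by (rule Bochner_Integration.integrable_bound[of _ "\<lambda>x. K * \<bar>f (h + x) - f x\<bar>"])
   (use id b4 K in \<open>auto simp: abs_mult\<close>)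
 have "((\<lambda>h. K * (LBINT x. \<bar>f (h + x) - f x\<bar>)) \<longlongrightarrow> 0) (at 0)"
  using tendsto_mult_left[OF L1_translation_continuous[OF f], of K] by simp
 then have "eventually (\<lambda>h. K * (LBINT x. \<bar>f (h + x) - f x\<bar>) < e / 108) (at 0)"
  using e by (intro order_tendstoD(2)) auto
 then show "eventually (\<lambda>h. dist (LBINT x. (f (h + x) - f x) ^ 4) 0 < e) (at 0)"
 proof eventually_elim
  case (elim h)
  let ?d = "\<lambda>x. f x - T M (f x)"
  have pt: "(f (h + x) - f x) ^ 4 \<le> 27 * ((?d (h + x)) ^ 4 + (T M (f (h + x)) - T M (f x)) ^ 4 + (?d x) ^ 4)" for x
   using fourth_power_triangle[of "?d (h + x)" "T M (f (h + x)) - T M (f x)" "- ?d x"]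
   unfolding power_minus_even[OF even_numeral] by simp
  have "(LBINT x. (f (h + x) - f x) ^ 4) \<le>
   (LBINT x. 27 * ((?d (h + x)) ^ 4 + (T M (f (h + x)) - T M (f x)) ^ 4 + (?d x) ^ 4))"
   by (rule integral_mono_AE') (use i4 i4h iT pt in auto)
  also have "\<dots> = 27 * ((LBINT x. ?d x ^ 4) + (LBINT x. (T M (f (h + x)) - T M (f x)) ^ 4)
    + (LBINT x. ?d x ^ 4))"
   using i4 i4h iT eqh by simp
  also have "(LBINT x. (T M (f (h + x)) - T M (f x)) ^ 4) \<le> (LBINT x. K * \<bar>f (h + x) - f x\<bar>)"
   using iT id b4 by (intro integral_mono) auto
  finally have "(LBINT x. (f (h + x) - f x) ^ 4) \<le>
    27 * ((LBINT x. ?d x ^ 4) + K * (LBINT x. \<bar>f (h + x) - f x\<bar>) + (LBINT x. ?d x ^ 4))"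
   by simp
  also have "\<dots> < 27 * (e / 108 + e / 108 + e / 108)"
   using elim M by (intro mult_strict_left_mono add_strict_mono) auto
  also have "\<dots> < e" using e by simp
  finally show ?case by (simp add: dist_real_def)
 qed
qed

lemma L4_translation_modulus:
 fixes f :: "'a::euclidean_space => real"
 assumes "L1 f" "L1 (\<lambda>x. f x ^ 4)" "e > 0"
 obtains d where "d > 0" "\<And>h. norm h < d ==> (LBINT x. (f (h + x) - f x) ^ 4) \<le> e"
proof -
 have "eventually (\<lambda>h. (LBINT x. (f (h + x) - f x) ^ 4) < e) (at 0)"
  using order_tendstoD(2)[OF L4_translation_continuous[OF assms(1,2)] assms(3)] .
 then obtain d where "d > 0" "\<And>h. h \<noteq> 0 ==> norm h < d ==> (LBINT x. (f (h + x) - f x) ^ 4) < e"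
  by (auto simp: eventually_at dist_norm)
 note d = this
 have "(LBINT x. (f (h + x) - f x) ^ 4) \<le> e" if "norm h < d" for h
  using d(2)[OF _ that] assms(3) by (cases "h = 0") auto
 then show ?thesis using d by (intro that[of d]) auto
qed

lemma L1_translation_modulus:
 fixes f :: "'a::euclidean_space => real"
 assumes "L1 f" "e > 0"
 obtains d where "d > 0" "\<And>h. norm h < d ==> (LBINT x. \<bar>f (h + x) - f x\<bar>) \<le> e"
proof -
 have "eventually (\<lambda>h. (LBINT x. \<bar>f (h + x) - f x\<bar>) < e) (at 0)"
  using order_tendstoD(2)[OF L1_translation_continuous[OF assms(1)] assms(2)] .
 then obtain d where d: "d > 0" "\<And>h. h \<noteq> 0 ==> norm h < d ==> (LBINT x. \<bar>f (h + x) - f x\<bar>) < e"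
  by (auto simp: eventually_at dist_norm)
 have "(LBINT x. \<bar>f (h + x) - f x\<bar>) \<le> e" if "norm h < d" for h
  using d(2)[OF _ that] assms(2) by (cases "h = 0") auto
 then show ?thesis using d by (intro that[of d]) auto
qed

section \<open>Borel representatives\<close>

text \<open>Integrals over \<open>lebesgue_on U\<close> are awkward under translations and products.  This and the following lemmas move them to the Borel measure of the whole space, with functions that vanish outside \<open>U\<close>.\<close>

lemma lebesgue_on_borel_version:
 fixes g :: "'a::euclidean_space => real"
 assumes U: "U \<in> sets borel" and g: "g \<in> borel_measurable (lebesgue_on U)"
 obtains g' where "g' \<in> Borel" "\<And>x. x \<notin> U ==> g' x = 0"
  "AE x in lborel. x \<in> U --> g x = g' x"
proof -
 have [measurable]: "U \<in> sets borel" by fact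
 have "(\<lambda>x. if x \<in> U then g x else 0) \<in> borel_measurable lebesgue"
  using U by (intro borel_measurable_if_I[OF g]) auto
 then obtain k where k: "k \<in> borel_measurable lborel" "AE x in lborel. (if x \<in> U then g x else 0) = k x"
  using completion_ex_borel_measurable_real by blast
 have "AE x in lborel. x \<in> U --> g x = (if x \<in> U then k x else 0)"
  using k(2) by eventually_elim auto
 then show ?thesis using k(1) by (intro that[of "\<lambda>x. if x \<in> U then k x else 0"]) auto
qed

lemma AE_lebesgue_on_iff:
 assumes U: "U \<in> sets borel"
 shows "(AE x in lebesgue_on U. Q x) \<longleftrightarrow> (AE x in lborel. x \<in> U --> Q x)"
 using U by (simp add: AE_restrict_space_iff AE_completion_iff)

lemma borel_measurable_lebesgue_AE:
 fixes f k :: "'a::euclidean_space => real"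
 assumes k: "k \<in> borel_measurable lebesgue" and ae: "AE x in lebesgue. f x = k x"
 shows "f \<in> borel_measurable lebesgue"
proof (rule measurableI)
 fix A :: "real set" assume "A \<in> sets borel"
 then have "k -` A \<inter> space lebesgue \<in> sets lebesgue" by (rule measurable_sets[OF k])
 then show "f -` A \<inter> space lebesgue \<in> sets lebesgue"
  by (rule complete_measure.in_sets_AE[OF completion.complete_measure_axioms, rotated]) (use ae in auto)
qed auto

lemma integral_lebesgue_on_borel:
 fixes F F' :: "'a::euclidean_space => real"
 assumes U: "U \<in> sets borel" and F': "F' \<in> Borel" and z: "\<And>x. x \<notin> U ==> F' x = 0"
  and ae: "AE x in lborel. x \<in> U --> F x = F' x"
 shows "(\<integral>x. F x \<partial>lebesgue_on U) = (LBINT x. F' x)"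
  and "integrable (lebesgue_on U) F \<longleftrightarrow> L1 F'"
  and "F \<in> borel_measurable (lebesgue_on U)"
proof -
 have ind: "ind U x *\<^sub>R F' x = F' x" for x using z[of x] by (auto simp: indicator_def)
 have aeu: "AE x in lebesgue. ind U x *\<^sub>R F x = F' x"
  using AE_completion[OF ae] by eventually_elim (use z in \<open>auto simp: indicator_def\<close>)
 have F'm: "F' \<in> borel_measurable lebesgue" using F' by (simp add: measurable_completion)
 have m: "(\<lambda>x. ind U x *\<^sub>R F x) \<in> borel_measurable lebesgue"
  by (rule borel_measurable_lebesgue_AE[OF F'm aeu])
 show "F \<in> borel_measurable (lebesgue_on U)"
  using m U by (subst borel_measurable_restrict_space_iff) auto
 have "(\<integral>x. F x \<partial>lebesgue_on U) = (\<integral>x. ind U x *\<^sub>R F x \<partial>lebesgue)"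
  using U by (intro integral_restrict_space) auto
 also have "\<dots> = (\<integral>x. F' x \<partial>lebesgue)" by (rule integral_cong_AE[OF m F'm aeu])
 also have "\<dots> = (LBINT x. F' x)" using F' by (intro integral_completion) auto
 finally show "(\<integral>x. F x \<partial>lebesgue_on U) = (LBINT x. F' x)" .
 have "integrable (lebesgue_on U) F \<longleftrightarrow> integrable lebesgue (\<lambda>x. ind U x *\<^sub>R F x)"
  using U by (intro integrable_restrict_space) auto
 also have "\<dots> \<longleftrightarrow> integrable lebesgue F'" by (rule integrable_cong_AE[OF m F'm aeu])
 also have "\<dots> \<longleftrightarrow> L1 F'" using F' by (intro integrable_completion) auto
 finally show "integrable (lebesgue_on U) F \<longleftrightarrow> L1 F'" .
qed

lemma integrable_lborel_mult_bounded:
 fixes f g :: "'a::euclidean_space => real"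
 assumes "L1 f" "g \<in> Borel" "\<And>x. \<bar>g x\<bar> \<le> M"
 shows "L1 (\<lambda>x. f x * g x)"
proof -
 have "M \<ge> 0" using assms(3)[of undefined] by linarith
 show ?thesis
 proof (rule Bochner_Integration.integrable_bound[where f = "\<lambda>x. M * \<bar>f x\<bar>"])
  show "AE x in lborel. norm (f x * g x) \<le> norm (M * \<bar>f x\<bar>)"
  proof (intro AE_I2)
   fix x
   have "\<bar>g x\<bar> * \<bar>f x\<bar> \<le> M * \<bar>f x\<bar>" by (intro mult_right_mono assms) auto
   then show "norm (f x * g x) \<le> norm (M * \<bar>f x\<bar>)" using \<open>M \<ge> 0\<close> by (simp add: abs_mult mult.commute)
  qed
 qed (use assms in auto)
qed

section \<open>Mollification\<close>

locale mollif =
 fixes C \<epsilon> :: real and \<eta> :: "real^2 => real"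
 assumes mol: "mollifier C \<epsilon> \<eta>"
begin

lemma smooth_eta: "smooth \<eta>" and eta_nonneg: "0 \<le> \<eta> x" and eta_even: "\<eta> (- x) = \<eta> x"
 and eta_zero: "\<epsilon> \<le> norm x ==> \<eta> x = 0" and eta_integral: "(LBINT x. \<eta> x) = 1"
 and deta_bound: "\<bar>pd i \<eta> x\<bar> \<le> C / \<epsilon> ^ 3"
 using mol by (auto simp: mollifier_def)

lemma eta_borel [measurable]: "\<eta> \<in> Borel"
 by (intro borel_measurable_continuous_onI smooth_continuous_on smooth_eta)

lemma eta_integrable: "L1 \<eta>"
 using eta_integral not_integrable_integral_eq by fastforce

lemma eta_bounded: "\<exists>M>0. \<forall>x. \<bar>\<eta> x\<bar> \<le> M"
 using continuous_compact_support_bounded[OF smooth_continuous_on[OF smooth_eta] eta_zero] by metis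

lemma eta_flip: "\<eta> (x - y) = \<eta> (y - x)"
 using eta_even[of "x - y"] by simp

lemma mollify_eq_shift:
 assumes [measurable]: "f \<in> Borel"
 shows "(LBINT y. f y * \<eta> (x - y)) = (LBINT h. f (h + x) * \<eta> h)"
 using lborel_shift(1)[of "\<lambda>y. f y * \<eta> (y - x)" x] by (simp add: eta_flip[of x] add.commute)

lemma mollify_borel [measurable]:
 assumes [measurable]: "f \<in> Borel"
 shows "(\<lambda>x. LBINT y. f y * \<eta> (x - y)) \<in> Borel"
 by (rule lborel.borel_measurable_lebesgue_integral) measurable

text \<open>The common source of the estimates below: an average of translations over a small ball inherits every bound that is uniform in the translation.\<close>

lemma average_translation_bound:
 assumes [measurable]: "case_prod \<Phi> \<in> borel_measurable (borel \<Otimes>\<^sub>M borel)" and nn: "\<And>x h. 0 \<le> \<Phi> x h"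
  and A: "\<And>h. norm h < \<epsilon> ==> L1 (\<lambda>x. \<Phi> x h)" "\<And>h. norm h < \<epsilon> ==> (LBINT x. \<Phi> x h) \<le> A" "0 \<le> A"
 shows "(\<integral>\<^sup>+x. \<integral>\<^sup>+h. ennreal (\<Phi> x h * \<eta> h) \<partial>lborel \<partial>lborel) \<le> ennreal A"
proof -
 have "(\<integral>\<^sup>+x. \<integral>\<^sup>+h. ennreal (\<Phi> x h * \<eta> h) \<partial>lborel \<partial>lborel) =
   (\<integral>\<^sup>+h. \<integral>\<^sup>+x. ennreal (\<Phi> x h * \<eta> h) \<partial>lborel \<partial>lborel)"
  by (rule lborel_pair.Fubini'[symmetric]) measurable
 also have "\<dots> \<le> (\<integral>\<^sup>+h. ennreal A * ennreal (\<eta> h) \<partial>lborel)"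
 proof (intro nn_integral_mono)
  fix h
  have "(\<integral>\<^sup>+x. ennreal (\<Phi> x h * \<eta> h) \<partial>lborel) = (\<integral>\<^sup>+x. ennreal (\<Phi> x h) \<partial>lborel) * ennreal (\<eta> h)"
   using nn eta_nonneg by (subst nn_integral_multc[symmetric]) (auto simp: ennreal_mult)
  also have "\<dots> \<le> ennreal A * ennreal (\<eta> h)"
  proof (cases "norm h < \<epsilon>")
   case True
   then show ?thesis using A nn
    by (subst nn_integral_eq_integral) (auto intro!: mult_right_mono ennreal_leI)
  qed (use eta_zero in auto)
  finally show "(\<integral>\<^sup>+x. ennreal (\<Phi> x h * \<eta> h) \<partial>lborel) \<le> ennreal A * ennreal (\<eta> h)" .
 qed
 also have "\<dots> = ennreal A * ennreal 1"
  using eta_nonneg eta_integral eta_integrable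
  by (subst nn_integral_cmult) (auto simp: nn_integral_eq_integral)
 finally show ?thesis by simp
qed

lemma mollify_minus:
 assumes f: "L1 f"
 shows "(LBINT y. f y * \<eta> (x - y)) - f x = (LBINT h. (f (h + x) - f x) * \<eta> h)"
  and "L1 (\<lambda>h. (f (h + x) - f x) * \<eta> h)"
proof -
 have [measurable]: "f \<in> Borel" using f by auto
 have fs: "L1 (\<lambda>h. f (h + x))" using lborel_shift(2)[of f x] f by (simp add: add.commute)
 obtain M where M: "M > 0" "\<And>x. \<bar>\<eta> x\<bar> \<le> M" using eta_bounded by blast
 have i1: "L1 (\<lambda>h. f (h + x) * \<eta> h)"
  by (rule integrable_lborel_mult_bounded[OF fs _ M(2)]) auto
 have i2: "L1 (\<lambda>h. f x * \<eta> h)" using eta_integrable by auto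
 show "L1 (\<lambda>h. (f (h + x) - f x) * \<eta> h)"
  using Bochner_Integration.integrable_diff[OF i1 i2] by (simp add: algebra_simps)
 show "(LBINT y. f y * \<eta> (x - y)) - f x = (LBINT h. (f (h + x) - f x) * \<eta> h)"
  using Bochner_Integration.integral_diff[OF i1 i2] eta_integral
  by (simp add: mollify_eq_shift algebra_simps)
qed

lemma mollify_L1:
 assumes f: "L1 f" and A: "\<And>h. norm h < \<epsilon> ==> (LBINT x. \<bar>f (h + x) - f x\<bar>) \<le> A" "0 \<le> A"
 shows "L1 (\<lambda>x. \<bar>(LBINT y. f y * \<eta> (x - y)) - f x\<bar>)"
  and "(LBINT x. \<bar>(LBINT y. f y * \<eta> (x - y)) - f x\<bar>) \<le> A"
proof -
 have [measurable]: "f \<in> Borel" using f by auto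
 have "ennreal \<bar>(LBINT y. f y * \<eta> (x - y)) - f x\<bar> \<le> (\<integral>\<^sup>+h. ennreal (\<bar>f (h + x) - f x\<bar> * \<eta> h) \<partial>lborel)" for x
 proof -
  have "L1 (\<lambda>h. \<bar>f (h + x) - f x\<bar> * \<eta> h)"
   using integrable_abs[OF mollify_minus(2)[OF f, of x]] eta_nonneg by (simp add: abs_mult)
  then have "(\<integral>\<^sup>+h. ennreal (\<bar>f (h + x) - f x\<bar> * \<eta> h) \<partial>lborel) = ennreal (LBINT h. \<bar>f (h + x) - f x\<bar> * \<eta> h)"
   using eta_nonneg by (intro nn_integral_eq_integral) auto
  moreover have "\<bar>LBINT h. (f (h + x) - f x) * \<eta> h\<bar> \<le> (LBINT h. \<bar>f (h + x) - f x\<bar> * \<eta> h)"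
   using integral_abs_bound[of lborel "\<lambda>h. (f (h + x) - f x) * \<eta> h"] eta_nonneg by (simp add: abs_mult)
  ultimately show ?thesis using mollify_minus(1)[OF f, of x] by (simp add: ennreal_leI)
 qed
 then have "(\<integral>\<^sup>+x. ennreal \<bar>(LBINT y. f y * \<eta> (x - y)) - f x\<bar> \<partial>lborel) \<le>
   (\<integral>\<^sup>+x. \<integral>\<^sup>+h. ennreal (\<bar>f (h + x) - f x\<bar> * \<eta> h) \<partial>lborel \<partial>lborel)"
  by (intro nn_integral_mono)
 also have "\<dots> \<le> ennreal A"
 proof (rule average_translation_bound)
  show "L1 (\<lambda>x. \<bar>f (h + x) - f x\<bar>)" for h
   using lborel_shift(2)[of f h] f by auto
 qed (use A in auto)
 finally have *: "(\<integral>\<^sup>+x. ennreal \<bar>(LBINT y. f y * \<eta> (x - y)) - f x\<bar> \<partial>lborel) \<le> ennreal A" .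
 show "L1 (\<lambda>x. \<bar>(LBINT y. f y * \<eta> (x - y)) - f x\<bar>)"
  "(LBINT x. \<bar>(LBINT y. f y * \<eta> (x - y)) - f x\<bar>) \<le> A"
  using nn_integral_le_imp_integral_le[OF _ _ * A(2)] by auto
qed

lemma weighted_square_integral:
 assumes k: "L1 (\<lambda>h. k h * \<eta> h)" and k2: "L1 (\<lambda>h. (k h)^2 * \<eta> h)"
 shows "(LBINT h. k h * \<eta> h)^2 \<le> (LBINT h. (k h)^2 * \<eta> h)"
proof -
 define m where "m = (LBINT h. k h * \<eta> h)"
 have "0 \<le> (LBINT h. (k h - m)^2 * \<eta> h)" using eta_nonneg by (intro integral_nonneg_AE) auto
 also have "(\<lambda>h. (k h - m)^2 * \<eta> h) = (\<lambda>h. (k h)^2 * \<eta> h - 2 * m * (k h * \<eta> h) + m^2 * \<eta> h)"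
  by (auto simp: power2_eq_square algebra_simps)
 also have "(LBINT h. (k h)^2 * \<eta> h - 2 * m * (k h * \<eta> h) + m^2 * \<eta> h) =
   (LBINT h. (k h)^2 * \<eta> h) - 2 * m * m + m^2"
  using k k2 eta_integrable eta_integral by (simp add: m_def)
 finally show ?thesis by (simp add: m_def power2_eq_square)
qed

lemma mollify_L2:
 assumes f: "L1 f" and f2: "L1 (\<lambda>x. (f x)^2)"
  and A: "\<And>h. norm h < \<epsilon> ==> (LBINT x. (f (h + x) - f x)^2) \<le> A" "0 \<le> A"
 shows "L1 (\<lambda>x. ((LBINT y. f y * \<eta> (x - y)) - f x)^2)"
  and "(LBINT x. ((LBINT y. f y * \<eta> (x - y)) - f x)^2) \<le> A"
proof -
 have [measurable]: "f \<in> Borel" using f by auto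
 obtain M where M: "M > 0" "\<And>x. \<bar>\<eta> x\<bar> \<le> M" using eta_bounded by blast
 have fh2: "L1 (\<lambda>x. (f (h + x))^2)" for h
  using lborel_shift(2)[of "\<lambda>x. (f x)^2" h] f2 by simp
 have d2: "(p - q)^2 \<le> 2 * (p^2 + q^2)" for p q :: real
  using sum_squares_bound[of p "- q"] by (simp add: power2_eq_square algebra_simps)
 have "ennreal (((LBINT y. f y * \<eta> (x - y)) - f x)^2) \<le> (\<integral>\<^sup>+h. ennreal ((f (h + x) - f x)^2 * \<eta> h) \<partial>lborel)" for x
 proof -
  have i: "L1 (\<lambda>h. 2 * ((f (h + x))^2 * \<eta> h + (f x)^2 * \<eta> h))"
   using fh2[of x] integrable_lborel_mult_bounded[of "\<lambda>h. (f (h + x))^2" \<eta> M] M eta_integrable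
   by (auto simp: add.commute)
  have "L1 (\<lambda>h. (f (h + x) - f x)^2 * \<eta> h)"
  proof (rule Bochner_Integration.integrable_bound[OF i])
   show "AE h in lborel. norm ((f (h + x) - f x)^2 * \<eta> h) \<le> norm (2 * ((f (h + x))^2 * \<eta> h + (f x)^2 * \<eta> h))"
   proof (intro AE_I2)
    fix h
    have "(f (h + x) - f x)^2 * \<eta> h \<le> 2 * ((f (h + x))^2 + (f x)^2) * \<eta> h"
     by (intro mult_right_mono d2 eta_nonneg)
    then show "norm ((f (h + x) - f x)^2 * \<eta> h) \<le> norm (2 * ((f (h + x))^2 * \<eta> h + (f x)^2 * \<eta> h))"
     using eta_nonneg[of h] by (simp add: algebra_simps)
   qed
  qed auto
  then have "(\<integral>\<^sup>+h. ennreal ((f (h + x) - f x)^2 * \<eta> h) \<partial>lborel) = ennreal (LBINT h. (f (h + x) - f x)^2 * \<eta> h)"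
   and "(LBINT h. (f (h + x) - f x) * \<eta> h)^2 \<le> (LBINT h. (f (h + x) - f x)^2 * \<eta> h)"
   using eta_nonneg mollify_minus(2)[OF f, of x]
   by (auto intro!: nn_integral_eq_integral weighted_square_integral)
  then show ?thesis using mollify_minus(1)[OF f, of x] by (simp add: ennreal_leI)
 qed
 then have "(\<integral>\<^sup>+x. ennreal (((LBINT y. f y * \<eta> (x - y)) - f x)^2) \<partial>lborel) \<le>
   (\<integral>\<^sup>+x. \<integral>\<^sup>+h. ennreal ((f (h + x) - f x)^2 * \<eta> h) \<partial>lborel \<partial>lborel)"
  by (intro nn_integral_mono)
 also have "\<dots> \<le> ennreal A"
 proof (rule average_translation_bound)
  show "L1 (\<lambda>x. (f (h + x) - f x)^2)" for h
  proof (rule Bochner_Integration.integrable_bound[of _ "\<lambda>x. 2 * ((f (h + x))^2 + (f x)^2)"])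
   show "AE x in lborel. norm ((f (h + x) - f x)^2) \<le> norm (2 * ((f (h + x))^2 + (f x)^2))"
    using d2 by (intro AE_I2) (smt (verit) real_norm_def zero_le_power2)
  qed (use fh2 f2 in auto)
 qed (use A in auto)
 finally have *: "(\<integral>\<^sup>+x. ennreal (((LBINT y. f y * \<eta> (x - y)) - f x)^2) \<partial>lborel) \<le> ennreal A" .
 show "L1 (\<lambda>x. ((LBINT y. f y * \<eta> (x - y)) - f x)^2)"
  "(LBINT x. ((LBINT y. f y * \<eta> (x - y)) - f x)^2) \<le> A"
  using nn_integral_le_imp_integral_le[OF _ _ * A(2)] by auto
qed

lemma closure_support_subset: "closure {y. \<eta> (x - y) \<noteq> 0} \<subseteq> cball x \<epsilon>"
proof (rule closure_minimal)
 show "{y. \<eta> (x - y) \<noteq> 0} \<subseteq> cball x \<epsilon>"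
  using eta_zero by (auto simp: dist_norm) (meson le_less_linear less_le_not_le nle_le)
qed auto

lemma smooth_eta_shift: "smooth (\<lambda>y. \<eta> (x - y))"
 using smooth_affine[OF smooth_eta, of x "-1"] by simp

lemma frechet_eta_shift:
 "frechet_derivative (\<lambda>y. \<eta> (x - y)) (at y) v = - frechet_derivative \<eta> (at (x - y)) v"
 using frechet_derivative_affine[OF smooth_eta, of x "-1" y v] by simp

lemma test_function_mult_eta:
 assumes "smooth \<zeta>" "closed F" "cball x \<epsilon> \<inter> F \<subseteq> U" "\<And>y. \<zeta> y \<noteq> 0 ==> y \<in> F"
 shows "test_function U (\<lambda>y. \<zeta> y * \<eta> (x - y))"
proof -
 have "closure {y. \<zeta> y * \<eta> (x - y) \<noteq> 0} \<subseteq> closure {y. \<eta> (x - y) \<noteq> 0} \<inter> F"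
  using assms(2,4) by (intro Int_greatest closure_mono closure_minimal) auto
 then have *: "closure {y. \<zeta> y * \<eta> (x - y) \<noteq> 0} \<subseteq> cball x \<epsilon> \<inter> F" using closure_support_subset by blast
 then have "compact (closure {y. \<zeta> y * \<eta> (x - y) \<noteq> 0})"
  using bounded_subset[OF bounded_cball[of x \<epsilon>]] by (auto simp: compact_eq_bounded_closed)
 then show ?thesis unfolding test_function_def
  using * assms by (auto intro: smooth_mult smooth_eta_shift)
qed

lemma test_function_eta:
 assumes "cball x \<epsilon> \<subseteq> U"
 shows "test_function U (\<lambda>y. \<eta> (x - y))"
 using test_function_mult_eta[OF smooth_const[of 1], of UNIV x U] assms by simp

end

section \<open>Uniqueness of weak derivatives\<close>

text \<open>On \<open>K\<close> the excess of \<open>|h|\<close> over \<open>M\<close> is at most the distance of \<open>h\<close> from its mollification, which is small in the mean by continuity of translations.\<close>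

lemma mollified_limit_AE:
 fixes h :: "real^2 => real"
 assumes U: "open U" and li: "loc_integrable U h" and ex: "\<And>\<epsilon>. \<epsilon> > 0 ==> \<exists>\<eta>. mollifier C \<epsilon> \<eta>"
  and K: "compact K" "K \<subseteq> U" and M: "0 \<le> M" and e0: "e0 > 0"
  and bd: "\<And>\<epsilon> \<eta> x. 0 < \<epsilon> ==> \<epsilon> < e0 ==> mollifier C \<epsilon> \<eta> ==> x \<in> K ==> cball x \<epsilon> \<subseteq> U ==>
   \<bar>\<integral>y. h y * \<eta> (x - y) \<partial>lebesgue_on U\<bar> \<le> M"
 shows "AE x in lborel. x \<in> K --> \<bar>h x\<bar> \<le> M"
proof -
 have Ub: "U \<in> sets borel" using U by simp
 obtain r where r: "r > 0" "(\<Union>x\<in>K. cball x r) \<subseteq> U"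
  using compact_subset_open_imp_cball_epsilon_subset[OF K(1) U K(2)] by metis
 define K' where "K' = {x + y | x y. x \<in> K \<and> y \<in> cball 0 r}"
 have K'c: "compact K'" unfolding K'_def using K(1) by (intro compact_sums) auto
 have cb: "y \<in> K'" if "x \<in> K" "dist x y \<le> r" for x y
  unfolding K'_def using that by (intro CollectI exI[of _ x] exI[of _ "y - x"]) (auto simp: dist_norm norm_minus_commute)
 have K'U: "K' \<subseteq> U"
 proof
  fix z assume "z \<in> K'"
  then obtain x y where "x \<in> K" "norm y \<le> r" "z = x + y" by (auto simp: K'_def)
  then have "z \<in> cball x r" by (simp add: dist_norm)
  then show "z \<in> U" using r \<open>x \<in> K\<close> by blast
 qed
 have KK': "K \<subseteq> K'" using cb r(1) by force
 have K'b: "K' \<in> sets borel" using K'c by (simp add: compact_imp_closed)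
 have Kb[measurable]: "K \<in> sets borel" using K(1) by (simp add: compact_imp_closed)
 have hi: "integrable (lebesgue_on K') h" using li K'c K'U by (auto simp: loc_integrable_def)
 obtain f where f[measurable]: "f \<in> Borel" and fz: "\<And>x. x \<notin> K' ==> f x = 0"
  and fh: "AE x in lborel. x \<in> K' --> h x = f x"
  using lebesgue_on_borel_version[OF K'b] hi by blast
 have fi: "L1 f" using integral_lebesgue_on_borel(2)[OF K'b f fz fh] hi by simp
 have bound: "(LBINT x. ind K x * max 0 (\<bar>f x\<bar> - M)) \<le> e" if e: "e > 0" for e
 proof -
  obtain d where d: "d > 0" "\<And>k. norm k < d ==> (LBINT x. \<bar>f (k + x) - f x\<bar>) \<le> e"
   using L1_translation_modulus[OF fi e] by metis
  define \<epsilon> where "\<epsilon> = min d (min e0 r) / 2"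
  have eps: "\<epsilon> > 0" "\<epsilon> < d" "\<epsilon> < e0" "\<epsilon> < r" using d(1) e0 r(1) by (auto simp: \<epsilon>_def)
  obtain \<eta> where mo: "mollifier C \<epsilon> \<eta>" using ex eps(1) by blast
  interpret mollif C \<epsilon> \<eta> by unfold_locales fact
  have Fb: "\<bar>LBINT y. f y * \<eta> (x - y)\<bar> \<le> M" if x: "x \<in> K" for x
  proof -
   have "(\<integral>y. h y * \<eta> (x - y) \<partial>lebesgue_on U) = (LBINT y. f y * \<eta> (x - y))"
   proof (rule integral_lebesgue_on_borel(1)[OF Ub])
    show "f y * \<eta> (x - y) = 0" if "y \<notin> U" for y using that K'U fz by auto
    show "AE y in lborel. y \<in> U --> h y * \<eta> (x - y) = f y * \<eta> (x - y)"
     using fh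
    proof eventually_elim
     case (elim y)
     have "\<eta> (x - y) = 0" if "y \<notin> K'"
     proof (rule eta_zero)
      have "\<not> dist x y \<le> r" using cb[OF x] that by blast
      then show "\<epsilon> \<le> norm (x - y)" using eps by (simp add: dist_norm)
     qed
     then show ?case using elim by auto
    qed
   qed measurable
   moreover have "cball x \<epsilon> \<subseteq> U" using r(2) x eps by (meson UN_subset_iff less_imp_le subset_cball subset_trans)
   ultimately show ?thesis using bd[OF eps(1,3) mo x] by simp
  qed
  have *: "norm k < \<epsilon> ==> (LBINT x. \<bar>f (k + x) - f x\<bar>) \<le> e" for k using d(2) eps(2) by auto
  note mo1 = mollify_L1[OF fi * less_imp_le[OF e]]
  have "(LBINT x. ind K x * max 0 (\<bar>f x\<bar> - M)) \<le> (LBINT x. \<bar>(LBINT y. f y * \<eta> (x - y)) - f x\<bar>)"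
  proof (rule integral_mono_AE')
   show "AE x in lborel. ind K x * max 0 (\<bar>f x\<bar> - M) \<le> \<bar>(LBINT y. f y * \<eta> (x - y)) - f x\<bar>"
   proof (intro AE_I2)
    fix x
    show "ind K x * max 0 (\<bar>f x\<bar> - M) \<le> \<bar>(LBINT y. f y * \<eta> (x - y)) - f x\<bar>"
     using Fb[of x] by (cases "x \<in> K") auto
   qed
  qed (use mo1 in auto)
  with mo1 show ?thesis by linarith
 qed
 have int: "L1 (\<lambda>x. ind K x * max 0 (\<bar>f x\<bar> - M))"
  by (rule Bochner_Integration.integrable_bound[OF fi]) (use M in \<open>auto simp: indicator_def\<close>)
 have "(LBINT x. ind K x * max 0 (\<bar>f x\<bar> - M)) \<le> 0"
  by (rule field_le_epsilon) (use bound in auto)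
 moreover have "(LBINT x. ind K x * max 0 (\<bar>f x\<bar> - M)) \<ge> 0"
  by (intro integral_nonneg_AE) auto
 ultimately have "AE x in lborel. ind K x * max 0 (\<bar>f x\<bar> - M) = 0"
  using integral_nonneg_eq_0_iff_AE[OF int] by simp
 with fh show ?thesis
  by eventually_elim (use KK' in \<open>auto simp: indicator_def\<close>)
qed

lemma AE_on_open_if_AE_on_compacts:
 fixes U :: "'a::euclidean_space set"
 assumes U: "open U" and K: "\<And>K. compact K ==> K \<subseteq> U ==> AE x in lborel. x \<in> K --> Q x"
 shows "AE x in lborel. x \<in> U --> Q x"
proof -
 have "\<exists>D :: nat => 'a set. (\<forall>n. compact (D n)) \<and> (\<forall>n. D n \<subseteq> U) \<and> \<Union>(range D) = U"
 proof (rule open_Union_compact_subsets[OF U])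
  fix D :: "nat => 'a set"
  assume "\<And>n. compact (D n)" "\<And>n. D n \<subseteq> U" "\<Union>(range D) = U"
  then show ?thesis by (intro exI[of _ D]) simp
 qed
 then obtain D :: "nat => 'a set" where D: "\<forall>n. compact (D n)" "\<forall>n. D n \<subseteq> U" "\<Union>(range D) = U"
  by (elim exE conjE) (rule that)
 have "AE x in lborel. x \<in> D n --> Q x" for n
  using K[of "D n"] D(1,2) by simp
 then have "AE x in lborel. \<forall>n. x \<in> D n --> Q x"
  by (simp only: AE_all_countable) simp
 then show ?thesis by eventually_elim (use D(3) in auto)
qed

text \<open>Testing with the mollifier itself shows that every mollification vanishes.\<close>

theorem weakly_zero_imp_AE_zero:
 fixes h :: "real^2 => real"
 assumes U: "open U" and li: "loc_integrable U h"
  and z: "\<And>\<phi>. test_function U \<phi> ==> (\<integral>x. h x * \<phi> x \<partial>lebesgue_on U) = 0"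
 shows "AE x in lebesgue_on U. h x = 0"
proof -
 obtain C where "C > 0" and ex: "\<And>\<epsilon>. \<epsilon> > 0 ==> \<exists>\<eta>. mollifier C \<epsilon> \<eta>" using exists_mollifier by metis
 have "AE x in lborel. x \<in> U --> \<bar>h x\<bar> \<le> 0"
 proof (rule AE_on_open_if_AE_on_compacts[OF U])
  fix K assume K: "compact K" "K \<subseteq> U"
  show "AE x in lborel. x \<in> K --> \<bar>h x\<bar> \<le> 0"
  proof (rule mollified_limit_AE[OF U li ex K order_refl zero_less_one])
   fix \<epsilon> \<eta> x assume "mollifier C \<epsilon> \<eta>" and x: "cball x \<epsilon> \<subseteq> U"
   then interpret mollif C \<epsilon> \<eta> by unfold_locales
   show "\<bar>\<integral>y. h y * \<eta> (x - y) \<partial>lebesgue_on U\<bar> \<le> 0"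
    using z[OF test_function_eta[OF x]] by simp
  qed
 qed
 then show ?thesis using U by (subst AE_lebesgue_on_iff) auto
qed

lemma test_function_deriv_zero:
 assumes "test_function U \<phi>" "x \<notin> U"
 shows "\<phi> x = 0" "frechet_derivative \<phi> (at x) v = 0"
proof -
 have c: "closure {x. \<phi> x \<noteq> 0} \<subseteq> U" using assms by (auto simp: test_function_def)
 have out: "\<phi> y = 0" if "y \<notin> closure {x. \<phi> x \<noteq> 0}" for y
  using that closure_subset[of "{x. \<phi> x \<noteq> 0}"] by blast
 have x: "x \<notin> closure {x. \<phi> x \<noteq> 0}" using c assms(2) by auto
 show "\<phi> x = 0" by (rule out[OF x])
 show "frechet_derivative \<phi> (at x) v = 0"
 proof (rule frechet_derivative_zero_open)
  show "open (- closure {x. \<phi> x \<noteq> 0})" by (intro open_Compl closed_closure)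
  show "x \<in> - closure {x. \<phi> x \<noteq> 0}" using x by blast
  show "\<phi> y = 0" if "y \<in> - closure {x. \<phi> x \<noteq> 0}" for y
   by (rule out) (use that in blast)
 qed
qed

lemma integrable_mult_test_function:
 fixes g \<phi> :: "real^2 => real"
 assumes U: "open U" and li: "loc_integrable U g" and t: "test_function U \<phi>"
 shows "integrable (lebesgue_on U) (\<lambda>x. g x * \<phi> x)"
  and "integrable (lebesgue_on U) (\<lambda>x. g x * pd j \<phi> x)"
proof -
 define K where "K = closure {x. \<phi> x \<noteq> 0}"
 have K: "compact K" "K \<subseteq> U" and s: "smooth \<phi>" using t by (auto simp: K_def test_function_def)
 have Kb: "K \<in> sets borel" and Ub: "U \<in> sets borel" using K U by (auto intro: borel_compact)
 have gi: "integrable (lebesgue_on K) g" using li K by (auto simp: loc_integrable_def)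
 obtain f where f[measurable]: "f \<in> Borel" and fz: "\<And>x. x \<notin> K ==> f x = 0"
  and fg: "AE x in lborel. x \<in> K --> g x = f x"
  using lebesgue_on_borel_version[OF Kb] gi by blast
 have fi: "L1 f" using integral_lebesgue_on_borel(2)[OF Kb f fz fg] gi by simp
 have main: "integrable (lebesgue_on U) (\<lambda>x. g x * k x)" if k: "continuous_on UNIV k" and kz: "\<And>x. x \<notin> K ==> k x = 0" for k
 proof -
  obtain r where "r > 0" "K \<subseteq> ball 0 r" using compact_imp_bounded[OF K(1)] bounded_subset_ballD by blast
  then obtain M where "\<And>x. \<bar>k x\<bar> \<le> M"
   using continuous_compact_support_bounded[OF k, of r] kz by (metis dist_0_norm linorder_not_le mem_ball subsetD)
  moreover have [measurable]: "k \<in> Borel" using k by (rule borel_measurable_continuous_onI)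
  ultimately have fk: "L1 (\<lambda>x. f x * k x)"
   by (intro integrable_lborel_mult_bounded[OF fi]) auto
  have "f x * k x = 0" if "x \<notin> U" for x using fz[of x] K(2) that by auto
  moreover have "AE x in lborel. x \<in> U --> g x * k x = f x * k x"
   using fg
  proof eventually_elim
   case (elim x)
   then show ?case using kz[of x] by auto
  qed
  ultimately show ?thesis
   using fk by (subst integral_lebesgue_on_borel(2)[OF Ub, of "\<lambda>x. f x * k x"]) auto
 qed
 show "integrable (lebesgue_on U) (\<lambda>x. g x * \<phi> x)"
 proof (rule main[OF smooth_continuous_on[OF s]])
  show "\<phi> x = 0" if "x \<notin> K" for x
   using that closure_subset[of "{x. \<phi> x \<noteq> 0}"] unfolding K_def by blast
 qed
 have t': "test_function K \<phi>" using t K by (auto simp: test_function_def K_def)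
 show "integrable (lebesgue_on U) (\<lambda>x. g x * pd j \<phi> x)"
  using test_function_deriv_zero[OF t']
  by (intro main smooth_continuous_on[OF smooth_partial[OF s]]) (auto simp: Basis_vec_def)
qed

theorem weak_deriv_unique:
 fixes g :: "real^2 => real"
 assumes U: "open U" and h: "has_weak_deriv U (axis j 1) g h" and k: "has_weak_deriv U (axis j 1) g k"
 shows "AE x in lebesgue_on U. h x = k x"
proof -
 have li: "loc_integrable U h" "loc_integrable U k" using h k by (auto simp: has_weak_deriv_def)
 have "AE x in lebesgue_on U. h x - k x = 0"
 proof (rule weakly_zero_imp_AE_zero[OF U])
  show "loc_integrable U (\<lambda>x. h x - k x)" using li by (auto simp: loc_integrable_def)
  fix \<phi> assume t: "test_function U \<phi>"
  note i = integrable_mult_test_function(1)[OF U _ t]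
  have "(\<integral>x. (h x - k x) * \<phi> x \<partial>lebesgue_on U) = (\<integral>x. h x * \<phi> x \<partial>lebesgue_on U) - (\<integral>x. k x * \<phi> x \<partial>lebesgue_on U)"
   using i[OF li(1)] i[OF li(2)] by (simp add: left_diff_distrib)
  also have "\<dots> = 0" using h k t by (simp add: has_weak_deriv_def)
  finally show "(\<integral>x. (h x - k x) * \<phi> x \<partial>lebesgue_on U) = 0" .
 qed
 then show ?thesis by simp
qed

lemma weak_deriv_works:
 "has_weak_deriv U b g h ==> has_weak_deriv U b g (weak_deriv U b g)"
 unfolding weak_deriv_def by (rule someI[where P = "has_weak_deriv U b g"])

lemma linear_axis_expand:
 fixes g :: "real^2 => real"
 assumes "linear g"
 shows "g v = (\<Sum>j\<in>UNIV. v $ j * g (axis j 1))"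
proof -
 have "g v = g (\<Sum>j\<in>UNIV. v $ j *\<^sub>R axis j 1)"
  using basis_expansion[of v] by (simp add: scalar_mult_eq_scaleR)
 then show ?thesis by (simp add: linear_sum[OF assms] linear_scale[OF assms])
qed

context mollif
begin

lemma deta_borel [measurable]: "(\<lambda>x. pd i \<eta> x) \<in> Borel"
 by (intro borel_measurable_continuous_onI smooth_continuous_on smooth_partial smooth_eta)
  (auto simp: Basis_vec_def)

lemma deta_expand: "frechet_derivative \<eta> (at x) v = (\<Sum>j\<in>UNIV. v $ j * pd j \<eta> x)"
 by (rule linear_axis_expand[OF linear_frechet_derivative[OF smooth_differentiable[OF smooth_eta]]])

lemma deta_zero: "\<epsilon> < norm x ==> frechet_derivative \<eta> (at x) v = 0"
 by (rule frechet_derivative_zero_open[of "- cball 0 \<epsilon>" _ _ 0]) (use eta_zero in auto)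

lemma convolution_directional_derivative:
 assumes f: "L1 f"
 shows "((\<lambda>s. LBINT z. f z * \<eta> (x + s *\<^sub>R v - z)) has_real_derivative
   (\<Sum>j\<in>UNIV. v $ j * (LBINT z. f z * pd j \<eta> (x + s *\<^sub>R v - z)))) (at s)"
proof -
 have [measurable]: "f \<in> Borel" using f by auto
 define L where "L = (\<Sum>j\<in>UNIV. \<bar>v $ j\<bar> * (C / \<epsilon> ^ 3))"
 have Db: "\<bar>frechet_derivative \<eta> (at p) v\<bar> \<le> L" for p
 proof -
  have "\<bar>frechet_derivative \<eta> (at p) v\<bar> \<le> (\<Sum>j\<in>UNIV. \<bar>v $ j * pd j \<eta> p\<bar>)"
   unfolding deta_expand[of p v] by (rule sum_abs)
  also have "\<dots> \<le> L" unfolding L_def abs_mult by (intro sum_mono mult_left_mono deta_bound) auto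
  finally show ?thesis .
 qed
 have der: "((\<lambda>t. \<eta> (x + t *\<^sub>R v - z)) has_real_derivative frechet_derivative \<eta> (at (x + t *\<^sub>R v - z)) v) (at t)" for t z
 proof -
  have "((\<lambda>t. \<eta> (x + t *\<^sub>R v - z)) has_derivative (\<lambda>h. frechet_derivative \<eta> (at (x + t *\<^sub>R v - z)) (h *\<^sub>R v))) (at t)"
   by (rule has_derivative_compose[OF _ smooth_has_derivative[OF smooth_eta]]) (auto intro!: derivative_eq_intros)
  then show ?thesis unfolding has_field_derivative_def
   by (simp add: linear_scale[OF linear_frechet_derivative[OF smooth_differentiable[OF smooth_eta]]] mult_commute_abs)
 qed
 have Lip: "\<bar>\<eta> (x + t *\<^sub>R v - z) - \<eta> (x + s *\<^sub>R v - z)\<bar> \<le> L * \<bar>t - s\<bar>" for t z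
  using field_differentiable_bound[of UNIV "\<lambda>t. \<eta> (x + t *\<^sub>R v - z)" "\<lambda>t. frechet_derivative \<eta> (at (x + t *\<^sub>R v - z)) v" L t s]
   der Db by auto
 have ide: "L1 (\<lambda>z. f z * pd j \<eta> (p - z))" for p j
  by (rule integrable_lborel_mult_bounded[OF f _ deta_bound]) measurable
 obtain M where M: "M > 0" "\<And>x. \<bar>\<eta> x\<bar> \<le> M" using eta_bounded by blast
 have ie: "L1 (\<lambda>z. f z * \<eta> (p - z))" for p
  by (rule integrable_lborel_mult_bounded[OF f _ M(2)]) measurable
 have sumeq: "(\<Sum>j\<in>UNIV. v $ j * (LBINT z. f z * pd j \<eta> (x + s *\<^sub>R v - z)))
   = (LBINT z. f z * frechet_derivative \<eta> (at (x + s *\<^sub>R v - z)) v)"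
 proof -
  have "f z * frechet_derivative \<eta> (at (x + s *\<^sub>R v - z)) v =
   (\<Sum>j\<in>UNIV. v $ j * (f z * pd j \<eta> (x + s *\<^sub>R v - z)))" for z
   unfolding deta_expand[of _ v] sum_distrib_left by (simp add: mult.left_commute)
  then show ?thesis using ide by simp
 qed
 show ?thesis
  unfolding sumeq has_field_derivative_iff tendsto_at_iff_sequentially
 proof (intro allI impI)
  fix X :: "nat => real" assume X: "\<forall>i. X i \<in> UNIV - {s}" "X \<longlonglongrightarrow> s"
  have "(\<lambda>n. LBINT z. f z * ((\<eta> (x + X n *\<^sub>R v - z) - \<eta> (x + s *\<^sub>R v - z)) / (X n - s)))
    \<longlonglongrightarrow> (LBINT z. f z * frechet_derivative \<eta> (at (x + s *\<^sub>R v - z)) v)"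
  proof (rule integral_dominated_convergence[where w = "\<lambda>z. L * \<bar>f z\<bar>"])
   show "AE z in lborel. (\<lambda>n. f z * ((\<eta> (x + X n *\<^sub>R v - z) - \<eta> (x + s *\<^sub>R v - z)) / (X n - s)))
     \<longlonglongrightarrow> f z * frechet_derivative \<eta> (at (x + s *\<^sub>R v - z)) v"
   proof (intro AE_I2 tendsto_mult tendsto_const)
    fix z
    show "(\<lambda>n. (\<eta> (x + X n *\<^sub>R v - z) - \<eta> (x + s *\<^sub>R v - z)) / (X n - s)) \<longlonglongrightarrow> frechet_derivative \<eta> (at (x + s *\<^sub>R v - z)) v"
     using der[of z s, unfolded has_field_derivative_iff tendsto_at_iff_sequentially] X by (auto simp: o_def)
   qed
   show "AE z in lborel. norm (f z * ((\<eta> (x + X n *\<^sub>R v - z) - \<eta> (x + s *\<^sub>R v - z)) / (X n - s))) \<le> L * \<bar>f z\<bar>" for n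
   proof (intro AE_I2)
    fix z
    have "X n - s \<noteq> 0" using X by auto
    then have "\<bar>(\<eta> (x + X n *\<^sub>R v - z) - \<eta> (x + s *\<^sub>R v - z)) / (X n - s)\<bar> \<le> L"
     using Lip[of "X n" z] by (simp add: divide_simps)
    then have "\<bar>f z\<bar> * \<bar>(\<eta> (x + X n *\<^sub>R v - z) - \<eta> (x + s *\<^sub>R v - z)) / (X n - s)\<bar> \<le> \<bar>f z\<bar> * L"
     by (intro mult_left_mono) auto
    then show "norm (f z * ((\<eta> (x + X n *\<^sub>R v - z) - \<eta> (x + s *\<^sub>R v - z)) / (X n - s))) \<le> L * \<bar>f z\<bar>"
     by (simp add: abs_mult mult.commute)
   qed
   show "(\<lambda>z. f z * frechet_derivative \<eta> (at (x + s *\<^sub>R v - z)) v) \<in> borel_measurable lborel"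
    unfolding deta_expand[of _ v] by measurable
  qed (use f in auto)
  moreover have "(LBINT z. f z * ((\<eta> (x + X n *\<^sub>R v - z) - \<eta> (x + s *\<^sub>R v - z)) / (X n - s))) =
   ((LBINT z. f z * \<eta> (x + X n *\<^sub>R v - z)) - (LBINT z. f z * \<eta> (x + s *\<^sub>R v - z))) / (X n - s)" for n
   using ie by (simp add: right_diff_distrib[symmetric] Bochner_Integration.integral_diff[symmetric] del: Bochner_Integration.integral_diff)
  ultimately show "((\<lambda>y. ((LBINT z. f z * \<eta> (x + y *\<^sub>R v - z)) - (LBINT z. f z * \<eta> (x + s *\<^sub>R v - z))) / (y - s)) \<circ> X)
   \<longlonglongrightarrow> (LBINT z. f z * frechet_derivative \<eta> (at (x + s *\<^sub>R v - z)) v)"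
   by (simp only: o_def)
 qed
qed

end

section \<open>Functions with bounded weak gradient are bounded\<close>

lemma loc_integrable_borel_version:
 assumes li: "loc_integrable U g" and K: "compact K" "K \<subseteq> U"
 shows "\<exists>g'. g' \<in> Borel \<and> (\<forall>x. x \<notin> K --> g' x = 0)
  \<and> (AE x in lborel. x \<in> K --> g x = g' x) \<and> L1 g'"
proof -
 have Kb: "K \<in> sets borel" using K(1) by (rule borel_compact)
 have gi: "integrable (lebesgue_on K) g" using li K by (simp add: loc_integrable_def)
 have gm: "g \<in> borel_measurable (lebesgue_on K)" using gi by (rule borel_measurable_integrable)
 show ?thesis
 proof (rule lebesgue_on_borel_version[OF Kb gm])
  fix g' assume a: "g' \<in> Borel" "\<And>x. x \<notin> K ==> g' x = 0"
   "AE x in lborel. x \<in> K --> g x = g' x"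
  have "L1 g'" using integral_lebesgue_on_borel(2)[OF Kb a] gi by simp
  with a show ?thesis by (intro exI[of _ g'] conjI) auto
 qed
qed

lemma integral_local_borel_version:
 fixes g g' k :: "'a::euclidean_space => real"
 assumes U: "open U" and KU: "K \<subseteq> U"
  and g': "g' \<in> Borel" and z: "\<forall>x. x \<notin> K --> g' x = 0"
  and ae: "AE x in lborel. x \<in> K --> g x = g' x"
  and k: "k \<in> Borel" and kz: "\<And>x. x \<notin> K ==> k x = 0"
 shows "(\<integral>x. g x * k x \<partial>lebesgue_on U) = (LBINT x. g' x * k x)"
proof (rule integral_lebesgue_on_borel(1))
 show "U \<in> sets borel" using U by simp
 show "(\<lambda>x. g' x * k x) \<in> Borel" using g' k by simp
 show "g' x * k x = 0" if "x \<notin> U" for x using that KU z by auto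
 show "AE x in lborel. x \<in> U --> g x * k x = g' x * k x"
  using ae
 proof eventually_elim
  case (elim x)
  then show ?case by (cases "x \<in> K") (simp_all add: kz)
 qed
qed

lemma compact_add_cball: "compact K ==> compact {x + y | x y. x \<in> K \<and> y \<in> cball (0::'a::euclidean_space) r}"
 by (rule compact_sums) auto

lemma cball_subset_add: "x \<in> K ==> cball x r \<subseteq> {x + y | x y. x \<in> K \<and> y \<in> cball (0::'a::euclidean_space) r}"
proof
 fix y assume "x \<in> K" "y \<in> cball x r"
 then show "y \<in> {x + y | x y. x \<in> K \<and> y \<in> cball (0::'a) r}"
  by (intro CollectI exI[of _ x] exI[of _ "y - x"]) (auto simp: dist_norm norm_minus_commute)
qed

lemma add_cball_subset:
 assumes "\<And>x. x \<in> K ==> cball x r \<subseteq> U"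
 shows "{x + y | x y. x \<in> K \<and> y \<in> cball (0::'a::euclidean_space) r} \<subseteq> U"
proof
 fix z assume "z \<in> {x + y | x y. x \<in> K \<and> y \<in> cball (0::'a) r}"
 then obtain x y where "x \<in> K" "norm y \<le> r" "z = x + y" by auto
 then have "z \<in> cball x r" by (simp add: dist_norm)
 then show "z \<in> U" using assms[OF \<open>x \<in> K\<close>] by blast
qed

context mollif
begin

lemma integral_eta_shift: "(LBINT z. \<eta> (p - z)) = 1" "L1 (\<lambda>z. \<eta> (p - z))"
 using lborel_reflect[of \<eta> p] eta_integral eta_integrable by auto

text \<open>The derivative of a mollification along a segment is the mollification of the weak derivative, as long as the mollifier stays in \<open>U\<close> along the segment.\<close>

lemma mollified_lipschitz:
 assumes U: "open U" and seg: "\<And>s. 0 \<le> s ==> s \<le> 1 ==> cball (x + s *\<^sub>R v) \<epsilon> \<subseteq> U"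
  and wd: "\<And>j. has_weak_deriv U (axis j 1) f (h j)"
  and hb: "\<And>j. AE x in lborel. x \<in> U --> \<bar>h j x\<bar> \<le> N" and N0: "0 \<le> N"
 shows "\<bar>(\<integral>y. f y * \<eta> (x + v - y) \<partial>lebesgue_on U) - (\<integral>y. f y * \<eta> (x - y) \<partial>lebesgue_on U)\<bar>
   \<le> 2 * N * norm v"
proof -
 define S where "S = (\<lambda>s. x + s *\<^sub>R v) ` {0..1}"
 have Sc: "compact S" unfolding S_def by (intro compact_continuous_image continuous_intros) auto
 define K where "K = {x + y | x y. x \<in> S \<and> y \<in> cball 0 \<epsilon>}"
 have K: "compact K" "K \<subseteq> U"
 proof -
  show "compact K" unfolding K_def by (rule compact_add_cball[OF Sc])
  show "K \<subseteq> U" unfolding K_def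
  proof (rule add_cball_subset)
   fix y assume "y \<in> S"
   then obtain s where "s \<in> {0..1}" "y = x + s *\<^sub>R v" unfolding S_def by (rule imageE) auto
   then show "cball y \<epsilon> \<subseteq> U" using seg[of s] by simp
  qed
 qed
 have cbK: "cball (x + s *\<^sub>R v) \<epsilon> \<subseteq> K" if "0 \<le> s" "s \<le> 1" for s
  unfolding K_def by (rule cball_subset_add) (use that in \<open>auto simp: S_def\<close>)
 have li: "loc_integrable U f" "\<And>j. loc_integrable U (h j)" using wd by (auto simp: has_weak_deriv_def)
 obtain f' where f': "f' \<in> Borel" "\<forall>x. x \<notin> K --> f' x = 0"
   "AE x in lborel. x \<in> K --> f x = f' x" "L1 f'"
  using loc_integrable_borel_version[OF li(1) K] by blast
 have etaK: "\<eta> (x + s *\<^sub>R v - y) = 0" if "0 \<le> s" "s \<le> 1" "y \<notin> K" for s y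
  using subsetD[OF cbK[OF that(1,2)], of y] that(3) by (intro eta_zero) (force simp: dist_norm)
 have detaK: "frechet_derivative \<eta> (at (x + s *\<^sub>R v - y)) w = 0" if "0 \<le> s" "s \<le> 1" "y \<notin> K" for s y w
  using subsetD[OF cbK[OF that(1,2)], of y] that(3) by (intro deta_zero) (force simp: dist_norm)
 have comp: "\<bar>LBINT z. f' z * pd j \<eta> (x + s *\<^sub>R v - z)\<bar> \<le> N"
  if s: "0 \<le> s" "s \<le> 1" for s j
 proof -
  define p where "p = x + s *\<^sub>R v"
  obtain k where k: "k \<in> Borel" "\<forall>x. x \<notin> K --> k x = 0"
   "AE x in lborel. x \<in> K --> h j x = k x" "L1 k"
   using loc_integrable_borel_version[OF li(2)[of j] K] by blast
  have "(LBINT z. f' z * pd j \<eta> (p - z))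
   = (\<integral>z. f z * pd j \<eta> (p - z) \<partial>lebesgue_on U)"
   unfolding p_def
   by (rule integral_local_borel_version[OF U K(2) f'(1-3), symmetric]) (measurable, rule detaK[OF s])
  also have "\<dots> = - (\<integral>z. f z * pd j (\<lambda>y. \<eta> (p - y)) z \<partial>lebesgue_on U)"
   by (simp add: frechet_eta_shift)
  also have "\<dots> = (\<integral>z. h j z * \<eta> (p - z) \<partial>lebesgue_on U)"
   using wd[of j] test_function_eta[OF seg[OF s]] by (simp add: has_weak_deriv_def p_def)
  also have "\<dots> = (LBINT z. k z * \<eta> (p - z))"
   unfolding p_def
   by (rule integral_local_borel_version[OF U K(2) k(1-3)]) (measurable, rule etaK[OF s])
  finally have eq: "(LBINT z. f' z * pd j \<eta> (p - z)) = (LBINT z. k z * \<eta> (p - z))" .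
  have "\<bar>LBINT z. k z * \<eta> (p - z)\<bar> \<le> (LBINT z. \<bar>k z * \<eta> (p - z)\<bar>)" by (rule integral_abs_bound)
  also have "\<dots> \<le> (LBINT z. N * \<eta> (p - z))"
  proof (rule integral_mono_AE')
   show "AE z in lborel. \<bar>k z * \<eta> (p - z)\<bar> \<le> N * \<eta> (p - z)"
    using k(3) hb[of j]
   proof eventually_elim
    case (elim z)
    show ?case
    proof (cases "z \<in> K")
     case True
     then have "\<bar>k z\<bar> \<le> N" using elim K(2) by auto
     then show ?thesis using eta_nonneg[of "p - z"] by (simp add: abs_mult mult_right_mono)
    next
     case False
     then show ?thesis using etaK[OF s] by (simp add: p_def)
    qed
   qed
  qed (use integral_eta_shift eta_nonneg N0 in auto)
  also have "\<dots> = N" using integral_eta_shift by simp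
  finally show ?thesis using eq by (simp add: p_def)
 qed
 have G: "(\<integral>y. f y * \<eta> (x + s *\<^sub>R v - y) \<partial>lebesgue_on U) = (LBINT z. f' z * \<eta> (x + s *\<^sub>R v - z))"
  if s: "0 \<le> s" "s \<le> 1" for s
  by (rule integral_local_borel_version[OF U K(2) f'(1-3)]) (measurable, rule etaK[OF s])
 have "\<bar>(LBINT z. f' z * \<eta> (x + 1 *\<^sub>R v - z)) - (LBINT z. f' z * \<eta> (x + 0 *\<^sub>R v - z))\<bar>
   \<le> (2 * N * norm v) * norm (1 - 0 :: real)"
  unfolding real_norm_def[symmetric]
 proof (rule field_differentiable_bound[of "{0..1}"])
  fix s :: real assume s: "s \<in> {0..1}"
  show "((\<lambda>s. LBINT z. f' z * \<eta> (x + s *\<^sub>R v - z)) has_real_derivative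
   (\<Sum>j\<in>UNIV. v $ j * (LBINT z. f' z * pd j \<eta> (x + s *\<^sub>R v - z)))) (at s within {0..1})"
   by (rule has_field_derivative_at_within[OF convolution_directional_derivative[OF f'(4)]])
  have "\<bar>\<Sum>j\<in>UNIV. v $ j * (LBINT z. f' z * pd j \<eta> (x + s *\<^sub>R v - z))\<bar>
   \<le> (\<Sum>j\<in>UNIV. \<bar>v $ j * (LBINT z. f' z * pd j \<eta> (x + s *\<^sub>R v - z))\<bar>)"
   by (rule sum_abs)
  also have "\<dots> \<le> (\<Sum>j\<in>(UNIV::2 set). norm v * N)"
   unfolding abs_mult using comp s N0
   by (intro sum_mono mult_mono) (auto simp: component_le_norm_cart)
  finally show "norm (\<Sum>j\<in>UNIV. v $ j * (LBINT z. f' z * pd j \<eta> (x + s *\<^sub>R v - z)))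
   \<le> 2 * N * norm v" by (simp add: mult_ac)
 qed auto
 then show ?thesis using G[of 0] G[of 1] by simp
qed

end

lemma norm_vec2: "norm (x :: real^2) = sqrt ((x$1)^2 + (x$2)^2)"
 by (simp add: norm_vec_def L2_set_def UNIV_2)

lemma annulus_eq_norm:
 assumes "0 < a" "0 < b"
 shows "annulus a b = {x. a < norm x \<and> norm x < b}"
proof -
 have "a < norm x \<longleftrightarrow> a^2 < (x$1)^2 + (x$2)^2" "norm x < b \<longleftrightarrow> (x$1)^2 + (x$2)^2 < b^2" for x :: "real^2"
  using assms real_less_rsqrt real_less_lsqrt
  by (auto simp: norm_vec2 intro!: real_less_rsqrt real_less_lsqrt)
   (smt (verit, best) real_sqrt_less_iff real_sqrt_abs real_sqrt_unique)+
 then show ?thesis by (auto simp: annulus_def)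
qed

lemma open_annulus: "open (annulus a b)"
 unfolding annulus_def
 by (intro open_Collect_conj open_Collect_less continuous_intros)

text \<open>Mollifications are Lipschitz along segments with a constant that does not depend on the scale.  A radial segment leads from any point to the middle of the annulus, and a short one from there to every point of a ball of fixed radius; averaging over that ball bounds the mollification by the integral of \<open>|f|\<close>.  In this way the potential, whose gradient is bounded, is seen to be square integrable.\<close>

theorem bounded_weak_gradient_imp_bounded:
 assumes ab: "0 < a" "a < b"
  and wd: "\<And>j. has_weak_deriv (annulus a b) (axis j 1) f (h j)"
  and hb: "\<And>j. AE x in lborel. x \<in> annulus a b --> \<bar>h j x\<bar> \<le> N"
 shows "\<exists>M. AE x in lborel. x \<in> annulus a b --> \<bar>f x\<bar> \<le> M"
proof -
 define U where "U = annulus a b"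
 have Ueq: "U = {x. a < norm x \<and> norm x < b}" using annulus_eq_norm ab by (simp add: U_def)
 have U: "open U" by (simp add: U_def open_annulus)
 note wd' = wd[folded U_def] and hb' = hb[folded U_def]
 have li: "loc_integrable U f" using wd' by (auto simp: has_weak_deriv_def)
 obtain C where "C > 0" and ex: "\<And>\<epsilon>. \<epsilon> > 0 ==> \<exists>\<eta>. mollifier C \<epsilon> \<eta>" using exists_mollifier by metis
 define N' where "N' = max N 0"
 have hb'': "AE x in lborel. x \<in> U --> \<bar>h j x\<bar> \<le> N'" for j
  using hb'[of j] by eventually_elim (auto simp: N'_def)
 have N': "0 \<le> N'" by (simp add: N'_def)
 define d where "d = (b - a) / 4"
 define m where "m = (a + b) / 2"
 have d: "d > 0" "m - 2 * d = a" "m + 2 * d = b" "m > 0" using ab by (auto simp: d_def m_def field_simps)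
 define R where "R = {x::real^2. m - 3/2 * d \<le> norm x \<and> norm x \<le> m + 3/2 * d}"
 have R: "compact R" "R \<subseteq> U"
 proof -
  have "closed R" unfolding R_def by (intro closed_Collect_conj closed_Collect_le continuous_intros)
  moreover have "R \<subseteq> cball 0 (m + 3/2 * d)" by (auto simp: R_def)
  ultimately show "compact R" using bounded_subset[OF bounded_cball] by (auto simp: compact_eq_bounded_closed)
  show "R \<subseteq> U" using d by (auto simp: R_def Ueq)
 qed
 obtain g where g: "g \<in> Borel" "\<forall>x. x \<notin> R --> g x = 0"
   "AE x in lborel. x \<in> R --> f x = g x" "L1 g"
  using loc_integrable_borel_version[OF li R] by blast
 define I where "I = (LBINT x. \<bar>g x\<bar>)"
 have I: "0 \<le> I" by (simp add: I_def)
 define M where "M = 2 * N' * (b - a) + 2 * N' * d + 3 * I / measure lborel (ball (0::real^2) d)"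
 have vol: "measure lborel (ball p d) = measure lborel (ball (0::real^2) d)" "0 < measure lborel (ball (0::real^2) d)" for p :: "real^2"
  using d by (simp_all add: content_ball unit_ball_vol_2)
 have M0: "0 \<le> M" unfolding M_def using N' d ab I vol by auto
 have "AE x in lborel. x \<in> U --> \<bar>f x\<bar> \<le> M"
 proof (rule AE_on_open_if_AE_on_compacts[OF U])
  fix K assume K: "compact K" "K \<subseteq> U"
  obtain r where r: "r > 0" "(\<Union>x\<in>K. cball x r) \<subseteq> U"
   using compact_subset_open_imp_cball_epsilon_subset[OF K(1) U K(2)] by metis
  have e0: "min r (d/2) > 0" using r d by simp
  show "AE x in lborel. x \<in> K --> \<bar>f x\<bar> \<le> M"
  proof (rule mollified_limit_AE[OF U li ex K M0 e0])
   fix \<epsilon> \<eta> x assume eps: "0 < \<epsilon>" "\<epsilon> < min r (d/2)" and mo: "mollifier C \<epsilon> \<eta>" and x: "x \<in> K" "cball x \<epsilon> \<subseteq> U"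
   interpret mollif C \<epsilon> \<eta> by unfold_locales fact
   define F where "F x = (\<integral>y. f y * \<eta> (x - y) \<partial>lebesgue_on U)" for x
   have nx: "norm x > 0" using x(1) K(2) ab by (auto simp: Ueq subset_iff)
   have cb: "cball z \<epsilon> \<subseteq> U" if "a + \<epsilon> < norm z" "norm z < b - \<epsilon>" for z
   proof
    fix y assume "y \<in> cball z \<epsilon>"
    then have "norm (z - y) \<le> \<epsilon>" by (simp add: dist_norm)
    then show "y \<in> U" using that norm_triangle_ineq2[of z y] norm_triangle_ineq2[of y z]
     by (simp add: Ueq norm_minus_commute)
   qed
   have xin: "a + \<epsilon> < norm x" "norm x < b - \<epsilon>"
   proof -
    have "x + (\<epsilon> / norm x) *\<^sub>R x \<in> U" "x - (\<epsilon> / norm x) *\<^sub>R x \<in> U"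
     using eps nx by (auto intro!: subsetD[OF x(2)] simp: dist_norm)
    moreover have "norm (x + (\<epsilon> / norm x) *\<^sub>R x) = norm x + \<epsilon>"
    proof -
     have "x + (\<epsilon> / norm x) *\<^sub>R x = (1 + \<epsilon> / norm x) *\<^sub>R x" by (simp add: scaleR_add_left)
     then have "norm (x + (\<epsilon> / norm x) *\<^sub>R x) = (1 + \<epsilon> / norm x) * norm x" using eps nx by simp
     then show ?thesis using nx by (simp add: field_simps)
    qed
    moreover have "\<epsilon> < norm x"
    proof (rule ccontr)
     assume "\<not> \<epsilon> < norm x"
     then have "0 \<in> U" using x(2) by (auto simp: subset_iff)
     then show False using ab by (simp add: Ueq)
    qed
    moreover have "norm (x - (\<epsilon> / norm x) *\<^sub>R x) = \<bar>norm x - \<epsilon>\<bar>"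
    proof -
     have "x - (\<epsilon> / norm x) *\<^sub>R x = (1 - \<epsilon> / norm x) *\<^sub>R x" by (simp add: scaleR_diff_left)
     then have "norm (x - (\<epsilon> / norm x) *\<^sub>R x) = \<bar>1 - \<epsilon> / norm x\<bar> * \<bar>norm x\<bar>" by simp
     also have "\<dots> = \<bar>(1 - \<epsilon> / norm x) * norm x\<bar>" by (simp add: abs_mult)
     also have "(1 - \<epsilon> / norm x) * norm x = norm x - \<epsilon>" using nx by (simp add: left_diff_distrib)
     finally show ?thesis .
    qed
    ultimately show "a + \<epsilon> < norm x" "norm x < b - \<epsilon>" by (auto simp: Ueq)
   qed
   have eps2: "\<epsilon> < d/2" using eps by simp
   define p where "p = (m / norm x) *\<^sub>R x"
   have np: "norm p = m" using nx d by (simp add: p_def)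
   have s1: "\<bar>F (x + (p - x)) - F x\<bar> \<le> 2 * N' * norm (p - x)"
    unfolding F_def
   proof (rule mollified_lipschitz[OF U _ wd' hb'' N'])
    fix s :: real assume s: "0 \<le> s" "s \<le> 1"
    have "x + s *\<^sub>R (p - x) = ((1 - s) + s * (m / norm x)) *\<^sub>R x"
     by (simp add: p_def algebra_simps)
    then have "norm (x + s *\<^sub>R (p - x)) = \<bar>(1 - s) + s * (m / norm x)\<bar> * norm x" by simp
    also have "\<bar>(1 - s) + s * (m / norm x)\<bar> = (1 - s) + s * (m / norm x)"
     using s nx d by (intro abs_of_nonneg add_nonneg_nonneg mult_nonneg_nonneg) auto
    also have "((1 - s) + s * (m / norm x)) * norm x = (1 - s) * norm x + s * m"
     using nx by (simp add: distrib_right)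
    finally have n: "norm (x + s *\<^sub>R (p - x)) = (1 - s) * norm x + s * m" .
    have "(1 - s) * (a + \<epsilon>) + s * (a + \<epsilon>) < (1 - s) * norm x + s * m"
     using s xin eps2 d by (cases "s = 0") (auto intro!: add_le_less_mono mult_left_mono)
    moreover have "(1 - s) * norm x + s * m < (1 - s) * (b - \<epsilon>) + s * (b - \<epsilon>)"
     using s xin eps2 d by (cases "s = 0") (auto intro!: add_le_less_mono mult_left_mono)
    moreover have "(1 - s) * c + s * c = c" for c :: real by (simp add: algebra_simps)
    ultimately show "cball (x + s *\<^sub>R (p - x)) \<epsilon> \<subseteq> U" by (intro cb) (simp_all only: n)
   qed
   have "p - x = ((m - norm x) / norm x) *\<^sub>R x" using nx by (simp add: p_def diff_divide_distrib scaleR_diff_left)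
   then have "norm (p - x) = \<bar>m - norm x\<bar>" using nx by simp
   also have "\<dots> \<le> b - a" using xin d eps by (simp add: abs_if)
   finally have npx: "norm (p - x) \<le> b - a" .
   have s1': "\<bar>F p - F x\<bar> \<le> 2 * N' * (b - a)"
    using s1 mult_left_mono[OF npx, of "2 * N'"] N' by simp
   have s2: "\<bar>F p\<bar> \<le> 2 * N' * d + \<bar>LBINT z. g z * \<eta> (y - z)\<bar>" if y: "y \<in> ball p d" for y
   proof -
    have ny: "norm (y - p) < d" using y by (simp add: dist_norm norm_minus_commute)
    have inb: "cball z \<epsilon> \<subseteq> R" if "norm (z - p) \<le> d" for z
    proof
     fix w assume "w \<in> cball z \<epsilon>"
     then have "norm (w - p) \<le> d + d / 2"
      using norm_triangle_ineq[of "w - z" "z - p"] that eps2 by (simp add: dist_norm norm_minus_commute)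
     then show "w \<in> R" using norm_triangle_ineq2[of w p] norm_triangle_ineq2[of p w] np
      by (simp add: R_def norm_minus_commute)
    qed
    have "\<bar>F (p + (y - p)) - F p\<bar> \<le> 2 * N' * norm (y - p)"
     unfolding F_def
    proof (rule mollified_lipschitz[OF U _ wd' hb'' N'])
     fix s :: real assume s: "0 \<le> s" "s \<le> 1"
     have "norm (p + s *\<^sub>R (y - p) - p) \<le> 1 * norm (y - p)" using s by (simp add: mult_left_le_one_le)
     then show "cball (p + s *\<^sub>R (y - p)) \<epsilon> \<subseteq> U" using inb[of "p + s *\<^sub>R (y - p)"] R(2) ny by auto
    qed
    also have "\<dots> \<le> 2 * N' * d" using ny N' by (intro mult_left_mono) auto
    finally have "\<bar>F y - F p\<bar> \<le> 2 * N' * d" by simp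
    moreover have "F y = (LBINT z. g z * \<eta> (y - z))"
     unfolding F_def
    proof (rule integral_local_borel_version[OF U R(2) g(1-3)])
     show "\<eta> (y - z) = 0" if "z \<notin> R" for z
      using subsetD[OF inb[of y], of z] ny that by (intro eta_zero) (force simp: dist_norm)
    qed measurable
    ultimately show ?thesis by linarith
   qed
   have gs: "L1 (\<lambda>x. g (k + x))" "(LBINT x. \<bar>g (k + x)\<bar>) = I" for k
    using lborel_shift(2)[OF g(1)] g(4) lborel_shift(1)[of "\<lambda>x. \<bar>g x\<bar>" k] g(1) by (auto simp: I_def)
   have tr: "(LBINT x. \<bar>g (k + x) - g x\<bar>) \<le> 2 * I" for k
   proof -
    have "(LBINT x. \<bar>g (k + x) - g x\<bar>) \<le> (LBINT x. \<bar>g (k + x)\<bar> + \<bar>g x\<bar>)"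
     using gs g(4) by (intro integral_mono) auto
    also have "\<dots> = (LBINT x. \<bar>g (k + x)\<bar>) + (LBINT x. \<bar>g x\<bar>)"
     using gs g(4) by (intro Bochner_Integration.integral_add) auto
    finally show ?thesis using gs(2) by (simp add: I_def)
   qed
   define c where "c y = (LBINT z. g z * \<eta> (y - z))" for y
   have cm: "L1 (\<lambda>x. \<bar>c x - g x\<bar>)" "(LBINT x. \<bar>c x - g x\<bar>) \<le> 2 * I"
    using mollify_L1[OF g(4) tr] I by (auto simp: c_def)
   have [measurable]: "c \<in> Borel" using g(1) unfolding c_def by measurable
   have ci: "L1 (\<lambda>x. \<bar>c x\<bar>)"
   proof (rule Bochner_Integration.integrable_bound)
    show "L1 (\<lambda>x. \<bar>c x - g x\<bar> + \<bar>g x\<bar>)" using cm g(4) by auto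
   qed auto
   have "(LBINT x. \<bar>c x\<bar>) \<le> (LBINT x. \<bar>c x - g x\<bar> + \<bar>g x\<bar>)"
    using ci cm g(4) by (intro integral_mono) auto
   also have "\<dots> = (LBINT x. \<bar>c x - g x\<bar>) + I" using cm g(4) by (simp add: I_def)
   finally have c3: "(LBINT x. \<bar>c x\<bar>) \<le> 3 * I" using cm(2) by linarith
   have "(LBINT y. (\<bar>F p\<bar> - 2 * N' * d) * indicator (ball p d) y) \<le> (LBINT y. \<bar>c y\<bar>)"
   proof (rule integral_mono[OF _ ci])
    show "L1 (\<lambda>y. (\<bar>F p\<bar> - 2 * N' * d) * indicator (ball p d) y)"
     using d by (intro integrable_mult_right integrable_real_indicator) (auto simp: emeasure_ball)
    show "(\<bar>F p\<bar> - 2 * N' * d) * indicator (ball p d) y \<le> \<bar>c y\<bar>" for y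
     using s2[of y] by (auto simp: indicator_def c_def)
   qed
   then have "(\<bar>F p\<bar> - 2 * N' * d) * measure lborel (ball (0::real^2) d) \<le> 3 * I" using c3 vol(1)[of p] by simp
   then have "\<bar>F p\<bar> - 2 * N' * d \<le> 3 * I / measure lborel (ball (0::real^2) d)"
    using vol(2) by (simp add: field_simps)
   then have "\<bar>F x\<bar> \<le> M" using s1' unfolding M_def by linarith
   then show "\<bar>\<integral>y. f y * \<eta> (x - y) \<partial>lebesgue_on U\<bar> \<le> M" by (simp add: F_def)
  qed
 qed
 then show ?thesis unfolding U_def by blast
qed

section \<open>Polar coordinates\<close>

lemma circ_nth [simp]: "circ r \<theta> $ 1 = r * cos \<theta>" "circ r \<theta> $ 2 = r * sin \<theta>"
 by (simp_all add: circ_def)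

lemma norm_circ: "norm (circ r \<theta>) = \<bar>r\<bar>"
proof -
 have "(r * cos \<theta>)^2 + (r * sin \<theta>)^2 = r^2 * ((cos \<theta>)^2 + (sin \<theta>)^2)"
  by (simp only: power_mult_distrib distrib_left)
 then show ?thesis by (simp add: norm_vec2)
qed

lemma circ_eq_scaleR: "circ r \<theta> = r *\<^sub>R circ 1 \<theta>"
 by (simp add: vec_eq_iff forall_2)

lemma circ_expand: "circ r \<theta> = (r * cos \<theta>) *\<^sub>R axis 1 1 + (r * sin \<theta>) *\<^sub>R axis 2 1"
 by (simp add: vec_eq_iff forall_2 axis_def)

lemma continuous_on_circ [continuous_intros]:
 fixes f g :: "'a::real_normed_vector => real"
 shows "continuous_on S f ==> continuous_on S g ==> continuous_on S (\<lambda>x. circ (f x) (g x))"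
 unfolding circ_expand by (intro continuous_intros)

lemma lborel_distr_vector:
 "distr (lborel :: (real \<times> real) measure) borel (\<lambda>z. vector [fst z, snd z]) = (lborel :: (real^2) measure)"
proof (rule lborel_eqI[symmetric])
 have eq: "(vector [fst z, snd z] :: real^2) = fst z *\<^sub>R axis 1 1 + snd z *\<^sub>R axis 2 1" for z
  by (simp add: vec_eq_iff forall_2 axis_def)
 have m[measurable]: "(\<lambda>z. vector [fst z, snd z] :: real^2) \<in> Borel"
  unfolding eq by (intro borel_measurable_continuous_onI continuous_intros)
 fix l u :: "real^2" assume lu: "\<And>b. b \<in> Basis ==> l \<bullet> b \<le> u \<bullet> b"
 have "l $ 1 \<le> u $ 1" "l $ 2 \<le> u $ 2"
  using lu[of "axis 1 1"] lu[of "axis 2 1"] by (simp_all add: inner_axis axis_in_Basis_iff)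
 moreover have "(\<lambda>z. vector [fst z, snd z]) -` box l u \<inter> space lborel = box (l $ 1, l $ 2) (u $ 1, u $ 2)"
  by (auto simp: mem_box_cart forall_2 mem_box Basis_prod_def)
 moreover have "prod ((\<bullet>) (u - l)) Basis = (u $ 1 - l $ 1) * (u $ 2 - l $ 2)"
 proof -
  have B: "(Basis :: (real^2) set) = {axis 1 1, axis 2 1}"
   by (simp add: Basis_vec_def UNIV_2 insert_commute)
  show ?thesis unfolding B by (subst prod.insert) (auto simp: inner_axis axis_eq_axis)
 qed
 ultimately show "emeasure (distr lborel borel (\<lambda>z. vector [fst z, snd z])) (box l u) = (\<Prod>b\<in>Basis. (u - l) \<bullet> b)"
  by (subst emeasure_distr) (auto simp: emeasure_lborel_box_eq Basis_prod_def prod.union_disjoint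
    ennreal_mult' mult.commute[of _ "u $ 2 - l $ 2"])
qed auto

lemma integral_vec2_box:
 fixes F :: "real^2 => real"
 assumes c: "continuous_on UNIV F" and pq: "p \<le> q" "c \<le> d"
 shows "integral (box (vector [p, c]) (vector [q, d])) F = integral {p..q} (\<lambda>r. integral {c..d} (\<lambda>\<theta>. F (vector [r, \<theta>])))"
proof -
 have [measurable]: "F \<in> Borel" by (rule borel_measurable_continuous_onI[OF c])
 have eq: "(vector [fst z, snd z] :: real^2) = fst z *\<^sub>R axis 1 1 + snd z *\<^sub>R axis 2 1" for z
  by (simp add: vec_eq_iff forall_2 axis_def)
 have cv: "continuous_on UNIV (\<lambda>z. vector [fst z, snd z] :: real^2)"
  unfolding eq by (intro continuous_intros)
 have m[measurable]: "(\<lambda>z. vector [fst z, snd z] :: real^2) \<in> Borel"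
  by (rule borel_measurable_continuous_onI[OF cv])
 have cF: "continuous_on S (\<lambda>z. F (vector [fst z, snd z]))" for S
  using continuous_on_subset[OF continuous_on_compose2[OF c cv subset_UNIV] subset_UNIV] by simp
 let ?B = "cbox (vector [p, c]) (vector [q, d]) :: (real^2) set"
 have "integral (box (vector [p, c]) (vector [q, d])) F = integral ?B F"
  by (rule integral_open_interval)
 also have "\<dots> = (\<integral>x\<in>?B. F x \<partial>lborel)"
  by (intro set_borel_integral_eq_integral(2)[symmetric] borel_integrable_compact[unfolded set_integrable_def[symmetric]]
    continuous_on_subset[OF c]) (auto simp: set_integrable_def intro!: borel_integrable_compact continuous_on_subset[OF c])
 also have "\<dots> = (\<integral>x. ind ?B x * F x \<partial>distr lborel borel (\<lambda>z. vector [fst z, snd z]))"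
  by (simp add: set_lebesgue_integral_def lborel_distr_vector)
 also have "\<dots> = (LBINT z. ind ?B (vector [fst z, snd z]) * F (vector [fst z, snd z]))"
  by (rule integral_distr) measurable
 also have "\<dots> = (\<integral>z\<in>cbox (p, c) (q, d). F (vector [fst z, snd z]) \<partial>lborel)"
  unfolding set_lebesgue_integral_def
  by (intro Bochner_Integration.integral_cong) (auto simp: indicator_def mem_box_cart forall_2 cbox_Pair_eq)
 also have "\<dots> = integral (cbox (p, c) (q, d)) (\<lambda>z. F (vector [fst z, snd z]))"
  by (intro set_borel_integral_eq_integral(2)) (unfold set_integrable_def, rule borel_integrable_compact[OF _ cF], simp)
 also have "\<dots> = integral {p..q} (\<lambda>r. integral {c..d} (\<lambda>\<theta>. F (vector [r, \<theta>])))"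
  using integral_prod_continuous[OF cF] by simp
 finally show ?thesis .
qed

text \<open>The radius is the outer variable, as is needed to apply one-dimensional inequalities along rays or to integrate over circles.\<close>

theorem polar_integral:
 fixes g :: "real^2 => real"
 assumes c: "continuous_on UNIV g" and pq: "0 < p" "p < q"
 shows "(LBINT x. ind {x. p < norm x \<and> norm x < q} x * g x)
   = integral {p..q} (\<lambda>r. integral {0..2*pi} (\<lambda>\<theta>. r * g (circ r \<theta>)))"
proof -
 define G :: "real^2 => real^2" where "G x = circ (x $ 1) (x $ 2)" for x
 define G' :: "real^2 => real^2 => real^2" where
  "G' x h = (cos (x $ 2) * h $ 1 - x $ 1 * sin (x $ 2) * h $ 2) *\<^sub>R axis 1 1
    + (sin (x $ 2) * h $ 1 + x $ 1 * cos (x $ 2) * h $ 2) *\<^sub>R axis 2 1" for x h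
 define S :: "(real^2) set" where "S = box (vector [p, 0]) (vector [q, 2 * pi])"
 have S: "x \<in> S \<longleftrightarrow> p < x $ 1 \<and> x $ 1 < q \<and> 0 < x $ 2 \<and> x $ 2 < 2 * pi" for x
  by (auto simp: S_def mem_box_cart forall_2)
 define A where "A = {x::real^2. p < norm x \<and> norm x < q}"
 have derG: "(G has_derivative G' x) (at x within S)" for x
 proof -
  have nth: "((\<lambda>x::real^2. x $ i) has_derivative (\<lambda>h. h $ i)) F" for i F
   by (rule bounded_linear_imp_has_derivative[OF bounded_linear_vec_nth])
  show ?thesis
   unfolding G_def[abs_def] G'_def[abs_def] circ_expand
   by (auto intro!: derivative_eq_intros nth simp: algebra_simps)
 qed
 have det: "det (matrix (G' x)) = x $ 1" for x
 proof -
  have "det (matrix (G' x)) = x $ 1 * (cos (x $ 2) * cos (x $ 2)) + x $ 1 * (sin (x $ 2) * sin (x $ 2))"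
   by (simp add: det_2 matrix_def G'_def axis_def algebra_simps)
  also have "\<dots> = x $ 1 * ((cos (x $ 2))^2 + (sin (x $ 2))^2)"
   by (simp only: power2_eq_square distrib_left)
  finally show ?thesis by simp
 qed
 have inj: "inj_on G S"
 proof (rule inj_onI)
  fix x y assume x: "x \<in> S" and y: "y \<in> S" and e: "G x = G y"
  have "x $ 1 = y $ 1" using arg_cong[OF e, of norm] x y pq by (simp add: G_def norm_circ S)
  moreover have "cos (x $ 2) = cos (y $ 2)" "sin (x $ 2) = sin (y $ 2)"
   using e x pq calculation by (auto simp: G_def vec_eq_iff forall_2 S)
  then obtain n :: int where n: "x $ 2 = y $ 2 + 2 * pi * n"
   using sin_cos_eq_iff[of "x $ 2" "y $ 2"] by auto
  have "2 * pi * n < 2 * pi * 1" "2 * pi * (- 1) < 2 * pi * n" using n x y unfolding S by linarith+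
  then have "real_of_int n < 1" "- 1 < real_of_int n" using pi_gt_zero by (auto simp only: mult_less_cancel_left_pos)
  then have "n = 0" by linarith
  ultimately show "x = y" using n by (simp add: vec_eq_iff forall_2)
 qed
 have GA: "G ` S \<subseteq> A" using pq by (auto simp: G_def A_def norm_circ S)
 have AG: "A - G ` S \<subseteq> {x. x $ 2 = 0}"
 proof (rule ccontr)
  assume "\<not> ?thesis"
  then obtain x where x: "x \<in> A" "x \<notin> G ` S" "x $ 2 \<noteq> 0" by auto
  define r where "r = norm x"
  have r: "p < r" "r < q" "r > 0" using x(1) pq by (auto simp: A_def r_def)
  have "(x $ 1 / r)^2 + (x $ 2 / r)^2 = ((x $ 1)^2 + (x $ 2)^2) / r^2" by (simp add: power_divide add_divide_distrib)
  also have "(x $ 1)^2 + (x $ 2)^2 = r^2" by (simp add: r_def norm_vec2)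
  finally have "(x $ 1 / r)^2 + (x $ 2 / r)^2 = 1" using r by simp
  then obtain t where t: "0 \<le> t" "t < 2 * pi" "x $ 1 / r = cos t" "x $ 2 / r = sin t"
   using sincos_total_2pi by metis
  have "t \<noteq> 0" using t(4) x(3) r by auto
  then have "vector [r, t] \<in> S" using t r by (simp add: S)
  moreover have "G (vector [r, t]) = x" using t r by (simp add: G_def vec_eq_iff forall_2 field_simps)
  ultimately show False using x(2) by force
 qed
 have negl: "negligible (sym_diff A (G ` S))"
  using GA negligible_subset[OF negligible_standard_hyperplane_cart[of 2] AG]
  by (simp add: Diff_eq_empty_iff[THEN iffD2])
 have Ab: "A \<in> sets borel"
  unfolding A_def by (intro borel_open open_Collect_conj open_Collect_less continuous_intros)
 have gi: "set_integrable lborel A g"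
 proof (rule set_integrable_subset)
  show "set_integrable lborel (cball 0 q) g"
   unfolding set_integrable_def by (intro borel_integrable_compact continuous_on_subset[OF c]) auto
 qed (use Ab in \<open>auto simp: A_def\<close>)
 have gabs: "g absolutely_integrable_on A"
  using gi Ab by (simp add: set_integrable_def integrable_completion borel_measurable_continuous_onI[OF c])
 have n1: "negligible {x \<in> A - G ` S. g x \<noteq> 0}" and n2: "negligible {x \<in> G ` S - A. g x \<noteq> 0}"
  by (rule negligible_subset[OF negl]; blast)+
 have gGS: "g absolutely_integrable_on G ` S"
  using absolutely_integrable_spike_set_eq[OF n1 n2] gabs by simp
 have vabs: "(\<lambda>x. vec (g x) :: real^1) absolutely_integrable_on G ` S"
  using gGS by (subst absolutely_integrable_componentwise_iff) (auto simp: Basis_vec_def inner_axis)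
 have Sl: "S \<in> sets lebesgue" by (simp add: S_def)
 have cov: "integral (G ` S) (\<lambda>x. vec (g x) :: real^1) = integral S (\<lambda>x. \<bar>det (matrix (G' x))\<bar> *\<^sub>R (vec (g (G x)) :: real^1))"
  using integral_change_of_variables[OF Sl derG inj, of "\<lambda>x. vec (g x) :: real^1"] vabs by simp
 have vint: "(\<lambda>x. \<bar>det (matrix (G' x))\<bar> *\<^sub>R (vec (g (G x)) :: real^1)) absolutely_integrable_on S"
  using absolutely_integrable_change_of_variables[OF Sl derG inj, of "\<lambda>x. vec (g x) :: real^1"] vabs by simp
 have "(LBINT x. ind A x * g x) = integral A g"
  using set_borel_integral_eq_integral(2)[OF gi] by (simp add: set_lebesgue_integral_def)
 also have "\<dots> = integral (G ` S) g"
  by (rule integral_spike_set[OF n1 n2])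
 also have "\<dots> = integral (G ` S) (\<lambda>x. (vec (g x) :: real^1) $ 1)" by simp
 also have "\<dots> = integral S (\<lambda>x. \<bar>det (matrix (G' x))\<bar> *\<^sub>R (vec (g (G x)) :: real^1)) $ 1"
  using cov set_lebesgue_integral_eq_integral(1)[OF vabs] by (simp only: integral_component_eq_cart)
 also have "\<dots> = integral S (\<lambda>x. (\<bar>det (matrix (G' x))\<bar> *\<^sub>R (vec (g (G x)) :: real^1)) $ 1)"
  using set_lebesgue_integral_eq_integral(1)[OF vint] by (simp only: integral_component_eq_cart)
 also have "\<dots> = integral S (\<lambda>x. x $ 1 * g (G x))"
  using pq by (intro integral_cong) (auto simp: det S)
 also have "\<dots> = integral {p..q} (\<lambda>r. integral {0..2*pi} (\<lambda>\<theta>. r * g (circ r \<theta>)))"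
 proof -
  have "continuous_on UNIV (\<lambda>x. x $ 1 * g (G x))"
   unfolding G_def by (intro continuous_intros continuous_on_compose2[OF c]) auto
  from integral_vec2_box[OF this, of p q 0 "2 * pi"] show ?thesis
   using pq by (simp add: S_def G_def)
 qed
 finally show ?thesis by (simp add: A_def)
qed

section \<open>One-dimensional estimates and the Hardy inequality\<close>

definition grad_sq :: "(real^2 => real) => real^2 => real" where
 "grad_sq V x = (\<Sum>j\<in>UNIV. (pd j V x)^2)"

lemma grad_sq_nonneg: "0 \<le> grad_sq V x"
 by (simp add: grad_sq_def sum_nonneg)

lemma continuous_on_grad_sq: "smooth V ==> continuous_on S (grad_sq V)"
 unfolding grad_sq_def[abs_def]
 by (intro continuous_intros smooth_continuous_on smooth_partial) (auto simp: Basis_vec_def)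

text \<open>The Cauchy-Schwarz inequality for the integral of the derivative.\<close>

lemma increment_sq_le:
 fixes \<phi> \<phi>' :: "real => real"
 assumes pq: "p \<le> q" and d: "\<And>x. x \<in> {p..q} ==> (\<phi> has_real_derivative \<phi>' x) (at x)"
  and c: "continuous_on {p..q} \<phi>'"
 shows "(\<phi> q - \<phi> p)^2 \<le> (q - p) * integral {p..q} (\<lambda>x. (\<phi>' x)^2)"
proof (cases "p = q")
 case False
 then have pq': "p < q" using pq by simp
 define m where "m = (\<phi> q - \<phi> p) / (q - p)"
 have ftc: "(\<phi>' has_integral (\<phi> q - \<phi> p)) {p..q}"
  by (rule fundamental_theorem_of_calculus[OF pq])
   (use d in \<open>auto simp: has_real_derivative_iff_has_vector_derivative[symmetric] intro: has_field_derivative_at_within\<close>)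
 have i2: "(\<lambda>x. (\<phi>' x)^2) integrable_on {p..q}" by (intro integrable_continuous_real continuous_intros c)
 have "((\<lambda>x. (\<phi>' x)^2 - 2 * m * \<phi>' x + m^2) has_integral
   (integral {p..q} (\<lambda>x. (\<phi>' x)^2) - 2 * m * (\<phi> q - \<phi> p) + m^2 * (q - p))) {p..q}"
  using pq by (intro has_integral_add has_integral_diff has_integral_mult_right ftc integrable_integral i2)
   (use has_integral_const_real[of "m^2" p q] in \<open>simp add: mult.commute\<close>)
 then have "0 \<le> integral {p..q} (\<lambda>x. (\<phi>' x)^2) - 2 * m * (\<phi> q - \<phi> p) + m^2 * (q - p)"
 proof (rule has_integral_nonneg)
  fix x
  have "(\<phi>' x)^2 - 2 * m * \<phi>' x + m^2 = (\<phi>' x - m)^2" by (simp add: power2_eq_square algebra_simps)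
  then show "0 \<le> (\<phi>' x)^2 - 2 * m * \<phi>' x + m^2" by simp
 qed
 also have "\<dots> = integral {p..q} (\<lambda>x. (\<phi>' x)^2) - (\<phi> q - \<phi> p)^2 / (q - p)"
 proof -
  have "- 2 * (D / L) * D + (D / L)^2 * L = - (D^2 / L)" if "L > 0" for D L :: real
   using that by (simp add: power2_eq_square)
  from this[of "q - p" "\<phi> q - \<phi> p"] show ?thesis using pq' unfolding m_def by linarith
 qed
 finally show ?thesis using pq' by (simp add: field_simps)
qed simp

lemma smooth_line_derivative:
 assumes "smooth (V :: real^2 => real)"
 shows "((\<lambda>s. V (x + s *\<^sub>R v)) has_real_derivative frechet_derivative V (at (x + s *\<^sub>R v)) v) (at s)"
proof -
 have "((\<lambda>t. V (x + t *\<^sub>R v)) has_derivative (\<lambda>h. frechet_derivative V (at (x + s *\<^sub>R v)) (h *\<^sub>R v))) (at s)"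
  by (rule has_derivative_compose[OF _ smooth_has_derivative[OF assms]]) (auto intro!: derivative_eq_intros)
 then show ?thesis unfolding has_field_derivative_def
  by (simp add: linear_scale[OF linear_frechet_derivative[OF smooth_differentiable[OF assms]]] mult_commute_abs)
qed

lemma frechet_expand:
 "smooth (V :: real^2 => real) ==> frechet_derivative V (at x) v = (\<Sum>j\<in>UNIV. v $ j * pd j V x)"
 by (rule linear_axis_expand[OF linear_frechet_derivative[OF smooth_differentiable]])

lemma directional_sq_le:
 assumes "smooth (V :: real^2 => real)"
 shows "(frechet_derivative V (at x) v)^2 \<le> (norm v)^2 * grad_sq V x"
proof -
 have cs: "(p * r + q * s)^2 \<le> (p^2 + q^2) * (r^2 + s^2)" for p q r s :: real
  using zero_le_power2[of "p * s - q * r"] by (simp add: power2_eq_square algebra_simps)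
 show ?thesis
  unfolding frechet_expand[OF assms, of x v] grad_sq_def norm_vec2 sum_2
  using cs[of "v $ 1" "pd 1 V x" "v $ 2" "pd 2 V x"]
  by simp
qed

lemma segment_increment_sq_le:
 assumes V: "smooth (V :: real^2 => real)" and pq: "p \<le> q"
 shows "(V (x + q *\<^sub>R v) - V (x + p *\<^sub>R v))^2 \<le> (q - p) * integral {p..q} (\<lambda>s. (norm v)^2 * grad_sq V (x + s *\<^sub>R v))"
proof -
 have cd: "continuous_on UNIV (\<lambda>y. frechet_derivative V (at y) v)"
  unfolding frechet_expand[OF V, of _ v]
  by (intro continuous_intros smooth_continuous_on smooth_partial V) (auto simp: Basis_vec_def)
 have c: "continuous_on {p..q} (\<lambda>s. frechet_derivative V (at (x + s *\<^sub>R v)) v)"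
  by (intro continuous_on_compose2[OF cd] continuous_intros) auto
 have cg: "continuous_on {p..q} (\<lambda>s. grad_sq V (x + s *\<^sub>R v))"
  by (intro continuous_on_compose2[OF continuous_on_grad_sq[OF V, of UNIV]] continuous_intros) auto
 have "(V (x + q *\<^sub>R v) - V (x + p *\<^sub>R v))^2 \<le> (q - p) * integral {p..q} (\<lambda>s. (frechet_derivative V (at (x + s *\<^sub>R v)) v)^2)"
  by (rule increment_sq_le[OF pq smooth_line_derivative[OF V] c])
 also have "\<dots> \<le> (q - p) * integral {p..q} (\<lambda>s. (norm v)^2 * grad_sq V (x + s *\<^sub>R v))"
  using pq by (intro mult_left_mono integral_le integrable_continuous_real continuous_intros c cg directional_sq_le[OF V]) auto
 finally show ?thesis .
qed

text \<open>On each ray the difference of \<open>V\<close> from its value on the circle of radius \<open>r0\<close> is the integral of a derivative over a segment of length at most \<open>q - p\<close>.  Squaring, applying the Cauchy-Schwarz inequality and integrating in polar coordinates gives the second term; the factor \<open>b/a\<close> compares the weights \<open>r\<close> at two radii.  The boundary term vanishes in the limit for functions with zero trace.\<close>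

theorem hardy_smooth:
 assumes V: "smooth (V :: real^2 => real)" and ab: "0 < a" "a \<le> p" "p < q" "q \<le> b" and r0: "r0 = p \<or> r0 = q"
 shows "(LBINT x. ind {x. p < norm x \<and> norm x < q} x * (V x)^2)
   \<le> 2 * b * (q - p) * integral {0..2*pi} (\<lambda>\<theta>. (V (circ r0 \<theta>))^2)
   + 2 * (q - p)^2 * (b / a) * (LBINT x. ind {x. p < norm x \<and> norm x < q} x * grad_sq V x)"
proof -
 define J where "J \<theta> = integral {p..q} (\<lambda>s. grad_sq V (circ s \<theta>))" for \<theta>
 define A where "A = integral {0..2*pi} (\<lambda>\<theta>. (V (circ r0 \<theta>))^2)"
 have cV: "continuous_on S (\<lambda>z. V (circ (f z) (g z)))" if "continuous_on S f" "continuous_on S g"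
  for S :: "'z::real_normed_vector set" and f g
  using that by (intro continuous_on_compose2[OF smooth_continuous_on[OF V, of UNIV]] continuous_intros) auto
 have cW: "continuous_on S (\<lambda>z. grad_sq V (circ (f z) (g z)))" if "continuous_on S f" "continuous_on S g"
  for S :: "'z::real_normed_vector set" and f g
  using that by (intro continuous_on_compose2[OF continuous_on_grad_sq[OF V, of UNIV]] continuous_intros) auto
 have cJ: "continuous_on {0..2*pi} J"
  unfolding J_def
  using integral_continuous_on_param[of "{0..2*pi}" p q "\<lambda>\<theta> s. grad_sq V (circ s \<theta>)"]
  by (simp add: cbox_interval case_prod_unfold cW continuous_intros)
 have J0: "0 \<le> J \<theta>" for \<theta> unfolding J_def by (intro integral_nonneg integrable_continuous_real cW continuous_intros grad_sq_nonneg)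
 have incr: "(V (circ t \<theta>) - V (circ s \<theta>))^2 \<le> (q - p) * J \<theta>" if "p \<le> s" "s \<le> t" "t \<le> q" for s t \<theta>
 proof -
  have "norm (circ 1 \<theta>) = 1" by (simp add: norm_circ)
  then have "(V (circ t \<theta>) - V (circ s \<theta>))^2 \<le> (t - s) * integral {s..t} (\<lambda>r. grad_sq V (circ r \<theta>))"
   using segment_increment_sq_le[OF V that(2), of 0 "circ 1 \<theta>"] by (simp add: circ_eq_scaleR[symmetric])
  also have "\<dots> \<le> (q - p) * J \<theta>"
   unfolding J_def using that
   by (intro mult_mono integral_subset_le integral_nonneg integrable_continuous_real cW continuous_intros) (auto intro: grad_sq_nonneg)
  finally show ?thesis .
 qed
 have pt: "r * (V (circ r \<theta>))^2 \<le> b * (2 * (V (circ r0 \<theta>))^2 + 2 * (q - p) * J \<theta>)" if r: "p \<le> r" "r \<le> q" for r \<theta>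
 proof -
  have "(V (circ r \<theta>) - V (circ r0 \<theta>))^2 \<le> (q - p) * J \<theta>"
   using r0 incr[of p r \<theta>] incr[of r q \<theta>] r by (auto simp: power2_commute)
  moreover have "y^2 \<le> 2 * z^2 + 2 * (y - z)^2" for y z :: real
   using zero_le_power2[of "y - 2 * z"] by (simp add: power2_eq_square algebra_simps)
  from this[of "V (circ r \<theta>)" "V (circ r0 \<theta>)"]
  have "(V (circ r \<theta>))^2 \<le> 2 * (V (circ r0 \<theta>))^2 + 2 * (V (circ r \<theta>) - V (circ r0 \<theta>))^2" .
  ultimately have "(V (circ r \<theta>))^2 \<le> 2 * (V (circ r0 \<theta>))^2 + 2 * (q - p) * J \<theta>" by linarith
  then show ?thesis using r ab by (intro mult_mono) auto
 qed
 define K where "K = b * (2 * A + 2 * (q - p) * integral {0..2*pi} J)"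
 have inner: "integral {0..2*pi} (\<lambda>\<theta>. r * (V (circ r \<theta>))^2) \<le> K" if r: "r \<in> {p..q}" for r
 proof -
  have "integral {0..2*pi} (\<lambda>\<theta>. r * (V (circ r \<theta>))^2) \<le>
    integral {0..2*pi} (\<lambda>\<theta>. b * (2 * (V (circ r0 \<theta>))^2 + 2 * (q - p) * J \<theta>))"
   using pt r by (intro integral_le integrable_continuous_real continuous_intros cV cJ) auto
  also have "\<dots> = b * (2 * A + 2 * (q - p) * integral {0..2*pi} J)"
  proof -
   have "(\<lambda>\<theta>. 2 * (V (circ r0 \<theta>))^2) integrable_on {0..2*pi}" "(\<lambda>\<theta>. 2 * (q - p) * J \<theta>) integrable_on {0..2*pi}"
    by (intro integrable_continuous_real continuous_intros cV cJ)+
   then show ?thesis unfolding A_def by (simp add: integral_add)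
  qed
  finally show ?thesis by (simp add: K_def)
 qed
 have cp: "continuous_on {p..q} (\<lambda>r. integral {0..2*pi} (\<lambda>\<theta>. r * (V (circ r \<theta>))^2))"
  using integral_continuous_on_param[of "{p..q}" 0 "2*pi" "\<lambda>r \<theta>. r * (V (circ r \<theta>))^2"]
  by (simp add: cbox_interval case_prod_unfold cV continuous_intros)
 have "(LBINT x. ind {x. p < norm x \<and> norm x < q} x * (V x)^2)
  = integral {p..q} (\<lambda>r. integral {0..2*pi} (\<lambda>\<theta>. r * (V (circ r \<theta>))^2))"
  using ab by (intro polar_integral continuous_intros smooth_continuous_on V) auto
 also have "\<dots> \<le> integral {p..q} (\<lambda>r. K)"
  by (intro integral_le integrable_continuous_real cp inner continuous_intros) auto
 also have "\<dots> = (q - p) * K" using ab by simp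
 finally have 1: "(LBINT x. ind {x. p < norm x \<and> norm x < q} x * (V x)^2) \<le> (q - p) * K" .
 have sw: "integral {0..2*pi} J = integral {p..q} (\<lambda>s. integral {0..2*pi} (\<lambda>\<theta>. grad_sq V (circ s \<theta>)))"
  unfolding J_def
  using integral_swap_continuous[of 0 p "2*pi" q "\<lambda>\<theta> s. grad_sq V (circ s \<theta>)"]
  by (simp add: cbox_interval case_prod_unfold cW continuous_intros)
 have cs: "continuous_on {p..q} (\<lambda>s. integral {0..2*pi} (\<lambda>\<theta>. grad_sq V (circ s \<theta>)))"
  using integral_continuous_on_param[of "{p..q}" 0 "2*pi" "\<lambda>s \<theta>. grad_sq V (circ s \<theta>)"]
  by (simp add: cbox_interval case_prod_unfold cW continuous_intros)
 have "a * integral {0..2*pi} J = integral {p..q} (\<lambda>s. a * integral {0..2*pi} (\<lambda>\<theta>. grad_sq V (circ s \<theta>)))"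
  unfolding sw by simp
 also have "\<dots> \<le> integral {p..q} (\<lambda>s. s * integral {0..2*pi} (\<lambda>\<theta>. grad_sq V (circ s \<theta>)))"
 proof (intro integral_le integrable_continuous_real continuous_intros cs mult_right_mono)
  show "0 \<le> integral {0..2*pi} (\<lambda>\<theta>. grad_sq V (circ s \<theta>))" for s
   by (intro integral_nonneg integrable_continuous_real cW continuous_intros grad_sq_nonneg)
 qed (use ab in auto)
 also have "\<dots> = (LBINT x. ind {x. p < norm x \<and> norm x < q} x * grad_sq V x)"
  using ab by (subst polar_integral[OF continuous_on_grad_sq[OF V]]) auto
 finally have "integral {0..2*pi} J \<le> (LBINT x. ind {x. p < norm x \<and> norm x < q} x * grad_sq V x) / a"
  using ab by (simp add: field_simps)
 then have "(q - p) * K \<le> (q - p) * (b * (2 * A + 2 * (q - p) * ((LBINT x. ind {x. p < norm x \<and> norm x < q} x * grad_sq V x) / a)))"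
  unfolding K_def using ab by (intro mult_left_mono add_left_mono) auto
 also have "\<dots> = 2 * b * (q - p) * A + 2 * (q - p)^2 * (b / a) * (LBINT x. ind {x. p < norm x \<and> norm x < q} x * grad_sq V x)"
 proof -
  have "d * (b * (2 * A + 2 * d * (G / a))) = 2 * b * d * A + 2 * d^2 * (b / a) * G" for d G
   by (simp add: power2_eq_square algebra_simps)
  then show ?thesis .
 qed
 finally show ?thesis using 1 unfolding A_def by linarith
qed

section \<open>Convergence in the space of square integrable functions\<close>

text \<open>Square integrability as a predicate on an arbitrary measure: it is needed both on the plane and on the boundary circles.\<close>

definition L2_fun :: "'a measure => ('a => real) => bool" where
 "L2_fun M f \<longleftrightarrow> f \<in> borel_measurable M \<and> integrable M (\<lambda>x. (f x)^2)"

definition L2_lim :: "'a measure => (nat => 'a => real) => ('a => real) => bool" where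
 "L2_lim M F f \<longleftrightarrow> (\<forall>k. L2_fun M (F k)) \<and> L2_fun M f \<and> (\<lambda>k. \<integral>x. (F k x - f x)^2 \<partial>M) \<longlonglongrightarrow> 0"

lemma square_add_le: "(x + y)^2 \<le> 2 * x^2 + 2 * y^2" for x y :: real
 using zero_le_power2[of "x - y"] by (simp add: power2_eq_square algebra_simps)

lemma L2_fun_add:
 assumes "L2_fun M f" "L2_fun M g"
 shows "L2_fun M (\<lambda>x. f x + g x)"
 unfolding L2_fun_def
proof
 have [measurable]: "f \<in> borel_measurable M" "g \<in> borel_measurable M" using assms by (auto simp: L2_fun_def)
 show "(\<lambda>x. f x + g x) \<in> borel_measurable M" by measurable
 show "integrable M (\<lambda>x. (f x + g x)^2)"
 proof (rule Bochner_Integration.integrable_bound)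
  show "integrable M (\<lambda>x. 2 * (f x)^2 + 2 * (g x)^2)" using assms by (auto simp: L2_fun_def)
  show "AE x in M. norm ((f x + g x)^2) \<le> norm (2 * (f x)^2 + 2 * (g x)^2)"
  proof (intro AE_I2)
   fix x
   have "0 \<le> 2 * (f x)^2 + 2 * (g x)^2" by simp
   then show "norm ((f x + g x)^2) \<le> norm (2 * (f x)^2 + 2 * (g x)^2)"
    using square_add_le[of "f x" "g x"] by simp
  qed
 qed measurable
qed

lemma L2_fun_mult:
 assumes "L2_fun M f" and g[measurable]: "g \<in> borel_measurable M" and B: "\<And>x. \<bar>g x\<bar> \<le> B"
 shows "L2_fun M (\<lambda>x. g x * f x)"
 unfolding L2_fun_def
proof
 have [measurable]: "f \<in> borel_measurable M" using assms by (auto simp: L2_fun_def)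
 show "(\<lambda>x. g x * f x) \<in> borel_measurable M" by measurable
 show "integrable M (\<lambda>x. (g x * f x)^2)"
 proof (rule Bochner_Integration.integrable_bound)
  show "integrable M (\<lambda>x. B^2 * (f x)^2)" using assms by (auto simp: L2_fun_def)
  show "AE x in M. norm ((g x * f x)^2) \<le> norm (B^2 * (f x)^2)"
   using power_mono[OF B, where n = 2] by (intro AE_I2) (simp add: power_mult_distrib mult_right_mono)
 qed measurable
qed

lemma L2_fun_uminus: "L2_fun M f ==> L2_fun M (\<lambda>x. - f x)"
 by (auto simp: L2_fun_def)

lemma L2_fun_diff: "L2_fun M f ==> L2_fun M g ==> L2_fun M (\<lambda>x. f x - g x)"
 using L2_fun_add[OF _ L2_fun_uminus, of M f g] by simp

lemma L2_lim_dom: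
 assumes F: "\<And>k. L2_fun M (F k)" and f: "L2_fun M f"
  and b: "\<And>k. (\<integral>x. (F k x - f x)^2 \<partial>M) \<le> d k" and d: "d \<longlonglongrightarrow> 0"
 shows "L2_lim M F f"
 unfolding L2_lim_def
proof (intro conjI allI F f)
 show "(\<lambda>k. \<integral>x. (F k x - f x)^2 \<partial>M) \<longlonglongrightarrow> 0"
  by (rule tendsto_sandwich[OF _ _ tendsto_const d]) (use b in auto)
qed

lemma L2_lim_add:
 assumes F: "L2_lim M F f" and G: "L2_lim M G g"
 shows "L2_lim M (\<lambda>k x. F k x + G k x) (\<lambda>x. f x + g x)"
proof (rule L2_lim_dom)
 have d: "L2_fun M (\<lambda>x. F k x - f x)" "L2_fun M (\<lambda>x. G k x - g x)" for k
  using F G by (auto simp: L2_lim_def intro: L2_fun_diff)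
 show "L2_fun M (\<lambda>x. F k x + G k x)" "L2_fun M (\<lambda>x. f x + g x)" for k
  using F G by (auto simp: L2_lim_def intro: L2_fun_add)
 show "(\<integral>x. (F k x + G k x - (f x + g x))^2 \<partial>M) \<le> 2 * (\<integral>x. (F k x - f x)^2 \<partial>M) + 2 * (\<integral>x. (G k x - g x)^2 \<partial>M)" for k
 proof -
  have "(\<integral>x. (F k x + G k x - (f x + g x))^2 \<partial>M) \<le> (\<integral>x. 2 * (F k x - f x)^2 + 2 * (G k x - g x)^2 \<partial>M)"
  proof (rule integral_mono_AE')
   show "AE x in M. (F k x + G k x - (f x + g x))^2 \<le> 2 * (F k x - f x)^2 + 2 * (G k x - g x)^2"
   proof (intro AE_I2)
    fix x
    show "(F k x + G k x - (f x + g x))^2 \<le> 2 * (F k x - f x)^2 + 2 * (G k x - g x)^2"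
     using square_add_le[of "F k x - f x" "G k x - g x"] by (simp add: algebra_simps)
   qed
  qed (use d in \<open>auto simp: L2_fun_def\<close>)
  then show ?thesis using d by (simp add: L2_fun_def)
 qed
 show "(\<lambda>k. 2 * (\<integral>x. (F k x - f x)^2 \<partial>M) + 2 * (\<integral>x. (G k x - g x)^2 \<partial>M)) \<longlonglongrightarrow> 0"
 proof -
  have "(\<lambda>k. 2 * (\<integral>x. (F k x - f x)^2 \<partial>M) + 2 * (\<integral>x. (G k x - g x)^2 \<partial>M)) \<longlonglongrightarrow> 2 * 0 + 2 * 0"
   using F G by (intro tendsto_intros) (auto simp: L2_lim_def)
  then show ?thesis by simp
 qed
qed

lemma L2_lim_mult:
 assumes F: "L2_lim M F f" and g: "g \<in> borel_measurable M" and B: "\<And>x. \<bar>g x\<bar> \<le> B"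
 shows "L2_lim M (\<lambda>k x. g x * F k x) (\<lambda>x. g x * f x)"
proof (rule L2_lim_dom)
 have d: "L2_fun M (\<lambda>x. F k x - f x)" for k
  using F by (auto simp: L2_lim_def intro: L2_fun_diff)
 show "L2_fun M (\<lambda>x. g x * F k x)" "L2_fun M (\<lambda>x. g x * f x)" for k
  using F L2_fun_mult[OF _ g B] by (auto simp: L2_lim_def)
 show "(\<integral>x. (g x * F k x - g x * f x)^2 \<partial>M) \<le> B^2 * (\<integral>x. (F k x - f x)^2 \<partial>M)" for k
 proof -
  have "(\<integral>x. (g x * F k x - g x * f x)^2 \<partial>M) \<le> (\<integral>x. B^2 * (F k x - f x)^2 \<partial>M)"
  proof (rule integral_mono_AE')
   show "AE x in M. (g x * F k x - g x * f x)^2 \<le> B^2 * (F k x - f x)^2"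
    unfolding right_diff_distrib[symmetric] power_mult_distrib
    using power_mono[OF B, where n = 2] by (intro AE_I2 mult_right_mono) auto
  qed (use d in \<open>auto simp: L2_fun_def\<close>)
  then show ?thesis by simp
 qed
 show "(\<lambda>k. B^2 * (\<integral>x. (F k x - f x)^2 \<partial>M)) \<longlonglongrightarrow> 0"
  using tendsto_mult_left[of _ 0 sequentially "B^2"] F by (auto simp: L2_lim_def)
qed

lemma L2_lim_uminus: "L2_lim M F f ==> L2_lim M (\<lambda>k x. - F k x) (\<lambda>x. - f x)"
 using L2_lim_mult[of M F f "\<lambda>_. -1" 1] by simp

text \<open>From \<open>2 s t \<le> s^2 / \<kappa> + \<kappa> t^2\<close>; the parameter \<open>\<kappa>\<close> is sent to zero after the difference has tended to zero.\<close>

lemma L2_close_integral_sq: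
 assumes F: "L2_fun M F" and f: "L2_fun M f" and k: "\<kappa> > 0"
 shows "\<bar>(\<integral>x. (F x)^2 \<partial>M) - (\<integral>x. (f x)^2 \<partial>M)\<bar> \<le> (1 + 1 / \<kappa>) * (\<integral>x. (F x - f x)^2 \<partial>M) + \<kappa> * (\<integral>x. (f x)^2 \<partial>M)"
proof -
 have d: "L2_fun M (\<lambda>x. F x - f x)" using F f by (rule L2_fun_diff)
 have pt: "\<bar>(F x)^2 - (f x)^2\<bar> \<le> (1 + 1 / \<kappa>) * (F x - f x)^2 + \<kappa> * (f x)^2" for x
 proof -
  define s where "s = F x - f x"
  have e: "(F x)^2 - (f x)^2 = s^2 + 2 * s * f x" by (simp add: s_def power2_eq_square algebra_simps)
  have "0 \<le> (s + \<kappa> * f x)^2 / \<kappa>" "0 \<le> (s - \<kappa> * f x)^2 / \<kappa>" using k by auto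
  then have "\<bar>2 * s * f x\<bar> \<le> s^2 / \<kappa> + \<kappa> * (f x)^2"
   using k by (simp add: power2_eq_square field_simps abs_le_iff)
  then have "\<bar>(F x)^2 - (f x)^2\<bar> \<le> s^2 + (s^2 / \<kappa> + \<kappa> * (f x)^2)" unfolding e using abs_triangle_ineq[of "s^2" "2 * s * f x"] by simp
  then show ?thesis by (simp add: s_def algebra_simps)
 qed
 have "\<bar>(\<integral>x. (F x)^2 \<partial>M) - (\<integral>x. (f x)^2 \<partial>M)\<bar> = \<bar>\<integral>x. (F x)^2 - (f x)^2 \<partial>M\<bar>"
  using F f by (simp add: L2_fun_def)
 also have "\<dots> \<le> (\<integral>x. \<bar>(F x)^2 - (f x)^2\<bar> \<partial>M)" by (rule integral_abs_bound)
 also have "\<dots> \<le> (\<integral>x. (1 + 1 / \<kappa>) * (F x - f x)^2 + \<kappa> * (f x)^2 \<partial>M)"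
  using F f d pt by (intro integral_mono) (auto simp: L2_fun_def)
 also have "\<dots> = (1 + 1 / \<kappa>) * (\<integral>x. (F x - f x)^2 \<partial>M) + \<kappa> * (\<integral>x. (f x)^2 \<partial>M)"
  using f d by (simp add: L2_fun_def)
 finally show ?thesis .
qed

lemma L2_lim_integral_sq:
 assumes F: "L2_lim M F f"
 shows "(\<lambda>k. \<integral>x. (F k x)^2 \<partial>M) \<longlonglongrightarrow> (\<integral>x. (f x)^2 \<partial>M)"
proof (rule LIMSEQ_I)
 fix e :: real assume e: "e > 0"
 define N where "N = (\<integral>x. (f x)^2 \<partial>M)"
 have N: "N \<ge> 0" by (simp add: N_def)
 define \<kappa> where "\<kappa> = e / (2 * (N + 1))"
 have k: "\<kappa> > 0" "\<kappa> * N \<le> e / 2" using e N by (auto simp: \<kappa>_def field_simps)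
 have "(\<lambda>k. (1 + 1 / \<kappa>) * (\<integral>x. (F k x - f x)^2 \<partial>M)) \<longlonglongrightarrow> (1 + 1 / \<kappa>) * 0"
  using F by (intro tendsto_intros) (auto simp: L2_lim_def)
 then have "eventually (\<lambda>k. (1 + 1 / \<kappa>) * (\<integral>x. (F k x - f x)^2 \<partial>M) < e / 2) sequentially"
  using e by (intro order_tendstoD(2)) auto
 then obtain n0 where n0: "\<And>k. k \<ge> n0 ==> (1 + 1 / \<kappa>) * (\<integral>x. (F k x - f x)^2 \<partial>M) < e / 2"
  by (auto simp: eventually_sequentially)
 show "\<exists>n0. \<forall>n\<ge>n0. norm ((\<integral>x. (F n x)^2 \<partial>M) - (\<integral>x. (f x)^2 \<partial>M)) < e"
 proof (intro exI[of _ n0] allI impI)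
  fix n assume "n0 \<le> n"
  then show "norm ((\<integral>x. (F n x)^2 \<partial>M) - (\<integral>x. (f x)^2 \<partial>M)) < e"
  proof -
   have "\<bar>(\<integral>x. (F n x)^2 \<partial>M) - N\<bar> \<le> (1 + 1 / \<kappa>) * (\<integral>x. (F n x - f x)^2 \<partial>M) + \<kappa> * N"
    using L2_close_integral_sq[of M "F n" f \<kappa>] F k unfolding L2_lim_def N_def by simp
   also have "\<dots> < e / 2 + e / 2" by (rule add_less_le_mono[OF n0[OF \<open>n0 \<le> n\<close>] k(2)])
   finally show ?thesis by (simp add: N_def)
  qed
 qed
qed

lemma L2_lim_shift:
 fixes F :: "nat => 'a::euclidean_space => real"
 assumes F: "L2_lim lborel F f"
 shows "L2_lim lborel (\<lambda>k x. F k (h + x)) (\<lambda>x. f (h + x))"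
proof -
 have [measurable]: "f \<in> Borel" "F k \<in> Borel" for k
  using F by (auto simp: L2_lim_def L2_fun_def)
 show ?thesis
  using F lborel_shift(2)[of "\<lambda>x. (f x)^2" h] lborel_shift(2)[of "\<lambda>x. (F _ x)^2" h]
   lborel_shift(1)[of "\<lambda>x. (F _ x - f x)^2" h]
  by (simp add: L2_lim_def L2_fun_def)
qed

section \<open>Functions approximated by smooth ones\<close>

text \<open>The fundamental theorem of calculus in one variable at a time, by Fubini.\<close>

lemma integral_partial_eq_zero:
 assumes g: "smooth (g :: real^2 => real)" and z: "\<And>x. norm x \<ge> r ==> g x = 0"
 shows "(LBINT x. pd j g x) = 0"
proof -
 let ?v = "axis j 1 :: real^2"
 let ?D = "\<lambda>x. frechet_derivative g (at x) ?v"
 have cD: "continuous_on UNIV ?D"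
  by (intro smooth_continuous_on smooth_partial g) (auto simp: Basis_vec_def)
 have Dz: "?D x = 0" if "norm x \<ge> r + 1" for x
  by (rule frechet_derivative_zero_open[of "- cball 0 r" _ _ 0]) (use that z in auto)
 obtain L where L: "L > 0" "\<And>x. \<bar>?D x\<bar> \<le> L"
  using continuous_compact_support_bounded[OF cD Dz] by metis
 have nv: "norm ?v = 1" by simp
 have [measurable]: "g \<in> Borel"
  by (intro borel_measurable_continuous_onI smooth_continuous_on g)
 have gi: "L1 g"
  by (rule continuous_compact_support_integrable[OF smooth_continuous_on[OF g] z])
 define X where "X n = 1 / real (Suc n)" for n
 have X: "X n > 0" "X n \<le> 1" "X n \<noteq> 0" for n by (auto simp: X_def)
 have Xlim: "X \<longlonglongrightarrow> 0" unfolding X_def using LIMSEQ_inverse_real_of_nat by (simp add: inverse_eq_divide)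
 have Lip: "\<bar>g (x + s *\<^sub>R ?v) - g x\<bar> \<le> L * \<bar>s\<bar>" for x s
  using field_differentiable_bound[of UNIV "\<lambda>t. g (x + t *\<^sub>R ?v)" "\<lambda>t. ?D (x + t *\<^sub>R ?v)" L s 0]
   smooth_line_derivative[OF g] L by auto
 have "(\<lambda>n. LBINT x. (g (x + X n *\<^sub>R ?v) - g x) / X n) \<longlonglongrightarrow> (LBINT x. ?D x)"
 proof (rule integral_dominated_convergence[where w = "\<lambda>x. L * indicator (ball 0 (\<bar>r\<bar> + 1)) x"])
  show "L1 (\<lambda>x. L * indicator (ball (0::real^2) (\<bar>r\<bar> + 1)) x)"
   by (intro integrable_mult_right integrable_real_indicator) (auto simp: emeasure_ball)
  show "AE x in lborel. (\<lambda>n. (g (x + X n *\<^sub>R ?v) - g x) / X n) \<longlonglongrightarrow> ?D x"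
  proof (intro AE_I2)
   fix x
   have "(\<lambda>n. (g (x + (0 + X n) *\<^sub>R ?v) - g (x + 0 *\<^sub>R ?v)) / X n) \<longlonglongrightarrow> ?D (x + 0 *\<^sub>R ?v)"
    using smooth_line_derivative[OF g, of x ?v 0, unfolded DERIV_def tendsto_at_iff_sequentially] X Xlim
    by (auto simp: o_def)
   then show "(\<lambda>n. (g (x + X n *\<^sub>R ?v) - g x) / X n) \<longlonglongrightarrow> ?D x" by simp
  qed
  show "AE x in lborel. norm ((g (x + X n *\<^sub>R ?v) - g x) / X n) \<le> L * indicator (ball 0 (\<bar>r\<bar> + 1)) x" for n
  proof (intro AE_I2)
   fix x
   show "norm ((g (x + X n *\<^sub>R ?v) - g x) / X n) \<le> L * indicator (ball 0 (\<bar>r\<bar> + 1)) x"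
   proof (cases "norm x < \<bar>r\<bar> + 1")
    case True
    then show ?thesis using Lip[of x "X n"] X(1)[of n] by (simp add: field_simps)
   next
    case False
    have "norm (x + X n *\<^sub>R ?v) \<ge> norm x - 1"
     using norm_triangle_ineq2[of x "- (X n *\<^sub>R ?v)"] X[of n] by simp
    then have "g (x + X n *\<^sub>R ?v) = 0" "g x = 0" using False z by auto
    then show ?thesis using L by simp
   qed
  qed
  show "?D \<in> borel_measurable lborel" using borel_measurable_continuous_onI[OF cD] by simp
 qed measurable
 moreover have "(LBINT x. (g (x + X n *\<^sub>R ?v) - g x) / X n) = 0" for n
  using lborel_shift[of g "X n *\<^sub>R ?v"] gi by (simp add: add.commute)
 ultimately have "(\<lambda>n::nat. 0) \<longlonglongrightarrow> (LBINT x. ?D x)" by (simp only:)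
 then show ?thesis by (simp add: LIMSEQ_const_iff)
qed

lemma smooth_loc_integrable:
 assumes g: "smooth (g :: 'a::euclidean_space => real)"
 shows "loc_integrable U g"
 unfolding loc_integrable_def
proof (intro allI impI)
 fix K assume K: "compact K \<and> K \<subseteq> U"
 then have Kb[measurable]: "K \<in> sets borel" by (auto intro: borel_compact)
 have [measurable]: "g \<in> Borel"
  by (intro borel_measurable_continuous_onI smooth_continuous_on g)
 have "L1 (\<lambda>x. ind K x *\<^sub>R g x)"
  using K by (intro borel_integrable_compact smooth_continuous_on g) auto
 then show "integrable (lebesgue_on K) g"
  by (subst integral_lebesgue_on_borel(2)[OF Kb, of "\<lambda>x. ind K x *\<^sub>R g x"]) auto
qed

lemma test_function_outside_ball:
 assumes "test_function U \<phi>"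
 obtains r where "\<And>x. norm x \<ge> r ==> \<phi> x = 0"
proof -
 have "bounded (closure {x. \<phi> x \<noteq> 0})" using assms by (auto simp: test_function_def compact_imp_bounded)
 then obtain r where r: "closure {x. \<phi> x \<noteq> 0} \<subseteq> ball 0 r" using bounded_subset_ballD by blast
 have "\<phi> x = 0" if "norm x \<ge> r" for x
 proof (rule ccontr)
  assume "\<phi> x \<noteq> 0"
  then have "x \<in> closure {x. \<phi> x \<noteq> 0}" using closure_subset[of "{x. \<phi> x \<noteq> 0}"] by blast
  then show False using r that by auto
 qed
 then show ?thesis by (rule that)
qed

lemma smooth_has_weak_deriv:
 assumes U: "open (U :: (real^2) set)" and g: "smooth g"
 shows "has_weak_deriv U (axis j 1) g (\<lambda>x. pd j g x)"
 unfolding has_weak_deriv_def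
proof (intro conjI allI impI)
 have sD: "smooth (\<lambda>x. pd j g x)"
  by (intro smooth_partial g) (auto simp: Basis_vec_def)
 show li: "loc_integrable U g" "loc_integrable U (\<lambda>x. pd j g x)"
  using g sD by (auto intro: smooth_loc_integrable)
 fix \<phi> assume t: "test_function U \<phi>"
 then have s: "smooth \<phi>" by (simp add: test_function_def)
 obtain r where r: "\<And>x. norm x \<ge> r ==> \<phi> x = 0" by (rule test_function_outside_ball[OF t]) blast
 have Ub: "U \<in> sets borel" using U by simp
 have cont: "continuous_on UNIV (\<lambda>x. pd j h x)" if "smooth h" for h :: "real^2 => real"
  by (intro smooth_continuous_on smooth_partial that) (auto simp: Basis_vec_def)
 note [measurable] = borel_measurable_continuous_onI[OF cont[OF g]] borel_measurable_continuous_onI[OF cont[OF s]]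
  borel_measurable_continuous_onI[OF smooth_continuous_on[OF g]] borel_measurable_continuous_onI[OF smooth_continuous_on[OF s]]
 have e1: "(\<integral>x. g x * pd j \<phi> x \<partial>lebesgue_on U) = (LBINT x. g x * pd j \<phi> x)"
  and i1: "L1 (\<lambda>x. g x * pd j \<phi> x)"
  using integral_lebesgue_on_borel(1,2)[OF Ub, of "\<lambda>x. g x * pd j \<phi> x" "\<lambda>x. g x * pd j \<phi> x"]
   test_function_deriv_zero(2)[OF t] integrable_mult_test_function(2)[OF U li(1) t] by auto
 have e2: "(\<integral>x. pd j g x * \<phi> x \<partial>lebesgue_on U) = (LBINT x. pd j g x * \<phi> x)"
  and i2: "L1 (\<lambda>x. pd j g x * \<phi> x)"
  using integral_lebesgue_on_borel(1,2)[OF Ub, of "\<lambda>x. pd j g x * \<phi> x" "\<lambda>x. pd j g x * \<phi> x"]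
   test_function_deriv_zero(1)[OF t] integrable_mult_test_function(1)[OF U li(2) t] by auto
 have "(LBINT x. pd j (\<lambda>x. g x * \<phi> x) x) = 0"
  by (rule integral_partial_eq_zero[OF smooth_mult[OF g s], of r]) (use r in auto)
 then have "(LBINT x. g x * pd j \<phi> x + pd j g x * \<phi> x) = 0"
  by (simp add: frechet_derivative_mult_real smooth_differentiable g s)
 then show "(\<integral>x. g x * pd j \<phi> x \<partial>lebesgue_on U)
   = - (\<integral>x. pd j g x * \<phi> x \<partial>lebesgue_on U)"
  unfolding e1 e2 using i1 i2 by simp
qed

text \<open>Approximation in \<open>H\<^sup>1(S)\<close> by smooth functions, with representatives extended by zero.  The trace of the velocity is only given through such an approximation, so that the inequalities below are proved for smooth functions and passed to the limit.\<close>

definition H1_approx ::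
 "(real^2) set => (nat => real^2 => real) => (real^2 => real) => (2 => real^2 => real) => bool" where
 "H1_approx S \<phi> v D \<longleftrightarrow> (\<forall>k. smooth (\<phi> k)) \<and> L2_lim lborel (\<lambda>k x. ind S x * \<phi> k x) v \<and>
   (\<forall>j. L2_lim lborel (\<lambda>k x. ind S x * pd j (\<phi> k) x) (D j))"

text \<open>The increment is the integral of the gradient along the segment from \<open>y\<close> to \<open>y + h\<close>; the hypothesis keeps that segment inside \<open>S\<close>.\<close>

lemma smooth_translation_bound:
 assumes V: "smooth (V :: real^2 => real)" and S[measurable]: "S \<in> sets borel" and A[measurable]: "A \<in> sets borel"
  and seg: "\<And>y s. y \<in> A ==> 0 \<le> s ==> s \<le> 1 ==> y + s *\<^sub>R h \<in> S"
  and i: "L1 (\<lambda>x. ind S x * grad_sq V x)"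
 shows "(LBINT y. ind A y * (V (h + y) - V y)^2) \<le> (norm h)^2 * (LBINT x. ind S x * grad_sq V x)"
proof -
 define g where "g x = ind S x * grad_sq V x" for x
 have [measurable]: "grad_sq V \<in> Borel" "V \<in> Borel"
  by (intro borel_measurable_continuous_onI continuous_on_grad_sq smooth_continuous_on V)+
 have gm[measurable]: "g \<in> Borel" unfolding g_def by measurable
 have g0: "0 \<le> g x" for x by (simp add: g_def grad_sq_nonneg)
 have pt: "ennreal (ind A y * (V (h + y) - V y)^2) \<le> (\<integral>\<^sup>+s. ind {0..1} s * ennreal ((norm h)^2 * g (s *\<^sub>R h + y)) \<partial>lborel)" for y
 proof (cases "y \<in> A")
  case True
  have c: "continuous_on {0..1} (\<lambda>s. (norm h)^2 * grad_sq V (y + s *\<^sub>R h))"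
   by (intro continuous_intros continuous_on_compose2[OF continuous_on_grad_sq[OF V, of UNIV]]) auto
  have si: "set_integrable lborel {0..1} (\<lambda>s. (norm h)^2 * grad_sq V (y + s *\<^sub>R h))"
   unfolding set_integrable_def by (intro borel_integrable_compact c) auto
  have "(V (h + y) - V y)^2 \<le> integral {0..1} (\<lambda>s. (norm h)^2 * grad_sq V (y + s *\<^sub>R h))"
   using segment_increment_sq_le[OF V, of 0 1 y h] by (simp add: add.commute)
  also have "\<dots> = (LBINT s. ind {0..1} s * ((norm h)^2 * grad_sq V (y + s *\<^sub>R h)))"
   using set_borel_integral_eq_integral(2)[OF si] by (simp only: set_lebesgue_integral_def real_scaleR_def)
  finally have "ennreal ((V (h + y) - V y)^2) \<le> ennreal (LBINT s. ind {0..1} s * ((norm h)^2 * grad_sq V (y + s *\<^sub>R h)))"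
   by (rule ennreal_leI)
  also have "\<dots> = (\<integral>\<^sup>+s. ennreal (ind {0..1} s * ((norm h)^2 * grad_sq V (y + s *\<^sub>R h))) \<partial>lborel)"
   using si by (intro nn_integral_eq_integral[symmetric]) (auto simp: set_integrable_def grad_sq_nonneg)
  also have "\<dots> = (\<integral>\<^sup>+s. ind {0..1} s * ennreal ((norm h)^2 * g (s *\<^sub>R h + y)) \<partial>lborel)"
   using seg[OF True] by (intro nn_integral_cong) (auto simp: indicator_def g_def add.commute)
  finally show ?thesis using True by simp
 qed simp
 have "(\<integral>\<^sup>+y. ennreal (ind A y * (V (h + y) - V y)^2) \<partial>lborel) \<le>
   (\<integral>\<^sup>+y. \<integral>\<^sup>+s. ind {0..1} s * ennreal ((norm h)^2 * g (s *\<^sub>R h + y)) \<partial>lborel \<partial>lborel)"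
  by (intro nn_integral_mono pt)
 also have "\<dots> = (\<integral>\<^sup>+s. \<integral>\<^sup>+y. ind {0..1} s * ennreal ((norm h)^2 * g (s *\<^sub>R h + y)) \<partial>lborel \<partial>lborel)"
  by (rule lborel_pair.Fubini'[symmetric]) measurable
 also have "\<dots> = (\<integral>\<^sup>+s. ind {0..1} s * ennreal ((norm h)^2 * (LBINT x. g x)) \<partial>(lborel :: real measure))"
 proof (intro nn_integral_cong)
  fix s :: real
  have "(\<integral>\<^sup>+y. ind {0..1} s * ennreal ((norm h)^2 * g (s *\<^sub>R h + y)) \<partial>lborel) =
   ind {0..1} s * (\<integral>\<^sup>+y. ennreal ((norm h)^2 * g (s *\<^sub>R h + y)) \<partial>lborel)"
   by (rule nn_integral_cmult) measurable
  also have "(\<integral>\<^sup>+y. ennreal ((norm h)^2 * g (s *\<^sub>R h + y)) \<partial>lborel) = ennreal (LBINT y. (norm h)^2 * g (s *\<^sub>R h + y))"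
   using lborel_shift(2)[OF gm] i g0 by (intro nn_integral_eq_integral) (auto simp: g_def[abs_def])
  also have "(LBINT y. (norm h)^2 * g (s *\<^sub>R h + y)) = (norm h)^2 * (LBINT x. g x)"
   using lborel_shift(1)[OF gm] by simp
  finally show "(\<integral>\<^sup>+y. ind {0..1} s * ennreal ((norm h)^2 * g (s *\<^sub>R h + y)) \<partial>lborel)
    = ind {0..1} s * ennreal ((norm h)^2 * (LBINT x. g x))" .
 qed
 also have "\<dots> = ennreal ((norm h)^2 * (LBINT x. g x))"
  by (subst nn_integral_multc) auto
 finally have "(\<integral>\<^sup>+y. ennreal (ind A y * (V (h + y) - V y)^2) \<partial>lborel) \<le> ennreal ((norm h)^2 * (LBINT x. g x))" .
 then show ?thesis unfolding g_def[symmetric] using g0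
  by (intro nn_integral_le_imp_integral_le(2)) (auto intro: mult_nonneg_nonneg integral_nonneg_AE)
qed

lemma H1_translation_bound:
 assumes ap: "H1_approx S \<phi> v D" and S[measurable]: "S \<in> sets borel" and A[measurable]: "A \<in> sets borel"
  and seg: "\<And>y s. y \<in> A ==> 0 \<le> s ==> s \<le> 1 ==> y + s *\<^sub>R h \<in> S"
 shows "(LBINT y. ind A y * (v (h + y) - v y)^2) \<le> (norm h)^2 * (\<Sum>j\<in>UNIV. LBINT x. (D j x)^2)"
proof -
 have V: "smooth (\<phi> k)" for k using ap by (simp add: H1_approx_def)
 let ?F = "\<lambda>k x. ind S x * \<phi> k x"
 let ?G = "\<lambda>j k x. ind S x * pd j (\<phi> k) x"
 have lv: "L2_lim lborel ?F v" and lD: "L2_lim lborel (?G j) (D j)" for j using ap by (auto simp: H1_approx_def)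
 have ind2: "(ind X x :: real)^2 = ind X x" for X and x :: "real^2" by (simp add: indicator_def)
 have iG: "L1 (\<lambda>x. (?G j k x)^2)" for j k using lD by (auto simp: L2_lim_def L2_fun_def)
 have eqG: "ind S x * grad_sq (\<phi> k) x = (\<Sum>j\<in>UNIV. (?G j k x)^2)" for k x
  by (simp add: grad_sq_def sum_distrib_left power_mult_distrib ind2)
 have "L2_lim lborel (\<lambda>k x. ind A x * (?F k (h + x) + - ?F k x)) (\<lambda>x. ind A x * (v (h + x) + - v x))"
  by (rule L2_lim_mult[OF L2_lim_add[OF L2_lim_shift[OF lv] L2_lim_uminus[OF lv]], of _ 1]) (auto simp: indicator_def)
 from L2_lim_integral_sq[OF this]
 have "(\<lambda>k. LBINT x. ind A x * (\<phi> k (h + x) - \<phi> k x)^2) \<longlonglongrightarrow> (LBINT x. ind A x * (v (h + x) - v x)^2)"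
 proof -
  have "(ind A x * (?F k (h + x) + - ?F k x))^2 = ind A x * (\<phi> k (h + x) - \<phi> k x)^2" for k x
   using seg[of x 0] seg[of x 1] by (auto simp: indicator_def add.commute)
  moreover have "(ind A x * (v (h + x) + - v x))^2 = ind A x * (v (h + x) - v x)^2" for x
   by (simp add: power_mult_distrib ind2)
  ultimately show ?thesis
   using L2_lim_integral_sq[OF \<open>L2_lim lborel (\<lambda>k x. ind A x * (?F k (h + x) + - ?F k x)) _\<close>] by simp
 qed
 moreover have "(\<lambda>k. (norm h)^2 * (\<Sum>j\<in>UNIV. LBINT x. (?G j k x)^2)) \<longlonglongrightarrow> (norm h)^2 * (\<Sum>j\<in>UNIV. LBINT x. (D j x)^2)"
  by (intro tendsto_intros L2_lim_integral_sq lD)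
 moreover have "(LBINT x. ind A x * (\<phi> k (h + x) - \<phi> k x)^2) \<le> (norm h)^2 * (\<Sum>j\<in>UNIV. LBINT x. (?G j k x)^2)" for k
 proof -
  have "L1 (\<lambda>x. ind S x * grad_sq (\<phi> k) x)" unfolding eqG using iG by auto
  from smooth_translation_bound[OF V S A seg this]
  show ?thesis unfolding eqG using iG by simp
 qed
 ultimately show ?thesis by (intro LIMSEQ_le) auto
qed

section \<open>Sobolev functions with traces on the annulus\<close>

lemma integrable_powr_2_iff: "(\<lambda>x. \<bar>g x\<bar> powr 2) = (\<lambda>x. (g x :: real)^2)"
proof
 fix x show "\<bar>g x\<bar> powr 2 = (g x)^2" by (cases "g x = 0") (simp_all add: powr_numeral)
qed

lemma Lspace_2_iff: "g \<in> Lspace (ereal 2) U \<longleftrightarrow> L2_fun (lebesgue_on U) g"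
 by (auto simp: Lspace_def L2_fun_def integrable_powr_2_iff)

lemma L2norm_sq: "(L2norm U g)^2 = (\<integral>x. (g x)^2 \<partial>lebesgue_on U)"
 by (simp add: L2norm_def)

lemma L2_fun_borel_version:
 assumes U: "U \<in> sets borel" and g': "g' \<in> Borel" and z: "\<And>x. x \<notin> U ==> g' x = 0"
  and ae: "AE x in lborel. x \<in> U --> g x = g' x"
 shows "L2_fun (lebesgue_on U) g \<longleftrightarrow> L2_fun lborel g'"
  and "(\<integral>x. (g x)^2 \<partial>lebesgue_on U) = (LBINT x. (g' x)^2)"
proof -
 have ae2: "AE x in lborel. x \<in> U --> (g x)^2 = (g' x)^2" using ae by eventually_elim auto
 have z2: "(g' x)^2 = 0" if "x \<notin> U" for x using z[OF that] by simp
 have m2: "(\<lambda>x. (g' x)^2) \<in> Borel" using g' by measurable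
 show "(\<integral>x. (g x)^2 \<partial>lebesgue_on U) = (LBINT x. (g' x)^2)"
  by (rule integral_lebesgue_on_borel(1)[OF U m2 z2 ae2])
 show "L2_fun (lebesgue_on U) g \<longleftrightarrow> L2_fun lborel g'"
  using integral_lebesgue_on_borel(2)[OF U m2 z2 ae2] integral_lebesgue_on_borel(3)[OF U g' z ae] g'
  by (simp add: L2_fun_def)
qed

lemma Basis_real2: "(Basis :: (real^2) set) = {axis 1 1, axis 2 1}"
 by (simp add: Basis_vec_def UNIV_2 insert_commute)

lemma Hnorm_sq_1_bounds:
 fixes U :: "(real^2) set"
 shows "(L2norm U g)^2 \<le> Hnorm_sq 1 U g" "(L2norm U (weak_deriv U (axis j 1) g))^2 \<le> Hnorm_sq 1 U g"
proof -
 have "axis 1 (1::real) \<noteq> (axis 2 1 :: real^2)" by (simp add: axis_eq_axis)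
 then have e: "Hnorm_sq 1 U g = (L2norm U g)^2 + ((L2norm U (weak_deriv U (axis 1 1) g))^2 + (L2norm U (weak_deriv U (axis 2 1) g))^2)"
  by (simp add: Basis_real2)
 show "(L2norm U g)^2 \<le> Hnorm_sq 1 U g" unfolding e by simp
 show "(L2norm U (weak_deriv U (axis j 1) g))^2 \<le> Hnorm_sq 1 U g"
  unfolding e using exhaust_2[of j] by auto
qed

lemma Wspace_1_2D:
 fixes U :: "(real^2) set"
 assumes U: "open U" and g: "g \<in> Wspace 1 2 U"
 shows "L2_fun (lebesgue_on U) g" "has_weak_deriv U (axis j 1) g (weak_deriv U (axis j 1) g)"
  "L2_fun (lebesgue_on U) (weak_deriv U (axis j 1) g)"
proof -
 show "L2_fun (lebesgue_on U) g" using g by (simp add: Lspace_2_iff)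
 have "axis j 1 \<in> (Basis :: (real^2) set)" by (simp add: axis_in_Basis_iff)
 moreover have "\<forall>b\<in>Basis. \<exists>h\<in>Lspace (ereal 2) U. has_weak_deriv U b g h" using g by simp
 ultimately obtain h where h: "h \<in> Lspace (ereal 2) U" "has_weak_deriv U (axis j 1) g h" by blast
 show w: "has_weak_deriv U (axis j 1) g (weak_deriv U (axis j 1) g)" by (rule weak_deriv_works[OF h(2)])
 have Ub: "U \<in> sets borel" using U by simp
 have hm: "h \<in> borel_measurable (lebesgue_on U)" using h(1) by (simp add: Lspace_2_iff L2_fun_def)
 obtain h' where h': "h' \<in> Borel" "\<And>x. x \<notin> U ==> h' x = 0" "AE x in lborel. x \<in> U --> h x = h' x"
  using lebesgue_on_borel_version[OF Ub hm] by metis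
 have "AE x in lborel. x \<in> U --> weak_deriv U (axis j 1) g x = h x"
  using weak_deriv_unique[OF U w h(2)] by (simp add: AE_lebesgue_on_iff[OF Ub])
 then have "AE x in lborel. x \<in> U --> weak_deriv U (axis j 1) g x = h' x"
  using h'(3) by eventually_elim auto
 from L2_fun_borel_version(1)[OF Ub h'(1,2) this] L2_fun_borel_version(1)[OF Ub h'] h(1)
 show "L2_fun (lebesgue_on U) (weak_deriv U (axis j 1) g)" by (simp add: Lspace_2_iff)
qed

lemma has_weak_deriv_diff:
 fixes U :: "(real^2) set"
 assumes U: "open U" and f: "has_weak_deriv U (axis j 1) f h" and g: "has_weak_deriv U (axis j 1) g k"
 shows "has_weak_deriv U (axis j 1) (\<lambda>x. f x - g x) (\<lambda>x. h x - k x)"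
 unfolding has_weak_deriv_def
proof (intro conjI allI impI)
 have li: "loc_integrable U f" "loc_integrable U g" "loc_integrable U h" "loc_integrable U k"
  using f g by (auto simp: has_weak_deriv_def)
 show "loc_integrable U (\<lambda>x. f x - g x)" "loc_integrable U (\<lambda>x. h x - k x)"
  using li by (auto simp: loc_integrable_def)
 fix \<phi> assume t: "test_function U \<phi>"
 note i = integrable_mult_test_function[OF U _ t]
 have "(\<integral>x. (f x - g x) * pd j \<phi> x \<partial>lebesgue_on U) =
   (\<integral>x. f x * pd j \<phi> x \<partial>lebesgue_on U) - (\<integral>x. g x * pd j \<phi> x \<partial>lebesgue_on U)"
  unfolding left_diff_distrib by (rule Bochner_Integration.integral_diff[OF i(2)[OF li(1)] i(2)[OF li(2)]])
 also have "\<dots> = - (\<integral>x. h x * \<phi> x \<partial>lebesgue_on U) + (\<integral>x. k x * \<phi> x \<partial>lebesgue_on U)"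
  using f g t by (simp add: has_weak_deriv_def)
 also have "\<dots> = - (\<integral>x. (h x - k x) * \<phi> x \<partial>lebesgue_on U)"
  unfolding left_diff_distrib Bochner_Integration.integral_diff[OF i(1)[OF li(3)] i(1)[OF li(4)]] by simp
 finally show "(\<integral>x. (f x - g x) * pd j \<phi> x \<partial>lebesgue_on U)
   = - (\<integral>x. (h x - k x) * \<phi> x \<partial>lebesgue_on U)" .
qed

lemma L2_fun_indicator_continuous:
 fixes g :: "'a::euclidean_space => real"
 assumes g: "continuous_on UNIV g" and S[measurable]: "S \<in> sets borel" and b: "bounded S"
 shows "L2_fun lborel (\<lambda>x. ind S x * g x)"
proof -
 obtain r where r: "S \<subseteq> cball 0 r" using bounded_subset_ballD[OF b, of 0] ball_subset_cball by blast
 have [measurable]: "g \<in> Borel" by (rule borel_measurable_continuous_onI[OF g])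
 have "L1 (\<lambda>x. indicator (cball 0 r) x *\<^sub>R (g x)^2)"
  by (intro borel_integrable_compact continuous_intros continuous_on_subset[OF g]) auto
 then have "L1 (\<lambda>x. (ind S x * g x)^2)"
  by (rule Bochner_Integration.integrable_bound) (use r in \<open>auto simp: indicator_def subset_iff\<close>)
 then show ?thesis by (simp add: L2_fun_def)
qed

lemma bounded_annulus: "0 < a ==> a < b ==> bounded (annulus a b)"
 by (rule bounded_subset[OF bounded_cball[of 0 b]]) (auto simp: annulus_eq_norm)

text \<open>The sequence that defines the trace converges in a norm that contains weak derivatives of differences; uniqueness of weak derivatives identifies these with differences of derivatives.\<close>

theorem has_trace_H1_approx:
 assumes ab: "0 < a" "a < b" and tr: "has_trace a b g h"
  and g': "g' \<in> Borel" "\<And>x. x \<notin> annulus a b ==> g' x = 0"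
   "AE x in lborel. x \<in> annulus a b --> g x = g' x"
  and D: "\<And>j. D j \<in> Borel" "\<And>j x. x \<notin> annulus a b ==> D j x = 0"
   "\<And>j. AE x in lborel. x \<in> annulus a b --> weak_deriv (annulus a b) (axis j 1) g x = D j x"
 shows "\<exists>\<phi>. H1_approx (annulus a b) \<phi> g' D \<and>
   (\<forall>r\<in>{a, b}. L2_lim (lebesgue_on {0..2*pi}) (\<lambda>k \<theta>. \<phi> k (circ r \<theta>)) (\<lambda>\<theta>. h (circ r \<theta>)))"
proof -
 define U where "U = annulus a b"
 have U: "open U" by (simp add: U_def open_annulus)
 then have Ub[measurable]: "U \<in> sets borel" by simp
 have bU: "bounded U" unfolding U_def using ab by (rule bounded_annulus)
 note g' = g'[folded U_def] and D = D[folded U_def]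
 have gW: "g \<in> Wspace 1 2 U" and hL: "\<And>r. r \<in> {a, b} ==> (\<lambda>\<theta>. h (circ r \<theta>)) \<in> Lspace 2 {0..2*pi}"
  using tr by (auto simp: has_trace_def U_def)
 obtain \<phi> where \<phi>: "\<And>k. smooth (\<phi> k)" and lim: "(\<lambda>k. Hnorm_sq 1 U (\<lambda>x. \<phi> k x - g x)) \<longlonglongrightarrow> 0"
  and lc: "\<And>r. r \<in> {a, b} ==> (\<lambda>k. L2norm {0..2*pi} (\<lambda>\<theta>. \<phi> k (circ r \<theta>) - h (circ r \<theta>))) \<longlonglongrightarrow> 0"
  using tr unfolding has_trace_def U_def by blast
 note W = Wspace_1_2D[OF U gW]
 have cont: "continuous_on UNIV (\<lambda>x. pd j (\<phi> k) x)" for k j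
  by (intro smooth_continuous_on smooth_partial \<phi>) (auto simp: Basis_vec_def)
 have "L2_lim lborel (\<lambda>k x. ind U x * \<phi> k x) g'"
 proof (rule L2_lim_dom[OF _ _ _ lim])
  show "L2_fun lborel (\<lambda>x. ind U x * \<phi> k x)" for k
   by (rule L2_fun_indicator_continuous[OF smooth_continuous_on[OF \<phi>] Ub bU])
  show "L2_fun lborel g'" using W(1) L2_fun_borel_version(1)[OF Ub g'] by simp
  show "(LBINT x. (ind U x * \<phi> k x - g' x)^2) \<le> Hnorm_sq 1 U (\<lambda>x. \<phi> k x - g x)" for k
  proof -
   note [measurable] = g'(1) borel_measurable_continuous_onI[OF smooth_continuous_on[OF \<phi>]]
   have "(\<integral>x. (\<phi> k x - g x)^2 \<partial>lebesgue_on U) = (LBINT x. (ind U x * \<phi> k x - g' x)^2)"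
   proof (rule L2_fun_borel_version(2)[OF Ub])
    show "AE x in lborel. x \<in> U --> \<phi> k x - g x = ind U x * \<phi> k x - g' x"
     using g'(3) by eventually_elim auto
   qed (use g'(2) in auto)
   then show ?thesis using Hnorm_sq_1_bounds(1)[of U "\<lambda>x. \<phi> k x - g x"] by (simp add: L2norm_sq)
  qed
 qed
 moreover have "L2_lim lborel (\<lambda>k x. ind U x * pd j (\<phi> k) x) (D j)" for j
 proof (rule L2_lim_dom[OF _ _ _ lim])
  show "L2_fun lborel (\<lambda>x. ind U x * pd j (\<phi> k) x)" for k
   by (rule L2_fun_indicator_continuous[OF cont Ub bU])
  show "L2_fun lborel (D j)" using W(3)[of j] L2_fun_borel_version(1)[OF Ub D(1-3)] by simp
  show "(LBINT x. (ind U x * pd j (\<phi> k) x - D j x)^2) \<le> Hnorm_sq 1 U (\<lambda>x. \<phi> k x - g x)" for k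
  proof -
   note [measurable] = D(1) borel_measurable_continuous_onI[OF cont]
   have wd: "has_weak_deriv U (axis j 1) (\<lambda>x. \<phi> k x - g x) (\<lambda>x. pd j (\<phi> k) x - weak_deriv U (axis j 1) g x)"
    by (rule has_weak_deriv_diff[OF U smooth_has_weak_deriv[OF U \<phi>] W(2)])
   have u: "AE x in lborel. x \<in> U --> weak_deriv U (axis j 1) (\<lambda>x. \<phi> k x - g x) x = pd j (\<phi> k) x - weak_deriv U (axis j 1) g x"
    using weak_deriv_unique[OF U weak_deriv_works[OF wd] wd] by (simp add: AE_lebesgue_on_iff[OF Ub])
   have "(\<integral>x. (weak_deriv U (axis j 1) (\<lambda>x. \<phi> k x - g x) x)^2 \<partial>lebesgue_on U)
     = (LBINT x. (ind U x * pd j (\<phi> k) x - D j x)^2)"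
   proof (rule L2_fun_borel_version(2)[OF Ub])
    show "AE x in lborel. x \<in> U --> weak_deriv U (axis j 1) (\<lambda>x. \<phi> k x - g x) x =
      ind U x * pd j (\<phi> k) x - D j x"
     using u D(3)[of j] by eventually_elim auto
   qed (use D(2) in auto)
   then show ?thesis using Hnorm_sq_1_bounds(2)[of U j "\<lambda>x. \<phi> k x - g x"] by (simp add: L2norm_sq)
  qed
 qed
 moreover have "L2_lim (lebesgue_on {0..2*pi}) (\<lambda>k \<theta>. \<phi> k (circ r \<theta>)) (\<lambda>\<theta>. h (circ r \<theta>))" if r: "r \<in> {a, b}" for r
  unfolding L2_lim_def
 proof (intro conjI allI)
  show "L2_fun (lebesgue_on {0..2*pi}) (\<lambda>\<theta>. \<phi> k (circ r \<theta>))" for k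
  proof -
   have c: "continuous_on UNIV (\<lambda>\<theta>. \<phi> k (circ r \<theta>))"
    by (intro continuous_on_compose2[OF smooth_continuous_on[OF \<phi>, of UNIV]] continuous_intros) auto
   have "L2_fun lborel (\<lambda>\<theta>. ind {0..2*pi} \<theta> * \<phi> k (circ r \<theta>))"
    by (rule L2_fun_indicator_continuous[OF c]) auto
   then show ?thesis
    using borel_measurable_continuous_onI[OF c]
    by (subst L2_fun_borel_version(1)[of _ "\<lambda>\<theta>. ind {0..2*pi} \<theta> * \<phi> k (circ r \<theta>)"]) auto
  qed
  show "L2_fun (lebesgue_on {0..2*pi}) (\<lambda>\<theta>. h (circ r \<theta>))" using hL[OF r] by (simp add: Lspace_2_iff)
  show "(\<lambda>k. \<integral>\<theta>. (\<phi> k (circ r \<theta>) - h (circ r \<theta>))^2 \<partial>lebesgue_on {0..2*pi}) \<longlonglongrightarrow> 0"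
   using tendsto_power[OF lc[OF r], of 2] by (simp add: L2norm_sq)
 qed
 ultimately show ?thesis using \<phi> unfolding H1_approx_def U_def by blast
qed

lemma axis_nth_2: "(axis j 1 :: real^2) $ i = (if i = j then 1 else 0)"
 by (auto simp: axis_def)

text \<open>The Hardy inequality for \<open>V = \<Sum> x\<^sub>i \<phi>\<^sub>i\<close> in the limit: the boundary term tends to the integral of the squared normal trace, which vanishes.  The gradient of \<open>V\<close> produces the extra term \<open>v j x\<close>.\<close>

theorem H1_hardy:
 fixes \<phi> :: "2 => nat => real^2 => real"
 assumes ab: "0 < a" "a \<le> p" "p < q" "q \<le> b" and r0: "r0 = p \<or> r0 = q"
  and ap: "\<And>i. H1_approx (annulus a b) (\<phi> i) (v i) (D i)"
  and tr: "\<And>i. L2_lim (lebesgue_on {0..2*pi}) (\<lambda>k \<theta>. \<phi> i k (circ r0 \<theta>)) (w i)"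
  and nt: "AE \<theta> in lebesgue_on {0..2*pi}. (\<Sum>i\<in>UNIV. circ r0 \<theta> $ i * w i \<theta>) = 0"
 shows "(LBINT x. ind {x. p < norm x \<and> norm x < q} x * (\<Sum>i\<in>UNIV. x $ i * v i x)^2)
  \<le> 2 * (q - p)^2 * (b / a) * (LBINT x. ind {x. p < norm x \<and> norm x < q} x *
    (\<Sum>j\<in>UNIV. ((\<Sum>i\<in>UNIV. x $ i * D i j x) + v j x)^2))"
proof -
 define U where "U = annulus a b"
 define T where "T = {x::real^2. p < norm x \<and> norm x < q}"
 have "0 < b" using ab by linarith
 then have TU: "T \<subseteq> U" using ab by (auto simp: T_def U_def annulus_eq_norm)
 have Tb[measurable]: "T \<in> sets borel"
  unfolding T_def by (intro borel_open open_Collect_conj open_Collect_less continuous_intros)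
 have smo: "smooth (\<phi> i k)" for i k using ap by (simp add: H1_approx_def)
 define V where "V k x = (\<Sum>i\<in>UNIV. x $ i * \<phi> i k x)" for k x
 have sV: "smooth (V k)" for k
  unfolding V_def[abs_def] cart_eq_inner_axis by (intro smooth_sum smooth_mult smooth_inner smo)
 have fdV: "pd j (V k) x = (\<Sum>i\<in>UNIV. x $ i * pd j (\<phi> i k) x) + \<phi> j k x" for k x j
 proof -
  have nth: "((\<lambda>x::real^2. x $ i) has_derivative (\<lambda>h. h $ i)) F" for i F
   by (rule bounded_linear_imp_has_derivative[OF bounded_linear_vec_nth])
  have "(V k has_derivative (\<lambda>h. \<Sum>i\<in>UNIV. x $ i * frechet_derivative (\<phi> i k) (at x) h + h $ i * \<phi> i k x)) (at x)"
   unfolding V_def[abs_def]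
   by (intro has_derivative_sum has_derivative_mult nth smooth_has_derivative smo)
  then have "pd j (V k) x =
   (\<Sum>i\<in>UNIV. x $ i * pd j (\<phi> i k) x + axis j 1 $ i * \<phi> i k x)"
   by (simp only: frechet_derivative_at[symmetric])
  also have "\<dots> = (\<Sum>i\<in>UNIV. x $ i * pd j (\<phi> i k) x) + (\<Sum>i\<in>UNIV. if i = j then \<phi> i k x else 0)"
   unfolding sum.distrib axis_nth_2 by (simp add: if_distrib[of "\<lambda>z. z * _"] cong: if_cong)
  finally show ?thesis by simp
 qed
 define m where "m i x = ind T x * x $ i" for i and x :: "real^2"
 have mm[measurable]: "m i \<in> Borel" for i
 proof -
  have "continuous_on UNIV (\<lambda>x::real^2. x $ i)" by (intro continuous_intros)
  note [measurable] = borel_measurable_continuous_onI[OF this]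
  show ?thesis unfolding m_def by measurable
 qed
 have mb: "\<bar>m i x\<bar> \<le> b" for i x
  using component_le_norm_cart[of x i] ab by (auto simp: m_def T_def indicator_def)
 have lv: "L2_lim lborel (\<lambda>k x. ind U x * \<phi> i k x) (v i)"
  and lD: "L2_lim lborel (\<lambda>k x. ind U x * pd j (\<phi> i k) x) (D i j)" for i j
  using ap by (auto simp: H1_approx_def U_def)
 have ind: "ind T x * (ind U x :: real) = ind T x" for x using TU by (auto simp: indicator_def)
 have mi: "m i x * (ind U x * c) = m i x * c" for i x c using TU by (auto simp: m_def indicator_def)
 have ind2: "(ind T x * c)^2 = ind T x * c^2" for x and c :: real by (simp add: indicator_def)
 have L1: "(\<lambda>k. LBINT x. ind T x * (V k x)^2) \<longlonglongrightarrow> (LBINT x. ind T x * (\<Sum>i\<in>UNIV. x $ i * v i x)^2)"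
 proof -
  have "L2_lim lborel (\<lambda>k x. m 1 x * (ind U x * \<phi> 1 k x) + m 2 x * (ind U x * \<phi> 2 k x)) (\<lambda>x. m 1 x * v 1 x + m 2 x * v 2 x)"
   by (intro L2_lim_add L2_lim_mult[OF lv _ mb]) measurable
  from L2_lim_integral_sq[OF this] have "(\<lambda>k. LBINT x. (m 1 x * \<phi> 1 k x + m 2 x * \<phi> 2 k x)^2) \<longlonglongrightarrow> (LBINT x. (m 1 x * v 1 x + m 2 x * v 2 x)^2)"
   by (simp only: mi)
  moreover have "(m 1 x * c + m 2 x * d)^2 = ind T x * (x $ 1 * c + x $ 2 * d)^2" for x c d
   by (simp add: m_def ind2[symmetric] algebra_simps)
  ultimately show ?thesis by (simp only: V_def sum_2)
 qed
 have L2: "(\<lambda>k. LBINT x. ind T x * grad_sq (V k) x) \<longlonglongrightarrow>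
   (LBINT x. ind T x * (\<Sum>j\<in>UNIV. ((\<Sum>i\<in>UNIV. x $ i * D i j x) + v j x)^2))"
 proof -
  have tb: "\<bar>ind T x :: real\<bar> \<le> 1" for x by (simp add: indicator_def)
  let ?F = "\<lambda>j k x. m 1 x * (ind U x * pd j (\<phi> 1 k) x) + m 2 x * (ind U x * pd j (\<phi> 2 k) x)
    + ind T x * (ind U x * \<phi> j k x)"
  let ?f = "\<lambda>j x. m 1 x * D 1 j x + m 2 x * D 2 j x + ind T x * v j x"
  have l: "L2_lim lborel (?F j) (?f j)" for j
   by (intro L2_lim_add L2_lim_mult[OF lD _ mb] L2_lim_mult[OF lv _ tb]) measurable
  have Feq: "(?F j k x)^2 = ind T x * (pd j (V k) x)^2" for j k x
   unfolding fdV sum_2 mi ind2[symmetric] using TU by (auto simp: m_def indicator_def)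
  have feq: "(?f j x)^2 = ind T x * ((\<Sum>i\<in>UNIV. x $ i * D i j x) + v j x)^2" for j x
   unfolding sum_2 ind2[symmetric] by (auto simp: m_def indicator_def)
  have iF: "L1 (\<lambda>x. (?F j k x)^2)" and if': "L1 (\<lambda>x. (?f j x)^2)" for j k
   using l[of j] unfolding L2_lim_def L2_fun_def by blast+
  have "(\<lambda>k. \<Sum>j\<in>UNIV. LBINT x. (?F j k x)^2) \<longlonglongrightarrow> (\<Sum>j\<in>UNIV. LBINT x. (?f j x)^2)"
   by (intro tendsto_sum L2_lim_integral_sq l)
  then show ?thesis
   using iF if' unfolding Feq feq grad_sq_def sum_distrib_left by (simp only: Bochner_Integration.integral_sum)
 qed
 have L3: "(\<lambda>k. integral {0..2*pi} (\<lambda>\<theta>. (V k (circ r0 \<theta>))^2)) \<longlonglongrightarrow> 0"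
 proof -
  have cm: "(\<lambda>\<theta>. circ r0 \<theta> $ i) \<in> borel_measurable (lebesgue_on {0..2*pi})" for i
  proof (rule continuous_imp_measurable_on_sets_lebesgue)
   show "continuous_on {0..2*pi} (\<lambda>\<theta>. circ r0 \<theta> $ i)" by (intro continuous_intros)
  qed auto
  have cb: "\<bar>circ r0 \<theta> $ i\<bar> \<le> \<bar>r0\<bar>" for i \<theta>
   using component_le_norm_cart[of "circ r0 \<theta>" i] by (simp add: norm_circ)
  have l: "L2_lim (lebesgue_on {0..2*pi}) (\<lambda>k \<theta>. circ r0 \<theta> $ 1 * \<phi> 1 k (circ r0 \<theta>) + circ r0 \<theta> $ 2 * \<phi> 2 k (circ r0 \<theta>))
   (\<lambda>\<theta>. circ r0 \<theta> $ 1 * w 1 \<theta> + circ r0 \<theta> $ 2 * w 2 \<theta>)"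
   by (intro L2_lim_add L2_lim_mult[OF tr cm cb])
  have "(\<integral>\<theta>. (circ r0 \<theta> $ 1 * w 1 \<theta> + circ r0 \<theta> $ 2 * w 2 \<theta>)^2 \<partial>lebesgue_on {0..2*pi}) = 0"
   using nt by (intro integral_eq_zero_AE) (auto simp: sum_2 simp del: circ_nth elim!: eventually_mono)
  moreover have "(\<integral>\<theta>. (V k (circ r0 \<theta>))^2 \<partial>lebesgue_on {0..2*pi}) = integral {0..2*pi} (\<lambda>\<theta>. (V k (circ r0 \<theta>))^2)" for k
  proof (rule lebesgue_integral_eq_integral)
   show "integrable (lebesgue_on {0..2*pi}) (\<lambda>\<theta>. (V k (circ r0 \<theta>))^2)"
    using l unfolding L2_lim_def L2_fun_def V_def sum_2 by blast
  qed simp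
  ultimately show ?thesis using L2_lim_integral_sq[OF l] by (simp only: V_def sum_2)
 qed
 have "(\<lambda>k. 2 * b * (q - p) * integral {0..2*pi} (\<lambda>\<theta>. (V k (circ r0 \<theta>))^2)
   + 2 * (q - p)^2 * (b / a) * (LBINT x. ind T x * grad_sq (V k) x)) \<longlonglongrightarrow>
   2 * b * (q - p) * 0 + 2 * (q - p)^2 * (b / a) * (LBINT x. ind T x * (\<Sum>j\<in>UNIV. ((\<Sum>i\<in>UNIV. x $ i * D i j x) + v j x)^2))"
  by (intro tendsto_intros L2 L3)
 moreover have "(LBINT x. ind T x * (V k x)^2) \<le> 2 * b * (q - p) * integral {0..2*pi} (\<lambda>\<theta>. (V k (circ r0 \<theta>))^2)
   + 2 * (q - p)^2 * (b / a) * (LBINT x. ind T x * grad_sq (V k) x)" for k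
  unfolding T_def by (rule hardy_smooth[OF sV ab r0])
 ultimately have "(LBINT x. ind T x * (\<Sum>i\<in>UNIV. x $ i * v i x)^2) \<le> 2 * b * (q - p) * 0 + 2 * (q - p)^2 * (b / a) * (LBINT x. ind T x * (\<Sum>j\<in>UNIV. ((\<Sum>i\<in>UNIV. x $ i * D i j x) + v j x)^2))"
  by (intro LIMSEQ_le[OF L1]) auto
 then show ?thesis by (simp add: T_def)
qed

section \<open>The velocity at a fixed time\<close>

lemma square_sum3_le: "(x + y + z)^2 \<le> 3 * (x^2 + y^2 + z^2)" for x y z :: real
 using zero_le_power2[of "x - y"] zero_le_power2[of "y - z"] zero_le_power2[of "x - z"]
 by (simp add: power2_eq_square algebra_simps)

text \<open>Everything that the transport argument needs from the velocity at one time: increments of order \<open>|h|\<close>, the Hardy inequality for the radial component on strips at the boundary, and zero divergence against test functions.  The density \<open>\<Psi>\<close> does not depend on the strip, so that its integral over shrinking strips tends to zero.\<close>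

theorem boundary_velocity_facts:
 fixes u :: "real^2 => real^2" and v :: "2 => real^2 => real"
 assumes ab: "0 < a" "a < b" and bc: "boundary_conditions a b \<nu> \<rho>star \<alpha> u p"
  and div: "AE x in lebesgue_on (annulus a b). divergence (annulus a b) u x = 0"
  and v: "\<And>i. v i \<in> Borel" "\<And>i x. x \<notin> annulus a b ==> v i x = 0"
   "\<And>i. AE x in lborel. x \<in> annulus a b --> u x $ i = v i x"
 defines "E \<equiv> \<Sum>i\<in>UNIV. \<Sum>j\<in>UNIV. (L2norm (annulus a b) (weak_deriv (annulus a b) (axis j 1) (\<lambda>x. u x $ i)))^2"
 shows "\<And>i. L2_fun lborel (v i)"
  and "\<And>i A h. A \<in> sets borel ==> (\<And>y s. y \<in> A ==> 0 \<le> s ==> s \<le> 1 ==> y + s *\<^sub>R h \<in> annulus a b) ==>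
   (LBINT y. ind A y * (v i (h + y) - v i y)^2) \<le> (norm h)^2 * E"
  and "\<exists>\<Psi> :: real^2 => real. (\<forall>x. 0 \<le> \<Psi> x) \<and> L1 \<Psi> \<and>
   (LBINT x. \<Psi> x) \<le> 3 * (b^2 + 1) * (E + (\<Sum>i\<in>UNIV. LBINT x. (v i x)^2)) \<and>
   (\<forall>p q. a \<le> p --> p < q --> q \<le> b --> p = a \<or> q = b -->
    (LBINT x. ind {x. p < norm x \<and> norm x < q} x * (\<Sum>i\<in>UNIV. x $ i * v i x)^2)
     \<le> 2 * (q - p)^2 * (b / a) * (LBINT x. ind {x. p < norm x \<and> norm x < q} x * \<Psi> x))"
  and "\<And>\<phi>. test_function (annulus a b) \<phi> ==>
   (LBINT x. (\<Sum>i\<in>UNIV. v i x * pd i \<phi> x)) = 0"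
proof -
 define U where "U = annulus a b"
 have U: "open U" by (simp add: U_def open_annulus)
 then have Ub[measurable]: "U \<in> sets borel" by simp
 note v = v[folded U_def]
 obtain w where w: "\<And>i. has_trace a b (\<lambda>x. u x $ i) (\<lambda>x. w x $ i)"
  and wn: "AE_circle a (\<lambda>x. w x \<bullet> outward_normal a x = 0)" "AE_circle b (\<lambda>x. w x \<bullet> outward_normal a x = 0)"
 proof -
  obtain w and G :: "real^2 => real^2^2" where "\<forall>i. has_trace a b (\<lambda>x. u x $ i) (\<lambda>x. w x $ i)"
   "AE_circle a (\<lambda>x. w x \<bullet> outward_normal a x = 0)"
   "AE_circle b (\<lambda>x. w x \<bullet> outward_normal a x = 0 \<and> G x $ 2 $ 1 - G x $ 1 $ 2 = 0)"
   using bc unfolding boundary_conditions_def by blast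
  then show ?thesis by (intro that[of w]) (auto simp: AE_circle_def elim!: eventually_mono)
 qed
 have W: "(\<lambda>x. u x $ i) \<in> Wspace 1 2 U" for i using w[of i] by (simp add: has_trace_def U_def)
 note Wf = Wspace_1_2D[OF U W]
 define d where "d i j = weak_deriv U (axis j 1) (\<lambda>x. u x $ i)" for i j
 have "\<exists>D. D \<in> Borel \<and> (\<forall>x. x \<notin> U --> D x = 0) \<and> (AE x in lborel. x \<in> U --> d i j x = D x)" for i j
 proof -
  have "d i j \<in> borel_measurable (lebesgue_on U)" using Wf(3)[of j i] by (simp add: d_def L2_fun_def)
  then show ?thesis
  proof (rule lebesgue_on_borel_version[OF Ub])
   fix g' assume "g' \<in> Borel" "\<And>x. x \<notin> U ==> g' x = 0" "AE x in lborel. x \<in> U --> d i j x = g' x"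
   then show ?thesis by (intro exI[of _ g'] conjI allI impI)
  qed
 qed
 then have "\<exists>D. \<forall>i j. D i j \<in> Borel \<and> (\<forall>x. x \<notin> U --> D i j x = 0) \<and> (AE x in lborel. x \<in> U --> d i j x = D i j x)"
  by (intro choice allI)
 then obtain D where D': "\<forall>i j. D i j \<in> Borel \<and> (\<forall>x. x \<notin> U --> D i j x = 0) \<and> (AE x in lborel. x \<in> U --> d i j x = D i j x)"
  by (elim exE)
 then have D: "D i j \<in> Borel" "x \<notin> U ==> D i j x = 0"
  "AE x in lborel. x \<in> U --> d i j x = D i j x" for i j x by blast+
 have DL: "L2_fun lborel (D i j)" for i j
  using Wf(3)[of j i] L2_fun_borel_version(1)[OF Ub D(1-3)] by (simp add: d_def)
 show vL: "L2_fun lborel (v i)" for i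
  using Wf(1)[of i] L2_fun_borel_version(1)[OF Ub v(1-3)] by simp
 have Eeq: "E = (\<Sum>i\<in>UNIV. \<Sum>j\<in>UNIV. LBINT x. (D i j x)^2)"
  unfolding E_def U_def[symmetric] L2norm_sq d_def[symmetric]
  using L2_fun_borel_version(2)[OF Ub D(1-3)] by simp
 have "\<exists>\<phi>. H1_approx U \<phi> (v i) (D i) \<and>
   (\<forall>r\<in>{a, b}. L2_lim (lebesgue_on {0..2*pi}) (\<lambda>k \<theta>. \<phi> k (circ r \<theta>)) (\<lambda>\<theta>. w (circ r \<theta>) $ i))" for i
  by (rule has_trace_H1_approx[OF ab w, folded U_def, OF v D[unfolded d_def]])
 then have "\<exists>\<phi>. \<forall>i. H1_approx U (\<phi> i) (v i) (D i) \<and>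
   (\<forall>r\<in>{a, b}. L2_lim (lebesgue_on {0..2*pi}) (\<lambda>k \<theta>. \<phi> i k (circ r \<theta>)) (\<lambda>\<theta>. w (circ r \<theta>) $ i))"
  by (intro choice allI)
 then obtain \<phi> where \<phi>: "\<forall>i. H1_approx U (\<phi> i) (v i) (D i) \<and>
   (\<forall>r\<in>{a, b}. L2_lim (lebesgue_on {0..2*pi}) (\<lambda>k \<theta>. \<phi> i k (circ r \<theta>)) (\<lambda>\<theta>. w (circ r \<theta>) $ i))"
  by (elim exE)
 have ap: "H1_approx U (\<phi> i) (v i) (D i)" for i using \<phi> by blast
 have tr: "L2_lim (lebesgue_on {0..2*pi}) (\<lambda>k \<theta>. \<phi> i k (circ r \<theta>)) (\<lambda>\<theta>. w (circ r \<theta>) $ i)" if "r \<in> {a, b}" for i r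
  using \<phi> that by blast
 show "(LBINT y. ind A y * (v i (h + y) - v i y)^2) \<le> (norm h)^2 * E"
  if A: "A \<in> sets borel" and seg: "\<And>y s. y \<in> A ==> 0 \<le> s ==> s \<le> 1 ==> y + s *\<^sub>R h \<in> annulus a b" for i A h
 proof -
  have "(LBINT y. ind A y * (v i (h + y) - v i y)^2) \<le> (norm h)^2 * (\<Sum>j\<in>UNIV. LBINT x. (D i j x)^2)"
   using seg by (intro H1_translation_bound[OF ap Ub A]) (simp add: U_def)
  also have "\<dots> \<le> (norm h)^2 * E"
   unfolding Eeq by (intro mult_left_mono member_le_sum[of i UNIV "\<lambda>i. \<Sum>j\<in>UNIV. LBINT x. (D i j x)^2"]) (auto intro!: sum_nonneg)
  finally show ?thesis .
 qed
 have nt: "AE \<theta> in lebesgue_on {0..2*pi}. (\<Sum>i\<in>UNIV. circ r \<theta> $ i * w (circ r \<theta>) $ i) = 0" if r: "r \<in> {a, b}" for r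
 proof -
  have rp: "r > 0" using r ab by auto
  have "AE \<theta> in lebesgue_on {0..2*pi}. w (circ r \<theta>) \<bullet> outward_normal a (circ r \<theta>) = 0"
   using r wn by (auto simp: AE_circle_def)
  then show ?thesis
  proof eventually_elim
   case (elim \<theta>)
   have "outward_normal a (circ r \<theta>) = circ r \<theta> /\<^sub>R r \<or> outward_normal a (circ r \<theta>) = - (circ r \<theta> /\<^sub>R r)"
    using rp by (simp add: outward_normal_def norm_circ)
   then have "w (circ r \<theta>) \<bullet> circ r \<theta> = 0" using elim rp by auto
   then show ?case by (simp add: inner_vec_def mult.commute)
  qed
 qed
 show "\<exists>\<Psi> :: real^2 => real. (\<forall>x. 0 \<le> \<Psi> x) \<and> L1 \<Psi> \<and>
   (LBINT x. \<Psi> x) \<le> 3 * (b^2 + 1) * (E + (\<Sum>i\<in>UNIV. LBINT x. (v i x)^2)) \<and>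
   (\<forall>p q. a \<le> p --> p < q --> q \<le> b --> p = a \<or> q = b -->
    (LBINT x. ind {x. p < norm x \<and> norm x < q} x * (\<Sum>i\<in>UNIV. x $ i * v i x)^2)
     \<le> 2 * (q - p)^2 * (b / a) * (LBINT x. ind {x. p < norm x \<and> norm x < q} x * \<Psi> x))"
 proof -
  define Q where "Q x = (\<Sum>j\<in>UNIV. ((\<Sum>i\<in>UNIV. x $ i * D i j x) + v j x)^2)" for x
  define \<Psi> where "\<Psi> x = ind U x * Q x" for x
  define R where "R x = 3 * (b^2 + 1) * ((\<Sum>i\<in>UNIV. \<Sum>j\<in>UNIV. (D i j x)^2) + (\<Sum>j\<in>UNIV. (v j x)^2))" for x
  note [measurable] = v(1) D(1)
  have "continuous_on UNIV (\<lambda>x::real^2. x $ i)" for i by (intro continuous_intros)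
  note [measurable] = borel_measurable_continuous_onI[OF this]
  have Qm[measurable]: "Q \<in> Borel" unfolding Q_def[abs_def] by measurable
  have Q0: "0 \<le> Q x" for x unfolding Q_def by (intro sum_nonneg) auto
  have Rb: "\<Psi> x \<le> R x" for x
  proof (cases "x \<in> U")
   case True
   then have "norm x \<le> b" using ab by (simp add: U_def annulus_eq_norm)
   then have xb: "(x $ i)^2 \<le> b^2" for i
    using component_le_norm_cart[of x i] ab by (metis abs_le_square_iff abs_of_pos less_trans order_trans)
   have e: "((\<Sum>i\<in>UNIV. x $ i * D i j x) + v j x)^2 \<le> 3 * (b^2 + 1) * ((D 1 j x)^2 + (D 2 j x)^2 + (v j x)^2)" for j
   proof -
    have "((\<Sum>i\<in>UNIV. x $ i * D i j x) + v j x)^2 \<le> 3 * ((x $ 1 * D 1 j x)^2 + (x $ 2 * D 2 j x)^2 + (v j x)^2)"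
     unfolding sum_2 by (rule square_sum3_le)
    also have "\<dots> \<le> 3 * ((b^2 + 1) * (D 1 j x)^2 + (b^2 + 1) * (D 2 j x)^2 + (b^2 + 1) * (v j x)^2)"
    proof (intro mult_left_mono add_mono)
     have m: "(x $ i * c)^2 \<le> (b^2 + 1) * c^2" for i c
      unfolding power_mult_distrib using xb[of i] by (intro mult_right_mono) auto
     show "(x $ 1 * D 1 j x)^2 \<le> (b^2 + 1) * (D 1 j x)^2" "(x $ 2 * D 2 j x)^2 \<le> (b^2 + 1) * (D 2 j x)^2" by (rule m)+
     have "1 * (v j x)^2 \<le> (b^2 + 1) * (v j x)^2" by (intro mult_right_mono) auto
     then show "(v j x)^2 \<le> (b^2 + 1) * (v j x)^2" by simp
    qed simp
    also have "\<dots> = 3 * (b^2 + 1) * ((D 1 j x)^2 + (D 2 j x)^2 + (v j x)^2)"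
     by algebra
    finally show ?thesis .
   qed
   have "Q x \<le> (\<Sum>j\<in>UNIV. 3 * (b^2 + 1) * ((D 1 j x)^2 + (D 2 j x)^2 + (v j x)^2))"
    unfolding Q_def by (intro sum_mono e)
   also have "\<dots> = R x" unfolding R_def sum_2 by algebra
   finally show ?thesis using True by (simp add: \<Psi>_def)
  next
   case False
   have "0 \<le> R x" unfolding R_def by (intro mult_nonneg_nonneg add_nonneg_nonneg sum_nonneg) auto
   then show ?thesis using False by (simp add: \<Psi>_def)
  qed
  have P0: "0 \<le> \<Psi> x" for x using Q0 by (simp add: \<Psi>_def)
  have [measurable]: "\<Psi> \<in> Borel" unfolding \<Psi>_def[abs_def] by measurable
  have iD: "L1 (\<lambda>x. (D i j x)^2)" and iv: "L1 (\<lambda>x. (v i x)^2)" for i j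
   using DL vL by (auto simp: L2_fun_def)
  have Ri: "L1 R" unfolding R_def[abs_def] using iD iv by simp
  have Pi: "L1 \<Psi>"
   by (rule Bochner_Integration.integrable_bound[OF Ri]) (use Rb P0 in \<open>auto intro!: AE_I2 order_trans[OF Rb]\<close>)
  have "(LBINT x. \<Psi> x) \<le> (LBINT x. R x)" by (intro integral_mono Pi Ri Rb)
  also have "\<dots> = 3 * (b^2 + 1) * (E + (\<Sum>i\<in>UNIV. LBINT x. (v i x)^2))"
   unfolding R_def[abs_def] Eeq using iD iv by simp
  finally have Pb: "(LBINT x. \<Psi> x) \<le> 3 * (b^2 + 1) * (E + (\<Sum>i\<in>UNIV. LBINT x. (v i x)^2))" .
  have strip: "(LBINT x. ind {x. p < norm x \<and> norm x < q} x * (\<Sum>i\<in>UNIV. x $ i * v i x)^2)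
     \<le> 2 * (q - p)^2 * (b / a) * (LBINT x. ind {x. p < norm x \<and> norm x < q} x * \<Psi> x)"
   if pq: "a \<le> p" "p < q" "q \<le> b" "p = a \<or> q = b" for p q
  proof -
   define r0 where "r0 = (if p = a then p else q)"
   have r0: "r0 = p \<or> r0 = q" "r0 \<in> {a, b}" using pq(4) by (auto simp: r0_def)
   have e: "ind {x. p < norm x \<and> norm x < q} x * Q x = ind {x. p < norm x \<and> norm x < q} x * \<Psi> x" for x
    using pq ab by (auto simp: \<Psi>_def U_def annulus_eq_norm indicator_def)
   show ?thesis
    using H1_hardy[OF ab(1) pq(1-3) r0(1) ap[unfolded U_def] tr[OF r0(2)] nt[OF r0(2)]]
    unfolding Q_def[symmetric] e .
  qed
  show ?thesis by (intro exI[of _ \<Psi>] conjI allI impI P0 Pi Pb strip)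
 qed
 show "(LBINT x. (\<Sum>i\<in>UNIV. v i x * pd i \<phi> x)) = 0"
  if t': "test_function (annulus a b) \<phi>" for \<phi>
 proof -
  have t: "test_function U \<phi>" using t' by (simp add: U_def)
  then have s: "smooth \<phi>" by (simp add: test_function_def)
  have "continuous_on UNIV (\<lambda>x. pd i \<phi> x)" for i
   by (intro smooth_continuous_on smooth_partial s) (auto simp: Basis_vec_def)
  note [measurable] = borel_measurable_continuous_onI[OF this] borel_measurable_continuous_onI[OF smooth_continuous_on[OF s]] v(1) D(1)
  have li: "loc_integrable U (\<lambda>x. u x $ i)" "loc_integrable U (d i j)" for i j
   using Wf(2)[of j i] by (auto simp: has_weak_deriv_def d_def)
  have e1: "(\<integral>x. u x $ i * pd i \<phi> x \<partial>lebesgue_on U) = (LBINT x. v i x * pd i \<phi> x)"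
   "L1 (\<lambda>x. v i x * pd i \<phi> x)" for i
  proof -
   have ae: "AE x in lborel. x \<in> U --> u x $ i * pd i \<phi> x = v i x * pd i \<phi> x"
    using v(3)[of i] by eventually_elim auto
   have z: "v i x * pd i \<phi> x = 0" if "x \<notin> U" for x using v(2)[OF that] by simp
   show "(\<integral>x. u x $ i * pd i \<phi> x \<partial>lebesgue_on U) = (LBINT x. v i x * pd i \<phi> x)"
    by (rule integral_lebesgue_on_borel(1)[OF Ub _ z ae]) measurable
   show "L1 (\<lambda>x. v i x * pd i \<phi> x)"
    using integrable_mult_test_function(2)[OF U li(1) t, of i i] by (subst (asm) integral_lebesgue_on_borel(2)[OF Ub _ z ae]) measurable
  qed
  have id: "integrable (lebesgue_on U) (\<lambda>x. d i i x * \<phi> x)" for i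
   by (rule integrable_mult_test_function(1)[OF U li(2) t])
  have "(LBINT x. (\<Sum>i\<in>UNIV. v i x * pd i \<phi> x)) = (\<Sum>i\<in>UNIV. LBINT x. v i x * pd i \<phi> x)"
   using e1(2) by (intro Bochner_Integration.integral_sum)
  also have "\<dots> = (\<Sum>i\<in>UNIV. - (\<integral>x. d i i x * \<phi> x \<partial>lebesgue_on U))"
   unfolding e1(1)[symmetric] using Wf(2) t by (intro sum.cong) (auto simp: has_weak_deriv_def d_def)
  also have "\<dots> = - (\<integral>x. (\<Sum>i\<in>UNIV. d i i x * \<phi> x) \<partial>lebesgue_on U)"
   using id by (simp add: sum_negf)
  also have "(\<integral>x. (\<Sum>i\<in>UNIV. d i i x * \<phi> x) \<partial>lebesgue_on U) = 0"
  proof (rule integral_eq_zero_AE)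
   show "AE x in lebesgue_on U. (\<Sum>i\<in>UNIV. d i i x * \<phi> x) = 0"
    using div unfolding U_def[symmetric]
    by eventually_elim (simp add: divergence_def d_def sum_distrib_right[symmetric])
  qed
  finally show ?thesis by simp
 qed
qed

section \<open>The commutator estimate\<close>

lemma integral_abs_le:
 fixes f g :: "'a => real"
 assumes g: "integrable M g" and b: "\<And>x. \<bar>f x\<bar> \<le> g x"
 shows "(\<integral>x. \<bar>f x\<bar> \<partial>M) \<le> (\<integral>x. g x \<partial>M)" "\<bar>\<integral>x. f x \<partial>M\<bar> \<le> (\<integral>x. g x \<partial>M)"
proof -
 have g0: "0 \<le> g x" for x using b[of x] by linarith
 show 1: "(\<integral>x. \<bar>f x\<bar> \<partial>M) \<le> (\<integral>x. g x \<partial>M)"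
  by (rule integral_mono_AE'[OF g]) (simp_all add: b g0)
 show "\<bar>\<integral>x. f x \<partial>M\<bar> \<le> (\<integral>x. g x \<partial>M)"
  using integral_abs_bound[of M f] 1 by linarith
qed

lemma abs_mult_le: "0 \<le> p ==> \<bar>q\<bar> \<le> B ==> \<bar>p * q\<bar> \<le> p * B" for p q B :: real
 by (simp add: abs_mult mult_left_mono)

definition L4_fun :: "('a::euclidean_space => real) => bool" where
 "L4_fun f \<longleftrightarrow> f \<in> Borel \<and> L1 (\<lambda>x. f x ^ 4)"

lemma L4_fun_shift: "L4_fun f ==> L4_fun (\<lambda>x. f (h + x))"
 using lborel_shift(2)[of "\<lambda>x. f x ^ 4" h] by (auto simp: L4_fun_def)

lemma L2_fun_shift: "L2_fun lborel f ==> L2_fun lborel (\<lambda>x. f (h + x))" for f :: "'a::euclidean_space => real"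
 using lborel_shift(2)[of "\<lambda>x. (f x)^2" h] by (auto simp: L2_fun_def)

lemma L4_L4_L2_integrable:
 assumes p: "L4_fun p" and q: "L4_fun q" and r: "L2_fun lborel r"
 shows "L1 (\<lambda>x. p x * q x * r x)"
  and "\<bar>LBINT x. p x * q x * r x\<bar> \<le> (LBINT x. p x ^ 4) + (LBINT x. q x ^ 4) + (LBINT x. (r x)^2)"
proof -
 have [measurable]: "p \<in> Borel" "q \<in> Borel" "r \<in> Borel"
  using p q r by (auto simp: L4_fun_def L2_fun_def)
 have i: "L1 (\<lambda>x. p x ^ 4 + q x ^ 4 + (r x)^2)" using p q r by (auto simp: L4_fun_def L2_fun_def)
 have b: "\<bar>p x * q x * r x\<bar> \<le> p x ^ 4 + q x ^ 4 + (r x)^2" for x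
 proof -
  have "2 * \<bar>p x * q x * r x\<bar> \<le> (p x * q x)^2 + (r x)^2"
   using sum_squares_bound[of "\<bar>p x * q x\<bar>" "\<bar>r x\<bar>"]
   unfolding abs_mult[of "p x * q x" "r x"] by (simp only: mult.assoc power2_abs)
  moreover have "2 * (p x * q x)^2 \<le> p x ^ 4 + q x ^ 4"
   using sum_squares_bound[of "(p x)^2" "(q x)^2"] by (simp add: power_mult_distrib)
  moreover have "0 \<le> p x ^ 4" "0 \<le> q x ^ 4" "0 \<le> (r x)^2" by simp_all
  ultimately show ?thesis by linarith
 qed
 show int: "L1 (\<lambda>x. p x * q x * r x)"
  by (rule Bochner_Integration.integrable_bound[OF i]) (use b in \<open>auto intro!: AE_I2 order_trans[OF b]\<close>)
 have "\<bar>LBINT x. p x * q x * r x\<bar> \<le> (LBINT x. p x ^ 4 + q x ^ 4 + (r x)^2)"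
  by (rule integral_abs_le(2)[OF i b])
 also have "\<dots> = (LBINT x. p x ^ 4) + (LBINT x. q x ^ 4) + (LBINT x. (r x)^2)"
  using p q r by (simp add: L4_fun_def L2_fun_def)
 finally show "\<bar>LBINT x. p x * q x * r x\<bar> \<le> (LBINT x. p x ^ 4) + (LBINT x. q x ^ 4) + (LBINT x. (r x)^2)" .
qed

text \<open>A bound for one of the iterated integrals of \<open>|f|\<close> is the form in which integrability on the product is at hand.\<close>

lemma Fubini_bound:
 fixes f :: "'a::euclidean_space => 'b::euclidean_space => real"
 assumes f: "case_prod f \<in> borel_measurable (borel \<Otimes>\<^sub>M borel)"
  and i: "\<And>y. L1 (\<lambda>x. f x y)" and b: "\<And>y. (LBINT x. \<bar>f x y\<bar>) \<le> B y" and B: "L1 B"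
 shows "(LBINT x. (LBINT y. f x y)) = (LBINT y. (LBINT x. f x y))"
  and "L1 (\<lambda>y. LBINT x. f x y)"
  and "L1 (\<lambda>x. LBINT y. f x y)"
proof -
 have fm[measurable]: "case_prod f \<in> borel_measurable (lborel \<Otimes>\<^sub>M lborel)" using f by simp
 have B0: "0 \<le> B y" for y
 proof -
  have "0 \<le> (LBINT x. \<bar>f x y\<bar>)" by simp
  then show ?thesis using b[of y] by linarith
 qed
 have "integrable (lborel \<Otimes>\<^sub>M lborel) (case_prod f)"
 proof (rule integrableI_bounded[OF fm])
  have "(\<integral>\<^sup>+z. ennreal (norm (case_prod f z)) \<partial>(lborel \<Otimes>\<^sub>M lborel)) = (\<integral>\<^sup>+y. \<integral>\<^sup>+x. ennreal \<bar>f x y\<bar> \<partial>lborel \<partial>lborel)"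
   by (subst lborel_pair.nn_integral_snd[symmetric]) (auto simp: case_prod_unfold)
  also have "\<dots> \<le> (\<integral>\<^sup>+y. ennreal (B y) \<partial>lborel)"
  proof (intro nn_integral_mono)
   fix y
   have "(\<integral>\<^sup>+x. ennreal \<bar>f x y\<bar> \<partial>lborel) = ennreal (LBINT x. \<bar>f x y\<bar>)"
    using i by (intro nn_integral_eq_integral) auto
   then show "(\<integral>\<^sup>+x. ennreal \<bar>f x y\<bar> \<partial>lborel) \<le> ennreal (B y)" using b[of y] by (simp add: ennreal_leI)
  qed
  also have "\<dots> = ennreal (LBINT y. B y)" using B B0 by (intro nn_integral_eq_integral) auto
  also have "\<dots> < \<infinity>" by simp
  finally show "(\<integral>\<^sup>+z. ennreal (norm (case_prod f z)) \<partial>(lborel \<Otimes>\<^sub>M lborel)) < \<infinity>" .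
 qed
 from lborel_pair.Fubini_integral[OF this] lborel_pair.integrable_snd[OF this] lborel_pair.integrable_fst[OF this]
 show "(LBINT x. (LBINT y. f x y)) = (LBINT y. (LBINT x. f x y))"
  "L1 (\<lambda>y. LBINT x. f x y)" "L1 (\<lambda>x. LBINT y. f x y)"
  by simp_all
qed

context mollif
begin

abbreviation (input) "de i x \<equiv> pd i \<eta> x"

text \<open>The correlation of \<open>\<eta>\<close> with its derivative; it appears when both mollifications in the energy flux are moved onto one variable.\<close>

definition kern :: "2 => real^2 => real" where
 "kern i h = (LBINT x. \<eta> x * de i (x - h))"

lemma kern_borel [measurable]: "kern i \<in> Borel"
 unfolding kern_def[abs_def] by (rule lborel.borel_measurable_lebesgue_integral) measurable

lemma C_eps_nonneg: "0 \<le> C / \<epsilon> ^ 3"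
 using deta_bound[of 0 1] by (meson abs_ge_zero order_trans)

lemma kern_bound: "\<bar>kern i h\<bar> \<le> C / \<epsilon> ^ 3"
proof -
 have "\<bar>kern i h\<bar> \<le> (LBINT x. \<eta> x * (C / \<epsilon> ^ 3))"
  unfolding kern_def
  by (rule integral_abs_le(2)) (use eta_integrable in simp, rule abs_mult_le[OF eta_nonneg deta_bound])
 also have "\<dots> = C / \<epsilon> ^ 3" using eta_integral by simp
 finally show ?thesis .
qed

lemma kern_zero: assumes "2 * \<epsilon> \<le> norm h" shows "kern i h = 0"
 unfolding kern_def
proof (rule integral_eq_zero_AE, intro AE_I2)
 fix x
 show "\<eta> x * de i (x - h) = 0"
 proof (cases "norm x < \<epsilon>")
  case True
  then have "\<epsilon> < norm (x - h)" using assms norm_triangle_ineq2[of h x] by (simp add: norm_minus_commute)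
  then show ?thesis using deta_zero by simp
 qed (use eta_zero in simp)
qed

lemma deta_odd: "de i (- x) = - de i x"
 using frechet_eta_shift[of 0 x "axis i 1"] eta_even by simp

text \<open>Because \<open>\<eta>\<close> is even and its derivative odd.  Oddness is what makes the symmetrisation work.\<close>

lemma kern_odd: "kern i (- h) = - kern i h"
proof -
 have "kern i (- h) = (LBINT x. \<eta> (- h + x) * de i (- h + x + h))"
  unfolding kern_def using lborel_shift(1)[of "\<lambda>x. \<eta> x * pd i \<eta> (x + h)" "- h"] by simp
 also have "\<dots> = (LBINT x. \<eta> (x - h) * de i x)" by (simp add: algebra_simps)
 also have "\<dots> = (LBINT x. \<eta> (h - x - h) * de i (h - x))"
  using lborel_reflect(1)[of "\<lambda>x. \<eta> (x - h) * pd i \<eta> x" h] by simp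
 also have "\<dots> = (LBINT x. - (\<eta> x * de i (x - h)))"
 proof (intro Bochner_Integration.integral_cong refl)
  fix x
  show "\<eta> (h - x - h) * de i (h - x) = - (\<eta> x * de i (x - h))"
   using deta_odd[of "x - h" i] eta_even[of x] by simp
 qed
 finally show ?thesis by (simp add: kern_def)
qed

lemma kern_integrable: assumes "0 < \<epsilon>" shows "L1 (kern i)"
proof -
 have "L1 (\<lambda>h. (C / \<epsilon> ^ 3) * indicator (ball (0::real^2) (2 * \<epsilon>)) h)"
  using assms by (intro integrable_mult_right integrable_real_indicator) (auto simp: emeasure_ball)
 then show ?thesis
  by (rule Bochner_Integration.integrable_bound)
   (use kern_bound kern_zero abs_of_nonneg[OF C_eps_nonneg] in \<open>auto simp: indicator_def simp del: abs_divide intro!: AE_I2\<close>)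
qed

lemma mollify_bounds:
 assumes f: "L1 f"
 shows "L1 (\<lambda>z. f z * de i (x - z))" "\<bar>LBINT z. f z * de i (x - z)\<bar> \<le> C / \<epsilon> ^ 3 * (LBINT z. \<bar>f z\<bar>)"
  "L1 (\<lambda>z. f z * \<eta> (x - z))"
proof -
 have [measurable]: "f \<in> Borel" using f by auto
 show i: "L1 (\<lambda>z. f z * de i (x - z))"
  by (rule integrable_lborel_mult_bounded[OF f _ deta_bound]) measurable
 obtain M where M: "M > 0" "\<forall>x. \<bar>\<eta> x\<bar> \<le> M" using eta_bounded by blast
 show "L1 (\<lambda>z. f z * \<eta> (x - z))"
  by (rule integrable_lborel_mult_bounded[OF f, of _ M]) (use M in auto)
 have "\<bar>LBINT z. f z * de i (x - z)\<bar> \<le> (LBINT z. \<bar>f z\<bar> * (C / \<epsilon> ^ 3))"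
  by (rule integral_abs_le(2)) (use f abs_mult_le[OF abs_ge_zero deta_bound, of "f _"] in \<open>auto simp: abs_mult\<close>)
 also have "\<dots> = C / \<epsilon> ^ 3 * (LBINT z. \<bar>f z\<bar>)" by simp
 finally show "\<bar>LBINT z. f z * de i (x - z)\<bar> \<le> C / \<epsilon> ^ 3 * (LBINT z. \<bar>f z\<bar>)" .
qed

lemma integral_eta_const: "(LBINT x. \<eta> (x - y)) = 1" "L1 (\<lambda>x. \<eta> (x - y))"
 using lborel_shift[of \<eta> "- y"] eta_integral eta_integrable by (auto simp: algebra_simps)

lemma kern_pairing:
 assumes m: "L1 m"
 shows "(LBINT x. \<eta> (x - y) * (LBINT z. m z * de i (x - z))) = (LBINT h. m (h + y) * kern i h)"
proof -
 have [measurable]: "m \<in> Borel" using m by auto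
 have "(LBINT x. \<eta> (x - y) * (LBINT z. m z * de i (x - z))) = (LBINT x. (LBINT z. \<eta> (x - y) * (m z * de i (x - z))))"
  by simp
 also have "\<dots> = (LBINT z. (LBINT x. \<eta> (x - y) * (m z * de i (x - z))))"
 proof (rule Fubini_bound(1)[where B = "\<lambda>z. C / \<epsilon> ^ 3 * \<bar>m z\<bar>"])
  show i: "L1 (\<lambda>x. \<eta> (x - y) * (m z * de i (x - z)))" for z
  proof (rule integrable_lborel_mult_bounded[OF integral_eta_const(2), of _ "\<bar>m z\<bar> * (C / \<epsilon> ^ 3)"])
   show "\<bar>m z * de i (x - z)\<bar> \<le> \<bar>m z\<bar> * (C / \<epsilon> ^ 3)" for x
    unfolding abs_mult by (intro mult_left_mono deta_bound) auto
  qed measurable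
  show "(LBINT x. \<bar>\<eta> (x - y) * (m z * de i (x - z))\<bar>) \<le> C / \<epsilon> ^ 3 * \<bar>m z\<bar>" for z
  proof -
   have "(LBINT x. \<bar>\<eta> (x - y) * (m z * de i (x - z))\<bar>) \<le> (LBINT x. \<eta> (x - y) * (C / \<epsilon> ^ 3 * \<bar>m z\<bar>))"
   proof (rule integral_abs_le(1))
    fix x
    have "\<bar>m z * de i (x - z)\<bar> \<le> C / \<epsilon> ^ 3 * \<bar>m z\<bar>"
     using abs_mult_le[OF abs_ge_zero deta_bound, of "m z"] by (simp add: abs_mult mult.commute)
    then show "\<bar>\<eta> (x - y) * (m z * de i (x - z))\<bar> \<le> \<eta> (x - y) * (C / \<epsilon> ^ 3 * \<bar>m z\<bar>)"
     by (rule abs_mult_le[OF eta_nonneg])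
   qed (use integral_eta_const in simp)
   then show ?thesis using integral_eta_const by simp
  qed
  show "L1 (\<lambda>z. C / \<epsilon> ^ 3 * \<bar>m z\<bar>)" using m by auto
 qed measurable
 also have "\<dots> = (LBINT z. m z * kern i (z - y))"
 proof (intro Bochner_Integration.integral_cong refl)
  fix z
  have "kern i (z - y) = (LBINT x. \<eta> (x - y) * de i (x - z))"
   unfolding kern_def using lborel_shift(1)[of "\<lambda>x. \<eta> x * de i (x - (z - y))" "- y"] by (simp add: algebra_simps)
  then show "(LBINT x. \<eta> (x - y) * (m z * de i (x - z))) = m z * kern i (z - y)"
   by (simp add: mult.left_commute)
 qed
 also have "\<dots> = (LBINT h. m (h + y) * kern i h)"
  using lborel_shift(1)[of "\<lambda>z. m z * kern i (z - y)" y] by (simp add: add.commute)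
 finally show ?thesis .
qed

lemma mollify_pairing:
 assumes w: "L1 w" and m: "L1 m"
 shows "(LBINT x. (LBINT y. w y * \<eta> (x - y)) * (LBINT z. m z * de i (x - z)))
   = (LBINT y. w y * (LBINT h. m (h + y) * kern i h))" (is "?L = ?R")
  and "L1 (\<lambda>x. (LBINT y. w y * \<eta> (x - y)) * (LBINT z. m z * de i (x - z)))"
proof -
 have [measurable]: "w \<in> Borel" "m \<in> Borel" using w m by auto
 define M where "M x = (LBINT z. m z * de i (x - z))" for x
 define c where "c = C / \<epsilon> ^ 3 * (LBINT z. \<bar>m z\<bar>)"
 have [measurable]: "M \<in> Borel"
  unfolding M_def[abs_def] by (rule lborel.borel_measurable_lebesgue_integral) measurable
 have Mb: "\<bar>M x\<bar> \<le> c" for x unfolding M_def c_def by (rule mollify_bounds(2)[OF m])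
 have ie: "L1 (\<lambda>x. \<eta> (x - y) * M x)" for y
  by (rule integrable_lborel_mult_bounded[OF integral_eta_const(2) _ Mb]) measurable
 have ab: "(LBINT x. \<bar>\<eta> (x - y) * M x\<bar>) \<le> c" for y
 proof -
  have "(LBINT x. \<bar>\<eta> (x - y) * M x\<bar>) \<le> (LBINT x. \<eta> (x - y) * c)"
   by (rule integral_abs_le(1)) (use integral_eta_const in simp, rule abs_mult_le[OF eta_nonneg Mb])
  then show ?thesis using integral_eta_const by simp
 qed
 have F1: "(LBINT x. (LBINT y. w y * (\<eta> (x - y) * M x))) = (LBINT y. (LBINT x. w y * (\<eta> (x - y) * M x)))"
  and F1i: "L1 (\<lambda>x. LBINT y. w y * (\<eta> (x - y) * M x))"
 proof -
  have B: "L1 (\<lambda>y. \<bar>w y\<bar> * c)" using w by auto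
  have b: "(LBINT x. \<bar>w y * (\<eta> (x - y) * M x)\<bar>) \<le> \<bar>w y\<bar> * c" for y
   using mult_left_mono[OF ab, of "\<bar>w y\<bar>"] by (simp add: abs_mult)
  have i: "L1 (\<lambda>x. w y * (\<eta> (x - y) * M x))" for y using ie by simp
  have f: "(\<lambda>(x, y). w y * (\<eta> (x - y) * M x)) \<in> borel_measurable (borel \<Otimes>\<^sub>M borel)" by measurable
  from Fubini_bound[OF f i b B] show "(LBINT x. (LBINT y. w y * (\<eta> (x - y) * M x))) = (LBINT y. (LBINT x. w y * (\<eta> (x - y) * M x)))"
   "L1 (\<lambda>x. LBINT y. w y * (\<eta> (x - y) * M x))" by auto
 qed
 have e1: "(LBINT y. w y * \<eta> (x - y)) * M x = (LBINT y. w y * (\<eta> (x - y) * M x))" for x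
  by (simp add: mult.assoc[symmetric])
 have inner: "(LBINT x. \<eta> (x - y) * M x) = (LBINT h. m (h + y) * kern i h)" for y
  unfolding M_def by (rule kern_pairing[OF m])
 show "?L = ?R" unfolding M_def[symmetric] e1 F1 using inner by simp
 show "L1 (\<lambda>x. (LBINT y. w y * \<eta> (x - y)) * (LBINT z. m z * de i (x - z)))"
  using F1i unfolding M_def[symmetric] e1 .
qed

end

lemma L4_L1_imp_L2:
 assumes "L1 f" "L4_fun f"
 shows "L2_fun lborel f"
 unfolding L2_fun_def
proof
 show m: "f \<in> borel_measurable lborel" using assms by (simp add: L4_fun_def)
 have b: "(f x)^2 \<le> \<bar>f x\<bar> + f x ^ 4" for x
 proof (cases "\<bar>f x\<bar> \<le> 1")
  case True
  then have "\<bar>f x\<bar> * \<bar>f x\<bar> \<le> \<bar>f x\<bar> * 1" by (intro mult_left_mono) auto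
  then have "(f x)^2 \<le> \<bar>f x\<bar>" by (simp add: power2_eq_square)
  moreover have "0 \<le> f x ^ 4" by simp
  ultimately show ?thesis by linarith
 next
  case False
  then have "1 \<le> (f x)^2" using power_mono[of 1 "\<bar>f x\<bar>" 2] by simp
  then have "(f x)^2 * 1 \<le> (f x)^2 * (f x)^2" by (intro mult_left_mono) auto
  then show ?thesis by (simp add: power_add[symmetric])
 qed
 show "L1 (\<lambda>x. (f x)^2)"
  by (rule Bochner_Integration.integrable_bound[of _ "\<lambda>x. \<bar>f x\<bar> + f x ^ 4"])
   (use assms m b in \<open>auto simp: L4_fun_def\<close>)
qed

lemma L2_mult_integrable:
 assumes "L2_fun M f" "L2_fun M g"
 shows "integrable M (\<lambda>x. f x * g x)"
proof (rule Bochner_Integration.integrable_bound)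
 show "integrable M (\<lambda>x. (f x)^2 + (g x)^2)" using assms by (auto simp: L2_fun_def)
 have [measurable]: "f \<in> borel_measurable M" "g \<in> borel_measurable M" using assms by (auto simp: L2_fun_def)
 show "(\<lambda>x. f x * g x) \<in> borel_measurable M" by measurable
 show "AE x in M. norm (f x * g x) \<le> norm ((f x)^2 + (g x)^2)"
 proof (intro AE_I2)
  fix x
  have "2 * (\<bar>f x\<bar> * \<bar>g x\<bar>) \<le> (f x)^2 + (g x)^2" using sum_squares_bound[of "\<bar>f x\<bar>" "\<bar>g x\<bar>"] by simp
  moreover have "0 \<le> \<bar>f x\<bar> * \<bar>g x\<bar>" by simp
  ultimately have "\<bar>f x\<bar> * \<bar>g x\<bar> \<le> (f x)^2 + (g x)^2" by linarith
  then show "norm (f x * g x) \<le> norm ((f x)^2 + (g x)^2)" by (simp add: abs_mult)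
 qed
qed

context mollif
begin

lemma kern_times_bounded:
 assumes "0 < \<epsilon>" "a \<in> Borel" "\<And>h. \<bar>a h\<bar> \<le> c"
 shows "L1 (\<lambda>h. kern i h * a h)"
 by (rule integrable_lborel_mult_bounded[OF kern_integrable[OF assms(1)] assms(2,3)])

lemma kern_flip:
 assumes [measurable]: "a \<in> Borel"
 shows "(LBINT h. kern i h * a (- h)) = - (LBINT h. kern i h * a h)"
proof -
 have "(LBINT h. kern i h * a (- h)) = (LBINT h. kern i (- h) * a h)"
  using lborel_reflect(1)[of "\<lambda>h. kern i h * a (- h)" 0] by simp
 then show ?thesis by (simp add: kern_odd)
qed

text \<open>Write \<open>\<delta>\<close> for the increment under the translation by \<open>h\<close>.  The left-hand side is, up to its sign, the integral over \<open>h\<close> of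
\<open>\<Sum> kern i h \<integral> (\<delta>w)^2 \<delta>v\<^sub>i\<close>.  Indeed, expanding this product gives terms with \<open>w(y) w(h+y)\<close>, which are
exchanged by \<open>h \<mapsto> -h\<close> and add up since the kernel is odd, and terms with the square of \<open>w\<close> at one point,
which vanish, some because the kernel is odd and the others because \<open>v\<close> is divergence free near the support of \<open>w\<close>.
The kernel is bounded by \<open>C/\<epsilon>^3\<close> on a disc of area \<open>4\<pi>\<epsilon>^2\<close>, and the increment of \<open>v\<close> supplies the missing factor \<open>2\<epsilon>\<close>.\<close>

theorem commutator_bound:
 fixes w :: "real^2 => real" and v :: "2 => real^2 => real"
 assumes eps: "0 < \<epsilon>" and w1: "L1 w" and w4: "L4_fun w"
  and v1: "\<And>i. L1 (v i)" and v2: "\<And>i. L2_fun lborel (v i)"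
  and div: "\<And>x y. w y \<noteq> 0 ==> norm (x - y) < \<epsilon> ==> (\<Sum>i\<in>UNIV. LBINT z. v i z * de i (x - z)) = 0"
  and A: "\<And>h. norm h < 2 * \<epsilon> ==> (LBINT y. (w (h + y) - w y) ^ 4) \<le> A"
  and K: "K \<in> sets borel" "\<And>h y. norm h < 2 * \<epsilon> ==> y \<notin> K ==> w (h + y) - w y = 0"
  and E: "\<And>h i. norm h < 2 * \<epsilon> ==> (LBINT y. ind K y * (v i (h + y) - v i y)^2) \<le> (norm h)^2 * E" "0 \<le> E"
  and \<mu>: "0 < \<mu>"
 shows "\<bar>2 * (\<Sum>i\<in>UNIV. LBINT x. (LBINT y. w y * \<eta> (x - y)) * (LBINT z. w z * v i z * de i (x - z)))\<bar>
   \<le> 8 * pi * C * (A / \<mu> + \<mu> * E)"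
proof -
 have [measurable]: "w \<in> Borel" "v i \<in> Borel" for i
  using w1 v1 by auto
 have w2: "L2_fun lborel w" by (rule L4_L1_imp_L2[OF w1 w4])
 have mi: "L1 (\<lambda>z. w z * v i z)" for i by (rule L2_mult_integrable[OF w2 v2])
 define W where "W = (LBINT y. w y ^ 4)"
 define c where "c i = 2 * W + (LBINT y. (v i y)^2)" for i
 have sw: "(LBINT y. w (h + y) ^ 4) = W" for h
  unfolding W_def by (rule lborel_shift(1)[of "\<lambda>y. w y ^ 4"]) measurable
 have sv: "(LBINT y. (v i (h + y))^2) = (LBINT y. (v i y)^2)" for h i
  by (rule lborel_shift(1)[of "\<lambda>y. (v i y)^2"]) measurable
 have wS: "L4_fun (\<lambda>y. w (h + y))" for h by (rule L4_fun_shift[OF w4])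
 have vS: "L2_fun lborel (\<lambda>y. v i (h + y))" for i h by (rule L2_fun_shift[OF v2])
 define a where "a i h = (LBINT y. w y * w (h + y) * v i (h + y))" for i h
 define b where "b i h = (LBINT y. w y * w (h + y) * v i y)" for i h
 define c1 where "c1 i h = (LBINT y. w y * w y * v i (h + y))" for i h
 (* The symmetrised integrand; expanding it yields a, b, c1 and their translates. *)
 define q where "q i h = (LBINT y. (w (h + y) - w y) * (w (h + y) - w y) * (v i (h + y) - v i y))" for i h
 have meas[measurable]: "a i \<in> Borel" "b i \<in> Borel" "c1 i \<in> Borel" for i
  unfolding a_def[abs_def] b_def[abs_def] c1_def[abs_def]
  by (rule lborel.borel_measurable_lebesgue_integral; measurable)+
 have ab: "\<bar>a i h\<bar> \<le> c i" and bb: "\<bar>b i h\<bar> \<le> c i" and cb: "\<bar>c1 i h\<bar> \<le> c i" for i h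
  using L4_L4_L2_integrable(2)[OF w4 wS[of h] vS[of i h]] L4_L4_L2_integrable(2)[OF w4 wS[of h] v2[of i]]
   L4_L4_L2_integrable(2)[OF w4 w4 vS[of i h]]
  unfolding a_def b_def c1_def sw sv c_def W_def[symmetric] by linarith+
 note ia = kern_times_bounded[OF eps meas(1) ab] and ib = kern_times_bounded[OF eps meas(2) bb] and ic = kern_times_bounded[OF eps meas(3) cb]
 have ab_flip: "b i h = a i (- h)" for i h
 proof -
  have "a i (- h) = (LBINT y. w (h + y) * w (- h + (h + y)) * v i (- h + (h + y)))"
   unfolding a_def by (rule lborel_shift(1)[symmetric]) measurable
  then show ?thesis unfolding b_def by (simp add: mult.commute[of "w (h + _)"])
 qed
 have kb: "(LBINT h. kern i h * b i h) = - (LBINT h. kern i h * a i h)" for i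
  unfolding ab_flip by (rule kern_flip) measurable
 have I_eq: "(LBINT x. (LBINT y. w y * \<eta> (x - y)) * (LBINT z. w z * v i z * de i (x - z))) = (LBINT h. kern i h * a i h)" for i
 proof -
  have "(LBINT x. (LBINT y. w y * \<eta> (x - y)) * (LBINT z. w z * v i z * de i (x - z)))
   = (LBINT y. w y * (LBINT h. w (h + y) * v i (h + y) * kern i h))"
   by (rule mollify_pairing(1)[OF w1 mi])
  also have "\<dots> = (LBINT y. (LBINT h. kern i h * (w y * w (h + y) * v i (h + y))))"
   by (simp only: Bochner_Integration.integral_mult_right_zero[symmetric] mult_ac)
  also have "\<dots> = (LBINT h. (LBINT y. kern i h * (w y * w (h + y) * v i (h + y))))"
  proof (rule Fubini_bound(1)[where B = "\<lambda>h. \<bar>kern i h\<bar> * c i"])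
   show "L1 (\<lambda>y. kern i h * (w y * w (h + y) * v i (h + y)))" for h
    using L4_L4_L2_integrable(1)[OF w4 wS vS] by simp
   show "(LBINT y. \<bar>kern i h * (w y * w (h + y) * v i (h + y))\<bar>) \<le> \<bar>kern i h\<bar> * c i" for h
   proof -
    have L4a: "L4_fun (\<lambda>y. \<bar>w (g + y)\<bar>)" for g using wS[of g] by (auto simp: L4_fun_def)
    have L2a: "L2_fun lborel (\<lambda>y. \<bar>v i (h + y)\<bar>)" using vS[of i h] by (auto simp: L2_fun_def)
    have "\<bar>LBINT y. \<bar>w (0 + y)\<bar> * \<bar>w (h + y)\<bar> * \<bar>v i (h + y)\<bar>\<bar> \<le> c i"
     using L4_L4_L2_integrable(2)[OF L4a L4a L2a, of 0 h] sw[of 0] sw[of h] sv[of i h]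
     by (simp add: c_def)
    then have "(LBINT y. \<bar>w y * w (h + y) * v i (h + y)\<bar>) \<le> c i" by (simp add: abs_mult)
    then show ?thesis by (simp add: abs_mult mult_left_mono)
   qed
   show "L1 (\<lambda>h. \<bar>kern i h\<bar> * c i)" using kern_integrable[OF eps] by auto
  qed measurable
  finally show ?thesis by (simp add: a_def)
 qed
 have c1_zero: "(\<Sum>i\<in>UNIV. LBINT h. kern i h * c1 i h) = 0"
 proof -
  have e: "(LBINT h. kern i h * c1 i h) = (LBINT y. w y * w y * (LBINT h. v i (h + y) * kern i h))"
   and i1: "L1 (\<lambda>y. w y * w y * (LBINT h. v i (h + y) * kern i h))" for i
  proof -
   have F: "(LBINT y. (LBINT h. kern i h * (w y * w y * v i (h + y)))) = (LBINT h. (LBINT y. kern i h * (w y * w y * v i (h + y))))"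
    and Fi: "L1 (\<lambda>y. LBINT h. kern i h * (w y * w y * v i (h + y)))"
   proof -
    have i: "L1 (\<lambda>y. kern i h * (w y * w y * v i (h + y)))" for h
     using L4_L4_L2_integrable(1)[OF w4 w4 vS] by simp
    have bd: "(LBINT y. \<bar>kern i h * (w y * w y * v i (h + y))\<bar>) \<le> \<bar>kern i h\<bar> * c i" for h
    proof -
     have L4a: "L4_fun (\<lambda>y. \<bar>w y\<bar>)" using w4 by (auto simp: L4_fun_def)
     have L2a: "L2_fun lborel (\<lambda>y. \<bar>v i (h + y)\<bar>)" using vS[of i h] by (auto simp: L2_fun_def)
     have "\<bar>LBINT y. \<bar>w y\<bar> * \<bar>w y\<bar> * \<bar>v i (h + y)\<bar>\<bar> \<le> c i"
      using L4_L4_L2_integrable(2)[OF L4a L4a L2a] sv[of i h] by (simp add: c_def W_def)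
     then have "(LBINT y. \<bar>w y * w y * v i (h + y)\<bar>) \<le> c i" by (simp add: abs_mult)
     then show ?thesis by (simp add: abs_mult mult_left_mono)
    qed
    have B: "L1 (\<lambda>h. \<bar>kern i h\<bar> * c i)" using kern_integrable[OF eps] by auto
    have m: "(\<lambda>(y, h). kern i h * (w y * w y * v i (h + y))) \<in> borel_measurable (borel \<Otimes>\<^sub>M borel)" by measurable
    from Fubini_bound[OF m i bd B]
    show "(LBINT y. (LBINT h. kern i h * (w y * w y * v i (h + y)))) = (LBINT h. (LBINT y. kern i h * (w y * w y * v i (h + y))))"
     "L1 (\<lambda>y. LBINT h. kern i h * (w y * w y * v i (h + y)))" by auto
   qed
   have eq: "(LBINT h. kern i h * (w y * w y * v i (h + y))) = w y * w y * (LBINT h. v i (h + y) * kern i h)" for y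
    by (simp only: Bochner_Integration.integral_mult_right_zero[symmetric] mult_ac)
   show "L1 (\<lambda>y. w y * w y * (LBINT h. v i (h + y) * kern i h))" using Fi unfolding eq .
   show "(LBINT h. kern i h * c1 i h) = (LBINT y. w y * w y * (LBINT h. v i (h + y) * kern i h))"
    using F unfolding eq by (simp add: c1_def)
  qed
  have "(\<Sum>i\<in>UNIV. LBINT h. kern i h * c1 i h) = (LBINT y. (\<Sum>i\<in>UNIV. w y * w y * (LBINT h. v i (h + y) * kern i h)))"
   unfolding e using i1 by simp
  also have "\<dots> = 0"
  proof (rule integral_eq_zero_AE, intro AE_I2)
   fix y
   show "(\<Sum>i\<in>UNIV. w y * w y * (LBINT h. v i (h + y) * kern i h)) = 0"
   proof (cases "w y = 0")
    case False
    have ii: "L1 (\<lambda>x. \<eta> (x - y) * (LBINT z. v i z * de i (x - z)))" for i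
    proof (rule integrable_lborel_mult_bounded[OF integral_eta_const(2) _ mollify_bounds(2)[OF v1]])
     show "(\<lambda>x. LBINT z. v i z * de i (x - z)) \<in> Borel"
      by (rule lborel.borel_measurable_lebesgue_integral) measurable
    qed
    have "(\<Sum>i\<in>UNIV. LBINT h. v i (h + y) * kern i h) = (\<Sum>i\<in>UNIV. LBINT x. \<eta> (x - y) * (LBINT z. v i z * de i (x - z)))"
     by (simp add: kern_pairing[OF v1])
    also have "\<dots> = (LBINT x. (\<Sum>i\<in>UNIV. \<eta> (x - y) * (LBINT z. v i z * de i (x - z))))"
     using ii by simp
    also have "\<dots> = 0"
    proof (rule integral_eq_zero_AE, intro AE_I2)
     fix x
     show "(\<Sum>i\<in>UNIV. \<eta> (x - y) * (LBINT z. v i z * de i (x - z))) = 0"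
      using div[OF False, of x] eta_zero[of "x - y"] by (cases "norm (x - y) < \<epsilon>") (auto simp: sum_distrib_left[symmetric])
    qed
    finally show ?thesis by (simp add: sum_distrib_left[symmetric])
   qed simp
  qed
  finally show ?thesis .
 qed
 have q_eq: "q i h = c1 i h - c1 i (- h) - 2 * a i h + 2 * b i h" for i h
 proof -
  have s1: "(LBINT y. w (h + y) * w (h + y) * v i (h + y)) = (LBINT y. w y * w y * v i y)"
   by (rule lborel_shift(1)[of "\<lambda>y. w y * w y * v i y"]) measurable
  have s2: "c1 i (- h) = (LBINT y. w (h + y) * w (h + y) * v i y)"
   unfolding c1_def using lborel_shift(1)[of "\<lambda>y. w y * w y * v i (- h + y)" h] by simp
  have ints: "L1 (\<lambda>y. w (h + y) * w (h + y) * v i (h + y))" "L1 (\<lambda>y. w (h + y) * w (h + y) * v i y)"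
   "L1 (\<lambda>y. w y * w (h + y) * v i (h + y))" "L1 (\<lambda>y. w y * w (h + y) * v i y)"
   "L1 (\<lambda>y. w y * w y * v i (h + y))" "L1 (\<lambda>y. w y * w y * v i y)"
   by (intro L4_L4_L2_integrable(1) wS w4 vS v2)+
  have "q i h = (LBINT y. w (h + y) * w (h + y) * v i (h + y) - w (h + y) * w (h + y) * v i y - 2 * (w y * w (h + y) * v i (h + y))
    + 2 * (w y * w (h + y) * v i y) + w y * w y * v i (h + y) - w y * w y * v i y)"
   unfolding q_def by (intro Bochner_Integration.integral_cong refl) (simp add: algebra_simps)
  also have "\<dots> = (LBINT y. w (h + y) * w (h + y) * v i (h + y)) - (LBINT y. w (h + y) * w (h + y) * v i y) - 2 * a i h
    + 2 * b i h + c1 i h - (LBINT y. w y * w y * v i y)"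
   unfolding a_def b_def c1_def using ints by simp
  finally show ?thesis using s1 s2 by simp
 qed
 have ic': "L1 (\<lambda>h. kern i h * c1 i (- h))" for i
  using cb by (intro kern_times_bounded[OF eps]) (measurable, auto)
 have kq: "(LBINT h. kern i h * q i h) = 2 * (LBINT h. kern i h * c1 i h) - 4 * (LBINT h. kern i h * a i h)" for i
 proof -
  have "(LBINT h. kern i h * q i h) = (LBINT h. kern i h * c1 i h - kern i h * c1 i (- h) - 2 * (kern i h * a i h) + 2 * (kern i h * b i h))"
   unfolding q_eq by (intro Bochner_Integration.integral_cong refl) (simp add: algebra_simps)
  also have "\<dots> = (LBINT h. kern i h * c1 i h) - (LBINT h. kern i h * c1 i (- h)) - 2 * (LBINT h. kern i h * a i h) + 2 * (LBINT h. kern i h * b i h)"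
   using ia ib ic ic' by simp
  finally show ?thesis using kb[of i] kern_flip[OF meas(3), of i i] by simp
 qed
 have kq_bound: "\<bar>LBINT h. kern i h * q i h\<bar> \<le> 8 * pi * C * (A / \<mu> + \<mu> * E)" for i
 proof -
  have C0: "0 \<le> C" using C_eps_nonneg eps by (simp add: zero_le_divide_iff)
  have A0: "0 \<le> A" using A[of 0] eps by simp
  define t where "t = \<epsilon> / \<mu>"
  have t: "t > 0" using eps \<mu> by (simp add: t_def)
  have qb: "\<bar>q i h\<bar> \<le> (t * A + (1/t) * (4 * \<epsilon>^2 * E)) / 2" if h: "norm h < 2 * \<epsilon>" for h
  proof -
   have i4: "L1 (\<lambda>y. (w (h + y) - w y) ^ 4)"
   proof (rule Bochner_Integration.integrable_bound)
    show "L1 (\<lambda>y. 27 * (w (h + y) ^ 4 + w y ^ 4 + 0 ^ 4))" using wS[of h] w4 by (auto simp: L4_fun_def)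
    show "AE y in lborel. norm ((w (h + y) - w y) ^ 4) \<le> norm (27 * (w (h + y) ^ 4 + w y ^ 4 + 0 ^ 4))"
     using fourth_power_triangle[of "w (h + _)" "- w _" 0] by (intro AE_I2) simp
   qed measurable
   have i2: "L1 (\<lambda>y. ind K y * (v i (h + y) - v i y)^2)"
   proof -
    have "L2_fun lborel (\<lambda>y. v i (h + y) - v i y)" by (intro L2_fun_diff vS v2)
    then have "L1 (\<lambda>y. (v i (h + y) - v i y)^2)" by (simp add: L2_fun_def)
    from integrable_mult_indicator[OF _ this, of K] K(1) show ?thesis by simp
   qed
   have pt: "\<bar>(w (h + y) - w y) * (w (h + y) - w y) * (v i (h + y) - v i y)\<bar>
     \<le> (t * (w (h + y) - w y) ^ 4 + (1/t) * (ind K y * (v i (h + y) - v i y)^2)) / 2" for y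
   proof (cases "y \<in> K")
    case True
    have "2 * (x^2 * \<bar>z\<bar>) \<le> t * x ^ 4 + (1/t) * z^2" for x z :: real
    proof -
     have "0 \<le> (t * x^2 - \<bar>z\<bar>)^2 / t" using t by simp
     also have "\<dots> = t * x ^ 4 + (1/t) * z^2 - 2 * (x^2 * \<bar>z\<bar>)"
      using t by (simp add: power2_diff power_mult_distrib field_simps power2_eq_square[of t] flip: power_mult)
     finally show ?thesis by simp
    qed
    from this[of "w (h + y) - w y" "v i (h + y) - v i y"] True show ?thesis by (simp add: abs_mult power2_eq_square)
   next
    case False
    then show ?thesis using K(2)[OF h False] by simp
   qed
   have "\<bar>q i h\<bar> \<le> (LBINT y. (t * (w (h + y) - w y) ^ 4 + (1/t) * (ind K y * (v i (h + y) - v i y)^2)) / 2)"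
    unfolding q_def by (rule integral_abs_le(2)[OF _ pt]) (use i4 i2 in auto)
   also have "\<dots> = (t * (LBINT y. (w (h + y) - w y) ^ 4) + (1/t) * (LBINT y. ind K y * (v i (h + y) - v i y)^2)) / 2"
    using i4 i2 by simp
   also have "\<dots> \<le> (t * A + (1/t) * (4 * \<epsilon>^2 * E)) / 2"
   proof (intro divide_right_mono add_mono mult_left_mono A[OF h])
    have "(norm h)^2 \<le> (2 * \<epsilon>)^2" using h by (intro power_mono) auto
    then have "(norm h)^2 * E \<le> 4 * \<epsilon>^2 * E" using E(2) by (intro mult_right_mono) (auto simp: power_mult_distrib)
    then show "(LBINT y. ind K y * (v i (h + y) - v i y)^2) \<le> 4 * \<epsilon>^2 * E"
     using E(1)[OF h, of i] by linarith
   qed (use t in auto)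
   finally show ?thesis .
  qed
  define Q where "Q = (t * A + (1/t) * (4 * \<epsilon>^2 * E)) / 2"
  have Q0: "0 \<le> Q" unfolding Q_def using t A0 E(2) by simp
  have "\<bar>LBINT h. kern i h * q i h\<bar> \<le> (LBINT h. (C / \<epsilon> ^ 3 * Q) * indicator (ball (0::real^2) (2 * \<epsilon>)) h)"
  proof (rule integral_abs_le(2))
   show "L1 (\<lambda>h. (C / \<epsilon> ^ 3 * Q) * indicator (ball (0::real^2) (2 * \<epsilon>)) h)"
    using eps by (intro integrable_mult_right integrable_real_indicator) (auto simp: emeasure_ball)
   show "\<bar>kern i h * q i h\<bar> \<le> (C / \<epsilon> ^ 3 * Q) * indicator (ball (0::real^2) (2 * \<epsilon>)) h" for h
   proof (cases "norm h < 2 * \<epsilon>")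
    case True
    then have "\<bar>kern i h\<bar> * \<bar>q i h\<bar> \<le> C / \<epsilon> ^ 3 * Q"
     using qb[OF True] Q0 by (intro mult_mono kern_bound C_eps_nonneg) (auto simp: Q_def)
    then show ?thesis using True by (simp add: abs_mult)
   qed (use kern_zero in simp)
  qed
  also have "\<dots> = (C / \<epsilon> ^ 3 * Q) * (4 * pi * \<epsilon>^2)"
   using eps by (simp add: content_ball unit_ball_vol_2 power_mult_distrib)
  also have "\<dots> = 2 * pi * C * (A / \<mu> + 4 * \<mu> * E)"
   using eps \<mu> by (simp add: Q_def t_def field_simps power2_eq_square power3_eq_cube)
  also have "\<dots> \<le> 2 * pi * C * (4 * (A / \<mu> + \<mu> * E))"
  proof (rule mult_left_mono)
   have "0 \<le> A / \<mu>" using A0 \<mu> by simp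
   then show "A / \<mu> + 4 * \<mu> * E \<le> 4 * (A / \<mu> + \<mu> * E)" by (simp add: distrib_left mult.assoc del: divide_eq_0_iff)
  qed (use C0 in simp)
  finally show ?thesis by (simp add: mult_ac)
 qed
 have "2 * (\<Sum>i\<in>UNIV. LBINT x. (LBINT y. w y * \<eta> (x - y)) * (LBINT z. w z * v i z * de i (x - z)))
   = (\<Sum>i\<in>UNIV. (LBINT h. kern i h * c1 i h) - (LBINT h. kern i h * q i h) / 2)"
  unfolding I_eq sum_distrib_left kq by (intro sum.cong refl) (simp add: field_simps)
 also have "\<dots> = - (\<Sum>i\<in>UNIV. (LBINT h. kern i h * q i h)) / 2"
  unfolding sum_subtractf c1_zero by (simp add: sum_divide_distrib)
 finally have "\<bar>2 * (\<Sum>i\<in>UNIV. LBINT x. (LBINT y. w y * \<eta> (x - y)) * (LBINT z. w z * v i z * de i (x - z)))\<bar>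
   = \<bar>\<Sum>i\<in>UNIV. (LBINT h. kern i h * q i h)\<bar> / 2" by simp
 also have "\<dots> \<le> (\<Sum>i\<in>(UNIV::2 set). 8 * pi * C * (A / \<mu> + \<mu> * E)) / 2"
  by (intro divide_right_mono order_trans[OF sum_abs] sum_mono kq_bound) auto
 also have "\<dots> = 8 * pi * C * (A / \<mu> + \<mu> * E)" by simp
 finally show ?thesis .
qed

end

context mollif
begin

lemma convolve_integral:
 assumes f: "L1 f" and f0: "\<And>z. 0 \<le> f z"
 shows "(LBINT x. (LBINT z. f z * \<eta> (x - z))) = (LBINT z. f z)"
  and "L1 (\<lambda>x. LBINT z. f z * \<eta> (x - z))"
proof -
 have [measurable]: "f \<in> Borel" using f by auto
 have m: "(\<lambda>(x, z). f z * \<eta> (x - z)) \<in> borel_measurable (borel \<Otimes>\<^sub>M borel)" by measurable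
 have i: "L1 (\<lambda>x. f z * \<eta> (x - z))" for z using integral_eta_const by simp
 have b: "(LBINT x. \<bar>f z * \<eta> (x - z)\<bar>) \<le> f z" for z
  using f0 eta_nonneg integral_eta_const by (simp add: abs_mult)
 from Fubini_bound[OF m i b f]
 show "(LBINT x. (LBINT z. f z * \<eta> (x - z))) = (LBINT z. f z)"
  "L1 (\<lambda>x. LBINT z. f z * \<eta> (x - z))"
  using integral_eta_const by auto
qed

lemma weighted_square_shift:
 assumes k: "L1 (\<lambda>z. k z * \<eta> (x - z))" and k2: "L1 (\<lambda>z. (k z)^2 * \<eta> (x - z))"
  and [measurable]: "k \<in> Borel"
 shows "(LBINT z. k z * \<eta> (x - z))^2 \<le> (LBINT z. (k z)^2 * \<eta> (x - z))"
proof -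
 have r: "(LBINT z. f z * \<eta> (x - z)) = (LBINT h. f (x - h) * \<eta> h)"
  "L1 (\<lambda>z. f z * \<eta> (x - z)) \<longleftrightarrow> L1 (\<lambda>h. f (x - h) * \<eta> h)"
  if [measurable]: "f \<in> Borel" for f
  using lborel_reflect[of "\<lambda>z. f z * \<eta> (x - z)" x] by simp_all
 show ?thesis
  using weighted_square_integral[of "\<lambda>h. k (x - h)"] k k2 r[of k] r[of "\<lambda>z. (k z)^2"] by simp
qed

lemma mollify_fourth_power:
 assumes w1: "L1 w" and w4: "L4_fun w"
 shows "(LBINT y. w y * \<eta> (x - y)) ^ 4 \<le> (LBINT y. w y ^ 4 * \<eta> (x - y))"
  and "(LBINT y. (w y)^2 * \<eta> (x - y))^2 \<le> (LBINT y. w y ^ 4 * \<eta> (x - y))"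
proof -
 have [measurable]: "w \<in> Borel" using w1 by auto
 have w2: "L1 (\<lambda>y. (w y)^2)" using L4_L1_imp_L2[OF w1 w4] by (simp add: L2_fun_def)
 have i4: "L1 (\<lambda>y. w y ^ 4)" using w4 by (simp add: L4_fun_def)
 have sq: "((w y)^2)^2 = w y ^ 4" for y by simp
 show 2: "(LBINT y. (w y)^2 * \<eta> (x - y))^2 \<le> (LBINT y. w y ^ 4 * \<eta> (x - y))"
  using weighted_square_shift[OF mollify_bounds(3)[OF w2], of x] mollify_bounds(3)[OF i4, of x] unfolding sq by simp
 have "(LBINT y. w y * \<eta> (x - y))^2 \<le> (LBINT y. (w y)^2 * \<eta> (x - y))"
  by (rule weighted_square_shift[OF mollify_bounds(3)[OF w1] mollify_bounds(3)[OF w2]]) measurable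
 then have "((LBINT y. w y * \<eta> (x - y))^2)^2 \<le> (LBINT y. (w y)^2 * \<eta> (x - y))^2"
  by (intro power_mono) auto
 then show "(LBINT y. w y * \<eta> (x - y)) ^ 4 \<le> (LBINT y. w y ^ 4 * \<eta> (x - y))" using 2 by simp
qed

text \<open>Young's inequality with weights \<open>\<kappa>\<close> and \<open>1/\<kappa>\<close>, with Jensen's inequality for the convolutions.\<close>

lemma cutoff_flux_bound:
 assumes w1: "L1 w" and w4: "L4_fun w" and t1: "L1 \<theta>" and t4: "L4_fun \<theta>"
  and V: "L2_fun lborel V" and wt: "\<And>x. \<bar>w x\<bar> \<le> \<bar>\<theta> x\<bar>" and l: "0 < \<kappa>"
 shows "\<bar>LBINT x. 2 * (LBINT y. w y * \<eta> (x - y)) * (LBINT z. \<theta> z * V z * \<eta> (x - z))\<bar>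
   \<le> \<kappa> * (LBINT x. \<theta> x ^ 4) + (1 / \<kappa>) * (LBINT x. (V x)^2)"
  and "L1 (\<lambda>x. 2 * (LBINT y. w y * \<eta> (x - y)) * (LBINT z. \<theta> z * V z * \<eta> (x - z)))"
proof -
 have [measurable]: "w \<in> Borel" "\<theta> \<in> Borel" "V \<in> Borel"
  using w1 t1 V by (auto simp: L2_fun_def)
 have t2: "L2_fun lborel \<theta>" by (rule L4_L1_imp_L2[OF t1 t4])
 have n: "L1 (\<lambda>z. \<theta> z * V z)" by (rule L2_mult_integrable[OF t2 V])
 have it2: "L1 (\<lambda>z. (\<theta> z)^2)" and iV: "L1 (\<lambda>z. (V z)^2)"
  and iw4: "L1 (\<lambda>z. w z ^ 4)" and it4: "L1 (\<lambda>z. \<theta> z ^ 4)"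
  using t2 V w4 t4 by (auto simp: L2_fun_def L4_fun_def)
 define g where "g x = (LBINT y. w y * \<eta> (x - y))" for x
 define N where "N x = (LBINT z. \<theta> z * V z * \<eta> (x - z))" for x
 define P where "P x = (LBINT y. w y ^ 4 * \<eta> (x - y))" for x
 define R where "R x = (LBINT y. \<theta> y ^ 4 * \<eta> (x - y))" for x
 define S where "S x = (LBINT y. (V y)^2 * \<eta> (x - y))" for x
 define Q where "Q x = (LBINT y. (\<theta> y)^2 * \<eta> (x - y))" for x
 have [measurable]: "g \<in> Borel" "N \<in> Borel"
  unfolding g_def[abs_def] N_def[abs_def] by measurable
 have pt: "\<bar>2 * g x * N x\<bar> \<le> \<kappa> * ((P x + R x) / 2) + (1 / \<kappa>) * S x" for x
 proof -
  have "\<bar>g x * N x\<bar> = \<bar>LBINT z. g x * (\<theta> z * V z * \<eta> (x - z))\<bar>" by (simp add: N_def)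
  also have "\<dots> \<le> (LBINT z. (\<kappa> / 2) * (g x)^2 * ((\<theta> z)^2 * \<eta> (x - z)) + (1 / (2 * \<kappa>)) * ((V z)^2 * \<eta> (x - z)))"
  proof (rule integral_abs_le(2))
   show "L1 (\<lambda>z. (\<kappa> / 2) * (g x)^2 * ((\<theta> z)^2 * \<eta> (x - z)) + (1 / (2 * \<kappa>)) * ((V z)^2 * \<eta> (x - z)))"
    using mollify_bounds(3)[OF it2] mollify_bounds(3)[OF iV] by simp
   fix z
   have "0 \<le> (\<kappa> * \<bar>g x * \<theta> z\<bar> - \<bar>V z\<bar>)^2 / (2 * \<kappa>)" using l by simp
   also have "\<dots> = (\<kappa> / 2) * (g x * \<theta> z)^2 + (1 / (2 * \<kappa>)) * (V z)^2 - \<bar>g x * \<theta> z\<bar> * \<bar>V z\<bar>"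
   proof -
    have "(\<kappa> * X - Y)^2 / (2 * \<kappa>) = (\<kappa> / 2) * X^2 + (1 / (2 * \<kappa>)) * Y^2 - X * Y" for X Y :: real
     using l by (simp add: power2_eq_square field_simps)
    from this[of "\<bar>g x * \<theta> z\<bar>" "\<bar>V z\<bar>"] show ?thesis by simp
   qed
   finally have "\<bar>g x * \<theta> z\<bar> * \<bar>V z\<bar> * \<eta> (x - z) \<le> ((\<kappa> / 2) * (g x * \<theta> z)^2 + (1 / (2 * \<kappa>)) * (V z)^2) * \<eta> (x - z)"
    by (intro mult_right_mono eta_nonneg) simp
   then show "\<bar>g x * (\<theta> z * V z * \<eta> (x - z))\<bar> \<le> (\<kappa> / 2) * (g x)^2 * ((\<theta> z)^2 * \<eta> (x - z)) + (1 / (2 * \<kappa>)) * ((V z)^2 * \<eta> (x - z))"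
    using eta_nonneg[of "x - z"] by (simp add: abs_mult power_mult_distrib distrib_right mult.assoc)
  qed
  also have "\<dots> = (\<kappa> / 2) * ((g x)^2 * Q x) + (1 / (2 * \<kappa>)) * S x"
   unfolding Q_def S_def using mollify_bounds(3)[OF it2] mollify_bounds(3)[OF iV] by simp
  also have "\<dots> \<le> (\<kappa> / 2) * ((P x + R x) / 2) + (1 / (2 * \<kappa>)) * S x"
  proof (intro add_right_mono mult_left_mono)
   have "g x ^ 4 \<le> P x" "(Q x)^2 \<le> R x"
    unfolding g_def P_def Q_def R_def by (rule mollify_fourth_power(1)[OF w1 w4] mollify_fourth_power(2)[OF t1 t4])+
   moreover have "2 * ((g x)^2 * Q x) \<le> g x ^ 4 + (Q x)^2"
    using sum_squares_bound[of "(g x)^2" "Q x"] by simp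
   ultimately have "2 * ((g x)^2 * Q x) \<le> P x + R x" by (meson add_mono order_trans)
   then show "(g x)^2 * Q x \<le> (P x + R x) / 2" by simp
  qed (use l in auto)
  finally have "2 * \<bar>g x * N x\<bar> \<le> 2 * ((\<kappa> / 2) * ((P x + R x) / 2) + (1 / (2 * \<kappa>)) * S x)"
   by (intro mult_left_mono) simp_all
  also have "\<dots> = \<kappa> * ((P x + R x) / 2) + (1 / \<kappa>) * S x" by (simp add: field_simps)
  finally show ?thesis by (simp add: abs_mult)
 qed
 have iP: "L1 P" "(LBINT x. P x) = (LBINT z. w z ^ 4)"
  unfolding P_def[abs_def] using convolve_integral[OF iw4] by auto
 have iR: "L1 R" "(LBINT x. R x) = (LBINT z. \<theta> z ^ 4)"
  unfolding R_def[abs_def] using convolve_integral[OF it4] by auto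
 have iS: "L1 S" "(LBINT x. S x) = (LBINT z. (V z)^2)"
  unfolding S_def[abs_def] using convolve_integral[OF iV] by auto
 have ib: "L1 (\<lambda>x. \<kappa> * ((P x + R x) / 2) + (1 / \<kappa>) * S x)" using iP iR iS by simp
 have "L1 (\<lambda>x. 2 * g x * N x)"
  by (rule Bochner_Integration.integrable_bound[OF ib]) (use order_trans[OF pt abs_ge_self] in \<open>auto intro!: AE_I2\<close>)
 then show "L1 (\<lambda>x. 2 * (LBINT y. w y * \<eta> (x - y)) * (LBINT z. \<theta> z * V z * \<eta> (x - z)))"
  unfolding g_def N_def .
 have "\<bar>LBINT x. 2 * g x * N x\<bar> \<le> (LBINT x. \<kappa> * ((P x + R x) / 2) + (1 / \<kappa>) * S x)"
  by (rule integral_abs_le(2)[OF ib pt])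
 also have "\<dots> = \<kappa> * (((LBINT z. w z ^ 4) + (LBINT z. \<theta> z ^ 4)) / 2) + (1 / \<kappa>) * (LBINT z. (V z)^2)"
  using iP iR iS by simp
 also have "\<dots> \<le> \<kappa> * (LBINT z. \<theta> z ^ 4) + (1 / \<kappa>) * (LBINT z. (V z)^2)"
 proof (intro add_right_mono mult_left_mono)
  have "(LBINT z. w z ^ 4) \<le> (LBINT z. \<theta> z ^ 4)"
   using power_mono[OF wt, where n = 4] by (intro integral_mono iw4 it4) simp
  then show "((LBINT z. w z ^ 4) + (LBINT z. \<theta> z ^ 4)) / 2 \<le> (LBINT z. \<theta> z ^ 4)" by simp
 qed (use l in simp)
 finally show "\<bar>LBINT x. 2 * (LBINT y. w y * \<eta> (x - y)) * (LBINT z. \<theta> z * V z * \<eta> (x - z))\<bar>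
   \<le> \<kappa> * (LBINT x. \<theta> x ^ 4) + (1 / \<kappa>) * (LBINT x. (V x)^2)"
  unfolding g_def N_def .
qed

text \<open>The derivative of \<open>\<zeta> \<eta>(x - \<cdot>)\<close> has two terms: the one that falls on \<open>\<eta>\<close> is estimated by the commutator bound, the one that falls on \<open>\<zeta>\<close> is the flux through the cut-off.\<close>

theorem flux_bound:
 fixes \<theta> \<zeta> :: "real^2 => real" and v :: "2 => real^2 => real"
 assumes eps: "0 < \<epsilon>" and t1: "L1 \<theta>" and t4: "L4_fun \<theta>" and z: "smooth \<zeta>" "\<And>x. \<bar>\<zeta> x\<bar> \<le> 1"
  and v1: "\<And>i. L1 (v i)" and v2: "\<And>i. L2_fun lborel (v i)"
  and div: "\<And>x y. \<zeta> y \<noteq> 0 ==> norm (x - y) < \<epsilon> ==> (\<Sum>i\<in>UNIV. LBINT z. v i z * de i (x - z)) = 0"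
  and A: "\<And>h. norm h < 2 * \<epsilon> ==> (LBINT y. (\<zeta> (h + y) * \<theta> (h + y) - \<zeta> y * \<theta> y) ^ 4) \<le> A"
  and K: "K \<in> sets borel" "\<And>h y. norm h < 2 * \<epsilon> ==> y \<notin> K ==> \<zeta> (h + y) = 0 \<and> \<zeta> y = 0"
  and E: "\<And>h i. norm h < 2 * \<epsilon> ==> (LBINT y. ind K y * (v i (h + y) - v i y)^2) \<le> (norm h)^2 * E" "0 \<le> E"
  and V: "L2_fun lborel (\<lambda>x. \<Sum>i\<in>UNIV. v i x * pd i \<zeta> x)"
  and pos: "0 < \<mu>" "0 < \<kappa>"
 shows "\<bar>LBINT x. 2 * (LBINT y. \<zeta> y * \<theta> y * \<eta> (x - y)) *
    (LBINT z. \<theta> z * (\<Sum>i\<in>UNIV. v i z * pd i (\<lambda>z. \<zeta> z * \<eta> (x - z)) z))\<bar>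
   \<le> 8 * pi * C * (A / \<mu> + \<mu> * E) + \<kappa> * (LBINT x. \<theta> x ^ 4)
    + (1 / \<kappa>) * (LBINT x. (\<Sum>i\<in>UNIV. v i x * pd i \<zeta> x)^2)"
proof -
 define w where "w y = \<zeta> y * \<theta> y" for y
 define V where "V x = (\<Sum>i\<in>UNIV. v i x * pd i \<zeta> x)" for x
 have zc: "\<zeta> \<in> Borel" by (intro borel_measurable_continuous_onI smooth_continuous_on z)
 note [measurable] = zc
 have [measurable]: "\<theta> \<in> Borel" using t1 by auto
 have w1: "L1 w"
  using integrable_lborel_mult_bounded[OF t1 zc z(2)] by (simp add: w_def[abs_def] mult.commute)
 have wt: "\<bar>w x\<bar> \<le> \<bar>\<theta> x\<bar>" for x
  using z(2)[of x] by (simp add: w_def abs_mult mult_left_le_one_le)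
 have w4: "L4_fun w"
  unfolding L4_fun_def
 proof
  show "w \<in> Borel" using w1 by auto
  show "L1 (\<lambda>x. w x ^ 4)"
   by (rule Bochner_Integration.integrable_bound[of _ "\<lambda>x. \<theta> x ^ 4"])
    (use t4 w1 power_mono[OF wt, where n = 4] in \<open>auto simp: L4_fun_def\<close>)
 qed
 have w2: "L2_fun lborel w" and t2: "L2_fun lborel \<theta>" using L4_L1_imp_L2 w1 w4 t1 t4 by auto
 have VL: "L2_fun lborel V" using V unfolding V_def[abs_def] .
 define g where "g x = (LBINT y. w y * \<eta> (x - y))" for x
 have G: "(LBINT z. \<theta> z * (\<Sum>i\<in>UNIV. v i z * pd i (\<lambda>z. \<zeta> z * \<eta> (x - z)) z))
   = (LBINT z. \<theta> z * V z * \<eta> (x - z)) - (\<Sum>i\<in>UNIV. LBINT z. w z * v i z * de i (x - z))" for x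
 proof -
  have fd: "frechet_derivative (\<lambda>z. \<zeta> z * \<eta> (x - z)) (at z) u = - \<zeta> z * frechet_derivative \<eta> (at (x - z)) u + frechet_derivative \<zeta> (at z) u * \<eta> (x - z)" for z u
   by (subst frechet_derivative_mult_real[OF smooth_differentiable[OF z(1)] smooth_differentiable[OF smooth_eta_shift]]) (simp add: frechet_eta_shift)
  have e: "\<theta> z * (\<Sum>i\<in>UNIV. v i z * pd i (\<lambda>z. \<zeta> z * \<eta> (x - z)) z)
   = \<theta> z * V z * \<eta> (x - z) - (\<Sum>i\<in>UNIV. w z * v i z * de i (x - z))" for z
   unfolding fd V_def w_def sum_2 by (simp add: algebra_simps)
  have "L1 (\<lambda>z. \<theta> z * V z * \<eta> (x - z))" by (rule mollify_bounds(3)[OF L2_mult_integrable[OF t2 VL]])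
  moreover have "L1 (\<lambda>z. w z * v i z * de i (x - z))" for i by (rule mollify_bounds(1)[OF L2_mult_integrable[OF w2 v2]])
  ultimately show ?thesis unfolding e by simp
 qed
 have cm: "\<bar>2 * (\<Sum>i\<in>UNIV. LBINT x. g x * (LBINT z. w z * v i z * de i (x - z)))\<bar> \<le> 8 * pi * C * (A / \<mu> + \<mu> * E)"
  unfolding g_def
 proof (rule commutator_bound[OF eps w1 w4 v1 v2 _ _ K(1) _ E pos(1)])
  show "(\<Sum>i\<in>UNIV. LBINT z. v i z * de i (x - z)) = 0" if "w y \<noteq> 0" "norm (x - y) < \<epsilon>" for x y
   using div[of y x] that by (simp add: w_def)
  show "(LBINT y. (w (h + y) - w y) ^ 4) \<le> A" if "norm h < 2 * \<epsilon>" for h using A[OF that] by (simp add: w_def)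
  show "w (h + y) - w y = 0" if "norm h < 2 * \<epsilon>" "y \<notin> K" for h y using K(2)[OF that] by (simp add: w_def)
 qed
 note cf = cutoff_flux_bound[OF w1 w4 t1 t4 VL wt pos(2), folded g_def]
 have im: "L1 (\<lambda>x. g x * (LBINT z. w z * v i z * de i (x - z)))" for i
  unfolding g_def by (rule mollify_pairing(2)[OF w1 L2_mult_integrable[OF w2 v2]])
 have "(LBINT x. 2 * g x * ((LBINT z. \<theta> z * V z * \<eta> (x - z)) - (\<Sum>i\<in>UNIV. LBINT z. w z * v i z * de i (x - z))))
  = (LBINT x. 2 * g x * (LBINT z. \<theta> z * V z * \<eta> (x - z)) - 2 * (\<Sum>i\<in>UNIV. g x * (LBINT z. w z * v i z * de i (x - z))))"
  by (simp only: right_diff_distrib sum_distrib_left mult.assoc)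
 also have "\<dots> = (LBINT x. 2 * g x * (LBINT z. \<theta> z * V z * \<eta> (x - z)))
   - 2 * (\<Sum>i\<in>UNIV. LBINT x. g x * (LBINT z. w z * v i z * de i (x - z)))"
  using cf(2) im by simp
 finally show ?thesis using cm cf(1)
  unfolding G w_def[symmetric] g_def[symmetric] V_def[symmetric] by linarith
qed

end

section \<open>Squares of primitives and of mollifications\<close>

text \<open>Since \<open>g\<close> is Lipschitz continuous, \<open>g^2\<close> minus the integral of \<open>2 g G\<close> has increments of the order \<open>(t - s)^2\<close>; so its derivative is zero, although \<open>g\<close> need not be differentiable everywhere.\<close>

lemma integral_square_of_primitive:
 fixes g G :: "real => real"
 assumes \<tau>: "0 \<le> \<tau>" and G[measurable]: "G \<in> Borel" and M: "\<And>s. \<bar>G s\<bar> \<le> M"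
  and g: "\<And>t. 0 \<le> t ==> t \<le> \<tau> ==> g t = g 0 + (LBINT s. ind {0..t} s * G s)"
 shows "(g \<tau>)^2 - (g 0)^2 = (LBINT s. ind {0..\<tau>} s * (2 * g s * G s))"
  and "(\<lambda>s. ind {0..\<tau>} s * (2 * g s * G s)) \<in> Borel"
proof -
 have M0: "0 \<le> M" using M[of 0] by linarith
 have fin: "emeasure lborel {p..q} < \<infinity>" for p q :: real by (cases "p \<le> q") auto
 have intind: "L1 (\<lambda>r. ind X r * k r)"
  if "X \<subseteq> {0..\<tau>}" "X \<in> sets borel" "(\<lambda>r. ind {0..\<tau>} r * k r) \<in> Borel" "\<And>r. r \<in> {0..\<tau>} ==> \<bar>k r\<bar> \<le> c" for X k and c :: real
 proof -
  have [measurable]: "(\<lambda>r. ind {0..\<tau>} r * k r) \<in> Borel" "X \<in> sets borel" by fact+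
  have eq: "ind X r * k r = ind X r * (ind {0..\<tau>} r * k r)" for r
   using that(1) by (auto simp: indicator_def)
  show ?thesis unfolding eq
  proof (rule Bochner_Integration.integrable_bound[where f = "\<lambda>r. \<bar>c\<bar> * ind {0..\<tau>} r"])
   show "AE r in lborel. norm (ind X r * (ind {0..\<tau>} r * k r)) \<le> norm (\<bar>c\<bar> * ind {0..\<tau>} r)"
    using that(4) that(1) by (intro AE_I2) (force simp: indicator_def)
  qed (use fin in auto)
 qed
 have split: "(LBINT r. ind {0..t} r * k r) - (LBINT r. ind {0..s} r * k r) = (LBINT r. ind {s<..t} r * k r)"
  if "0 \<le> s" "s \<le> t" "t \<le> \<tau>" "(\<lambda>r. ind {0..\<tau>} r * k r) \<in> Borel" "\<And>r. r \<in> {0..\<tau>} ==> \<bar>k r\<bar> \<le> c" for s t k and c :: real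
 proof -
  have "(LBINT r. ind {0..t} r * k r) - (LBINT r. ind {0..s} r * k r)
   = (LBINT r. ind {0..t} r * k r - ind {0..s} r * k r)"
   using that by (intro Bochner_Integration.integral_diff[symmetric] intind[OF _ _ that(4,5)]) auto
  also have "\<dots> = (LBINT r. ind {s<..t} r * k r)"
   using that by (intro Bochner_Integration.integral_cong) (auto simp: indicator_def)
  finally show ?thesis .
 qed
 have bd: "\<bar>LBINT r. ind {s<..t} r * k r\<bar> \<le> c * (t - s)"
  if "s \<le> t" "0 \<le> c" "\<And>r. s < r ==> r \<le> t ==> \<bar>k r\<bar> \<le> c" for s t c and k :: "real => real"
 proof -
  have "\<bar>LBINT r. ind {s<..t} r * k r\<bar> \<le> (LBINT r. c * ind {s<..t} r)"
  proof (rule integral_abs_le(2))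
   show "L1 (\<lambda>r. c * ind {s<..t} r)"
    using that by (intro integrable_mult_right integrable_real_indicator) auto
   show "\<bar>ind {s<..t} r * k r\<bar> \<le> c * ind {s<..t} r" for r
    using that by (auto simp: indicator_def)
  qed
  then show ?thesis using that by simp
 qed
 have gd: "g t - g s = (LBINT r. ind {s<..t} r * G r)" if "0 \<le> s" "s \<le> t" "t \<le> \<tau>" for s t
  using split[OF that, of G M] M g[of t] g[of s] that by simp
 have gl: "\<bar>g t - g s\<bar> \<le> M * (t - s)" if "0 \<le> s" "s \<le> t" "t \<le> \<tau>" for s t
  unfolding gd[OF that] using that M M0 by (intro bd) auto
 have cg: "continuous_on {0..\<tau>} g"
 proof (rule continuous_onI)
  fix x e :: real assume x: "x \<in> {0..\<tau>}" and e: "0 < e"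
  show "\<exists>d>0. \<forall>x'\<in>{0..\<tau>}. dist x' x < d --> dist (g x') (g x) \<le> e"
  proof (intro exI[of _ "e / (M + 1)"] conjI ballI impI)
   show "0 < e / (M + 1)" using e M0 by simp
   fix y assume y: "y \<in> {0..\<tau>}" "dist y x < e / (M + 1)"
   have "\<bar>g y - g x\<bar> \<le> M * \<bar>y - x\<bar>"
    using gl[of x y] gl[of y x] x y by (cases "x \<le> y") (auto simp: abs_minus_commute)
   also have "\<dots> \<le> (M + 1) * (e / (M + 1))" using y M0 e by (intro mult_mono) (auto simp: dist_real_def)
   finally show "dist (g y) (g x) \<le> e" using M0 by (simp add: dist_real_def)
  qed
 qed
 have gm: "(\<lambda>r. ind {0..\<tau>} r * g r) \<in> Borel"
  using borel_measurable_continuous_on_indicator[OF _ cg] by simp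
 show kmeas: "(\<lambda>r. ind {0..\<tau>} r * (2 * g r * G r)) \<in> Borel"
 proof -
  have "(\<lambda>r. 2 * (ind {0..\<tau>} r * g r) * G r) \<in> Borel" using gm by measurable
  then show ?thesis by (simp add: mult_ac)
 qed
 define N where "N = \<bar>g 0\<bar> + M * \<tau>"
 have gb: "\<bar>g r\<bar> \<le> N" if "r \<in> {0..\<tau>}" for r
 proof -
  have "\<bar>g r - g 0\<bar> \<le> M * (r - 0)" using gl[of 0 r] that by simp
  also have "\<dots> \<le> M * \<tau>" using that M0 by (intro mult_left_mono) auto
  finally show ?thesis unfolding N_def by linarith
 qed
 have kb: "\<bar>2 * g r * G r\<bar> \<le> 2 * N * M" if "r \<in> {0..\<tau>}" for r
  using gb[OF that] M[of r] by (auto simp: abs_mult intro!: mult_mono)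
 define D where "D t = (g t)^2 - (LBINT r. ind {0..t} r * (2 * g r * G r))" for t
 have Dd: "\<bar>D t - D s\<bar> \<le> 2 * M^2 * (t - s)^2" if st: "0 \<le> s" "s \<le> t" "t \<le> \<tau>" for s t
 proof -
  let ?I = "ind {s<..t} :: real => real"
  have X: "{s<..t} \<subseteq> {0..\<tau>}" using st by auto
  have iG: "L1 (\<lambda>r. ?I r * G r)" by (rule intind[OF X, of G M]) (use M in auto)
  have ik: "L1 (\<lambda>r. ?I r * (2 * g r * G r))" by (rule intind[OF X _ kmeas kb]) auto
  have "D t - D s = (g t + g s) * (g t - g s) - (LBINT r. ?I r * (2 * g r * G r))"
   using split[OF st kmeas kb] unfolding D_def by (simp add: power2_eq_square algebra_simps)
  also have "\<dots> = (LBINT r. (g t + g s) * (?I r * G r) - ?I r * (2 * g r * G r))"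
   unfolding gd[OF st] using iG ik by simp
  also have "\<dots> = (LBINT r. ?I r * ((g t + g s - 2 * g r) * G r))"
   by (intro Bochner_Integration.integral_cong refl) (simp add: algebra_simps)
  finally have e: "D t - D s = (LBINT r. ?I r * ((g t + g s - 2 * g r) * G r))" .
  have "\<bar>D t - D s\<bar> \<le> (2 * M * (t - s) * M) * (t - s)"
   unfolding e
  proof (rule bd[OF st(2)])
   fix r assume r: "s < r" "r \<le> t"
   have "\<bar>g t - g r\<bar> \<le> M * (t - r)" "\<bar>g r - g s\<bar> \<le> M * (r - s)" using gl[of r t] gl[of s r] r st by auto
   moreover have "M * (t - r) \<le> M * (t - s)" "M * (r - s) \<le> M * (t - s)" using r M0 by (auto intro!: mult_left_mono)
   ultimately have "\<bar>g t + g s - 2 * g r\<bar> \<le> 2 * M * (t - s)" by linarith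
   then show "\<bar>(g t + g s - 2 * g r) * G r\<bar> \<le> 2 * M * (t - s) * M"
    unfolding abs_mult using M[of r] M0 by (intro mult_mono) auto
  qed (use st M0 in auto)
  then show ?thesis by (simp add: power2_eq_square mult_ac)
 qed
 have "\<exists>c. \<forall>x\<in>{0..\<tau>}. D x = c"
 proof (rule has_field_derivative_zero_constant)
  fix x assume x: "x \<in> {0..\<tau>}"
  show "(D has_field_derivative 0) (at x within {0..\<tau>})"
   unfolding has_field_derivative_iff
  proof (rule Lim_null_comparison)
   show "\<forall>\<^sub>F y in at x within {0..\<tau>}. norm ((D y - D x) / (y - x)) \<le> 2 * M^2 * \<bar>y - x\<bar>"
    unfolding eventually_at_filter
   proof (intro always_eventually allI impI)
    fix y assume y: "y \<noteq> x" "y \<in> {0..\<tau>}"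
    have "\<bar>D y - D x\<bar> \<le> 2 * M^2 * \<bar>y - x\<bar>^2"
     using Dd[of x y] Dd[of y x] x y by (cases "x \<le> y") (auto simp: abs_minus_commute power2_commute)
    then show "norm ((D y - D x) / (y - x)) \<le> 2 * M^2 * \<bar>y - x\<bar>"
     using y by (simp add: divide_simps power2_eq_square mult_ac)
   qed
   have "((\<lambda>y. 2 * M^2 * \<bar>y - x\<bar>) \<longlongrightarrow> 2 * M^2 * \<bar>x - x\<bar>) (at x within {0..\<tau>})" by (intro tendsto_intros)
   then show "((\<lambda>y. 2 * M^2 * \<bar>y - x\<bar>) \<longlongrightarrow> 0) (at x within {0..\<tau>})" by simp
  qed
 qed simp
 then have "D \<tau> = D 0" using \<tau> by auto
 moreover have "(LBINT r. ind {0..0} r * (2 * g r * G r)) = 0"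
 proof (rule integral_eq_zero_AE)
  show "AE r in lborel. ind {0..0} r * (2 * g r * G r) = 0"
   using AE_lborel_singleton[of "0::real"] by eventually_elim (auto simp: indicator_def)
 qed
 ultimately show "(g \<tau>)^2 - (g 0)^2 = (LBINT s. ind {0..\<tau>} s * (2 * g s * G s))"
  unfolding D_def by simp
qed

lemma L4_bounded_support_integrable:
 fixes f :: "'a::euclidean_space => real"
 assumes f: "L4_fun f" and z: "\<And>x. x \<notin> U ==> f x = 0" and U: "U \<in> sets borel" "bounded U"
 shows "L1 f"
proof (rule Bochner_Integration.integrable_bound)
 have "L1 (ind U :: 'a => real)"
  using U emeasure_bounded_finite[of U] by (intro integrable_real_indicator) auto
 then show "L1 (\<lambda>x. ind U x + f x ^ 4)" using f by (auto simp: L4_fun_def)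
 show "f \<in> borel_measurable lborel" using f by (simp add: L4_fun_def)
 show "AE x in lborel. norm (f x) \<le> norm (ind U x + f x ^ 4)"
 proof (intro AE_I2)
  fix x
  have "\<bar>y\<bar> \<le> 1 + y ^ 4" for y :: real
  proof -
   have "0 \<le> (y^2 - 1/2)^2" "0 \<le> (\<bar>y\<bar> - 1/2)^2" by simp_all
   then show ?thesis by (simp add: power2_diff power_mult[symmetric] power2_eq_square[of "1/2"] algebra_simps)
  qed
  then show "norm (f x) \<le> norm (ind U x + f x ^ 4)" using z[of x] by (cases "x \<in> U") auto
 qed
qed

lemma L2_bounded_support_integrable:
 fixes f :: "'a::euclidean_space => real"
 assumes f: "L2_fun lborel f" and z: "\<And>x. x \<notin> U ==> f x = 0" and U: "U \<in> sets borel" "bounded U"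
 shows "L1 f"
proof -
 have "L2_fun lborel (\<lambda>x. ind U x * 1)"
  by (rule L2_fun_indicator_continuous) (use U in auto)
 from L2_mult_integrable[OF this f] have "L1 (\<lambda>x. ind U x * f x)" by simp
 moreover have "ind U x * f x = f x" for x using z[of x] by (auto simp: indicator_def)
 ultimately show ?thesis by simp
qed

text \<open>The mollifications of a function in \<open>L\<^sup>1 \<inter> L\<^sup>4\<close> converge in \<open>L\<^sup>2\<close> by continuity of translations.\<close>

lemma mollified_square_tendsto:
 fixes \<eta> :: "nat => real^2 => real"
 assumes f1: "L1 f" and f4: "L4_fun f" and e: "\<epsilon> \<longlonglongrightarrow> 0" and mo: "\<And>n. mollifier C (\<epsilon> n) (\<eta> n)"
 shows "(\<lambda>n. LBINT x. (LBINT y. f y * \<eta> n (x - y))^2) \<longlonglongrightarrow> (LBINT x. (f x)^2)"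
proof -
 have [measurable]: "f \<in> Borel" using f1 by auto
 have f2: "L2_fun lborel f" by (rule L4_L1_imp_L2[OF f1 f4])
 have i4: "L1 (\<lambda>x. f x ^ 4)" using f4 by (simp add: L4_fun_def)
 have close: "\<forall>\<^sub>F n in sequentially. L1 (\<lambda>x. ((LBINT y. f y * \<eta> n (x - y)) - f x)^2) \<and>
   (LBINT x. ((LBINT y. f y * \<eta> n (x - y)) - f x)^2) \<le> r" if r: "r > 0" for r
 proof -
  have r2: "r / 2 > 0" using r by simp
  obtain d1 where d1: "d1 > 0" "\<And>h. norm h < d1 ==> (LBINT x. \<bar>f (h + x) - f x\<bar>) \<le> r / 2"
   using L1_translation_modulus[OF f1 r2] by metis
  obtain d2 where d2: "d2 > 0" "\<And>h. norm h < d2 ==> (LBINT x. (f (h + x) - f x) ^ 4) \<le> r / 2"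
   using L4_translation_modulus[OF f1 i4 r2] by metis
  have "\<forall>\<^sub>F n in sequentially. \<epsilon> n < min d1 d2" using d1 d2 by (intro order_tendstoD(2)[OF e]) auto
  then show ?thesis
  proof eventually_elim
   case (elim n)
   interpret mollif C "\<epsilon> n" "\<eta> n" by unfold_locales (rule mo)
   have A: "(LBINT x. (f (h + x) - f x)^2) \<le> r" if h: "norm h < \<epsilon> n" for h
   proof -
    have ish: "L1 (\<lambda>x. f (h + x))" using lborel_shift(2)[of f h] f1 by simp
    have sh4: "L4_fun (\<lambda>x. f (h + x))" by (rule L4_fun_shift[OF f4])
    have i: "L1 (\<lambda>x. \<bar>f (h + x) - f x\<bar>)" using ish f1 by auto
    have i4d: "L1 (\<lambda>x. (f (h + x) - f x) ^ 4)"
    proof (rule Bochner_Integration.integrable_bound)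
     show "L1 (\<lambda>x. 27 * (f (h + x) ^ 4 + f x ^ 4 + 0 ^ 4))" using sh4 i4 by (auto simp: L4_fun_def)
     show "AE x in lborel. norm ((f (h + x) - f x) ^ 4) \<le> norm (27 * (f (h + x) ^ 4 + f x ^ 4 + 0 ^ 4))"
      using fourth_power_triangle[of "f (h + _)" "- f _" 0] by (intro AE_I2) simp
    qed measurable
    have pt: "z^2 \<le> \<bar>z\<bar> + z ^ 4" for z :: real
    proof (cases "\<bar>z\<bar> \<le> 1")
     case True
     then have "\<bar>z\<bar> * \<bar>z\<bar> \<le> \<bar>z\<bar> * 1" by (intro mult_left_mono) auto
     then have "z^2 \<le> \<bar>z\<bar>" by (simp add: power2_eq_square)
     moreover have "0 \<le> z ^ 4" by simp
     ultimately show ?thesis by linarith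
    next
     case False
     then have "1 \<le> z^2" using power_mono[of 1 "\<bar>z\<bar>" 2] by simp
     then have "z^2 * 1 \<le> z^2 * z^2" by (intro mult_left_mono) auto
     then show ?thesis by (simp add: power_add[symmetric])
    qed
    have "(LBINT x. (f (h + x) - f x)^2) \<le> (LBINT x. \<bar>f (h + x) - f x\<bar> + (f (h + x) - f x) ^ 4)"
     by (rule integral_mono_AE') (use i i4d pt in auto)
    also have "\<dots> = (LBINT x. \<bar>f (h + x) - f x\<bar>) + (LBINT x. (f (h + x) - f x) ^ 4)"
     using i i4d by simp
    also have "\<dots> \<le> r / 2 + r / 2" using d1(2)[of h] d2(2)[of h] h elim by (intro add_mono) auto
    finally show ?thesis by simp
   qed
   show ?case using mollify_L2[OF f1 _ A] f2 r by (auto simp: L2_fun_def)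
  qed
 qed
 show ?thesis
 proof (rule LIMSEQ_I)
  fix r :: real assume r: "r > 0"
  define N where "N = (LBINT x. (f x)^2)"
  have N: "N \<ge> 0" by (simp add: N_def)
  define \<kappa> where "\<kappa> = r / (4 * (N + 1))"
  have k: "\<kappa> > 0" "\<kappa> * N \<le> r / 4" using r N by (auto simp: \<kappa>_def field_simps)
  have "r / (4 * (1 + 1 / \<kappa>)) > 0" using r k(1) by (simp add: add_pos_pos)
  from close[OF this] obtain n0 where n0: "\<And>n. n \<ge> n0 ==> L1 (\<lambda>x. ((LBINT y. f y * \<eta> n (x - y)) - f x)^2)"
   "\<And>n. n \<ge> n0 ==> (LBINT x. ((LBINT y. f y * \<eta> n (x - y)) - f x)^2) \<le> r / (4 * (1 + 1 / \<kappa>))"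
   by (auto simp: eventually_sequentially)
  show "\<exists>n0. \<forall>n\<ge>n0. norm ((LBINT x. (LBINT y. f y * \<eta> n (x - y))^2) - (LBINT x. (f x)^2)) < r"
  proof (intro exI[of _ n0] allI impI)
   fix n assume n: "n0 \<le> n"
   interpret mollif C "\<epsilon> n" "\<eta> n" by unfold_locales (rule mo)
   have "L2_fun lborel (\<lambda>x. (LBINT y. f y * \<eta> n (x - y)) - f x)" using n0(1)[OF n] by (simp add: L2_fun_def)
   from L2_fun_add[OF this f2] have F: "L2_fun lborel (\<lambda>x. LBINT y. f y * \<eta> n (x - y))" by simp
   have p: "0 < 1 + 1 / \<kappa>" using k(1) by (simp add: add_pos_pos)
   have "\<bar>(LBINT x. (LBINT y. f y * \<eta> n (x - y))^2) - N\<bar> \<le> (1 + 1 / \<kappa>) * (LBINT x. ((LBINT y. f y * \<eta> n (x - y)) - f x)^2) + \<kappa> * N"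
    unfolding N_def by (rule L2_close_integral_sq[OF F f2 k(1)])
   also have "\<dots> \<le> (1 + 1 / \<kappa>) * (r / (4 * (1 + 1 / \<kappa>))) + r / 4"
    using p by (intro add_mono mult_left_mono n0(2)[OF n] k(2)) auto
   also have "(1 + 1 / \<kappa>) * (r / (4 * (1 + 1 / \<kappa>))) = r / 4"
   proof -
    have "p * (r / (4 * p)) = r / 4" if "p > 0" for p using that by (simp add: field_simps)
    from this[OF p] show ?thesis .
   qed
   finally show "norm ((LBINT x. (LBINT y. f y * \<eta> n (x - y))^2) - (LBINT x. (f x)^2)) < r"
    using r by (simp add: N_def)
  qed
 qed
qed

section \<open>Transport by a tangential velocity\<close>

text \<open>The data of the transport problem on \<open>[0,\<tau>]\<close>.  Here \<open>\<Theta> t\<close> is the weakly continuous representative, defined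
at every time, while \<open>H\<close> is jointly measurable and agrees with it at almost every time; at the
exceptional times \<open>H\<close> and \<open>v\<close> can be set to zero, so that all bounds hold for every \<open>s\<close> with the same constant \<open>B\<close>.\<close>

locale transport =
 fixes a b \<tau> B :: real and \<Theta> H :: "real => real^2 => real" and v :: "2 => real => real^2 => real"
 assumes ab: "0 < a" "a < b" and tau: "0 \<le> \<tau>"
  and H_meas [measurable]: "case_prod H \<in> borel_measurable (borel \<Otimes>\<^sub>M borel)"
  and v_meas [measurable]: "\<And>i. case_prod (v i) \<in> borel_measurable (borel \<Otimes>\<^sub>M borel)"
  and H_zero: "\<And>s x. x \<notin> annulus a b ==> H s x = 0"
  and v_zero: "\<And>i s x. x \<notin> annulus a b ==> v i s x = 0"
  and Theta_zero: "\<And>t x. x \<notin> annulus a b ==> \<Theta> t x = 0"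
  and Theta4: "\<And>t. 0 \<le> t ==> t \<le> \<tau> ==> L4_fun (\<Theta> t)"
  and H4: "\<And>s. L4_fun (H s)" "\<And>s. (LBINT x. H s x ^ 4) \<le> B"
  and v2: "\<And>i s. L2_fun lborel (v i s)" "\<And>i s. (LBINT x. (v i s x)^2) \<le> B"
  and v_translation: "\<And>s i A h. A \<in> sets borel ==>
   (\<And>y r. y \<in> A ==> 0 \<le> r ==> r \<le> 1 ==> y + r *\<^sub>R h \<in> annulus a b) ==>
   (LBINT y. ind A y * (v i s (h + y) - v i s y)^2) \<le> (norm h)^2 * B"
  and v_hardy: "\<And>s. \<exists>\<Psi> :: real^2 => real. (\<forall>x. 0 \<le> \<Psi> x) \<and> L1 \<Psi> \<and>
   (LBINT x. \<Psi> x) \<le> B \<and>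
   (\<forall>p q. a \<le> p --> p < q --> q \<le> b --> p = a \<or> q = b -->
    (LBINT x. ind {x. p < norm x \<and> norm x < q} x * (\<Sum>i\<in>UNIV. x $ i * v i s x)^2)
     \<le> 2 * (q - p)^2 * (b / a) * (LBINT x. ind {x. p < norm x \<and> norm x < q} x * \<Psi> x))"
  and v_div: "\<And>s \<phi>. test_function (annulus a b) \<phi> ==>
   (LBINT x. (\<Sum>i\<in>UNIV. v i s x * pd i \<phi> x)) = 0"
  and agree: "AE s in lborel. s \<in> {0..\<tau>} --> (AE x in lborel. H s x = \<Theta> s x)"
  and equation: "\<And>\<phi> t. test_function (annulus a b) \<phi> ==> 0 \<le> t ==> t \<le> \<tau> ==>
   (LBINT x. \<Theta> t x * \<phi> x) = (LBINT x. \<Theta> 0 x * \<phi> x) +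
    (LBINT s. ind {0..t} s *
     (LBINT x. H s x * (\<Sum>i\<in>UNIV. v i s x * pd i \<phi> x)))"
begin

abbreviation (input) "\<Omega> \<equiv> annulus a b"

lemma omega_facts: "open \<Omega>" "\<Omega> \<in> sets borel" "bounded \<Omega>" "emeasure lborel \<Omega> < \<infinity>"
 using ab bounded_annulus open_annulus[of a b] emeasure_bounded_finite[of \<Omega>] by auto

lemma B_nonneg: "0 \<le> B"
proof -
 have "0 \<le> (LBINT x. H 0 x ^ 4)" by simp
 then show ?thesis using H4(2)[of 0] by linarith
qed

lemma H_section [measurable]: "H s \<in> Borel"
 using H4(1)[of s] by (simp add: L4_fun_def)

lemma v_section [measurable]: "v i s \<in> Borel"
 using v2(1)[of i s] by (simp add: L2_fun_def)

lemma H_integrable: "L1 (H s)"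
 by (rule L4_bounded_support_integrable[OF H4(1) H_zero omega_facts(2,3)])

lemma Theta_integrable: "0 \<le> t ==> t \<le> \<tau> ==> L1 (\<Theta> t)"
 by (rule L4_bounded_support_integrable[OF Theta4 Theta_zero omega_facts(2,3)])

lemma v_integrable: "L1 (v i s)"
 by (rule L2_bounded_support_integrable[OF v2(1) v_zero omega_facts(2,3)])

definition vol :: real where "vol = measure lborel \<Omega>"

text \<open>This makes the weak formulation Lipschitz in time for a fixed test function, so that the square of the tested density can be differentiated in time.\<close>

lemma bounded_times_Hv:
 assumes k: "\<And>i z. \<bar>k i z\<bar> \<le> L" "\<And>i. k i \<in> Borel"
 shows "L1 (\<lambda>z. H s z * (\<Sum>i\<in>UNIV. v i s z * k i z))"
  and "\<bar>LBINT z. H s z * (\<Sum>i\<in>UNIV. v i s z * k i z)\<bar> \<le> L * (2 * vol + 4 * B)"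
proof -
 have L0: "0 \<le> L" using k(1)[of 1 0] by linarith
 define D where "D z = L * (2 * (ind \<Omega> z + H s z ^ 4) + ((v 1 s z)^2 + (v 2 s z)^2))" for z
 have iO: "L1 (ind \<Omega> :: real^2 => real)"
  using omega_facts by (intro integrable_real_indicator) auto
 have iD: "L1 D" unfolding D_def[abs_def] using iO H4(1)[of s] v2(1) by (auto simp: L4_fun_def L2_fun_def)
 have b: "\<bar>H s z * (\<Sum>i\<in>UNIV. v i s z * k i z)\<bar> \<le> D z" for z
 proof -
  have h2: "(H s z)^2 \<le> ind \<Omega> z + H s z ^ 4"
  proof (cases "z \<in> \<Omega>")
   case True
   have "0 \<le> ((H s z)^2 - 1/2)^2" by simp
   then have "(H s z)^2 \<le> 1 + H s z ^ 4" by (simp add: power2_diff power2_eq_square[of "1/2"] flip: power_mult)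
   then show ?thesis using True by simp
  qed (simp add: H_zero)
  have e: "\<bar>H s z * (v i s z * k i z)\<bar> \<le> L * ((H s z)^2 + (v i s z)^2)" for i
  proof -
   have "2 * (\<bar>H s z\<bar> * \<bar>v i s z\<bar>) \<le> (H s z)^2 + (v i s z)^2" using sum_squares_bound[of "\<bar>H s z\<bar>" "\<bar>v i s z\<bar>"] by simp
   moreover have "0 \<le> \<bar>H s z\<bar> * \<bar>v i s z\<bar>" by simp
   ultimately have "\<bar>H s z\<bar> * \<bar>v i s z\<bar> \<le> (H s z)^2 + (v i s z)^2" by linarith
   then have "(\<bar>H s z\<bar> * \<bar>v i s z\<bar>) * \<bar>k i z\<bar> \<le> ((H s z)^2 + (v i s z)^2) * L" using k(1)[of i z] by (intro mult_mono) auto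
   then show ?thesis by (simp add: abs_mult mult_ac)
  qed
  have "\<bar>H s z * (\<Sum>i\<in>UNIV. v i s z * k i z)\<bar> \<le> \<bar>H s z * (v 1 s z * k 1 z)\<bar> + \<bar>H s z * (v 2 s z * k 2 z)\<bar>"
   unfolding sum_2 distrib_left by (rule abs_triangle_ineq)
  also have "\<dots> \<le> L * ((H s z)^2 + (v 1 s z)^2) + L * ((H s z)^2 + (v 2 s z)^2)" by (intro add_mono e)
  also have "\<dots> = L * (2 * (H s z)^2 + ((v 1 s z)^2 + (v 2 s z)^2))" by (simp add: algebra_simps)
  also have "\<dots> \<le> D z" unfolding D_def using h2 L0 by (intro mult_left_mono add_right_mono) auto
  finally show ?thesis .
 qed
 note [measurable] = k(2)
 show "L1 (\<lambda>z. H s z * (\<Sum>i\<in>UNIV. v i s z * k i z))"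
  by (rule Bochner_Integration.integrable_bound[OF iD]) (measurable, use b order_trans[OF b abs_ge_self] in auto)
 have "\<bar>LBINT z. H s z * (\<Sum>i\<in>UNIV. v i s z * k i z)\<bar> \<le> (LBINT z. D z)"
  by (rule integral_abs_le(2)[OF iD b])
 also have "\<dots> = L * (2 * (vol + (LBINT z. H s z ^ 4)) + ((LBINT z. (v 1 s z)^2) + (LBINT z. (v 2 s z)^2)))"
  unfolding D_def using iO H4(1)[of s] v2(1) by (simp add: L4_fun_def L2_fun_def vol_def)
 also have "\<dots> \<le> L * (2 * (vol + B) + (B + B))"
  using L0 H4(2)[of s] v2(2)[of 1 s] v2(2)[of 2 s] by (intro mult_left_mono add_mono) auto
 finally show "\<bar>LBINT z. H s z * (\<Sum>i\<in>UNIV. v i s z * k i z)\<bar> \<le> L * (2 * vol + 4 * B)" by (simp add: add.commute)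
qed

lemma H_abs_integral: "(LBINT z. \<bar>H s z\<bar>) \<le> vol + B"
proof -
 have iO: "L1 (ind \<Omega> :: real^2 => real)"
  using omega_facts by (intro integrable_real_indicator) auto
 have i4: "L1 (\<lambda>z. H s z ^ 4)" using H4(1)[of s] by (simp add: L4_fun_def)
 have "(LBINT z. \<bar>H s z\<bar>) \<le> (LBINT z. ind \<Omega> z + H s z ^ 4)"
 proof (rule integral_abs_le(1))
  show "L1 (\<lambda>z. ind \<Omega> z + H s z ^ 4)" using iO i4 by simp
  fix z
  have "\<bar>y\<bar> \<le> 1 + y ^ 4" for y :: real
  proof -
   have "0 \<le> (y^2 - 1/2)^2" "0 \<le> (\<bar>y\<bar> - 1/2)^2" by simp_all
   then show ?thesis by (simp add: power2_diff power_mult[symmetric] power2_eq_square[of "1/2"] algebra_simps)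
  qed
  then show "\<bar>H s z\<bar> \<le> ind \<Omega> z + H s z ^ 4" using H_zero[of z s] by (cases "z \<in> \<Omega>") auto
 qed
 also have "\<dots> = vol + (LBINT z. H s z ^ 4)" using iO i4 by (simp add: vol_def)
 finally show ?thesis using H4(2)[of s] by linarith
qed

end

lemma bounded_compact_support_integrable:
 fixes f :: "real^2 => real"
 assumes "f \<in> Borel" "\<And>x. \<bar>f x\<bar> \<le> c" "\<And>x. x \<notin> K ==> f x = 0" "compact K"
 shows "L1 f" "(LBINT x. \<bar>f x\<bar>) \<le> c * measure lborel K"
proof -
 have K: "K \<in> sets borel" "emeasure lborel K < \<infinity>"
  using assms(4) emeasure_bounded_finite[OF compact_imp_bounded] by (auto intro: borel_compact)
 have i: "L1 (\<lambda>x. c * ind K x)" using K by (intro integrable_mult_right integrable_real_indicator) auto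
 have b: "\<bar>f x\<bar> \<le> c * ind K x" for x using assms(2)[of x] assms(3)[of x] by (cases "x \<in> K") auto
 show "L1 f"
  by (rule Bochner_Integration.integrable_bound[OF i]) (use assms(1) b order_trans[OF b abs_ge_self] in auto)
 show "(LBINT x. \<bar>f x\<bar>) \<le> c * measure lborel K"
  using integral_abs_le(1)[OF i b] by simp
qed

text \<open>The margin \<open>d\<close> leaves room for translations and mollifiers near the support of \<open>\<zeta>\<close>.\<close>

locale cutoff_transport = transport +
 fixes \<zeta> :: "real^2 => real" and K :: "(real^2) set" and d :: real
 assumes zeta: "smooth \<zeta>" "\<And>x. \<bar>\<zeta> x\<bar> \<le> 1" "\<And>x. \<zeta> x \<noteq> 0 ==> x \<in> K"
  and K: "compact K" and d: "0 < d" "\<And>x. x \<in> K ==> cball x d \<subseteq> annulus a b"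
begin

text \<open>The square of \<open>v \<cdot> \<nabla>\<zeta>\<close> measures how much the velocity crosses the level lines of the cut-off.\<close>

definition R :: "real => real" where
 "R s = (LBINT x. (\<Sum>i\<in>UNIV. v i s x * pd i \<zeta> x)^2)"

lemma zeta_borel [measurable]: "\<zeta> \<in> Borel"
 by (intro borel_measurable_continuous_onI smooth_continuous_on zeta)

lemma dzeta_continuous: "continuous_on UNIV (\<lambda>x. pd i \<zeta> x)"
 by (intro smooth_continuous_on smooth_partial zeta) (auto simp: Basis_vec_def)

lemma dzeta_borel [measurable]: "(\<lambda>x. pd i \<zeta> x) \<in> Borel"
 by (rule borel_measurable_continuous_onI[OF dzeta_continuous])

lemma dzeta_bounded: "\<exists>L>0. \<forall>i x. \<bar>pd i \<zeta> x\<bar> \<le> L"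
proof -
 obtain r where r: "K \<subseteq> ball 0 r" using bounded_subset_ballD[OF compact_imp_bounded[OF K], of 0] by blast
 have z: "pd i \<zeta> x = 0" if "norm x \<ge> r + 1" for x i
 proof (rule frechet_derivative_zero_open[of "- cball 0 r" _ _ 0])
  show "\<zeta> y = 0" if "y \<in> - cball 0 r" for y
   using zeta(3)[of y] r that by (auto simp: subset_iff) (meson dual_order.strict_implies_order)
 qed (use that in auto)
 have "\<exists>L>0. \<forall>x. \<bar>pd i \<zeta> x\<bar> \<le> L" for i
  using continuous_compact_support_bounded[OF dzeta_continuous z] by metis
 then obtain L where L: "\<And>i. L i > 0" "\<And>i x. \<bar>pd i \<zeta> x\<bar> \<le> L i" by metis
 have "\<bar>pd i \<zeta> x\<bar> \<le> max (L 1) (L 2)" for i x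
  using L(2)[of x 1] L(2)[of x 2] exhaust_2[of i] by auto
 then show ?thesis using L(1)[of 1] by (intro exI[of _ "max (L 1) (L 2)"]) auto
qed

lemma V_L2: "L2_fun lborel (\<lambda>x. \<Sum>i\<in>UNIV. v i s x * pd i \<zeta> x)"
proof -
 obtain L where L: "\<And>i x. \<bar>pd i \<zeta> x\<bar> \<le> L" using dzeta_bounded by blast
 have "L2_fun lborel (\<lambda>x. pd i \<zeta> x * v i s x)" for i
  by (rule L2_fun_mult[OF v2(1) _ L]) measurable
 from L2_fun_add[OF this[of 1] this[of 2]] show ?thesis by (simp add: sum_2 mult.commute)
qed

lemma R_borel [measurable]: "R \<in> Borel"
 unfolding R_def[abs_def] by (rule lborel.borel_measurable_lebesgue_integral) measurable

lemma R_nonneg: "0 \<le> R s"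
 by (simp add: R_def)

lemma cutoff_L4: "L4_fun f ==> L4_fun (\<lambda>y. \<zeta> y * f y)"
 unfolding L4_fun_def
proof
 assume f: "f \<in> Borel \<and> L1 (\<lambda>x. f x ^ 4)"
 then have [measurable]: "f \<in> Borel" by simp
 show "(\<lambda>y. \<zeta> y * f y) \<in> Borel" by measurable
 show "L1 (\<lambda>x. (\<zeta> x * f x) ^ 4)"
 proof (rule Bochner_Integration.integrable_bound)
  show "L1 (\<lambda>x. f x ^ 4)" using f by simp
  show "AE x in lborel. norm ((\<zeta> x * f x) ^ 4) \<le> norm (f x ^ 4)"
  proof (intro AE_I2)
   fix x
   have "\<bar>\<zeta> x * f x\<bar> \<le> \<bar>f x\<bar>" using zeta(2)[of x] by (simp add: abs_mult mult_left_le_one_le)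
   from power_mono[OF this, of 4] show "norm ((\<zeta> x * f x) ^ 4) \<le> norm (f x ^ 4)" by simp
  qed
 qed measurable
qed

lemma cutoff_integrable: "L1 f ==> L1 (\<lambda>y. \<zeta> y * f y)"
 using integrable_lborel_mult_bounded[of f \<zeta> 1] zeta(2) by (simp add: mult.commute)

end

section \<open>The energy balance of the mollified density\<close>

locale mollified_transport = cutoff_transport + mollif +
 assumes eps: "0 < \<epsilon>" "\<epsilon> \<le> d / 4"
begin

definition moll :: "(real^2 => real) => real^2 => real" where
 "moll f x = (LBINT y. \<zeta> y * f y * \<eta> (x - y))"

definition flux :: "real => real^2 => real" where
 "flux s x = (LBINT z. H s z * (\<Sum>i\<in>UNIV. v i s z * pd i (\<lambda>z. \<zeta> z * \<eta> (x - z)) z))"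

definition energy_rate :: "real => real" where
 "energy_rate s = (LBINT x. 2 * moll (H s) x * flux s x)"

lemma dtest: "frechet_derivative (\<lambda>z. \<zeta> z * \<eta> (x - z)) (at z) u
  = - \<zeta> z * frechet_derivative \<eta> (at (x - z)) u + frechet_derivative \<zeta> (at z) u * \<eta> (x - z)"
 by (subst frechet_derivative_mult_real[OF smooth_differentiable[OF zeta(1)] smooth_differentiable[OF smooth_eta_shift]]) (simp add: frechet_eta_shift)

lemma dtest_bounded: "\<exists>L>0. \<forall>x i z. \<bar>pd i (\<lambda>z. \<zeta> z * \<eta> (x - z)) z\<bar> \<le> L"
proof -
 obtain L where L: "L > 0" "\<And>i x. \<bar>pd i \<zeta> x\<bar> \<le> L" using dzeta_bounded by blast
 obtain M where M: "M > 0" "\<And>x. \<bar>\<eta> x\<bar> \<le> M" using eta_bounded by blast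
 have "\<bar>pd i (\<lambda>z. \<zeta> z * \<eta> (x - z)) z\<bar> \<le> 1 * (C / \<epsilon> ^ 3) + L * M" for x i z
  unfolding dtest
 proof (rule order_trans[OF abs_triangle_ineq], rule add_mono)
  show "\<bar>- \<zeta> z * pd i \<eta> (x - z)\<bar> \<le> 1 * (C / \<epsilon> ^ 3)"
   unfolding abs_mult by (intro mult_mono) (use zeta(2)[of z] deta_bound in auto)
  show "\<bar>pd i \<zeta> z * \<eta> (x - z)\<bar> \<le> L * M"
   unfolding abs_mult using L M by (intro mult_mono) auto
 qed
 then show ?thesis using L(1) M(1) C_eps_nonneg by (intro exI[of _ "1 * (C / \<epsilon> ^ 3) + L * M"]) (auto intro: add_nonneg_pos)
qed

lemma dtest_joint_measurable [measurable]:
 "(\<lambda>(x, z). pd i (\<lambda>z. \<zeta> z * \<eta> (x - z)) z) \<in> borel_measurable (borel \<Otimes>\<^sub>M borel)"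
 unfolding dtest by measurable

lemma dtest_borel [measurable]:
 "(\<lambda>z. pd i (\<lambda>z. \<zeta> z * \<eta> (x - z)) z) \<in> Borel"
 unfolding dtest by measurable

lemma flux_bounded: "\<exists>c\<ge>0. \<forall>s x. \<bar>flux s x\<bar> \<le> c"
proof -
 obtain L where L: "\<And>x i z. \<bar>pd i (\<lambda>z. \<zeta> z * \<eta> (x - z)) z\<bar> \<le> L"
  using dtest_bounded by blast
 have "\<bar>flux s x\<bar> \<le> L * (2 * vol + 4 * B)" for s x
  unfolding flux_def by (rule bounded_times_Hv(2)[OF L]) measurable
 moreover from this[of 0 0] have "0 \<le> L * (2 * vol + 4 * B)" by (rule order_trans[OF abs_ge_zero])
 ultimately show ?thesis by blast
qed

lemma flux_joint_measurable [measurable]: "case_prod flux \<in> borel_measurable (borel \<Otimes>\<^sub>M borel)"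
proof -
 have m: "(\<lambda>(q, z). H (fst q) z * (\<Sum>i\<in>UNIV. v i (fst q) z * (- \<zeta> z * pd i \<eta> (snd q - z)
   + pd i \<zeta> z * \<eta> (snd q - z)))) \<in> borel_measurable ((borel \<Otimes>\<^sub>M borel) \<Otimes>\<^sub>M lborel)"
  by measurable
 show ?thesis
  unfolding flux_def[abs_def] dtest case_prod_unfold
  using lborel.borel_measurable_lebesgue_integral[OF m] by simp
qed

lemma moll_joint_measurable [measurable]: "(\<lambda>(s, x). moll (H s) x) \<in> borel_measurable (borel \<Otimes>\<^sub>M borel)"
proof -
 have m: "(\<lambda>(q, y). \<zeta> y * H (fst q) y * \<eta> (snd q - y)) \<in> borel_measurable ((borel \<Otimes>\<^sub>M borel) \<Otimes>\<^sub>M lborel)"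
  by measurable
 show ?thesis
  unfolding moll_def[abs_def] case_prod_unfold
  using lborel.borel_measurable_lebesgue_integral[OF m] by simp
qed

definition K2 where "K2 = {x + y | x y. x \<in> K \<and> y \<in> cball 0 \<epsilon>}"

lemma K2_compact: "compact K2"
 unfolding K2_def by (rule compact_add_cball[OF K])

lemma moll_zero: assumes "x \<notin> K2" shows "moll f x = 0"
 unfolding moll_def
proof (rule integral_eq_zero_AE, intro AE_I2)
 fix y
 show "\<zeta> y * f y * \<eta> (x - y) = 0"
 proof (cases "y \<in> K")
  case True
  then have "x \<notin> cball y \<epsilon>" using cball_subset_add[of y K \<epsilon>] assms by (auto simp: K2_def)
  then have "\<eta> (x - y) = 0" by (intro eta_zero) (simp add: dist_norm norm_minus_commute)
  then show ?thesis by simp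
 next
  case False
  then have "\<zeta> y = 0" using zeta(3) by blast
  then show ?thesis by simp
 qed
qed

lemma moll_bound:
 assumes f: "L1 f" and M: "\<And>x. \<bar>\<eta> x\<bar> \<le> M" and c: "(LBINT y. \<bar>f y\<bar>) \<le> c"
 shows "\<bar>moll f x\<bar> \<le> M * c"
proof -
 have M0: "0 \<le> M" using M[of 0] by linarith
 have "\<bar>moll f x\<bar> \<le> (LBINT y. M * \<bar>f y\<bar>)"
  unfolding moll_def
 proof (rule integral_abs_le(2))
  show "L1 (\<lambda>y. M * \<bar>f y\<bar>)" using f by auto
  fix y
  have "\<bar>\<zeta> y\<bar> * \<bar>f y\<bar> * \<bar>\<eta> (x - y)\<bar> \<le> (1 * \<bar>f y\<bar>) * M" by (intro mult_mono zeta(2) M) auto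
  then show "\<bar>\<zeta> y * f y * \<eta> (x - y)\<bar> \<le> M * \<bar>f y\<bar>" by (simp add: abs_mult mult.commute)
 qed
 also have "\<dots> = M * (LBINT y. \<bar>f y\<bar>)" by simp
 also have "\<dots> \<le> M * c" by (intro mult_left_mono c M0)
 finally show ?thesis .
qed

lemma test_is_test: "test_function (annulus a b) (\<lambda>y. \<zeta> y * \<eta> (x - y))"
proof (rule test_function_mult_eta[OF zeta(1)])
 show "closed K" using K by (rule compact_imp_closed)
 show "cball x \<epsilon> \<inter> K \<subseteq> annulus a b" using d by (auto simp: subset_iff)
qed (use zeta(3) in auto)

lemma moll_borel: "L1 f ==> moll f \<in> Borel"
proof -
 assume "L1 f"
 then have [measurable]: "f \<in> Borel" by auto
 show ?thesis unfolding moll_def[abs_def] by (rule lborel.borel_measurable_lebesgue_integral) measurable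
qed

lemma moll_square_integrable: assumes f: "L1 f" shows "L1 (\<lambda>x. (moll f x)^2)"
proof -
 obtain M where M: "M > 0" "\<And>x. \<bar>\<eta> x\<bar> \<le> M" using eta_bounded by blast
 have [measurable]: "moll f \<in> Borel" by (rule moll_borel[OF f])
 have b: "\<bar>(moll f x)^2\<bar> \<le> (M * (LBINT y. \<bar>f y\<bar>))^2" for x
  using power_mono[OF moll_bound[OF f M(2) order_refl, of x], of 2] by simp
 show ?thesis by (rule bounded_compact_support_integrable(1)[OF _ b _ K2_compact]) (measurable, simp add: moll_zero)
qed

text \<open>For each \<open>x\<close> the number \<open>moll (\<Theta> t) x\<close> is the density tested with \<open>\<zeta> \<eta>(x - \<cdot>)\<close>, hence a primitive of \<open>flux\<close>; its square is integrated in time and then in \<open>x\<close>.\<close>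

theorem energy_balance:
 shows "(LBINT x. (moll (\<Theta> \<tau>) x)^2) - (LBINT x. (moll (\<Theta> 0) x)^2) = (LBINT s. ind {0..\<tau>} s * energy_rate s)"
  and "energy_rate \<in> Borel"
proof -
 obtain c where c: "0 \<le> c" "\<And>s x. \<bar>flux s x\<bar> \<le> c" using flux_bounded by blast
 obtain M where M: "M > 0" "\<And>x. \<bar>\<eta> x\<bar> \<le> M" using eta_bounded by blast
 define m where "m = M * (vol + B)"
 have mb: "\<bar>moll (H s) x\<bar> \<le> m" for s x unfolding m_def by (rule moll_bound[OF H_integrable M(2) H_abs_integral])
 have m0: "0 \<le> m" using mb[of 0 0] by linarith
 show er: "energy_rate \<in> Borel"
  unfolding energy_rate_def[abs_def]
  by (rule lborel.borel_measurable_lebesgue_integral) measurable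
 have pointwise: "(moll (\<Theta> \<tau>) x)^2 - (moll (\<Theta> 0) x)^2 = (LBINT s. ind {0..\<tau>} s * (2 * moll (H s) x * flux s x))" for x
 proof -
  have fm: "(\<lambda>s. flux s x) \<in> Borel" by measurable
  have g: "moll (\<Theta> t) x = moll (\<Theta> 0) x + (LBINT s. ind {0..t} s * flux s x)" if "0 \<le> t" "t \<le> \<tau>" for t
   using equation[OF test_is_test that, of x] by (simp add: moll_def flux_def mult.assoc mult.left_commute[of "\<zeta> _"])
  note sq = integral_square_of_primitive[where g = "\<lambda>t. moll (\<Theta> t) x" and G = "\<lambda>s. flux s x", OF tau fm c(2) g]
  have "(LBINT s. ind {0..\<tau>} s * (2 * moll (\<Theta> s) x * flux s x)) = (LBINT s. ind {0..\<tau>} s * (2 * moll (H s) x * flux s x))"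
  proof (rule integral_cong_AE)
   show "(\<lambda>s. ind {0..\<tau>} s * (2 * moll (\<Theta> s) x * flux s x)) \<in> borel_measurable lborel" using sq(2) by simp
   show "(\<lambda>s. ind {0..\<tau>} s * (2 * moll (H s) x * flux s x)) \<in> borel_measurable lborel" by measurable
   show "AE s in lborel. ind {0..\<tau>} s * (2 * moll (\<Theta> s) x * flux s x) = ind {0..\<tau>} s * (2 * moll (H s) x * flux s x)"
    using agree
   proof eventually_elim
    case (elim s)
    show ?case
    proof (cases "s \<in> {0..\<tau>}")
     case True
     then have ae: "AE x in lborel. H s x = \<Theta> s x" using elim by simp
     have [measurable]: "\<Theta> s \<in> Borel" using Theta4[of s] True by (simp add: L4_fun_def)
     have "moll (H s) x = moll (\<Theta> s) x"
      unfolding moll_def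
     proof (rule integral_cong_AE)
      show "AE y in lborel. \<zeta> y * H s y * \<eta> (x - y) = \<zeta> y * \<Theta> s y * \<eta> (x - y)" using ae by eventually_elim simp
     qed measurable
     then show ?thesis by simp
    qed simp
   qed
  qed
  then show ?thesis using sq(1) by simp
 qed
 have "(LBINT x. (moll (\<Theta> \<tau>) x)^2) - (LBINT x. (moll (\<Theta> 0) x)^2) = (LBINT x. (moll (\<Theta> \<tau>) x)^2 - (moll (\<Theta> 0) x)^2)"
  using tau by (intro Bochner_Integration.integral_diff[symmetric] moll_square_integrable Theta_integrable) auto
 also have "\<dots> = (LBINT x. (LBINT s. ind {0..\<tau>} s * (2 * moll (H s) x * flux s x)))"
  by (simp add: pointwise)
 also have "\<dots> = (LBINT s. (LBINT x. ind {0..\<tau>} s * (2 * moll (H s) x * flux s x)))"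
 proof (rule Fubini_bound(1)[where B = "\<lambda>s. (2 * m * c * measure lborel K2) * ind {0..\<tau>} s"])
  have b: "\<bar>ind {0..\<tau>} s * (2 * moll (H s) x * flux s x)\<bar> \<le> 2 * m * c * ind {0..\<tau>} s" for s x
  proof -
   have "\<bar>moll (H s) x\<bar> * \<bar>flux s x\<bar> \<le> m * c" by (intro mult_mono mb c m0) auto
   then show ?thesis by (simp add: indicator_def abs_mult mult.commute[of m])
  qed
  have me: "(\<lambda>x. ind {0..\<tau>} s * (2 * moll (H s) x * flux s x)) \<in> Borel" for s by measurable
  have z: "ind {0..\<tau>} s * (2 * moll (H s) x * flux s x) = 0" if "x \<notin> K2" for s x using moll_zero[OF that] by simp
  show "L1 (\<lambda>x. ind {0..\<tau>} s * (2 * moll (H s) x * flux s x))" for s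
   by (rule bounded_compact_support_integrable(1)[OF me b z K2_compact])
  show "(LBINT x. \<bar>ind {0..\<tau>} s * (2 * moll (H s) x * flux s x)\<bar>) \<le> (2 * m * c * measure lborel K2) * ind {0..\<tau>} s" for s
  proof -
   have "(LBINT x. \<bar>ind {0..\<tau>} s * (2 * moll (H s) x * flux s x)\<bar>) \<le> (2 * m * c * ind {0..\<tau>} s) * measure lborel K2"
    by (rule bounded_compact_support_integrable(2)[OF me b z K2_compact])
   then show ?thesis by (simp only: mult_ac)
  qed
  show "L1 (\<lambda>s. (2 * m * c * measure lborel K2) * ind {0..\<tau>} s)"
   using tau by (intro integrable_mult_right integrable_real_indicator) auto
  show "(\<lambda>(x, s). ind {0..\<tau>} s * (2 * moll (H s) x * flux s x)) \<in> borel_measurable (borel \<Otimes>\<^sub>M borel)" by measurable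
 qed
 also have "\<dots> = (LBINT s. ind {0..\<tau>} s * energy_rate s)"
  by (simp add: energy_rate_def)
 finally show "(LBINT x. (moll (\<Theta> \<tau>) x)^2) - (LBINT x. (moll (\<Theta> 0) x)^2) = (LBINT s. ind {0..\<tau>} s * energy_rate s)" .
qed

text \<open>The margin \<open>\<epsilon> \<le> d/4\<close> keeps all translations by at most \<open>2\<epsilon>\<close> of points near \<open>K\<close> inside the annulus, where \<open>v\<close> has controlled increments and zero divergence.\<close>

theorem energy_rate_bound:
 assumes A: "\<And>h. norm h < 2 * \<epsilon> ==> (LBINT y. (\<zeta> (h + y) * H s (h + y) - \<zeta> y * H s y) ^ 4) \<le> A"
  and pos: "0 < \<mu>" "0 < \<kappa>"
 shows "\<bar>energy_rate s\<bar> \<le> 8 * pi * C * (A / \<mu> + \<mu> * B) + \<kappa> * B + (1 / \<kappa>) * R s"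
proof -
 define K3 where "K3 = {x + y | x y. x \<in> K \<and> y \<in> cball 0 (d / 2)}"
 have K3: "K3 \<in> sets borel" unfolding K3_def by (intro borel_compact compact_add_cball K)
 have "\<bar>energy_rate s\<bar> \<le> 8 * pi * C * (A / \<mu> + \<mu> * B) + \<kappa> * (LBINT x. H s x ^ 4)
    + (1 / \<kappa>) * (LBINT x. (\<Sum>i\<in>UNIV. v i s x * pd i \<zeta> x)^2)"
  unfolding energy_rate_def moll_def flux_def
 proof (rule flux_bound[OF eps(1) H_integrable H4(1) zeta(1,2) v_integrable v2(1) _ A K3 _ _ B_nonneg V_L2 pos])
  fix x y assume y: "\<zeta> y \<noteq> 0" "norm (x - y) < \<epsilon>"
  have "cball x \<epsilon> \<subseteq> cball y d"
  proof
   fix z assume "z \<in> cball x \<epsilon>"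
   then have "norm (z - y) \<le> \<epsilon> + \<epsilon>"
    using norm_triangle_ineq[of "z - x" "x - y"] y(2) by (simp add: dist_norm norm_minus_commute)
   then show "z \<in> cball y d" using eps by (simp add: dist_norm norm_minus_commute)
  qed
  then have "cball x \<epsilon> \<subseteq> annulus a b" using d(2) zeta(3)[OF y(1)] by blast
  from v_div[OF test_function_eta[OF this], of s]
  have "(LBINT z. (\<Sum>i\<in>UNIV. - (v i s z * pd i \<eta> (x - z)))) = 0"
   by (simp add: frechet_eta_shift)
  moreover have "L1 (\<lambda>z. v i s z * pd i \<eta> (x - z))" for i
   by (rule mollify_bounds(1)[OF v_integrable])
  ultimately show "(\<Sum>i\<in>UNIV. LBINT z. v i s z * pd i \<eta> (x - z)) = 0"
   by (simp add: sum_negf)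
 next
  fix h y assume h: "norm (h :: real^2) < 2 * \<epsilon>" and y: "y \<notin> K3"
  have "y \<notin> K" "h + y \<notin> K"
  proof -
   show "y \<notin> K" using y cball_subset_add[of y K "d / 2"] d(1) by (auto simp: K3_def)
   show "h + y \<notin> K"
   proof
    assume "h + y \<in> K"
    moreover have "y \<in> cball (h + y) (d / 2)" using h eps by (simp add: dist_norm)
    ultimately show False using y cball_subset_add[of "h + y" K "d / 2"] by (auto simp: K3_def)
   qed
  qed
  then show "\<zeta> (h + y) = 0 \<and> \<zeta> y = 0" using zeta(3) by blast
 next
  fix h :: "real^2" and i assume h: "norm h < 2 * \<epsilon>"
  show "(LBINT y. ind K3 y * (v i s (h + y) - v i s y)^2) \<le> (norm h)^2 * B"
  proof (rule v_translation[OF K3])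
   fix y r assume y: "y \<in> K3" and r: "0 \<le> r" "r \<le> (1::real)"
   obtain x z where xz: "x \<in> K" "norm z \<le> d / 2" "y = x + z" using y by (auto simp: K3_def)
   have "norm (r *\<^sub>R h) \<le> 1 * norm h" using r by (simp add: mult_left_le_one_le)
   then have "norm (z + r *\<^sub>R h) \<le> d" using xz(2) h eps norm_triangle_ineq[of z "r *\<^sub>R h"] by simp
   moreover have "x - (y + r *\<^sub>R h) = - (z + r *\<^sub>R h)" by (simp add: xz(3))
   ultimately have "y + r *\<^sub>R h \<in> cball x d" by (simp only: mem_cball dist_norm norm_minus_cancel)
   then show "y + r *\<^sub>R h \<in> annulus a b" using d(2)[OF xz(1)] by blast
  qed
 qed
 also have "\<dots> \<le> 8 * pi * C * (A / \<mu> + \<mu> * B) + \<kappa> * B + (1 / \<kappa>) * R s"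
  unfolding R_def using pos H4(2)[of s] by (intro add_right_mono add_left_mono mult_left_mono) auto
 finally show ?thesis .
qed

end

context mollified_transport
begin

text \<open>The energy balance at one scale, with the quantities that depend on the mollifier hidden behind \<open>F\<close>, so that a sequence of scales can be chosen.\<close>

lemma scale_step:
 "\<exists>F. F \<in> Borel \<and>
   (LBINT x. (LBINT y. \<zeta> y * \<Theta> \<tau> y * \<eta> (x - y))^2) - (LBINT x. (LBINT y. \<zeta> y * \<Theta> 0 y * \<eta> (x - y))^2)
    = (LBINT s. ind {0..\<tau>} s * F s) \<and>
   (\<forall>s A \<mu> \<kappa>. (\<forall>h. norm h < 2 * \<epsilon> --> (LBINT y. (\<zeta> (h + y) * H s (h + y) - \<zeta> y * H s y) ^ 4) \<le> A) -->
    0 < \<mu> --> 0 < \<kappa> --> \<bar>F s\<bar> \<le> 8 * pi * C * (A / \<mu> + \<mu> * B) + \<kappa> * B + (1 / \<kappa>) * R s)"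
proof (intro exI[of _ energy_rate] conjI allI impI)
 show "energy_rate \<in> Borel" by (rule energy_balance(2))
 show "(LBINT x. (LBINT y. \<zeta> y * \<Theta> \<tau> y * \<eta> (x - y))^2) - (LBINT x. (LBINT y. \<zeta> y * \<Theta> 0 y * \<eta> (x - y))^2)
    = (LBINT s. ind {0..\<tau>} s * energy_rate s)"
  using energy_balance(1) unfolding moll_def .
qed (rule energy_rate_bound, blast+)

end

context cutoff_transport
begin

lemma R_bounded: "\<exists>c. \<forall>s. R s \<le> c"
proof -
 obtain L where L: "L > 0" "\<And>i x. \<bar>pd i \<zeta> x\<bar> \<le> L" using dzeta_bounded by blast
 have "R s \<le> 2 * L^2 * (B + B)" for s
 proof -
  have iv: "L1 (\<lambda>x. (v i s x)^2)" for i using v2(1) by (simp add: L2_fun_def)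
  have "R s \<le> (LBINT x. 2 * L^2 * ((v 1 s x)^2 + (v 2 s x)^2))"
   unfolding R_def
  proof (rule integral_mono_AE')
   show "L1 (\<lambda>x. 2 * L^2 * ((v 1 s x)^2 + (v 2 s x)^2))" using iv by simp
   have "(\<Sum>i\<in>UNIV. v i s x * pd i \<zeta> x)^2 \<le> 2 * L^2 * ((v 1 s x)^2 + (v 2 s x)^2)" for x
   proof -
    have "(v i s x * pd i \<zeta> x)^2 \<le> (v i s x)^2 * L^2" for i
     unfolding power_mult_distrib using power_mono[OF L(2), where n = 2] by (intro mult_left_mono) simp_all
    then show ?thesis
     unfolding sum_2 using square_add_le[of "v 1 s x * pd 1 \<zeta> x" "v 2 s x * pd 2 \<zeta> x"]
     by (smt (verit, best) distrib_left mult.assoc mult.commute)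
   qed
   then show "AE x in lborel. (\<Sum>i\<in>UNIV. v i s x * pd i \<zeta> x)^2 \<le> 2 * L^2 * ((v 1 s x)^2 + (v 2 s x)^2)" by simp
  qed simp
  also have "\<dots> = 2 * L^2 * ((LBINT x. (v 1 s x)^2) + (LBINT x. (v 2 s x)^2))" using iv by simp
  also have "\<dots> \<le> 2 * L^2 * (B + B)" by (intro mult_left_mono add_mono v2(2)) auto
  finally show ?thesis .
 qed
 then show ?thesis by blast
qed

lemma time_integrable:
 fixes f :: "real => real"
 assumes [measurable]: "f \<in> Borel" and c: "\<And>s. \<bar>f s\<bar> \<le> c"
 shows "L1 (\<lambda>s. ind {0..\<tau>} s * f s)"
proof (rule Bochner_Integration.integrable_bound)
 show "L1 (\<lambda>s. c * ind {0..\<tau>} s)" using tau by (intro integrable_mult_right integrable_real_indicator) auto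
 show "AE s in lborel. norm (ind {0..\<tau>} s * f s) \<le> norm (c * ind {0..\<tau>} s)"
  using order_trans[OF c abs_ge_self] by (intro AE_I2) (auto simp: indicator_def)
qed measurable

lemma R_integrable: "L1 (\<lambda>s. ind {0..\<tau>} s * R s)"
proof -
 obtain c where c: "\<And>s. R s \<le> c" using R_bounded by blast
 show ?thesis by (rule time_integrable[OF R_borel, of c]) (use c R_nonneg in simp)
qed

text \<open>The parameter \<open>A\<close> of the commutator bound tends to zero with \<open>\<epsilon>\<close> at every time, but not uniformly in time.  Since \<open>A\<close> is bounded by a multiple of \<open>B\<close>, dominated convergence removes \<open>A/\<mu>\<close> for each fixed \<open>\<mu>\<close>; afterwards \<open>\<mu>\<close> tends to zero.\<close>

theorem cutoff_balance:
 assumes k: "0 < \<kappa>"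
 shows "\<bar>(LBINT x. (\<zeta> x * \<Theta> \<tau> x)^2) - (LBINT x. (\<zeta> x * \<Theta> 0 x)^2)\<bar>
   \<le> \<tau> * (\<kappa> * B) + (1 / \<kappa>) * (LBINT s. ind {0..\<tau>} s * R s)"
proof -
 obtain C where C: "C > 0" and ex: "\<And>\<epsilon>. \<epsilon> > 0 ==> \<exists>\<eta>. mollifier C \<epsilon> \<eta>" using exists_mollifier by metis
 define \<epsilon> where "\<epsilon> n = d / 4 * (1 / real (Suc n))" for n
 have e: "0 < \<epsilon> n" "\<epsilon> n \<le> d / 4" for n using d(1) by (auto simp: \<epsilon>_def field_simps)
 have elim: "\<epsilon> \<longlonglongrightarrow> 0"
 proof -
  have "(\<lambda>n. d / 4 * (1 / real (Suc n))) \<longlonglongrightarrow> d / 4 * 0"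
   using LIMSEQ_inverse_real_of_nat by (intro tendsto_intros) (simp add: inverse_eq_divide)
  then show ?thesis by (simp add: \<epsilon>_def[abs_def])
 qed
 have "\<exists>\<eta>. \<forall>n. mollifier C (\<epsilon> n) (\<eta> n)" using ex[OF e(1)] by (intro choice allI)
 then obtain \<eta> where mo: "\<And>n. mollifier C (\<epsilon> n) (\<eta> n)" by blast
 define Dl where "Dl n = (LBINT x. (LBINT y. \<zeta> y * \<Theta> \<tau> y * \<eta> n (x - y))^2) - (LBINT x. (LBINT y. \<zeta> y * \<Theta> 0 y * \<eta> n (x - y))^2)" for n
 have "\<exists>F. \<forall>n. F n \<in> Borel \<and> Dl n = (LBINT s. ind {0..\<tau>} s * F n s) \<and>
   (\<forall>s A \<mu> \<kappa>. (\<forall>h. norm h < 2 * \<epsilon> n --> (LBINT y. (\<zeta> (h + y) * H s (h + y) - \<zeta> y * H s y) ^ 4) \<le> A) -->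
    0 < \<mu> --> 0 < \<kappa> --> \<bar>F n s\<bar> \<le> 8 * pi * C * (A / \<mu> + \<mu> * B) + \<kappa> * B + (1 / \<kappa>) * R s)"
 proof (intro choice allI)
  fix n
  interpret mollified_transport a b \<tau> B \<Theta> H v \<zeta> K d C "\<epsilon> n" "\<eta> n"
   by unfold_locales (rule mo e)+
  show "\<exists>F. F \<in> Borel \<and> Dl n = (LBINT s. ind {0..\<tau>} s * F s) \<and>
   (\<forall>s A \<mu> \<kappa>. (\<forall>h. norm h < 2 * \<epsilon> n --> (LBINT y. (\<zeta> (h + y) * H s (h + y) - \<zeta> y * H s y) ^ 4) \<le> A) -->
    0 < \<mu> --> 0 < \<kappa> --> \<bar>F s\<bar> \<le> 8 * pi * C * (A / \<mu> + \<mu> * B) + \<kappa> * B + (1 / \<kappa>) * R s)"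
   using scale_step unfolding Dl_def .
 qed
 then obtain F where F: "\<forall>n. F n \<in> Borel \<and> Dl n = (LBINT s. ind {0..\<tau>} s * F n s) \<and>
   (\<forall>s A \<mu> \<kappa>. (\<forall>h. norm h < 2 * \<epsilon> n --> (LBINT y. (\<zeta> (h + y) * H s (h + y) - \<zeta> y * H s y) ^ 4) \<le> A) -->
    0 < \<mu> --> 0 < \<kappa> --> \<bar>F n s\<bar> \<le> 8 * pi * C * (A / \<mu> + \<mu> * B) + \<kappa> * B + (1 / \<kappa>) * R s)"
  by (elim exE)
 have Fm[measurable]: "F n \<in> Borel" for n using F by blast
 have DlF: "Dl n = (LBINT s. ind {0..\<tau>} s * F n s)" for n using F by blast
 have Fb: "\<bar>F n s\<bar> \<le> 8 * pi * C * (A / \<mu> + \<mu> * B) + \<kappa> * B + (1 / \<kappa>) * R s"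
  if "\<And>h. norm h < 2 * \<epsilon> n ==> (LBINT y. (\<zeta> (h + y) * H s (h + y) - \<zeta> y * H s y) ^ 4) \<le> A" "0 < \<mu>" for n s A \<mu>
  using F that k by blast
 define c1 where "c1 = 8 * pi * C"
 have c1: "c1 > 0" using C by (simp add: c1_def)
 have w1: "L1 (\<lambda>y. \<zeta> y * H s y)" and w4: "L4_fun (\<lambda>y. \<zeta> y * H s y)" for s
  by (rule cutoff_integrable[OF H_integrable], rule cutoff_L4[OF H4(1)])
 have w4B: "(LBINT y. (\<zeta> y * H s y) ^ 4) \<le> B" for s
 proof -
  have "(LBINT y. (\<zeta> y * H s y) ^ 4) \<le> (LBINT y. H s y ^ 4)"
  proof (rule integral_mono)
   show "L1 (\<lambda>y. (\<zeta> y * H s y) ^ 4)" "L1 (\<lambda>y. H s y ^ 4)"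
    using w4 H4(1) by (auto simp: L4_fun_def)
   fix y
   have "\<bar>\<zeta> y * H s y\<bar> \<le> \<bar>H s y\<bar>" using zeta(2)[of y] by (simp add: abs_mult mult_left_le_one_le)
   from power_mono[OF this, of 4] show "(\<zeta> y * H s y) ^ 4 \<le> H s y ^ 4" by simp
  qed
  then show ?thesis using H4(2)[of s] by linarith
 qed
 have A54: "(LBINT y. (\<zeta> (h + y) * H s (h + y) - \<zeta> y * H s y) ^ 4) \<le> 54 * B" for h s
 proof -
  define w where "w y = \<zeta> y * H s y" for y
  have w4': "L4_fun w" using w4 by (simp add: w_def[abs_def])
  have wB: "(LBINT y. w y ^ 4) \<le> B" using w4B by (simp add: w_def)
  have i: "L1 (\<lambda>y. w y ^ 4)" "L1 (\<lambda>y. w (h + y) ^ 4)"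
   using w4' L4_fun_shift[OF w4', of h] by (auto simp: L4_fun_def)
  have sh: "(LBINT y. w (h + y) ^ 4) = (LBINT y. w y ^ 4)"
   using w4' by (intro lborel_shift(1)[of "\<lambda>y. w y ^ 4"]) (auto simp: L4_fun_def)
  have "(LBINT y. (w (h + y) - w y) ^ 4) \<le> (LBINT y. 27 * (w (h + y) ^ 4 + w y ^ 4))"
  proof (rule integral_mono_AE')
   show "AE y in lborel. (w (h + y) - w y) ^ 4 \<le> 27 * (w (h + y) ^ 4 + w y ^ 4)"
    using fourth_power_triangle[of "w (h + _)" "- w _" 0] by (intro AE_I2) simp
  qed (use i in auto)
  also have "\<dots> = 27 * ((LBINT y. w (h + y) ^ 4) + (LBINT y. w y ^ 4))" using i by simp
  also have "\<dots> \<le> 54 * B" unfolding sh using wB by simp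
  finally show ?thesis by (simp add: w_def)
 qed
 define I where "I = (LBINT s. ind {0..\<tau>} s * R s)"
 have main: "\<bar>(LBINT x. (\<zeta> x * \<Theta> \<tau> x)^2) - (LBINT x. (\<zeta> x * \<Theta> 0 x)^2)\<bar>
   \<le> \<tau> * (c1 * \<mu> * B + \<kappa> * B) + (1 / \<kappa>) * I" if mu: "0 < \<mu>" for \<mu>
 proof -
  (* The part of the bound on F that survives the limit; ex is the excess over it. *)
  define base where "base s = c1 * \<mu> * B + \<kappa> * B + (1 / \<kappa>) * R s" for s
  have [measurable]: "base \<in> Borel" unfolding base_def[abs_def] by measurable
  define ex where "ex n s = max 0 (\<bar>F n s\<bar> - base s)" for n s
  have exm[measurable]: "ex n \<in> Borel" for n unfolding ex_def[abs_def] by measurable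
  have exle: "ex n s \<le> c1 * (A / \<mu>)"
   if "\<And>h. norm h < 2 * \<epsilon> n ==> (LBINT y. (\<zeta> (h + y) * H s (h + y) - \<zeta> y * H s y) ^ 4) \<le> A" "0 \<le> A" for n s A
  proof -
   have "\<bar>F n s\<bar> \<le> c1 * (A / \<mu> + \<mu> * B) + \<kappa> * B + (1 / \<kappa>) * R s" using Fb[OF that(1) mu] by (simp add: c1_def)
   then have "\<bar>F n s\<bar> - base s \<le> c1 * (A / \<mu>)" by (simp add: base_def distrib_left mult.assoc)
   moreover have "0 \<le> c1 * (A / \<mu>)" using c1 that(2) mu by simp
   ultimately show ?thesis by (simp add: ex_def)
  qed
  have exb: "ex n s \<le> c1 * (54 * B / \<mu>)" for n s
   by (rule exle) (use A54 B_nonneg in auto)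
  have ex0: "0 \<le> ex n s" for n s by (simp add: ex_def)
  have exlim: "(\<lambda>n. ex n s) \<longlonglongrightarrow> 0" for s
  proof (rule LIMSEQ_I)
   fix r :: real assume r: "r > 0"
   define A where "A = r * \<mu> / (2 * c1)"
   have A: "A > 0" using r mu c1 by (simp add: A_def)
   have i4: "L1 (\<lambda>y. (\<zeta> y * H s y) ^ 4)" using w4[of s] by (simp add: L4_fun_def)
   obtain \<delta> where dl: "\<delta> > 0" "\<And>h. norm h < \<delta> ==> (LBINT y. (\<zeta> (h + y) * H s (h + y) - \<zeta> y * H s y) ^ 4) \<le> A"
   proof (rule L4_translation_modulus[OF w1[of s] i4 A], goal_cases)
    case (1 \<delta>)
    show ?case by (rule 1(1)) (rule 1(2), rule 1(3))
   qed
   have "\<forall>\<^sub>F n in sequentially. \<epsilon> n < \<delta> / 2" using dl(1) by (intro order_tendstoD(2)[OF elim]) auto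
   then obtain n0 where n0: "\<And>n. n \<ge> n0 ==> \<epsilon> n < \<delta> / 2" by (auto simp: eventually_sequentially)
   show "\<exists>n0. \<forall>n\<ge>n0. norm (ex n s - 0) < r"
   proof (intro exI[of _ n0] allI impI)
    fix n assume n: "n0 \<le> n"
    have "ex n s \<le> c1 * (A / \<mu>)" by (rule exle) (use dl(2) n0[OF n] A in auto)
    also have "\<dots> = r / 2" using c1 mu by (simp add: A_def)
    finally show "norm (ex n s - 0) < r" using ex0[of n s] r by simp
   qed
  qed
  have exlim_int: "(\<lambda>n. LBINT s. ind {0..\<tau>} s * ex n s) \<longlonglongrightarrow> 0"
  proof -
   have "(\<lambda>n. LBINT s. ind {0..\<tau>} s * ex n s) \<longlonglongrightarrow> (\<integral>s. 0 \<partial>(lborel :: real measure))"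
   proof (rule integral_dominated_convergence[where w = "\<lambda>s. (c1 * (54 * B / \<mu>)) * ind {0..\<tau>} s"])
    show "L1 (\<lambda>s. (c1 * (54 * B / \<mu>)) * ind {0..\<tau>} s)"
     using tau by (intro integrable_mult_right integrable_real_indicator) auto
    show "AE s in lborel. (\<lambda>n. ind {0..\<tau>} s * ex n s) \<longlonglongrightarrow> 0"
     using tendsto_mult_left[OF exlim] by (intro AE_I2) fastforce
    show "AE s in lborel. norm (ind {0..\<tau>} s * ex n s) \<le> c1 * (54 * B / \<mu>) * ind {0..\<tau>} s" for n
     using exb ex0 by (intro AE_I2) (auto simp: indicator_def)
   qed measurable
   then show ?thesis by simp
  qed
  have iex: "L1 (\<lambda>s. ind {0..\<tau>} s * ex n s)" for n
   by (rule time_integrable[of _ "c1 * (54 * B / \<mu>)"]) (use exb ex0 in auto)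
  have ic: "L1 (\<lambda>s. (c1 * \<mu> * B + \<kappa> * B) * ind {0..\<tau>} s)"
   using tau by (intro integrable_mult_right integrable_real_indicator) auto
  have Dlb: "\<bar>Dl n\<bar> \<le> (LBINT s. ind {0..\<tau>} s * ex n s) + \<tau> * (c1 * \<mu> * B + \<kappa> * B) + (1 / \<kappa>) * I" for n
  proof -
   have "\<bar>Dl n\<bar> \<le> (LBINT s. ind {0..\<tau>} s * ex n s + (c1 * \<mu> * B + \<kappa> * B) * ind {0..\<tau>} s + (1 / \<kappa>) * (ind {0..\<tau>} s * R s))"
    unfolding DlF
   proof (rule integral_abs_le(2))
    show "L1 (\<lambda>s. ind {0..\<tau>} s * ex n s + (c1 * \<mu> * B + \<kappa> * B) * ind {0..\<tau>} s + (1 / \<kappa>) * (ind {0..\<tau>} s * R s))"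
     by (intro Bochner_Integration.integrable_add iex ic integrable_mult_right R_integrable)
    fix s
    have "\<bar>F n s\<bar> \<le> ex n s + base s" by (simp add: ex_def)
    then show "\<bar>ind {0..\<tau>} s * F n s\<bar> \<le> ind {0..\<tau>} s * ex n s + (c1 * \<mu> * B + \<kappa> * B) * ind {0..\<tau>} s + (1 / \<kappa>) * (ind {0..\<tau>} s * R s)"
     by (auto simp: indicator_def base_def)
   qed
   also have "\<dots> = (LBINT s. ind {0..\<tau>} s * ex n s) + \<tau> * (c1 * \<mu> * B + \<kappa> * B) + (1 / \<kappa>) * I"
    using iex ic R_integrable tau by (simp add: I_def)
   finally show ?thesis .
  qed
  have lim0: "Dl \<longlonglongrightarrow> (LBINT x. (\<zeta> x * \<Theta> \<tau> x)^2) - (LBINT x. (\<zeta> x * \<Theta> 0 x)^2)"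
   unfolding Dl_def[abs_def] using tau
   by (intro tendsto_diff mollified_square_tendsto[OF cutoff_integrable cutoff_L4 elim mo] Theta_integrable Theta4) auto
  have "(\<lambda>n. (LBINT s. ind {0..\<tau>} s * ex n s) + \<tau> * (c1 * \<mu> * B + \<kappa> * B) + (1 / \<kappa>) * I)
    \<longlonglongrightarrow> 0 + \<tau> * (c1 * \<mu> * B + \<kappa> * B) + (1 / \<kappa>) * I"
   by (intro tendsto_intros exlim_int)
  then have "\<bar>(LBINT x. (\<zeta> x * \<Theta> \<tau> x)^2) - (LBINT x. (\<zeta> x * \<Theta> 0 x)^2)\<bar> \<le> 0 + \<tau> * (c1 * \<mu> * B + \<kappa> * B) + (1 / \<kappa>) * I"
   using Dlb by (intro LIMSEQ_le[OF tendsto_rabs[OF lim0]]) auto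
  then show ?thesis by simp
 qed
 have "\<bar>(LBINT x. (\<zeta> x * \<Theta> \<tau> x)^2) - (LBINT x. (\<zeta> x * \<Theta> 0 x)^2)\<bar> \<le> \<tau> * (\<kappa> * B) + (1 / \<kappa>) * I"
 proof (rule field_le_epsilon)
  fix r :: real assume r: "r > 0"
  define q where "q = \<tau> * c1 * B"
  have q: "0 \<le> q" using tau c1 B_nonneg by (simp add: q_def)
  define \<mu> where "\<mu> = r / (q + 1)"
  have mu: "\<mu> > 0" using r q by (simp add: \<mu>_def)
  have "q * \<mu> \<le> r" using r q by (simp add: \<mu>_def field_simps)
  moreover have "\<tau> * (c1 * \<mu> * B + \<kappa> * B) = q * \<mu> + \<tau> * (\<kappa> * B)" by (simp add: q_def algebra_simps)
  ultimately show "\<bar>(LBINT x. (\<zeta> x * \<Theta> \<tau> x)^2) - (LBINT x. (\<zeta> x * \<Theta> 0 x)^2)\<bar> \<le> \<tau> * (\<kappa> * B) + (1 / \<kappa>) * I + r"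
   using main[OF mu] by linarith
 qed
 then show ?thesis by (simp add: I_def)
qed

end

section \<open>Removing the cut-off\<close>

text \<open>A product of two smooth steps in \<open>|x|^2\<close>.  Its gradient is radial, which is recorded by the scalar factor \<open>m\<close>, and \<open>M\<close> does not depend on the width \<open>\<delta>\<close> of the strips.\<close>

lemma radial_cutoff:
 fixes a b :: real
 obtains M :: real where "M > 0"
  "\<And>\<delta>. 0 < \<delta> ==> 8 * \<delta> \<le> b^2 - a^2 ==> \<exists>(\<zeta> :: real^2 => real) m. smooth \<zeta> \<and> (\<forall>x. 0 \<le> \<zeta> x \<and> \<zeta> x \<le> 1) \<and>
    (\<forall>x. \<zeta> x \<noteq> 0 --> a^2 + \<delta> \<le> x \<bullet> x \<and> x \<bullet> x \<le> b^2 - \<delta>) \<and>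
    (\<forall>x. a^2 + 2 * \<delta> \<le> x \<bullet> x --> x \<bullet> x \<le> b^2 - 2 * \<delta> --> \<zeta> x = 1) \<and>
    (\<forall>x i. pd i \<zeta> x = m x * x $ i) \<and> (\<forall>x. \<bar>m x\<bar> \<le> M / \<delta>) \<and>
    (\<forall>x. m x \<noteq> 0 --> a^2 + \<delta> \<le> x \<bullet> x \<and> x \<bullet> x \<le> a^2 + 2 * \<delta> \<or> b^2 - 2 * \<delta> \<le> x \<bullet> x \<and> x \<bullet> x \<le> b^2 - \<delta>)"
proof -
 obtain S :: "real => real" where S: "smooth S" "\<And>t. t \<le> 0 ==> S t = 0" "\<And>t. t \<ge> 1 ==> S t = 1"
  "\<And>t. 0 \<le> S t" "\<And>t. S t \<le> 1"
 proof (rule exists_smooth_step, goal_cases)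
  case (1 S)
  show ?case by (rule 1(1)) (fact 1(2-6))+
 qed
 define S' where "S' t = frechet_derivative S (at t) 1" for t
 have S'c: "continuous_on UNIV S'"
  unfolding S'_def[abs_def] by (rule smooth_continuous_on[OF smooth_partial[OF S(1)]]) simp
 have S'0: "S' t = 0" if "t < 0 \<or> 1 < t" for t
 proof (cases "t < 0")
  case True
  then show ?thesis unfolding S'_def by (intro frechet_derivative_zero_open[of "{..<0}" _ _ 0]) (auto intro: S)
 next
  case False
  with that show ?thesis unfolding S'_def by (intro frechet_derivative_zero_open[of "{1<..}" _ _ 1]) (auto intro: S)
 qed
 obtain L where L: "L > 0" "\<And>t. \<bar>S' t\<bar> \<le> L"
 proof (rule continuous_compact_support_bounded[OF S'c, of 2], goal_cases)
  case (1 x)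
  then show ?case by (intro S'0) auto
 next
  case (2 L)
  show ?case by (rule 2(1)) (fact 2(2), rule 2(3))
 qed
 have SD: "(S has_real_derivative S' t) (at t)" for t
 proof -
  have h: "(S has_derivative frechet_derivative S (at t)) (at t)" by (rule smooth_has_derivative[OF S(1)])
  have "frechet_derivative S (at t) h = S' t * h" for h
   unfolding S'_def using linear_cmul[OF has_derivative_linear[OF h], of h 1] by (simp only: real_scaleR_def mult.right_neutral mult.commute[of h])
  then have "frechet_derivative S (at t) = (*) (S' t)" by (rule ext)
  then show ?thesis using h unfolding has_field_derivative_def by (simp only:)
 qed
 show ?thesis
 proof (rule that[of "4 * L"])
  show "4 * L > 0" using L by simp
  fix \<delta> :: real assume d: "0 < \<delta>" "8 * \<delta> \<le> b^2 - a^2"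
  define g1 where "g1 t = (t - (a^2 + \<delta>)) / \<delta>" for t :: real
  define g2 where "g2 t = ((b^2 - \<delta>) - t) / \<delta>" for t :: real
  define p where "p t = S (g1 t) * S (g2 t)" for t
  define m where "m t = 2 * (S' (g1 t) * (1 / \<delta>) * S (g2 t) - S (g1 t) * (S' (g2 t) * (1 / \<delta>)))" for t
  define \<zeta> :: "real^2 => real" where "\<zeta> x = p (x \<bullet> x)" for x
  have "smooth (\<lambda>t::real. S (- ((a^2 + \<delta>) / \<delta>) + (1 / \<delta>) *\<^sub>R t) * S ((b^2 - \<delta>) / \<delta> + (- (1 / \<delta>)) *\<^sub>R t))"
   by (intro smooth_mult smooth_affine S(1))
  moreover have "- ((a^2 + \<delta>) / \<delta>) + (1 / \<delta>) *\<^sub>R t = g1 t" "(b^2 - \<delta>) / \<delta> + (- (1 / \<delta>)) *\<^sub>R t = g2 t" for t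
   by (simp_all add: g1_def g2_def diff_divide_distrib add_divide_distrib)
  ultimately have "smooth p" by (simp only: p_def[abs_def])
  then have sm: "smooth \<zeta>" unfolding \<zeta>_def[abs_def] by (rule smooth_compose[OF _ smooth_norm_sq])
  have pD: "(p has_real_derivative m t / 2) (at t)" for t
  proof -
   have "(g1 has_real_derivative 1 / \<delta>) (at t)" "(g2 has_real_derivative - (1 / \<delta>)) (at t)"
    unfolding g1_def[abs_def] g2_def[abs_def] using d by (auto intro!: derivative_eq_intros simp: field_simps)
   then have "(p has_real_derivative S (g1 t) * (S' (g2 t) * - (1 / \<delta>)) + (S' (g1 t) * (1 / \<delta>)) * S (g2 t)) (at t)"
    unfolding p_def[abs_def] by (intro DERIV_mult' DERIV_chain2[OF SD])
   then show ?thesis by (rule back_subst[of "\<lambda>m. (p has_real_derivative m) (at t)"]) (simp add: m_def algebra_simps)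
  qed
  have fd: "pd i \<zeta> x = m (x \<bullet> x) * x $ i" for x i
  proof -
   have "((\<lambda>x. x \<bullet> x) has_derivative (\<lambda>h. x \<bullet> h + h \<bullet> x)) (at x)" by (auto intro!: derivative_eq_intros)
   then have "(\<zeta> has_derivative (\<lambda>h. m (x \<bullet> x) / 2 * (x \<bullet> h + h \<bullet> x))) (at x)"
    unfolding \<zeta>_def[abs_def] by (rule has_derivative_compose) (rule pD[unfolded has_field_derivative_def])
   then have "frechet_derivative \<zeta> (at x) = (\<lambda>h. m (x \<bullet> x) / 2 * (x \<bullet> h + h \<bullet> x))" by (simp add: frechet_derivative_at[symmetric])
   then show ?thesis by (simp add: inner_axis inner_axis' field_simps)
  qed
  have mb: "\<bar>m t\<bar> \<le> 4 * L / \<delta>" for t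
  proof -
   have "\<bar>S' (g1 t) * S (g2 t)\<bar> \<le> L * 1" "\<bar>S (g1 t) * S' (g2 t)\<bar> \<le> 1 * L"
    unfolding abs_mult using L S by (intro mult_mono; simp)+
   then have "\<bar>S' (g1 t) * S (g2 t) - S (g1 t) * S' (g2 t)\<bar> \<le> 2 * L" by linarith
   moreover have "m t = (S' (g1 t) * S (g2 t) - S (g1 t) * S' (g2 t)) * (2 / \<delta>)" using d by (simp add: m_def field_simps)
   ultimately show ?thesis using d by (simp add: abs_mult field_simps)
  qed
  have gp: "g1 t < 0 \<longleftrightarrow> t < a^2 + \<delta>" "1 < g1 t \<longleftrightarrow> a^2 + 2 * \<delta> < t" "g1 t \<le> 0 \<longleftrightarrow> t \<le> a^2 + \<delta>" "1 \<le> g1 t \<longleftrightarrow> a^2 + 2 * \<delta> \<le> t"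
   "g2 t < 0 \<longleftrightarrow> b^2 - \<delta> < t" "1 < g2 t \<longleftrightarrow> t < b^2 - 2 * \<delta>" "g2 t \<le> 0 \<longleftrightarrow> b^2 - \<delta> \<le> t" "1 \<le> g2 t \<longleftrightarrow> t \<le> b^2 - 2 * \<delta>" for t
   using d by (auto simp: g1_def g2_def field_simps)
  have m0: "a^2 + \<delta> \<le> t \<and> t \<le> a^2 + 2 * \<delta> \<or> b^2 - 2 * \<delta> \<le> t \<and> t \<le> b^2 - \<delta>" if "m t \<noteq> 0" for t
  proof (rule ccontr)
   assume n: "\<not> ?thesis"
   consider "t < a^2 + \<delta>" | "b^2 - \<delta> < t" | "a^2 + 2 * \<delta> < t" "t < b^2 - 2 * \<delta>" using n by linarith
   then have "m t = 0"
    by cases (use gp[of t] S'0[of "g1 t"] S'0[of "g2 t"] S(2)[of "g1 t"] S(2)[of "g2 t"] in \<open>auto simp: m_def\<close>)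
   then show False using that by simp
  qed
  have supp: "a^2 + \<delta> \<le> x \<bullet> x \<and> x \<bullet> x \<le> b^2 - \<delta>" if "\<zeta> x \<noteq> 0" for x
   using that S(2)[of "g1 (x \<bullet> x)"] S(2)[of "g2 (x \<bullet> x)"] gp(3,7)[of "x \<bullet> x"] by (auto simp: \<zeta>_def p_def not_le intro: ccontr)
  have one: "\<zeta> x = 1" if "a^2 + 2 * \<delta> \<le> x \<bullet> x" "x \<bullet> x \<le> b^2 - 2 * \<delta>" for x
   using that gp(4,8)[of "x \<bullet> x"] by (simp add: \<zeta>_def p_def S(3))
  have bd: "0 \<le> \<zeta> x \<and> \<zeta> x \<le> 1" for x
   using S(4,5) by (simp add: \<zeta>_def p_def mult_le_one)
  show "\<exists>(\<zeta> :: real^2 => real) m. smooth \<zeta> \<and> (\<forall>x. 0 \<le> \<zeta> x \<and> \<zeta> x \<le> 1) \<and>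
    (\<forall>x. \<zeta> x \<noteq> 0 --> a^2 + \<delta> \<le> x \<bullet> x \<and> x \<bullet> x \<le> b^2 - \<delta>) \<and>
    (\<forall>x. a^2 + 2 * \<delta> \<le> x \<bullet> x --> x \<bullet> x \<le> b^2 - 2 * \<delta> --> \<zeta> x = 1) \<and>
    (\<forall>x i. pd i \<zeta> x = m x * x $ i) \<and> (\<forall>x. \<bar>m x\<bar> \<le> 4 * L / \<delta>) \<and>
    (\<forall>x. m x \<noteq> 0 --> a^2 + \<delta> \<le> x \<bullet> x \<and> x \<bullet> x \<le> a^2 + 2 * \<delta> \<or> b^2 - 2 * \<delta> \<le> x \<bullet> x \<and> x \<bullet> x \<le> b^2 - \<delta>)"
   by (rule exI[of _ \<zeta>], rule exI[of _ "\<lambda>x. m (x \<bullet> x)"]) (intro conjI allI impI sm bd supp one fd mb m0; assumption)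
 qed
qed

context transport
begin

text \<open>In \<open>|x|^2\<close> the strips have width \<open>3\<delta>\<close>: slightly more than the region where the gradient of the cut-off lives.\<close>

definition inner_strip :: "real => (real^2) set" where
 "inner_strip \<delta> = {x. a < norm x \<and> norm x < sqrt (a^2 + 3 * \<delta>)}"

definition outer_strip :: "real => (real^2) set" where
 "outer_strip \<delta> = {x. sqrt (b^2 - 3 * \<delta>) < norm x \<and> norm x < b}"

lemma strip_borel [measurable]: "inner_strip \<delta> \<in> sets borel" "outer_strip \<delta> \<in> sets borel"
 unfolding inner_strip_def outer_strip_def
 by (intro borel_open open_Collect_conj open_Collect_less continuous_intros)+

lemma radial_velocity_L2: "L2_fun lborel (\<lambda>x. \<Sum>i\<in>UNIV. x $ i * v i s x)"
proof -
 have c: "\<bar>ind \<Omega> x * x $ i\<bar> \<le> b" for x i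
 proof (cases "x \<in> \<Omega>")
  case True
  then have "norm x < b" using annulus_eq_norm[of a b] ab by simp
  then show ?thesis using component_le_norm_cart[of x i] True by simp
 qed (use ab in simp)
 have [measurable]: "\<Omega> \<in> sets borel" by (rule omega_facts)
 have e: "(\<lambda>x. ind \<Omega> x * x $ i * v i s x) = (\<lambda>x. x $ i * v i s x)" for i
  by (rule ext) (metis indicator_simps mult.left_neutral mult_zero_right v_zero)
 have "L2_fun lborel (\<lambda>x. ind \<Omega> x * x $ i * v i s x)" for i
  by (rule L2_fun_mult[OF v2(1) _ c]) measurable
 then have i: "L2_fun lborel (\<lambda>x. x $ i * v i s x)" for i unfolding e .
 from L2_fun_add[OF i[of 1] i[of 2]] show ?thesis by (simp add: sum_2)
qed

lemma strip_widths:
 assumes "0 < \<delta>" "8 * \<delta> \<le> b^2 - a^2"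
 shows "a < sqrt (a^2 + 3 * \<delta>)" "sqrt (a^2 + 3 * \<delta>) \<le> b" "(sqrt (a^2 + 3 * \<delta>) - a)^2 \<le> (3 * \<delta> / a)^2"
  "a \<le> sqrt (b^2 - 3 * \<delta>)" "sqrt (b^2 - 3 * \<delta>) < b" "(b - sqrt (b^2 - 3 * \<delta>))^2 \<le> (3 * \<delta> / a)^2"
proof -
 have n: "0 \<le> a^2 + 3 * \<delta>" "0 \<le> b^2 - 3 * \<delta>" using assms zero_le_power2[of a] by linarith+
 show 1: "a < sqrt (a^2 + 3 * \<delta>)" using assms by (intro real_less_rsqrt) simp
 show "sqrt (a^2 + 3 * \<delta>) \<le> b" using assms ab by (intro real_le_lsqrt) auto
 show 4: "a \<le> sqrt (b^2 - 3 * \<delta>)" using assms by (intro real_le_rsqrt) auto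
 show 5: "sqrt (b^2 - 3 * \<delta>) < b" using assms ab by (intro real_less_lsqrt) auto
 have w: "(y - x)^2 \<le> (3 * \<delta> / a)^2" if "y^2 - x^2 = 3 * \<delta>" "0 \<le> x" "x < y" "a \<le> y" for x y
 proof -
  have "(y - x) * a \<le> (y - x) * (y + x)" using that by (intro mult_left_mono) auto
  also have "\<dots> = 3 * \<delta>" using that(1) by (simp add: power2_eq_square algebra_simps)
  finally have "y - x \<le> 3 * \<delta> / a" using ab by (simp add: field_simps)
  then show ?thesis using that by (intro power_mono) auto
 qed
 show "(sqrt (a^2 + 3 * \<delta>) - a)^2 \<le> (3 * \<delta> / a)^2" using n 1 ab by (intro w) auto
 show "(b - sqrt (b^2 - 3 * \<delta>))^2 \<le> (3 * \<delta> / a)^2" using n 4 5 ab by (intro w) auto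
qed

text \<open>The factor \<open>(M/\<delta>)^2\<close> from the gradient is compensated by the squared width of the strip in the Hardy inequality.\<close>

lemma cutoff_flux_at_boundary:
 assumes d: "0 < \<delta>" "8 * \<delta> \<le> b^2 - a^2"
  and m: "\<And>x i. pd i \<zeta> x = m x * x $ i" "\<And>x. \<bar>m x\<bar> \<le> M / \<delta>"
   "\<And>x. m x \<noteq> 0 ==> a^2 + \<delta> \<le> x \<bullet> x \<and> x \<bullet> x \<le> a^2 + 2 * \<delta> \<or> b^2 - 2 * \<delta> \<le> x \<bullet> x \<and> x \<bullet> x \<le> b^2 - \<delta>"
  and Psi: "\<And>p q. a \<le> p ==> p < q ==> q \<le> b ==> p = a \<or> q = b ==>
    (LBINT x. ind {x. p < norm x \<and> norm x < q} x * (\<Sum>i\<in>UNIV. x $ i * v i s x)^2)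
     \<le> 2 * (q - p)^2 * (b / a) * (LBINT x. ind {x. p < norm x \<and> norm x < q} x * \<Psi> x)"
   "\<And>x. 0 \<le> \<Psi> x"
 shows "(LBINT x. (\<Sum>i\<in>UNIV. v i s x * pd i \<zeta> x)^2)
  \<le> 18 * M^2 * b / a ^ 3 * ((LBINT x. indicator (inner_strip \<delta>) x * \<Psi> x) + (LBINT x. indicator (outer_strip \<delta>) x * \<Psi> x))"
proof -
 define V where "V x = (\<Sum>i\<in>UNIV. x $ i * v i s x)" for x
 define c where "c = (M / \<delta>)^2"
 have iV: "L1 (\<lambda>x. (V x)^2)" using radial_velocity_L2[of s] by (simp add: L2_fun_def V_def)
 have iT: "L1 (\<lambda>x. ind T x * (V x)^2)" if "T \<in> sets borel" for T
  using integrable_mult_indicator[OF _ iV, of T] that by simp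
 have c0: "0 \<le> c" by (simp add: c_def)
 have mc: "(m x)^2 \<le> c" for x unfolding c_def using power_mono[OF m(2)[of x], of 2] by simp
 have e: "(\<Sum>i\<in>UNIV. v i s x * pd i \<zeta> x) = m x * V x" for x
  by (simp add: m(1) V_def sum_distrib_left mult_ac)
 have "(LBINT x. (m x * V x)^2)
  \<le> (LBINT x. c * (indicator (inner_strip \<delta>) x * (V x)^2 + indicator (outer_strip \<delta>) x * (V x)^2))"
 proof (rule integral_mono_AE')
  show "L1 (\<lambda>x. c * (indicator (inner_strip \<delta>) x * (V x)^2 + indicator (outer_strip \<delta>) x * (V x)^2))"
   by (intro integrable_mult_right Bochner_Integration.integrable_add iT strip_borel)
  have "(m x * V x)^2 \<le> c * (indicator (inner_strip \<delta>) x * (V x)^2 + indicator (outer_strip \<delta>) x * (V x)^2)" for x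
  proof (cases "m x * V x = 0")
   case True
   then show ?thesis using c0 by (simp only: True) simp
  next
   case False
   then have mx: "m x \<noteq> 0" by auto
   have nn: "x \<bullet> x = (norm x)^2" by (simp add: dot_square_norm)
   have "x \<in> inner_strip \<delta> \<or> x \<in> outer_strip \<delta>"
    using m(3)[OF mx] unfolding nn
   proof (elim disjE conjE)
    assume h: "a^2 + \<delta> \<le> (norm x)^2" "(norm x)^2 \<le> a^2 + 2 * \<delta>"
    have "a < norm x" by (rule power2_less_imp_less) (use h d norm_ge_zero[of x] in linarith)+
    moreover have "norm x < sqrt (a^2 + 3 * \<delta>)" using h d by (intro real_less_rsqrt) linarith
    ultimately show ?thesis by (simp add: inner_strip_def)
   next
    assume h: "b^2 - 2 * \<delta> \<le> (norm x)^2" "(norm x)^2 \<le> b^2 - \<delta>"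
    have "sqrt (b^2 - 3 * \<delta>) < norm x" using h d by (intro real_less_lsqrt) (auto simp: field_simps)
    moreover have "norm x < b" by (rule power2_less_imp_less) (use h d ab norm_ge_zero[of x] in linarith)+
    ultimately show ?thesis by (simp add: outer_strip_def)
   qed
   then have "1 \<le> indicator (inner_strip \<delta>) x + (indicator (outer_strip \<delta>) x :: real)" by (auto simp: indicator_def)
   then have "1 * (V x)^2 \<le> (indicator (inner_strip \<delta>) x + indicator (outer_strip \<delta>) x) * (V x)^2" by (rule mult_right_mono) simp
   then have "(m x)^2 * (V x)^2 \<le> c * ((indicator (inner_strip \<delta>) x + indicator (outer_strip \<delta>) x) * (V x)^2)"
    using mc[of x] c0 by (intro mult_mono) auto
   then show ?thesis by (simp add: power_mult_distrib distrib_right)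
  qed
  then show "AE x in lborel. (m x * V x)^2 \<le> c * (indicator (inner_strip \<delta>) x * (V x)^2 + indicator (outer_strip \<delta>) x * (V x)^2)" by simp
 qed (use c0 in auto)
 also have "\<dots> = c * ((LBINT x. indicator (inner_strip \<delta>) x * (V x)^2) + (LBINT x. indicator (outer_strip \<delta>) x * (V x)^2))"
  using iT[OF strip_borel(1)] iT[OF strip_borel(2)] by simp
 also have "\<dots> \<le> c * (2 * (3 * \<delta> / a)^2 * (b / a) * (LBINT x. indicator (inner_strip \<delta>) x * \<Psi> x)
   + 2 * (3 * \<delta> / a)^2 * (b / a) * (LBINT x. indicator (outer_strip \<delta>) x * \<Psi> x))"
 proof (intro mult_left_mono add_mono c0)
  have g: "2 * w * (b / a) * J \<le> 2 * (3 * \<delta> / a)^2 * (b / a) * J" if "w \<le> (3 * \<delta> / a)^2" "0 \<le> J" for w J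
   using that ab by (intro mult_right_mono mult_left_mono) auto
  have J: "0 \<le> (LBINT x. ind T x * \<Psi> x)" for T using Psi(2) by simp
  note w = strip_widths[OF d]
  show "(LBINT x. indicator (inner_strip \<delta>) x * (V x)^2) \<le> 2 * (3 * \<delta> / a)^2 * (b / a) * (LBINT x. indicator (inner_strip \<delta>) x * \<Psi> x)"
   using order_trans[OF Psi(1)[OF order_refl w(1,2)] g[OF w(3) J]] by (simp add: inner_strip_def V_def)
  show "(LBINT x. indicator (outer_strip \<delta>) x * (V x)^2) \<le> 2 * (3 * \<delta> / a)^2 * (b / a) * (LBINT x. indicator (outer_strip \<delta>) x * \<Psi> x)"
   using order_trans[OF Psi(1)[OF w(4,5) order_refl] g[OF w(6) J]] by (simp add: outer_strip_def V_def)
 qed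
 also have "\<dots> = 18 * M^2 * b / a ^ 3 * ((LBINT x. indicator (inner_strip \<delta>) x * \<Psi> x) + (LBINT x. indicator (outer_strip \<delta>) x * \<Psi> x))"
  using d ab by (simp add: c_def field_simps power2_eq_square power3_eq_cube)
 finally show ?thesis unfolding e .
qed

lemma balance_up_to_boundary_flux:
 assumes d: "0 < \<delta>" "8 * \<delta> \<le> b^2 - a^2" and k: "0 < \<kappa>"
  and z: "smooth \<zeta>" "\<And>x. 0 \<le> \<zeta> x \<and> \<zeta> x \<le> 1" "\<And>x. \<zeta> x \<noteq> 0 ==> a^2 + \<delta> \<le> x \<bullet> x \<and> x \<bullet> x \<le> b^2 - \<delta>"
 shows "\<bar>(LBINT x. (\<zeta> x * \<Theta> \<tau> x)^2) - (LBINT x. (\<zeta> x * \<Theta> 0 x)^2)\<bar>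
   \<le> \<tau> * (\<kappa> * B) + (1 / \<kappa>) * (LBINT s. ind {0..\<tau>} s * (LBINT x. (\<Sum>i\<in>UNIV. v i s x * pd i \<zeta> x)^2))"
  and "(\<lambda>s. LBINT x. (\<Sum>i\<in>UNIV. v i s x * pd i \<zeta> x)^2) \<in> Borel"
proof -
 define K :: "(real^2) set" where "K = {x. a^2 + \<delta> \<le> x \<bullet> x \<and> x \<bullet> x \<le> b^2 - \<delta>}"
 have Kn: "a < norm x \<and> norm x < b" if "x \<in> K" for x
 proof -
  have h: "a^2 + \<delta> \<le> (norm x)^2" "(norm x)^2 \<le> b^2 - \<delta>" using that by (auto simp: K_def dot_square_norm)
  show ?thesis by (intro conjI; rule power2_less_imp_less) (use h d ab norm_ge_zero[of x] in linarith)+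
 qed
 have K: "compact K"
 proof (subst compact_eq_bounded_closed, intro conjI)
  show "bounded K" by (rule bounded_subset[OF bounded_cball[of 0 b]]) (use Kn in fastforce)
  show "closed K" unfolding K_def by (intro closed_Collect_conj closed_Collect_le continuous_intros)
 qed
 have "K \<subseteq> annulus a b" using Kn ab by (auto simp: annulus_eq_norm)
 then obtain r where r: "r > 0" "(\<Union>x\<in>K. cball x r) \<subseteq> annulus a b"
  using compact_subset_open_imp_cball_epsilon_subset[OF K omega_facts(1)] by blast
 interpret cutoff_transport a b \<tau> B \<Theta> H v \<zeta> K r
  by unfold_locales (use z K r in \<open>auto simp: K_def\<close>)
 show "\<bar>(LBINT x. (\<zeta> x * \<Theta> \<tau> x)^2) - (LBINT x. (\<zeta> x * \<Theta> 0 x)^2)\<bar>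
   \<le> \<tau> * (\<kappa> * B) + (1 / \<kappa>) * (LBINT s. ind {0..\<tau>} s * (LBINT x. (\<Sum>i\<in>UNIV. v i s x * pd i \<zeta> x)^2))"
  using cutoff_balance[OF k] unfolding R_def .
 show "(\<lambda>s. LBINT x. (\<Sum>i\<in>UNIV. v i s x * pd i \<zeta> x)^2) \<in> Borel"
  using R_borel unfolding R_def[abs_def] .
qed

lemma cutoff_mass_tendsto:
 assumes t: "0 \<le> t" "t \<le> \<tau>"
  and Z: "\<And>n. continuous_on UNIV (Z n)" "\<And>n x. 0 \<le> Z n x \<and> Z n x \<le> 1" "\<And>x. x \<in> \<Omega> ==> \<forall>\<^sub>F n in sequentially. Z n x = (1 :: real)"
 shows "(\<lambda>n. LBINT x. (Z n x * \<Theta> t x)^2) \<longlonglongrightarrow> (LBINT x. (\<Theta> t x)^2)"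
proof (rule integral_dominated_convergence[where w = "\<lambda>x. (\<Theta> t x)^2"])
 have [measurable]: "Z n \<in> Borel" for n by (rule borel_measurable_continuous_onI[OF Z(1)])
 have T[measurable]: "\<Theta> t \<in> Borel" using Theta4[OF t] by (simp add: L4_fun_def)
 show "L1 (\<lambda>x. (\<Theta> t x)^2)"
  using L4_L1_imp_L2[OF Theta_integrable[OF t] Theta4[OF t]] by (simp add: L2_fun_def)
 show "(\<lambda>x. (Z n x * \<Theta> t x)^2) \<in> borel_measurable lborel" for n by measurable
 show "AE x in lborel. (\<lambda>n. (Z n x * \<Theta> t x)^2) \<longlonglongrightarrow> (\<Theta> t x)^2"
 proof (rule AE_I2)
  fix x
  have "\<forall>\<^sub>F n in sequentially. (Z n x * \<Theta> t x)^2 = (\<Theta> t x)^2"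
  proof (cases "x \<in> \<Omega>")
   case True
   from Z(3)[OF this] show ?thesis by eventually_elim simp
  qed (simp add: Theta_zero)
  then show "(\<lambda>n. (Z n x * \<Theta> t x)^2) \<longlonglongrightarrow> (\<Theta> t x)^2" by (rule tendsto_eventually)
 qed
 show "AE x in lborel. norm ((Z n x * \<Theta> t x)^2) \<le> (\<Theta> t x)^2" for n
 proof (rule AE_I2)
  fix x
  have "(Z n x)^2 \<le> 1" using Z(2)[of n x] by (simp add: power_le_one)
  then have "(Z n x)^2 * (\<Theta> t x)^2 \<le> 1 * (\<Theta> t x)^2" by (rule mult_right_mono) simp
  then show "norm ((Z n x * \<Theta> t x)^2) \<le> (\<Theta> t x)^2" by (simp add: power_mult_distrib)
 qed
 show "(\<lambda>x. (\<Theta> t x)^2) \<in> borel_measurable lborel" by measurable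
qed

text \<open>First \<open>\<delta>\<close> tends to zero, with \<open>\<kappa>\<close> fixed: the flux tends to zero at every time because \<open>\<Psi>\<close> is integrable, and it is bounded, so its time integral tends to zero.  Then \<open>\<kappa>\<close> tends to zero.\<close>

theorem transport_conserves_L2: "(LBINT x. (\<Theta> \<tau> x)^2) = (LBINT x. (\<Theta> 0 x)^2)"
proof -
 obtain M where M: "M > 0" and cut: "\<And>\<delta>. 0 < \<delta> ==> 8 * \<delta> \<le> b^2 - a^2 ==> \<exists>(\<zeta> :: real^2 => real) m. smooth \<zeta> \<and> (\<forall>x. 0 \<le> \<zeta> x \<and> \<zeta> x \<le> 1) \<and>
    (\<forall>x. \<zeta> x \<noteq> 0 --> a^2 + \<delta> \<le> x \<bullet> x \<and> x \<bullet> x \<le> b^2 - \<delta>) \<and>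
    (\<forall>x. a^2 + 2 * \<delta> \<le> x \<bullet> x --> x \<bullet> x \<le> b^2 - 2 * \<delta> --> \<zeta> x = 1) \<and>
    (\<forall>x i. pd i \<zeta> x = m x * x $ i) \<and> (\<forall>x. \<bar>m x\<bar> \<le> M / \<delta>) \<and>
    (\<forall>x. m x \<noteq> 0 --> a^2 + \<delta> \<le> x \<bullet> x \<and> x \<bullet> x \<le> a^2 + 2 * \<delta> \<or> b^2 - 2 * \<delta> \<le> x \<bullet> x \<and> x \<bullet> x \<le> b^2 - \<delta>)"
 proof (rule radial_cutoff[of b a], goal_cases)
  case (1 M)
  show ?case by (rule 1(1)[OF 1(2)]) (rule 1(3))
 qed
 (* The largest admissible width of the strips, measured in |x|^2. *)
 define c0 where "c0 = (b^2 - a^2) / 8"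
 have c0: "c0 > 0" using ab by (simp add: c0_def power_strict_mono)
 define \<delta> where "\<delta> n = c0 * (1 / real (Suc n))" for n
 have d: "0 < \<delta> n" "8 * \<delta> n \<le> b^2 - a^2" for n
 proof -
  show "0 < \<delta> n" using c0 by (simp add: \<delta>_def)
  have "c0 * (1 / real (Suc n)) \<le> c0 * 1" using c0 by (intro mult_left_mono) auto
  then have "\<delta> n \<le> c0" by (simp add: \<delta>_def)
  then show "8 * \<delta> n \<le> b^2 - a^2" unfolding c0_def by (simp add: field_simps)
 qed
 have dlim: "\<delta> \<longlonglongrightarrow> 0"
 proof -
  have "(\<lambda>n. c0 * (1 / real (Suc n))) \<longlonglongrightarrow> c0 * 0"
   using LIMSEQ_inverse_real_of_nat by (intro tendsto_intros) (simp add: inverse_eq_divide)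
  then show ?thesis by (simp add: \<delta>_def[abs_def])
 qed
 have "\<exists>Z. \<forall>n. \<exists>m. smooth (Z n) \<and> (\<forall>x. 0 \<le> Z n x \<and> Z n x \<le> 1) \<and>
    (\<forall>x. Z n x \<noteq> 0 --> a^2 + \<delta> n \<le> x \<bullet> x \<and> x \<bullet> x \<le> b^2 - \<delta> n) \<and>
    (\<forall>x. a^2 + 2 * \<delta> n \<le> x \<bullet> x --> x \<bullet> x \<le> b^2 - 2 * \<delta> n --> Z n x = 1) \<and>
    (\<forall>x i. pd i (Z n) x = m x * (x :: real^2) $ i) \<and> (\<forall>x. \<bar>m x\<bar> \<le> M / \<delta> n) \<and>
    (\<forall>x. m x \<noteq> 0 --> a^2 + \<delta> n \<le> x \<bullet> x \<and> x \<bullet> x \<le> a^2 + 2 * \<delta> n \<or> b^2 - 2 * \<delta> n \<le> x \<bullet> x \<and> x \<bullet> x \<le> b^2 - \<delta> n)"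
  by (intro choice allI cut d)
 then obtain Z where Zm: "\<forall>n. \<exists>m. smooth (Z n) \<and> (\<forall>x. 0 \<le> Z n x \<and> Z n x \<le> 1) \<and>
    (\<forall>x. Z n x \<noteq> 0 --> a^2 + \<delta> n \<le> x \<bullet> x \<and> x \<bullet> x \<le> b^2 - \<delta> n) \<and>
    (\<forall>x. a^2 + 2 * \<delta> n \<le> x \<bullet> x --> x \<bullet> x \<le> b^2 - 2 * \<delta> n --> Z n x = 1) \<and>
    (\<forall>x i. pd i (Z n) x = m x * (x :: real^2) $ i) \<and> (\<forall>x. \<bar>m x\<bar> \<le> M / \<delta> n) \<and>
    (\<forall>x. m x \<noteq> 0 --> a^2 + \<delta> n \<le> x \<bullet> x \<and> x \<bullet> x \<le> a^2 + 2 * \<delta> n \<or> b^2 - 2 * \<delta> n \<le> x \<bullet> x \<and> x \<bullet> x \<le> b^2 - \<delta> n)"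
  by (elim exE)
 have Z: "smooth (Z n)" "0 \<le> Z n x \<and> Z n x \<le> 1" "Z n x \<noteq> 0 ==> a^2 + \<delta> n \<le> x \<bullet> x \<and> x \<bullet> x \<le> b^2 - \<delta> n"
  "a^2 + 2 * \<delta> n \<le> x \<bullet> x ==> x \<bullet> x \<le> b^2 - 2 * \<delta> n ==> Z n x = 1" for n x
  using spec[OF Zm, of n] by blast+
 define Rn where "Rn n s = (LBINT x. (\<Sum>i\<in>UNIV. v i s x * pd i (Z n) x)^2)" for n s
 have Rn0: "0 \<le> Rn n s" for n s by (simp add: Rn_def)
 have Rm[measurable]: "Rn n \<in> Borel" for n
  unfolding Rn_def[abs_def] by (rule balance_up_to_boundary_flux(2)[OF d zero_less_one Z(1-3)])
 define I where "I n = (LBINT s. ind {0..\<tau>} s * Rn n s)" for n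
 define m where "m n t = (LBINT x. (Z n x * \<Theta> t x)^2)" for n t
 have bal: "\<bar>m n \<tau> - m n 0\<bar> \<le> \<tau> * (\<kappa> * B) + (1 / \<kappa>) * I n" if "0 < \<kappa>" for \<kappa> n
  unfolding m_def I_def Rn_def by (rule balance_up_to_boundary_flux(1)[OF d that Z(1-3)])
 define c where "c = 18 * M^2 * b / a ^ 3"
 have c: "0 \<le> c" using ab M by (simp add: c_def)
 have near: "\<forall>\<^sub>F n in sequentially. k * \<delta> n < r" if "0 < r" for k r :: real
  using tendsto_mult_left[OF dlim, of k] that by (intro order_tendstoD(2)[of "\<lambda>n. k * \<delta> n" 0]) auto
 have R: "(\<lambda>n. Rn n s) \<longlonglongrightarrow> 0 \<and> (\<forall>n. Rn n s \<le> c * (2 * B))" for s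
 proof -
  obtain \<Psi> :: "real^2 => real" where P: "(\<forall>x. 0 \<le> \<Psi> x) \<and> L1 \<Psi> \<and>
   (LBINT x. \<Psi> x) \<le> B \<and>
   (\<forall>p q. a \<le> p --> p < q --> q \<le> b --> p = a \<or> q = b -->
    (LBINT x. ind {x. p < norm x \<and> norm x < q} x * (\<Sum>i\<in>UNIV. x $ i * v i s x)^2)
     \<le> 2 * (q - p)^2 * (b / a) * (LBINT x. ind {x. p < norm x \<and> norm x < q} x * \<Psi> x))"
   using v_hardy[of s] by (elim exE)
  have P0: "0 \<le> \<Psi> x" for x using P by blast
  have Pi: "L1 \<Psi>" "(LBINT x. \<Psi> x) \<le> B" using P by blast+
  have P4: "(LBINT x. ind {x. p < norm x \<and> norm x < q} x * (\<Sum>i\<in>UNIV. x $ i * v i s x)^2)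
     \<le> 2 * (q - p)^2 * (b / a) * (LBINT x. ind {x. p < norm x \<and> norm x < q} x * \<Psi> x)"
   if "a \<le> p" "p < q" "q \<le> b" "p = a \<or> q = b" for p q
   using conjunct2[OF conjunct2[OF conjunct2[OF P]], rule_format, OF that] .
  have [measurable]: "\<Psi> \<in> Borel" using Pi(1) by (simp add: borel_measurable_integrable)
  define J where "J T = (LBINT x. ind T x * \<Psi> x)" for T
  have bound: "Rn n s \<le> c * (J (inner_strip (\<delta> n)) + J (outer_strip (\<delta> n)))" for n
  proof -
   obtain m where m: "\<forall>x i. pd i (Z n) x = m x * x $ i" "\<forall>x. \<bar>m x\<bar> \<le> M / \<delta> n"
    "\<forall>x. m x \<noteq> 0 --> a^2 + \<delta> n \<le> x \<bullet> x \<and> x \<bullet> x \<le> a^2 + 2 * \<delta> n \<or> b^2 - 2 * \<delta> n \<le> x \<bullet> x \<and> x \<bullet> x \<le> b^2 - \<delta> n"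
    using spec[OF Zm, of n] by (elim exE conjE)
   show ?thesis unfolding Rn_def J_def c_def
    by (rule cutoff_flux_at_boundary[OF d m(1)[rule_format] m(2)[rule_format] m(3)[rule_format] P4 P0])
  qed
  have Jle: "J T \<le> B" if "T \<in> sets borel" for T
  proof -
   have "J T \<le> (LBINT x. \<Psi> x)" unfolding J_def
    by (rule integral_mono_AE') (use Pi P0 in \<open>auto simp: indicator_def\<close>)
   then show ?thesis using Pi(2) by linarith
  qed
  have Jlim: "(\<lambda>n. J (T n)) \<longlonglongrightarrow> 0" if T: "\<And>n. T n \<in> sets borel" and out: "\<And>x. \<forall>\<^sub>F n in sequentially. x \<notin> T n" for T
  proof -
   note [measurable] = T
   have "(\<lambda>n. J (T n)) \<longlonglongrightarrow> (\<integral>x. 0 \<partial>(lborel :: (real^2) measure))" unfolding J_def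
   proof (rule integral_dominated_convergence[where w = \<Psi>])
    show "AE x in lborel. (\<lambda>n. indicator (T n) x * \<Psi> x) \<longlonglongrightarrow> 0"
    proof (rule AE_I2)
     fix x
     have "\<forall>\<^sub>F n in sequentially. indicator (T n) x * \<Psi> x = 0" using out[of x] by eventually_elim simp
     then show "(\<lambda>n. indicator (T n) x * \<Psi> x) \<longlonglongrightarrow> 0" by (rule tendsto_eventually)
    qed
    show "AE x in lborel. norm (indicator (T n) x * \<Psi> x) \<le> \<Psi> x" for n
     by (rule AE_I2) (use P0 in \<open>auto simp: indicator_def\<close>)
   qed (use Pi in measurable)
   then show ?thesis by simp
  qed
  have "\<forall>\<^sub>F n in sequentially. x \<notin> inner_strip (\<delta> n)" for x
  proof (cases "a < norm x")
   case True
   then have "0 < (norm x)^2 - a^2" using ab by (simp add: power_strict_mono)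
   from near[OF this, of 3] show ?thesis
   proof eventually_elim
    case (elim n)
    then have "sqrt (a^2 + 3 * \<delta> n) \<le> norm x" by (intro real_le_lsqrt) auto
    then show ?case by (simp add: inner_strip_def)
   qed
  qed (simp add: inner_strip_def)
  moreover have "\<forall>\<^sub>F n in sequentially. x \<notin> outer_strip (\<delta> n)" for x
  proof (cases "norm x < b")
   case True
   then have "0 < b^2 - (norm x)^2" using ab by (simp add: power_strict_mono)
   from near[OF this, of 3] show ?thesis
   proof eventually_elim
    case (elim n)
    then have "norm x \<le> sqrt (b^2 - 3 * \<delta> n)" by (intro real_le_rsqrt) auto
    then show ?case by (simp add: outer_strip_def)
   qed
  qed (simp add: outer_strip_def)
  ultimately have "(\<lambda>n. c * (J (inner_strip (\<delta> n)) + J (outer_strip (\<delta> n)))) \<longlonglongrightarrow> c * (0 + 0)"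
   by (intro tendsto_intros Jlim strip_borel)
  then have lim: "(\<lambda>n. c * (J (inner_strip (\<delta> n)) + J (outer_strip (\<delta> n)))) \<longlonglongrightarrow> 0" by simp
  have "(\<lambda>n. Rn n s) \<longlonglongrightarrow> 0"
   by (rule tendsto_sandwich[OF _ _ tendsto_const lim]) (rule always_eventually allI Rn0 bound)+
  moreover have "Rn n s \<le> c * (2 * B)" for n
  proof -
   have "c * (J (inner_strip (\<delta> n)) + J (outer_strip (\<delta> n))) \<le> c * (B + B)"
    using c by (intro mult_left_mono add_mono Jle strip_borel)
   then show ?thesis using bound[of n] by simp
  qed
  ultimately show ?thesis by blast
 qed
 have Ilim: "I \<longlonglongrightarrow> 0"
 proof -
  have "I \<longlonglongrightarrow> (\<integral>s. 0 \<partial>(lborel :: real measure))" unfolding I_def[abs_def]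
  proof (rule integral_dominated_convergence[where w = "\<lambda>s. (c * (2 * B)) * ind {0..\<tau>} s"])
   show "L1 (\<lambda>s. (c * (2 * B)) * ind {0..\<tau>} s)"
    using tau by (intro integrable_mult_right integrable_real_indicator) auto
   show "AE s in lborel. (\<lambda>n. ind {0..\<tau>} s * Rn n s) \<longlonglongrightarrow> 0"
   proof (rule AE_I2)
    fix s :: real
    show "(\<lambda>n. ind {0..\<tau>} s * Rn n s) \<longlonglongrightarrow> 0"
     using tendsto_mult_left[OF conjunct1[OF R[of s]], of "ind {0..\<tau>} s"] by simp
   qed
   show "AE s in lborel. norm (ind {0..\<tau>} s * Rn n s) \<le> c * (2 * B) * ind {0..\<tau>} s" for n
    using R Rn0 by (intro AE_I2) (auto simp: indicator_def)
  qed measurable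
  then show ?thesis by simp
 qed
 have Zone: "\<forall>\<^sub>F n in sequentially. Z n x = 1" if "x \<in> \<Omega>" for x
 proof -
  have "a < norm x" "norm x < b" using that ab by (auto simp: annulus_eq_norm)
  then have "0 < (norm x)^2 - a^2" "0 < b^2 - (norm x)^2" using ab by (auto simp: power_strict_mono)
  from near[OF this(1), of 2] near[OF this(2), of 2] show ?thesis
   by eventually_elim (rule Z(4); simp add: dot_square_norm)
 qed
 have mlim: "(\<lambda>n. m n t) \<longlonglongrightarrow> (LBINT x. (\<Theta> t x)^2)" if "0 \<le> t" "t \<le> \<tau>" for t
  unfolding m_def by (rule cutoff_mass_tendsto[OF that smooth_continuous_on[OF Z(1)] Z(2) Zone])
 define D where "D = (LBINT x. (\<Theta> \<tau> x)^2) - (LBINT x. (\<Theta> 0 x)^2)"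
 have Dlim: "(\<lambda>n. \<bar>m n \<tau> - m n 0\<bar>) \<longlonglongrightarrow> \<bar>D\<bar>" unfolding D_def using tau by (intro tendsto_intros mlim) auto
 have Dk: "\<bar>D\<bar> \<le> \<tau> * (\<kappa> * B)" if "0 < \<kappa>" for \<kappa>
 proof -
  have "(\<lambda>n. \<tau> * (\<kappa> * B) + (1 / \<kappa>) * I n) \<longlonglongrightarrow> \<tau> * (\<kappa> * B) + (1 / \<kappa>) * 0" by (intro tendsto_intros Ilim)
  then show ?thesis using bal[OF that] by (intro LIMSEQ_le[OF Dlim]) auto
 qed
 have "\<bar>D\<bar> \<le> 0"
 proof (rule field_le_epsilon)
  fix e :: real assume e: "e > 0"
  have q: "0 \<le> \<tau> * B" using tau B_nonneg by simp
  have "\<tau> * ((e / (\<tau> * B + 1)) * B) \<le> e" using e q by (simp add: field_simps)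
  moreover have "0 < e / (\<tau> * B + 1)" using e q by simp
  ultimately show "\<bar>D\<bar> \<le> 0 + e" using Dk by fastforce
 qed
 then show ?thesis by (simp add: D_def)
qed

end

section \<open>Representatives in space and time\<close>

text \<open>A null set of the product has null sections at almost every time.\<close>

lemma joint_borel_version:
 fixes g :: "real => real^2 => real"
 assumes U[measurable]: "U \<in> sets borel" and g: "jointly_measurable U g"
 shows "\<exists>G. case_prod G \<in> borel_measurable (borel \<Otimes>\<^sub>M borel) \<and> (\<forall>t x. x \<notin> U --> G t x = 0) \<and>
  (AE t in lborel. 0 < t --> (AE x in lborel. x \<in> U --> g t x = G t x))"
proof -
 have S: "{0<..} \<times> U \<in> sets (borel :: (real \<times> (real^2)) measure)"
  unfolding borel_prod[symmetric] by measurable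
 obtain g' where g': "g' \<in> Borel" "\<And>x. x \<notin> {0<..} \<times> U ==> g' x = 0"
  and ae: "AE x in lborel. x \<in> {0<..} \<times> U --> (\<lambda>(t, x). g t x) x = g' x"
 proof (rule lebesgue_on_borel_version[OF S g[unfolded jointly_measurable_def]], goal_cases)
  case (1 g')
  show ?case by (rule 1(1)) (fact 1(2), rule 1(3), assumption, fact 1(4))
 qed
 have "AE t in lborel. AE x in lborel. (t, x) \<in> {0<..} \<times> U --> (\<lambda>(t, x). g t x) (t, x) = g' (t, x)"
  by (rule lborel_pair.AE_pair) (use ae in \<open>simp only: lborel_prod\<close>)
 then have "AE t in lborel. 0 < t --> (AE x in lborel. x \<in> U --> g t x = g' (t, x))"
  by eventually_elim auto
 moreover have "case_prod (\<lambda>t x. g' (t, x)) \<in> borel_measurable (borel \<Otimes>\<^sub>M borel)"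
  using g'(1) by (simp add: borel_prod)
 ultimately show ?thesis using g'(2) by (intro exI[of _ "\<lambda>t x. g' (t, x)"]) auto
qed

lemma Hnorm_sq_nonneg: "0 \<le> Hnorm_sq k U g"
 by (induction k arbitrary: g) (auto intro!: add_nonneg_nonneg sum_nonneg)

lemma Hnorm_sq_2_bounds:
 fixes U :: "(real^2) set"
 shows "(L2norm U g)^2 \<le> Hnorm_sq 2 U g" "(L2norm U (weak_deriv U (axis j 1) g))^2 \<le> Hnorm_sq 2 U g"
proof -
 have e: "Hnorm_sq 2 U g = (L2norm U g)^2 + (\<Sum>b\<in>Basis. Hnorm_sq 1 U (weak_deriv U b g))"
  by (simp add: numeral_2_eq_2)
 have s: "0 \<le> (\<Sum>b\<in>Basis. Hnorm_sq 1 U (weak_deriv U b g))" by (intro sum_nonneg Hnorm_sq_nonneg)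
 show "(L2norm U g)^2 \<le> Hnorm_sq 2 U g" unfolding e using s by linarith
 have "(L2norm U (weak_deriv U (axis j 1) g))^2 \<le> Hnorm_sq 1 U (weak_deriv U (axis j 1) g)"
  by (rule Hnorm_sq_1_bounds(1))
 also have "\<dots> \<le> (\<Sum>b\<in>Basis. Hnorm_sq 1 U (weak_deriv U b g))"
  by (rule member_le_sum) (use Hnorm_sq_nonneg in \<open>auto simp: axis_in_Basis_iff simp del: One_nat_def Hnorm_sq.simps\<close>)
 finally show "(L2norm U (weak_deriv U (axis j 1) g))^2 \<le> Hnorm_sq 2 U g" unfolding e by (simp add: add_increasing)
qed

lemma inner_classical_grad: "w \<bullet> classical_grad g x = (\<Sum>i\<in>UNIV. w $ i * pd i g x)"
 by (simp add: inner_vec_def classical_grad_def)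

lemma classical_grad_cong_open:
 assumes "open U" "x \<in> U" "\<And>y. y \<in> U ==> g y = h y" "smooth h"
 shows "frechet_derivative g (at x) = frechet_derivative h (at x)"
proof -
 have "(g has_derivative frechet_derivative h (at x)) (at x)"
  by (rule has_derivative_transform_within_open[OF smooth_has_derivative[OF assms(4)] assms(1,2)]) (use assms(3) in simp)
 then show ?thesis by (rule frechet_derivative_at[symmetric])
qed

lemma test_function_mult_smooth:
 assumes h: "smooth h" and p: "test_function U \<phi>"
 shows "test_function U (\<lambda>x. h x * \<phi> x)"
proof -
 have s: "closure {x. h x * \<phi> x \<noteq> 0} \<subseteq> closure {x. \<phi> x \<noteq> 0}" by (intro closure_mono) auto
 have c: "compact (closure {x. \<phi> x \<noteq> 0})" "closure {x. \<phi> x \<noteq> 0} \<subseteq> U" "smooth \<phi>" using p by (auto simp: test_function_def)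
 have "compact (closure {x. h x * \<phi> x \<noteq> 0})"
  using compact_Int_closed[OF c(1) closed_closure, of "{x. h x * \<phi> x \<noteq> 0}"] s by (simp add: Int_absorb1)
 then show ?thesis unfolding test_function_def using s c smooth_mult[OF h c(3)] by blast
qed

lemma test_function_bounded:
 fixes \<phi> :: "real^2 => real"
 assumes "test_function U \<phi>"
 shows "\<exists>L. \<forall>x. \<bar>\<phi> x\<bar> \<le> L" "\<exists>L. \<forall>x. \<bar>pd i \<phi> x\<bar> \<le> L"
proof -
 have sm: "smooth \<phi>" using assms by (simp add: test_function_def)
 have "bounded (closure {x. \<phi> x \<noteq> 0})" using assms compact_imp_bounded by (auto simp: test_function_def)
 then obtain r where r: "closure {x. \<phi> x \<noteq> 0} \<subseteq> ball 0 r" using bounded_subset_ballD by blast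
 have t: "test_function (ball 0 r) \<phi>" using assms r by (simp add: test_function_def)
 have z: "\<phi> x = 0" "pd i \<phi> x = 0" if "norm x \<ge> r" for x
  using test_function_deriv_zero[OF t, of x] that by auto
 show "\<exists>L. \<forall>x. \<bar>\<phi> x\<bar> \<le> L"
  by (rule continuous_compact_support_bounded[OF smooth_continuous_on[OF sm] z(1)]) auto
 show "\<exists>L. \<forall>x. \<bar>pd i \<phi> x\<bar> \<le> L"
  by (rule continuous_compact_support_bounded[OF smooth_continuous_on[OF smooth_partial[OF sm]] z(2)]) (auto simp: axis_in_Basis_iff)
qed

text \<open>The source term \<open>-u \<cdot> \<nabla>\<rho>\<^sub>s\<close> is absorbed by testing the divergence condition with \<open>h \<phi>\<close>, where \<open>h\<close> extends \<open>\<rho>\<^sub>s\<close>: this turns the equation for \<open>\<rho>\<close> into the transport equation for \<open>\<rho> + \<rho>\<^sub>s - \<beta>\<close>.\<close>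

lemma flux_at_fixed_time:
 fixes r :: "real^2 => real" and v :: "2 => real^2 => real"
 assumes ab: "0 < a" "a < b" and phi: "test_function (annulus a b) \<phi>"
  and h: "smooth h" "\<And>x. x \<in> annulus a b ==> \<rho>s x = h x"
  and r: "L2_fun lborel r" "\<And>x. x \<notin> annulus a b ==> r x = 0" "AE x in lborel. x \<in> annulus a b --> R x = r x"
  and v: "\<And>i. L2_fun lborel (v i)" "\<And>i x. x \<notin> annulus a b ==> v i x = 0" "\<And>i. AE x in lborel. x \<in> annulus a b --> u x $ i = v i x"
  and div: "\<And>\<phi>. test_function (annulus a b) \<phi> ==>
   (LBINT x. (\<Sum>i\<in>UNIV. v i x * pd i \<phi> x)) = 0"
 shows "(\<integral>x. R x * (u x \<bullet> classical_grad \<phi> x) - (u x \<bullet> classical_grad \<rho>s x) * \<phi> x \<partial>lebesgue_on (annulus a b))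
  = (LBINT x. (r x + indicator (annulus a b) x * (h x - \<beta>)) * (\<Sum>i\<in>UNIV. v i x * pd i \<phi> x))"
proof -
 define U where "U = annulus a b"
 have U: "open U" "U \<in> sets borel" "bounded U" using ab bounded_annulus by (auto simp: U_def open_annulus)
 have sp: "smooth \<phi>" using phi by (simp add: test_function_def)
 define p where "p i x = pd i \<phi> x" for i :: 2 and x
 define k where "k i x = pd i h x" for i :: 2 and x
 define V where "V x = (\<Sum>i\<in>UNIV. v i x * p i x)" for x
 define W where "W x = (\<Sum>i\<in>UNIV. v i x * (k i x * \<phi> x))" for x
 have [measurable]: "r \<in> Borel" "v i \<in> Borel" for i using r(1) v(1) by (auto simp: L2_fun_def)
 have cont: "continuous_on UNIV (p i)" "continuous_on UNIV (k i)" "continuous_on UNIV \<phi>" "continuous_on UNIV h" for i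
  unfolding p_def[abs_def] k_def[abs_def]
  by (intro smooth_continuous_on smooth_partial sp h(1); simp add: axis_in_Basis_iff)+
 have [measurable]: "p i \<in> Borel" "k i \<in> Borel" "\<phi> \<in> Borel" "h \<in> Borel" for i
  by (intro borel_measurable_continuous_onI cont)+
 have vz: "v i x = 0" if "x \<notin> U" for i x using v(2) that by (simp add: U_def)
 have vi: "L1 (v i)" for i by (rule L2_bounded_support_integrable[OF v(1) vz U(2,3)])
 have tf: "test_function U \<phi>" "test_function U (\<lambda>x. h x * \<phi> x)"
  unfolding U_def by (rule phi test_function_mult_smooth[OF h(1)])+
 have fd: "pd i (\<lambda>x. h x * \<phi> x) x = h x * p i x + k i x * \<phi> x" for i x
  using frechet_derivative_mult_real[OF smooth_differentiable[OF h(1)] smooth_differentiable[OF sp], of x] by (simp add: p_def k_def)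
 have ivc: "L1 (\<lambda>x. v i x * g x)" if "continuous_on UNIV g" for i g
 proof -
  have "L1 (\<lambda>x. v i x * (ind U x * g x))"
   by (rule L2_mult_integrable[OF v(1) L2_fun_indicator_continuous[OF that U(2,3)]])
  moreover have "v i x * (ind U x * g x) = v i x * g x" for x by (cases "x \<in> U") (simp_all add: vz)
  ultimately show ?thesis by simp
 qed
 have irp: "L1 (\<lambda>x. r x * (v i x * p i x))" for i
 proof -
  obtain L where L: "\<forall>x. \<bar>p i x\<bar> \<le> L" using test_function_bounded(2)[OF tf(1), of i] unfolding p_def by (elim exE)
  have "L1 (\<lambda>x. r x * v i x * p i x)"
   by (rule integrable_lborel_mult_bounded[OF L2_mult_integrable[OF r(1) v(1)] _ L[rule_format]]) measurable
  then show ?thesis by (simp add: mult.assoc)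
 qed
 have irV: "L1 (\<lambda>x. r x * V x)" unfolding V_def sum_distrib_left by (intro Bochner_Integration.integrable_sum irp)
 have iV: "L1 V" unfolding V_def by (intro Bochner_Integration.integrable_sum ivc cont)
 have iW: "L1 W" unfolding W_def by (intro Bochner_Integration.integrable_sum ivc continuous_intros cont)
 have ihV: "L1 (\<lambda>x. h x * V x)"
 proof -
  have "L1 (\<lambda>x. \<Sum>i\<in>UNIV. v i x * (h x * p i x))" by (intro Bochner_Integration.integrable_sum ivc continuous_intros cont)
  then show ?thesis by (simp add: V_def sum_distrib_left mult_ac)
 qed
 have V0: "(LBINT x. V x) = 0" using div[OF phi] by (simp add: V_def p_def)
 have hVW0: "(LBINT x. h x * V x + W x) = 0"
 proof -
  have "(LBINT x. (\<Sum>i\<in>UNIV. v i x * (h x * p i x + k i x * \<phi> x))) = 0"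
   using div[OF tf(2)[unfolded U_def]] unfolding fd .
  then show ?thesis by (simp add: V_def W_def sum_distrib_left sum.distrib distrib_left mult_ac)
 qed
 have [measurable]: "V \<in> Borel" "W \<in> Borel" unfolding V_def[abs_def] W_def[abs_def] by measurable
 have "AE x in lborel. x \<in> U --> R x * (u x \<bullet> classical_grad \<phi> x) - (u x \<bullet> classical_grad \<rho>s x) * \<phi> x = r x * V x - W x"
 proof -
  have "AE x in lborel. \<forall>i. x \<in> U --> u x $ i = v i x" unfolding AE_all_countable U_def using v(3) by blast
  moreover have "AE x in lborel. x \<in> U --> R x = r x" using r(3) by (simp add: U_def)
  ultimately show ?thesis
  proof eventually_elim
   case (elim x)
   show ?case
   proof
    assume x: "x \<in> U"
    have "frechet_derivative \<rho>s (at x) = frechet_derivative h (at x)"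
     by (rule classical_grad_cong_open[OF U(1) x _ h(1)]) (simp add: h(2) U_def)
    with elim x show "R x * (u x \<bullet> classical_grad \<phi> x) - (u x \<bullet> classical_grad \<rho>s x) * \<phi> x = r x * V x - W x"
     by (simp add: inner_classical_grad V_def W_def p_def k_def sum_distrib_right mult.assoc)
   qed
  qed
 qed
 then have "(\<integral>x. R x * (u x \<bullet> classical_grad \<phi> x) - (u x \<bullet> classical_grad \<rho>s x) * \<phi> x \<partial>lebesgue_on U) = (LBINT x. r x * V x - W x)"
  by (intro integral_lebesgue_on_borel(1)[OF U(2)]) (auto simp: V_def W_def vz)
 also have "\<dots> = (LBINT x. r x * V x - W x) + (LBINT x. h x * V x + W x) - \<beta> * (LBINT x. V x)"
  unfolding V0 hVW0 by simp
 also have "\<dots> = (LBINT x. r x * V x + h x * V x - \<beta> * V x)"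
  using irV iW ihV iV by simp
 also have "\<dots> = (LBINT x. (r x + ind U x * (h x - \<beta>)) * V x)"
 proof (rule Bochner_Integration.integral_cong[OF refl])
  fix x
  show "r x * V x + h x * V x - \<beta> * V x = (r x + ind U x * (h x - \<beta>)) * V x"
   by (cases "x \<in> U") (simp_all add: algebra_simps V_def vz)
 qed
 finally show ?thesis by (simp add: U_def V_def p_def)
qed

section \<open>Conservation for solutions of the density equation\<close>

text \<open>The domain has finite measure and \<open>y^4 \<le> 1 + |y|\<^sup>q\<close>; this is where \<open>q \<ge> 4\<close> is used.\<close>

lemma Lspace_ge_4_imp_L4:
 fixes R r :: "real^2 => real"
 assumes U: "U \<in> sets borel" "bounded U" and q: "4 \<le> q"
  and R: "R \<in> Lspace (ereal q) U" "(\<integral>x. \<bar>R x\<bar> powr q \<partial>lebesgue_on U) \<le> C"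
  and r[measurable]: "r \<in> Borel" and rz: "\<And>x. x \<notin> U ==> r x = 0" and ae: "AE x in lborel. x \<in> U --> R x = r x"
 shows "L4_fun r" "(LBINT x. r x ^ 4) \<le> measure lborel U + C"
proof -
 have iR: "integrable (lebesgue_on U) (\<lambda>x. \<bar>R x\<bar> powr q)" using R(1) by (simp add: Lspace_def)
 have ae': "AE x in lborel. x \<in> U --> \<bar>R x\<bar> powr q = \<bar>r x\<bar> powr q" using ae by eventually_elim auto
 have m: "(\<lambda>x. \<bar>r x\<bar> powr q) \<in> Borel" by measurable
 have z: "\<bar>r x\<bar> powr q = 0" if "x \<notin> U" for x using rz[OF that] by simp
 have ir: "L1 (\<lambda>x. \<bar>r x\<bar> powr q)"
  using integral_lebesgue_on_borel(2)[OF U(1) m z ae'] iR by simp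
 have Ir: "(LBINT x. \<bar>r x\<bar> powr q) \<le> C"
  using integral_lebesgue_on_borel(1)[OF U(1) m z ae'] R(2) by simp
 have iU: "L1 (ind U :: real^2 => real)"
  using U emeasure_bounded_finite[of U] by (intro integrable_real_indicator) auto
 have b: "r x ^ 4 \<le> ind U x + \<bar>r x\<bar> powr q" for x
 proof (cases "x \<in> U")
  case True
  show ?thesis
  proof (cases "\<bar>r x\<bar> \<le> 1")
   case le: True
   have "r x ^ 4 = \<bar>r x\<bar> ^ 4" by simp
   also have "\<dots> \<le> 1" using power_le_one[of "\<bar>r x\<bar>" 4] le by simp
   finally show ?thesis using True by (simp add: add_increasing2)
  next
   case False
   have "r x ^ 4 = \<bar>r x\<bar> ^ 4" by simp
   also have "\<dots> = \<bar>r x\<bar> powr 4" using False by (simp add: powr_numeral)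
   also have "\<dots> \<le> \<bar>r x\<bar> powr q" using False q by (intro powr_mono) auto
   finally show ?thesis using True by simp
  qed
 qed (simp add: rz)
 have i: "L1 (\<lambda>x. ind U x + \<bar>r x\<bar> powr q)" using iU ir by simp
 have i4: "L1 (\<lambda>x. r x ^ 4)"
  by (rule Bochner_Integration.integrable_bound[OF i]) (measurable, use b in auto)
 then show "L4_fun r" by (simp add: L4_fun_def)
 have "(LBINT x. r x ^ 4) \<le> (LBINT x. ind U x + \<bar>r x\<bar> powr q)" by (rule integral_mono[OF i4 i b])
 also have "\<dots> = measure lborel U + (LBINT x. \<bar>r x\<bar> powr q)" using iU ir by simp
 finally show "(LBINT x. r x ^ 4) \<le> measure lborel U + C" using Ir by linarith
qed

lemma L4_fun_indicator_continuous:
 fixes g :: "'a::euclidean_space => real"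
 assumes g: "continuous_on UNIV g" and S[measurable]: "S \<in> sets borel" and b: "bounded S"
 shows "L4_fun (\<lambda>x. ind S x * g x)"
proof -
 have "L2_fun lborel (\<lambda>x. ind S x * (g x)^2)"
  by (rule L2_fun_indicator_continuous[OF _ S b]) (intro continuous_intros g)
 moreover have "(ind S x * (g x)^2)^2 = (ind S x * g x) ^ 4" for x
  by (simp add: indicator_def)
 moreover have [measurable]: "g \<in> Borel" by (rule borel_measurable_continuous_onI[OF g])
 ultimately show ?thesis by (simp add: L4_fun_def L2_fun_def)
qed

lemma L4_fun_add:
 assumes "L4_fun f" "L4_fun g"
 shows "L4_fun (\<lambda>x. f x + g x)" "(LBINT x. (f x + g x) ^ 4) \<le> 27 * ((LBINT x. f x ^ 4) + (LBINT x. g x ^ 4))"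
proof -
 have [measurable]: "f \<in> Borel" "g \<in> Borel" using assms by (auto simp: L4_fun_def)
 have i: "L1 (\<lambda>x. f x ^ 4)" "L1 (\<lambda>x. g x ^ 4)" using assms by (auto simp: L4_fun_def)
 have b: "(f x + g x) ^ 4 \<le> 27 * (f x ^ 4 + g x ^ 4)" for x using fourth_power_triangle[of "f x" "g x" 0] by simp
 have i2: "L1 (\<lambda>x. 27 * (f x ^ 4 + g x ^ 4))" using i by simp
 have i3: "L1 (\<lambda>x. (f x + g x) ^ 4)"
  by (rule Bochner_Integration.integrable_bound[OF i2]) (measurable, use b in auto)
 then show "L4_fun (\<lambda>x. f x + g x)" by (simp add: L4_fun_def)
 show "(LBINT x. (f x + g x) ^ 4) \<le> 27 * ((LBINT x. f x ^ 4) + (LBINT x. g x ^ 4))"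
  using integral_mono[OF i3 i2 b] i by simp
qed

text \<open>The solution is turned into the data of the transport problem.  Regularity, boundary conditions and agreement with the Borel representatives hold outside a null set of times, which is enlarged to a Borel set so that the representatives can be set to zero there without losing joint measurability.\<close>

theorem density_L2_conserved:
 fixes u :: "real => real^2 => real^2" and \<rho> P :: "real => real^2 => real"
 assumes ab: "0 < a" "a < b" and q: "4 \<le> q" and tau: "0 \<le> \<tau>"
  and h: "smooth h" "\<And>x. x \<in> annulus a b ==> \<rho>s x = h x"
  and u: "\<And>i. Linf_loc_H 2 (annulus a b) (\<lambda>t x. u t x $ i)"
  and rho_meas: "jointly_measurable (annulus a b) \<rho>"
  and rho_Lq: "\<And>t. 0 \<le> t ==> \<rho> t \<in> Lspace (ereal q) (annulus a b)"
  and rho_bound: "\<And>T. 0 < T ==> \<exists>C. \<forall>t\<in>{0..T}. (\<integral>x. \<bar>\<rho> t x\<bar> powr q \<partial>lebesgue_on (annulus a b)) \<le> C"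
  and eq: "density_equation (annulus a b) \<rho>s \<rho>0 u \<rho>"
  and div: "AE t in lebesgue_on {0<..}. AE x in lebesgue_on (annulus a b). divergence (annulus a b) (u t) x = 0"
  and init: "AE x in lebesgue_on (annulus a b). \<rho> 0 x = \<rho>0 x"
  and bc: "AE t in lebesgue_on {0<..}. boundary_conditions a b \<nu> \<rho>star \<alpha> (u t) (P t)"
 shows "(\<integral>x. (\<rho> \<tau> x + \<rho>s x - \<beta>)^2 \<partial>lebesgue_on (annulus a b)) = (\<integral>x. (\<rho>0 x + \<rho>s x - \<beta>)^2 \<partial>lebesgue_on (annulus a b))"
proof -
 define U where "U = annulus a b"
 have U: "open U" "U \<in> sets borel" "bounded U" using ab bounded_annulus by (auto simp: U_def open_annulus)
 note [measurable] = U(2)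
 define T where "T = \<tau> + 1"
 have T: "0 < T" "\<tau> < T" using tau by (auto simp: T_def)
 obtain C1 where C1: "\<forall>t\<in>{0..T}. (\<integral>x. \<bar>\<rho> t x\<bar> powr q \<partial>lebesgue_on U) \<le> C1"
  using rho_bound[OF T(1)] unfolding U_def by (elim exE)
 have "\<exists>c. \<forall>i. AE t in lebesgue_on {0<..<T}. (\<lambda>x. u t x $ i) \<in> Wspace 2 2 U \<and> Hnorm_sq 2 U (\<lambda>x. u t x $ i) \<le> c i"
  using u T(1) unfolding Linf_loc_H_def U_def by (intro choice allI) blast
 then obtain c where c: "\<forall>i. AE t in lebesgue_on {0<..<T}. (\<lambda>x. u t x $ i) \<in> Wspace 2 2 U \<and> Hnorm_sq 2 U (\<lambda>x. u t x $ i) \<le> c i"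
  by (elim exE)
 (* Absolute values, because nothing says that the given bounds are nonnegative. *)
 define C2 where "C2 = \<bar>c 1\<bar> + \<bar>c 2\<bar>"
 have C2: "0 \<le> C2" "c i \<le> C2" for i using exhaust_2[of i] by (auto simp: C2_def)
 have "\<exists>rv. \<forall>t. rv t \<in> Borel \<and> (\<forall>x. x \<notin> U --> rv t x = 0) \<and> (0 \<le> t --> (AE x in lborel. x \<in> U --> \<rho> t x = rv t x))"
 proof (intro choice allI)
  fix t :: real
  show "\<exists>r. r \<in> Borel \<and> (\<forall>x. x \<notin> U --> r x = 0) \<and> (0 \<le> t --> (AE x in lborel. x \<in> U --> \<rho> t x = r x))"
  proof (cases "0 \<le> t")
   case True
   have "\<rho> t \<in> borel_measurable (lebesgue_on U)" using rho_Lq[OF True] by (simp add: Lspace_def U_def)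
   from lebesgue_on_borel_version[OF U(2) this] show ?thesis by blast
  qed (auto intro: exI[of _ "\<lambda>x. 0"])
 qed
 then obtain rv where "\<forall>t. rv t \<in> Borel \<and> (\<forall>x. x \<notin> U --> rv t x = 0) \<and> (0 \<le> t --> (AE x in lborel. x \<in> U --> \<rho> t x = rv t x))"
  by (elim exE)
 then have rv: "rv t \<in> Borel" "x \<notin> U ==> rv t x = 0" "0 \<le> t ==> AE x in lborel. x \<in> U --> \<rho> t x = rv t x" for t x
  by blast+
 obtain G where "case_prod G \<in> borel_measurable (borel \<Otimes>\<^sub>M borel) \<and> (\<forall>t x. x \<notin> U --> G t x = 0) \<and>
  (AE t in lborel. 0 < t --> (AE x in lborel. x \<in> U --> \<rho> t x = G t x))"
  using joint_borel_version[OF U(2)] rho_meas unfolding U_def by blast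
 then have G[measurable]: "case_prod G \<in> borel_measurable (borel \<Otimes>\<^sub>M borel)" and Gz: "x \<notin> U ==> G t x = 0"
  and Gae: "AE t in lborel. 0 < t --> (AE x in lborel. x \<in> U --> \<rho> t x = G t x)" for t x by blast+
 have "\<exists>W. \<forall>i. case_prod (W i) \<in> borel_measurable (borel \<Otimes>\<^sub>M borel) \<and> (\<forall>t x. x \<notin> U --> W i t x = 0) \<and>
  (AE t in lborel. 0 < t --> (AE x in lborel. x \<in> U --> u t x $ i = W i t x))"
  using u unfolding Linf_loc_H_def U_def by (intro choice allI joint_borel_version[OF U(2)[unfolded U_def]]) blast
 then obtain W where "\<forall>i. case_prod (W i) \<in> borel_measurable (borel \<Otimes>\<^sub>M borel) \<and> (\<forall>t x. x \<notin> U --> W i t x = 0) \<and>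
  (AE t in lborel. 0 < t --> (AE x in lborel. x \<in> U --> u t x $ i = W i t x))" by (elim exE)
 then have W[measurable]: "case_prod (W i) \<in> borel_measurable (borel \<Otimes>\<^sub>M borel)" and Wz: "x \<notin> U ==> W i t x = 0"
  and Wae: "AE t in lborel. 0 < t --> (AE x in lborel. x \<in> U --> u t x $ i = W i t x)" for t x i by blast+
 define good where "good s \<longleftrightarrow> (AE x in lborel. x \<in> U --> \<rho> s x = G s x) \<and> (\<forall>i. AE x in lborel. x \<in> U --> u s x $ i = W i s x) \<and>
  boundary_conditions a b \<nu> \<rho>star \<alpha> (u s) (P s) \<and> (AE x in lebesgue_on U. divergence U (u s) x = 0) \<and>
  (\<forall>i. Hnorm_sq 2 U (\<lambda>x. u s x $ i) \<le> C2)" for s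
 have "AE s in lborel. s \<in> {0<..<T} --> good s"
 proof -
  have 1: "AE s in lborel. s \<in> {0<..} --> boundary_conditions a b \<nu> \<rho>star \<alpha> (u s) (P s)"
   using bc by (subst (asm) AE_lebesgue_on_iff) auto
  have 2: "AE s in lborel. s \<in> {0<..} --> (AE x in lebesgue_on U. divergence U (u s) x = 0)"
   using div unfolding U_def by (subst (asm) AE_lebesgue_on_iff) auto
  have 3: "AE s in lborel. \<forall>i. s \<in> {0<..<T} --> (\<lambda>x. u s x $ i) \<in> Wspace 2 2 U \<and> Hnorm_sq 2 U (\<lambda>x. u s x $ i) \<le> c i"
   unfolding AE_all_countable using c by (subst (asm) AE_lebesgue_on_iff) auto
  have 4: "AE s in lborel. \<forall>i. 0 < s --> (AE x in lborel. x \<in> U --> u s x $ i = W i s x)"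
   unfolding AE_all_countable using Wae by blast
  from 1 2 3 4 Gae show ?thesis
  proof eventually_elim
   case (elim s)
   show ?case
   proof
    assume s: "s \<in> {0<..<T}"
    have "Hnorm_sq 2 U (\<lambda>x. u s x $ i) \<le> C2" for i using elim(3) s C2(2)[of i] by (meson order_trans)
    with elim s show "good s" unfolding good_def by simp
   qed
  qed
 qed
 then obtain N where N: "{s \<in> space lborel. \<not> (s \<in> {0<..<T} --> good s)} \<subseteq> N" "emeasure lborel N = 0" "N \<in> sets lborel"
  by (rule AE_E)
 (* The good times, as a Borel set. *)
 define S where "S = {0<..<T} - N"
 have S[measurable]: "S \<in> sets borel" using N(3) by (simp add: S_def)
 have Sgood: "good s" "0 < s" if "s \<in> S" for s using N(1) that by (auto simp: S_def)
 have SAE: "AE s in lborel. s \<in> {0..\<tau>} --> s \<in> S"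
 proof -
  have "AE s in lborel. s \<notin> N" using N(2,3) by (intro AE_not_in) (auto simp: null_sets_def)
  moreover have "AE s in lborel. s \<noteq> (0::real)" by (rule AE_lborel_singleton)
  ultimately show ?thesis by eventually_elim (use T in \<open>auto simp: S_def\<close>)
 qed
 define k where "k x = ind U x * (h x - \<beta>)" for x
 have hc: "continuous_on UNIV (\<lambda>x. h x - \<beta>)" by (intro continuous_intros smooth_continuous_on h(1))
 have k4: "L4_fun k" unfolding k_def[abs_def] by (rule L4_fun_indicator_continuous[OF hc U(2,3)])
 have [measurable]: "k \<in> Borel" using k4 by (simp add: L4_fun_def)
 have kz: "k x = 0" if "x \<notin> U" for x using that by (simp add: k_def)
 define K4 where "K4 = (LBINT x. k x ^ 4)"
 have K4: "0 \<le> K4" by (simp add: K4_def)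
 define B4 where "B4 = 27 * (measure lborel U + \<bar>C1\<bar> + K4)"
 have B4: "0 \<le> B4" using K4 by (simp add: B4_def)
 (* One constant for all bounds; 18 = 3 * 6 counts four gradient and two velocity terms. *)
 define B where "B = B4 + (4 + 18 * (b^2 + 1)) * C2"
 have Bge: "B4 \<le> B" "4 * C2 \<le> B" "C2 \<le> B" "18 * (b^2 + 1) * C2 \<le> B" "0 \<le> B"
 proof -
  have "0 \<le> 18 * (b^2 + 1) * C2" using C2(1) by simp
  moreover have "B = B4 + 4 * C2 + 18 * (b^2 + 1) * C2" by (simp add: B_def algebra_simps)
  ultimately show "B4 \<le> B" "4 * C2 \<le> B" "C2 \<le> B" "18 * (b^2 + 1) * C2 \<le> B" "0 \<le> B"
   using B4 C2(1) by linarith+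
 qed
 define \<Theta> where "\<Theta> t x = rv t x + k x" for t x
 define H where "H s x = ind S s * (G s x + k x)" for s x
 define v where "v i s x = ind S s * W i s x" for i s x
 have L4bd: "L4_fun r \<and> (LBINT x. (r x + k x) ^ 4) \<le> B4 \<and> L4_fun (\<lambda>x. r x + k x)"
  if t: "0 \<le> t" "t \<le> T" and r: "r \<in> Borel" "\<And>x. x \<notin> U ==> r x = 0" "AE x in lborel. x \<in> U --> \<rho> t x = r x" for t r
 proof -
  have b: "(\<integral>x. \<bar>\<rho> t x\<bar> powr q \<partial>lebesgue_on U) \<le> C1" using C1 t by simp
  note f = Lspace_ge_4_imp_L4[OF U(2,3) q rho_Lq[OF t(1), folded U_def] b r]
  have "27 * ((LBINT x. r x ^ 4) + (LBINT x. k x ^ 4)) \<le> B4"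
   using f(2) by (simp add: B4_def K4_def)
  with L4_fun_add[OF f(1) k4] f(1) show ?thesis by linarith
 qed
 have Gs[measurable]: "G s \<in> Borel" and Ws[measurable]: "W i s \<in> Borel" for i s by measurable
 have facts_H: "L4_fun (G s)" "(LBINT x. (G s x + k x) ^ 4) \<le> B4" "L4_fun (\<lambda>x. G s x + k x)" if "s \<in> S" for s
  using L4bd[of s "G s"] that Sgood[OF that] Gs Gz by (auto simp: good_def S_def)
 define E where "E s = (\<Sum>i\<in>UNIV. \<Sum>j\<in>UNIV. (L2norm U (weak_deriv U (axis j 1) (\<lambda>x. u s x $ i)))^2)" for s
 have vel: "\<And>i. L2_fun lborel (W i s)"
   "\<And>i A h. A \<in> sets borel ==> (\<And>y s. y \<in> A ==> 0 \<le> s ==> s \<le> 1 ==> y + s *\<^sub>R h \<in> U) ==>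
    (LBINT y. ind A y * (W i s (h + y) - W i s y)^2) \<le> (norm h)^2 * E s"
   "\<exists>\<Psi> :: real^2 => real. (\<forall>x. 0 \<le> \<Psi> x) \<and> L1 \<Psi> \<and>
    (LBINT x. \<Psi> x) \<le> 3 * (b^2 + 1) * (E s + (\<Sum>i\<in>UNIV. LBINT x. (W i s x)^2)) \<and>
    (\<forall>p q. a \<le> p --> p < q --> q \<le> b --> p = a \<or> q = b -->
     (LBINT x. ind {x. p < norm x \<and> norm x < q} x * (\<Sum>i\<in>UNIV. x $ i * W i s x)^2)
      \<le> 2 * (q - p)^2 * (b / a) * (LBINT x. ind {x. p < norm x \<and> norm x < q} x * \<Psi> x))"
   "\<And>\<phi>. test_function U \<phi> ==> (LBINT x. (\<Sum>i\<in>UNIV. W i s x * pd i \<phi> x)) = 0"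
   "\<And>i. (LBINT x. (W i s x)^2) \<le> C2" "E s \<le> 4 * C2" if s: "s \<in> S" for s
 proof -
  have g: "boundary_conditions a b \<nu> \<rho>star \<alpha> (u s) (P s)" "AE x in lebesgue_on (annulus a b). divergence (annulus a b) (u s) x = 0"
   "\<And>i. AE x in lborel. x \<in> annulus a b --> u s x $ i = W i s x" "\<And>i. Hnorm_sq 2 U (\<lambda>x. u s x $ i) \<le> C2"
   using Sgood(1)[OF s] unfolding good_def U_def by blast+
  have z: "\<And>i x. x \<notin> annulus a b ==> W i s x = 0" using Wz by (simp add: U_def)
  note f = boundary_velocity_facts[OF ab g(1,2) Ws[of _ s] z g(3), folded U_def, folded E_def]
  show "\<And>i. L2_fun lborel (W i s)" by (rule f(1))
  show "\<And>i A h. A \<in> sets borel ==> (\<And>y s. y \<in> A ==> 0 \<le> s ==> s \<le> 1 ==> y + s *\<^sub>R h \<in> U) ==>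
    (LBINT y. ind A y * (W i s (h + y) - W i s y)^2) \<le> (norm h)^2 * E s" by (rule f(2))
  show "\<exists>\<Psi> :: real^2 => real. (\<forall>x. 0 \<le> \<Psi> x) \<and> L1 \<Psi> \<and>
    (LBINT x. \<Psi> x) \<le> 3 * (b^2 + 1) * (E s + (\<Sum>i\<in>UNIV. LBINT x. (W i s x)^2)) \<and>
    (\<forall>p q. a \<le> p --> p < q --> q \<le> b --> p = a \<or> q = b -->
     (LBINT x. ind {x. p < norm x \<and> norm x < q} x * (\<Sum>i\<in>UNIV. x $ i * W i s x)^2)
      \<le> 2 * (q - p)^2 * (b / a) * (LBINT x. ind {x. p < norm x \<and> norm x < q} x * \<Psi> x))" by (rule f(3))
  show "\<And>\<phi>. test_function U \<phi> ==> (LBINT x. (\<Sum>i\<in>UNIV. W i s x * pd i \<phi> x)) = 0" by (rule f(4))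
  show "(LBINT x. (W i s x)^2) \<le> C2" for i
   using L2_fun_borel_version(2)[OF U(2) Ws Wz g(3)[folded U_def, of i]] Hnorm_sq_2_bounds(1)[of U "\<lambda>x. u s x $ i"] g(4)[of i]
   unfolding L2norm_sq by linarith
  have "(L2norm U (weak_deriv U (axis j 1) (\<lambda>x. u s x $ i)))^2 \<le> C2" for i j
   using Hnorm_sq_2_bounds(2)[of U j "\<lambda>x. u s x $ i"] g(4)[of i] by linarith
  then have "E s \<le> (\<Sum>i\<in>(UNIV::2 set). \<Sum>j\<in>(UNIV::2 set). C2)" unfolding E_def by (intro sum_mono)
  then show "E s \<le> 4 * C2" by (simp add: sum_2)
 qed
 have grad_meas: "(\<lambda>x. pd i \<phi> x) \<in> Borel" "\<phi> \<in> Borel"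
  if "test_function U \<phi>" for \<phi> :: "real^2 => real" and i :: 2
  using that by (auto simp: test_function_def axis_in_Basis_iff intro!: borel_measurable_continuous_onI smooth_continuous_on smooth_partial)
 have irv: "L1 (rv t)" if "0 \<le> t" "t \<le> \<tau>" for t
 proof -
  have "L4_fun (rv t)" using L4bd[of t "rv t"] that T rv by auto
  then show ?thesis by (rule L4_bounded_support_integrable[OF _ rv(2) U(2,3)])
 qed
 have ik: "L1 k" by (rule L4_bounded_support_integrable[OF k4 kz U(2,3)])
 have agree: "AE s in lborel. s \<in> {0..\<tau>} --> (AE x in lborel. H s x = \<Theta> s x)"
  using SAE
 proof eventually_elim
  case (elim s)
  show ?case
  proof
   assume "s \<in> {0..\<tau>}"
   with elim have s: "s \<in> S" "0 \<le> s" by auto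
   have "AE x in lborel. x \<in> U --> \<rho> s x = G s x" using Sgood(1)[OF s(1)] by (simp add: good_def)
   with rv(3)[OF s(2)] show "AE x in lborel. H s x = \<Theta> s x"
   proof eventually_elim
    case (elim x)
    then show ?case using s by (cases "x \<in> U") (simp_all add: H_def \<Theta>_def Gz kz rv(2))
   qed
  qed
 qed
 have init': "AE x in lborel. x \<in> U --> \<rho>0 x = rv 0 x"
 proof -
  have "AE x in lborel. x \<in> U --> \<rho> 0 x = \<rho>0 x" using init unfolding U_def[symmetric] AE_lebesgue_on_iff[OF U(2)] .
  with rv(3)[OF order_refl] show ?thesis by eventually_elim auto
 qed
 have equation: "(LBINT x. \<Theta> t x * \<phi> x) = (LBINT x. \<Theta> 0 x * \<phi> x) +
    (LBINT s. ind {0..t} s *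
     (LBINT x. H s x * (\<Sum>i\<in>UNIV. v i s x * pd i \<phi> x)))"
  if phi: "test_function U \<phi>" and t: "0 \<le> t" "t \<le> \<tau>" for \<phi> t
 proof -
  note [measurable] = grad_meas[OF phi]
  define Q where "Q s = (\<integral>x. \<rho> s x * (u s x \<bullet> classical_grad \<phi> x) - (u s x \<bullet> classical_grad \<rho>s x) * \<phi> x \<partial>lebesgue_on U)" for s
  define Q' where "Q' s = (LBINT x. H s x * (\<Sum>i\<in>UNIV. v i s x * pd i \<phi> x))" for s
  have Q: "Q s = Q' s" if s: "s \<in> S" for s
  proof -
   have g: "AE x in lborel. x \<in> annulus a b --> \<rho> s x = G s x" "\<And>i. AE x in lborel. x \<in> annulus a b --> u s x $ i = W i s x"
    using Sgood(1)[OF s] unfolding good_def U_def by blast+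
   have G2: "L2_fun lborel (G s)"
    by (rule L4_L1_imp_L2[OF L4_bounded_support_integrable[OF facts_H(1)[OF s] Gz U(2,3)] facts_H(1)[OF s]])
   have "Q s = (LBINT x. (G s x + ind U x * (h x - \<beta>)) * (\<Sum>i\<in>UNIV. W i s x * pd i \<phi> x))"
    unfolding Q_def U_def
    by (rule flux_at_fixed_time[OF ab phi[unfolded U_def] h G2 Gz[unfolded U_def] g(1) vel(1)[OF s] Wz[unfolded U_def] g(2) vel(4)[OF s, unfolded U_def]])
   then show ?thesis using s by (simp add: Q'_def H_def v_def k_def)
  qed
  have Q'm[measurable]: "Q' \<in> Borel"
   unfolding Q'_def[abs_def] H_def v_def by (rule lborel.borel_measurable_lebesgue_integral) measurable
  have Qint: "(\<integral>s. Q s \<partial>lebesgue_on {0..t}) = (LBINT s. ind {0..t} s * Q' s)"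
  proof (rule integral_lebesgue_on_borel(1))
   show "AE s in lborel. s \<in> {0..t} --> Q s = ind {0..t} s * Q' s"
    using SAE by eventually_elim (use t Q in auto)
  qed auto
  have stat: "(\<integral>x. R x * \<phi> x \<partial>lebesgue_on U) = (LBINT x. rv t x * \<phi> x)"
   if "0 \<le> t" "AE x in lborel. x \<in> U --> R x = rv t x" for R t
  proof (rule integral_lebesgue_on_borel(1)[OF U(2)])
   show "(\<lambda>x. rv t x * \<phi> x) \<in> Borel" using rv(1)[of t] by measurable
   show "AE x in lborel. x \<in> U --> R x * \<phi> x = rv t x * \<phi> x" using that(2) by eventually_elim auto
  qed (simp add: rv(2))
  have "(\<integral>x. \<rho> t x * \<phi> x \<partial>lebesgue_on U) = (\<integral>x. \<rho>0 x * \<phi> x \<partial>lebesgue_on U) + (\<integral>s. Q s \<partial>lebesgue_on {0..t})"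
   using eq phi t(1) unfolding density_equation_def Q_def U_def by blast
  then have e: "(LBINT x. rv t x * \<phi> x) = (LBINT x. rv 0 x * \<phi> x) + (LBINT s. ind {0..t} s * Q' s)"
   unfolding Qint stat[OF t(1) rv(3)[OF t(1)]] stat[OF order_refl init'] .
  obtain L where L: "\<forall>x. \<bar>\<phi> x\<bar> \<le> L" using test_function_bounded(1)[OF phi] by (elim exE)
  have im: "L1 (\<lambda>x. g x * \<phi> x)" if "L1 g" for g
   by (rule integrable_lborel_mult_bounded[OF that grad_meas(2)[OF phi] L[rule_format]])
  have sp: "(LBINT x. \<Theta> t x * \<phi> x) = (LBINT x. rv t x * \<phi> x) + (LBINT x. k x * \<phi> x)" if "0 \<le> t" "t \<le> \<tau>" for t
   using im[OF irv[OF that]] im[OF ik] by (simp add: \<Theta>_def distrib_right)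
  show ?thesis using e sp[OF t] sp[OF order_refl tau] by (simp add: Q'_def)
 qed
 have "transport a b \<tau> B \<Theta> H v"
 proof (rule transport.intro)
  show "0 < a" "a < b" "0 \<le> \<tau>" by fact+
  show "case_prod H \<in> borel_measurable (borel \<Otimes>\<^sub>M borel)" unfolding H_def[abs_def] by measurable
  show "case_prod (v i) \<in> borel_measurable (borel \<Otimes>\<^sub>M borel)" for i unfolding v_def[abs_def] by measurable
  show "H s x = 0" if "x \<notin> annulus a b" for s x using that by (simp add: H_def Gz kz U_def)
  show "v i s x = 0" if "x \<notin> annulus a b" for i s x using that by (simp add: v_def Wz U_def)
  show "\<Theta> t x = 0" if "x \<notin> annulus a b" for t x using that by (simp add: \<Theta>_def rv(2) kz U_def)
  show "L4_fun (\<Theta> t)" if "0 \<le> t" "t \<le> \<tau>" for t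
   using L4bd[of t "rv t"] that T rv by (auto simp: \<Theta>_def[abs_def])
  show "L4_fun (H s)" for s
   using facts_H(3)[of s] by (cases "s \<in> S") (simp_all add: H_def[abs_def] L4_fun_def)
  show "(LBINT x. H s x ^ 4) \<le> B" for s
   using facts_H(2)[of s] Bge by (cases "s \<in> S") (simp_all add: H_def)
  show "L2_fun lborel (v i s)" for i s
   using vel(1)[of s i] by (cases "s \<in> S") (simp_all add: v_def[abs_def] L2_fun_def)
  show "(LBINT x. (v i s x)^2) \<le> B" for i s
   using vel(5)[of s i] Bge by (cases "s \<in> S") (simp_all add: v_def)
  show "(LBINT y. ind A y * (v i s (h + y) - v i s y)^2) \<le> (norm h)^2 * B"
   if "A \<in> sets borel" "\<And>y r. y \<in> A ==> 0 \<le> r ==> r \<le> 1 ==> y + r *\<^sub>R h \<in> annulus a b" for s i A h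
  proof (cases "s \<in> S")
   case True
   have "(LBINT y. ind A y * (W i s (h + y) - W i s y)^2) \<le> (norm h)^2 * E s"
    by (rule vel(2)[OF True that(1)]) (use that(2) in \<open>simp add: U_def\<close>)
   also have "\<dots> \<le> (norm h)^2 * B" using vel(6)[OF True] Bge(2) by (intro mult_left_mono) auto
   finally show ?thesis using True by (simp add: v_def)
  qed (use Bge in \<open>simp add: v_def\<close>)
  show "\<exists>\<Psi> :: real^2 => real. (\<forall>x. 0 \<le> \<Psi> x) \<and> L1 \<Psi> \<and>
   (LBINT x. \<Psi> x) \<le> B \<and>
   (\<forall>p q. a \<le> p --> p < q --> q \<le> b --> p = a \<or> q = b -->
    (LBINT x. ind {x. p < norm x \<and> norm x < q} x * (\<Sum>i\<in>UNIV. x $ i * v i s x)^2)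
     \<le> 2 * (q - p)^2 * (b / a) * (LBINT x. ind {x. p < norm x \<and> norm x < q} x * \<Psi> x))" for s
  proof (cases "s \<in> S")
   case True
   have "(\<Sum>i\<in>UNIV. LBINT x. (W i s x)^2) \<le> 2 * C2" using vel(5)[OF True, of 1] vel(5)[OF True, of 2] by (simp add: sum_2)
   then have "3 * (b^2 + 1) * (E s + (\<Sum>i\<in>UNIV. LBINT x. (W i s x)^2)) \<le> 3 * (b^2 + 1) * (6 * C2)"
    using vel(6)[OF True] by (intro mult_left_mono) auto
   also have "\<dots> \<le> B" using Bge(4) by (simp add: algebra_simps)
   finally have c: "3 * (b^2 + 1) * (E s + (\<Sum>i\<in>UNIV. LBINT x. (W i s x)^2)) \<le> B" .
   have e: "v i s = W i s" for i using True by (simp add: v_def[abs_def])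
   show ?thesis unfolding e using vel(3)[OF True]
    by (elim ex_forward conjE) (intro conjI; (assumption | rule order_trans[OF _ c]))
  qed (intro exI[of _ "\<lambda>x. 0"], simp add: v_def Bge(5))
  show "(LBINT x. (\<Sum>i\<in>UNIV. v i s x * pd i \<phi> x)) = 0"
   if "test_function (annulus a b) \<phi>" for s \<phi>
   using vel(4)[of s \<phi>] that by (cases "s \<in> S") (simp_all add: v_def U_def)
  show "AE s in lborel. s \<in> {0..\<tau>} --> (AE x in lborel. H s x = \<Theta> s x)" by (rule agree)
  show "(LBINT x. \<Theta> t x * \<phi> x) = (LBINT x. \<Theta> 0 x * \<phi> x) +
    (LBINT s. ind {0..t} s *
     (LBINT x. H s x * (\<Sum>i\<in>UNIV. v i s x * pd i \<phi> x)))"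
   if "test_function (annulus a b) \<phi>" "0 \<le> t" "t \<le> \<tau>" for \<phi> t
   by (rule equation) (use that in \<open>simp_all add: U_def\<close>)
 qed
 then have cons: "(LBINT x. (\<Theta> \<tau> x)^2) = (LBINT x. (\<Theta> 0 x)^2)" by (rule transport.transport_conserves_L2)
 have conv: "(\<integral>x. (R x + \<rho>s x - \<beta>)^2 \<partial>lebesgue_on U) = (LBINT x. (\<Theta> t x)^2)"
  if "AE x in lborel. x \<in> U --> R x = rv t x" for R t
 proof (rule integral_lebesgue_on_borel(1)[OF U(2)])
  show "(\<lambda>x. (\<Theta> t x)^2) \<in> Borel" unfolding \<Theta>_def using rv(1)[of t] by measurable
  show "(\<Theta> t x)^2 = 0" if "x \<notin> U" for x using that by (simp add: \<Theta>_def rv(2) kz)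
  show "AE x in lborel. x \<in> U --> (R x + \<rho>s x - \<beta>)^2 = (\<Theta> t x)^2"
   using that by eventually_elim (auto simp: \<Theta>_def k_def h(2) U_def add_diff_eq)
 qed
 show ?thesis using conv[OF rv(3)[OF tau]] conv[OF init'] cons by (simp add: U_def)
qed

section \<open>The asymptotic statements\<close>

text \<open>An open set is a countable union of compact sets.\<close>

lemma loc_integrable_measurable:
 fixes g :: "'a::euclidean_space => real"
 assumes U: "open U" and g: "loc_integrable U g"
 shows "g \<in> borel_measurable (lebesgue_on U)"
proof -
 obtain C :: "nat => 'a set" where C: "\<And>n. compact (C n)" "\<And>n. C n \<subseteq> U" "\<Union>(range C) = U"
  using open_Union_compact_subsets[OF U] by metis
 show ?thesis
 proof (rule measurable_piecewise_restrict[of "range C"])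
  show "countable (range C)" by simp
  show "space (lebesgue_on U) \<subseteq> \<Union>(range C)" using C(3) by simp
  fix K assume "K \<in> range C"
  then have K: "compact K" "K \<subseteq> U" using C by auto
  have KL: "K \<in> sets lebesgue" "U \<in> sets lebesgue" using K(1) U by (auto intro: lmeasurable_compact fmeasurableD borel_open)
  show "K \<inter> space (lebesgue_on U) \<in> sets (lebesgue_on U)"
   using K KL by (simp add: sets_restrict_space_iff Int_absorb2)
  have "restrict_space (lebesgue_on U) K = lebesgue_on K"
   using K KL by (subst restrict_restrict_space) (auto simp: Int_absorb1)
  then show "g \<in> borel_measurable (restrict_space (lebesgue_on U) K)"
   using g K unfolding loc_integrable_def by (simp add: borel_measurable_integrable)
 qed
qed

lemma bounded_imp_L2:
 fixes g :: "real^2 => real"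
 assumes U: "U \<in> sets borel" "bounded U" and m: "g \<in> borel_measurable (lebesgue_on U)"
  and M: "AE x in lborel. x \<in> U --> \<bar>g x\<bar> \<le> M"
 shows "L2_fun (lebesgue_on U) g"
proof -
 have "\<exists>g'. g' \<in> Borel \<and> (\<forall>x. x \<notin> U --> g' x = 0) \<and> (AE x in lborel. x \<in> U --> g x = g' x)"
  using lebesgue_on_borel_version[OF U(1) m] by blast
 then obtain g' where g'[measurable]: "g' \<in> Borel" and z: "\<And>x. x \<notin> U ==> g' x = 0"
  and ae: "AE x in lborel. x \<in> U --> g x = g' x" by blast
 have i: "L1 (\<lambda>x. M^2 * ind U x)"
  using U emeasure_bounded_finite[of U] by (intro integrable_mult_right integrable_real_indicator) auto
 have "L1 (\<lambda>x. (g' x)^2)"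
 proof (rule Bochner_Integration.integrable_bound[OF i])
  show "AE x in lborel. norm ((g' x)^2) \<le> norm (M^2 * ind U x)"
   using M ae
  proof eventually_elim
   case (elim x)
   show ?case
   proof (cases "x \<in> U")
    case True
    with elim have "\<bar>g' x\<bar> \<le> M" by simp
    from power_mono[OF this, of 2] show ?thesis using True by simp
   qed (simp add: z)
  qed
 qed measurable
 then have "L2_fun lborel g'" by (simp add: L2_fun_def)
 with L2_fun_borel_version(1)[OF U(1) g' z ae] show ?thesis by blast
qed

lemma Lspace_ge_4_imp_L2:
 fixes R :: "real^2 => real"
 assumes U: "U \<in> sets borel" "bounded U" and q: "4 \<le> q" and R: "R \<in> Lspace (ereal q) U"
 shows "L2_fun (lebesgue_on U) R"
proof -
 have m: "R \<in> borel_measurable (lebesgue_on U)" using R by (simp add: Lspace_def)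
 have "\<exists>g'. g' \<in> Borel \<and> (\<forall>x. x \<notin> U --> g' x = 0) \<and> (AE x in lborel. x \<in> U --> R x = g' x)"
  using lebesgue_on_borel_version[OF U(1) m] by blast
 then obtain r where r: "r \<in> Borel" and z: "\<And>x. x \<notin> U ==> r x = 0"
  and ae: "AE x in lborel. x \<in> U --> R x = r x" by blast
 have r4: "L4_fun r" by (rule Lspace_ge_4_imp_L4(1)[OF U q R order_refl r z ae])
 have "L2_fun lborel r" by (rule L4_L1_imp_L2[OF L4_bounded_support_integrable[OF r4 z U] r4])
 with L2_fun_borel_version(1)[OF U(1) r z ae] show ?thesis by blast
qed

lemma continuous_imp_L2:
 fixes g h :: "real^2 => real"
 assumes U: "U \<in> sets borel" "bounded U" and h: "continuous_on UNIV h" "\<And>x. x \<in> U ==> g x = h x"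
 shows "L2_fun (lebesgue_on U) g"
proof -
 have l: "L2_fun lborel (\<lambda>x. ind U x * h x)" by (rule L2_fun_indicator_continuous[OF h(1) U])
 then show ?thesis
  by (subst L2_fun_borel_version(1)[OF U(1), of "\<lambda>x. ind U x * h x"]) (use h(2) in \<open>auto simp: L2_fun_def\<close>)
qed

theorem theorem1p5:
  fixes a b \<nu> \<rho>star q :: real
    and \<alpha> f \<rho>s \<rho>0 :: "real^2 \<Rightarrow> real"
    and u0 :: "real^2 \<Rightarrow> real^2"
    and u :: "real \<Rightarrow> real^2 \<Rightarrow> real^2"
    and \<rho> P :: "real \<Rightarrow> real^2 \<Rightarrow> real"
    and \<Omega> :: "(real^2) set"
  assumes "0 < a" and "a < b" and "0 < \<nu>" and "0 < \<rho>star" and "4 \<le> q"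
    and Omega: "\<Omega> = annulus a b"
    and alpha: "W1inf_circle a \<alpha>" "AE_circle a (\<lambda>x. 0 \<le> \<nu> / a + \<alpha> x)"
    and potential: "\<And>j. \<exists>h \<in> Wspace 1 \<infinity> \<Omega>. has_weak_deriv \<Omega> (axis j 1) f h"
    and profile: "smooth_up_to_boundary \<Omega> \<rho>s"
    and hydrostatic:
      "\<exists>Ps. \<forall>j. has_weak_deriv \<Omega> (axis j 1) Ps (\<lambda>x. - (\<rho>s x * grad \<Omega> f x $ j))"
    and initial_velocity: "\<And>i. (\<lambda>x. u0 x $ i) \<in> Wspace 2 2 \<Omega>"
      "AE x in lebesgue_on \<Omega>. divergence \<Omega> u0 x = 0"
      "boundary_conditions a b \<nu> \<rho>star \<alpha> u0 (\<lambda>_. 0)"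
    and initial_density: "\<rho>0 \<in> Lspace (ereal q) \<Omega>"
    and solution: "boussinesq_solution a b \<nu> \<rho>star \<alpha> f \<rho>s q u0 \<rho>0 u \<rho> P"
  shows "(((\<lambda>t. \<integral>x. \<rho> t x * f x \<partial>lebesgue_on \<Omega>) \<longlongrightarrow> 0) at_top \<longleftrightarrow>
           (\<exists>\<gamma>>0. \<exists>\<beta> L.
              ((\<lambda>t. (L2norm \<Omega> (\<lambda>x. \<rho> t x + \<rho>s x + \<gamma> * f x - \<beta>))\<^sup>2) \<longlongrightarrow> L) at_top \<and>
              (L2norm \<Omega> (\<lambda>x. \<rho>0 x + \<rho>s x + \<gamma> * f x - \<beta>))\<^sup>2 - L
                = 2 * \<gamma> * (\<integral>x. \<rho>0 x * f x \<partial>lebesgue_on \<Omega>)))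
       \<and> (\<forall>\<gamma>>0. \<forall>\<beta>.
            ((\<lambda>t. L2norm \<Omega> (\<lambda>x. \<rho> t x + \<rho>s x - (- \<gamma> * f x + \<beta>))) \<longlongrightarrow> 0) at_top \<longleftrightarrow>
            ((\<lambda>t. 2 * \<gamma> * (\<integral>x. (\<rho>0 x - \<rho> t x) * f x \<partial>lebesgue_on \<Omega>)) \<longlongrightarrow>
               (L2norm \<Omega> (\<lambda>x. \<rho>0 x + \<rho>s x + \<gamma> * f x - \<beta>))\<^sup>2) at_top)"
proof -
 note ab = assms(1,2) and q = assms(5)
 have U: "open \<Omega>" "\<Omega> \<in> sets borel" "bounded \<Omega>" using ab bounded_annulus by (auto simp: Omega open_annulus)
 obtain h where h: "smooth h" "\<forall>x\<in>closure \<Omega>. \<rho>s x = h x" using profile unfolding smooth_up_to_boundary_def by blast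
 have hs: "\<rho>s x = h x" if "x \<in> \<Omega>" for x using h(2) closure_subset that by blast
 note sol = solution[unfolded boussinesq_solution_def Let_def, folded Omega]
 have rho_Lq: "\<rho> t \<in> Lspace (ereal q) \<Omega>" if "0 \<le> t" for t using sol that by blast
 have cons: "(\<integral>x. (\<rho> t x + \<rho>s x - \<beta>)^2 \<partial>lebesgue_on \<Omega>) = (\<integral>x. (\<rho>0 x + \<rho>s x - \<beta>)^2 \<partial>lebesgue_on \<Omega>)" if t: "0 \<le> t" for t \<beta>
  unfolding Omega
 proof (rule density_L2_conserved[OF ab q t h(1), where u = u and P = P and \<nu> = \<nu> and \<rho>star = \<rho>star and \<alpha> = \<alpha>], unfold Omega[symmetric])
  show "\<rho>s x = h x" if "x \<in> \<Omega>" for x by (rule hs[OF that])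
  show "\<rho> t \<in> Lspace (ereal q) \<Omega>" if "0 \<le> t" for t by (rule rho_Lq[OF that])
  show "\<exists>C. \<forall>t\<in>{0..T}. (\<integral>x. \<bar>\<rho> t x\<bar> powr q \<partial>lebesgue_on \<Omega>) \<le> C" if "0 < T" for T using sol that by blast
  show "Linf_loc_H 2 \<Omega> (\<lambda>t x. u t x $ i)" for i using sol by blast
 qed (use sol in blast)+
 obtain hh where hh: "\<forall>j. hh j \<in> Wspace 1 \<infinity> \<Omega> \<and> has_weak_deriv \<Omega> (axis j 1) f (hh j)"
  using choice[of "\<lambda>j h. h \<in> Wspace 1 \<infinity> \<Omega> \<and> has_weak_deriv \<Omega> (axis j 1) f h"] potential by blast
 have "\<exists>N. AE x in lborel. x \<in> \<Omega> --> \<bar>hh j x\<bar> \<le> N" for j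
 proof -
  have "hh j \<in> Lspace \<infinity> \<Omega>" using hh[rule_format, of j] unfolding One_nat_def Wspace.simps by blast
  then show ?thesis unfolding Lspace_def using AE_lebesgue_on_iff[OF U(2)] by auto
 qed
 then have "\<exists>N. \<forall>j. AE x in lborel. x \<in> \<Omega> --> \<bar>hh j x\<bar> \<le> N j" by (intro choice allI)
 then obtain N where N: "\<forall>j. AE x in lborel. x \<in> \<Omega> --> \<bar>hh j x\<bar> \<le> N j" by (elim exE)
 have "AE x in lborel. x \<in> \<Omega> --> \<bar>hh j x\<bar> \<le> max (N 1) (N 2)" for j
  using N[rule_format, of j] by eventually_elim (use exhaust_2[of j] in auto)
 then have "\<exists>M. AE x in lborel. x \<in> \<Omega> --> \<bar>f x\<bar> \<le> M"
  by (rule bounded_weak_gradient_imp_bounded[OF ab, of f hh, folded Omega, rotated]) (use hh in blast)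
 then obtain M where M: "AE x in lborel. x \<in> \<Omega> --> \<bar>f x\<bar> \<le> M" by (elim exE)
 have "loc_integrable \<Omega> f" using hh unfolding has_weak_deriv_def by blast
 from bounded_imp_L2[OF U(2,3) loc_integrable_measurable[OF U(1) this] M]
 have f2: "L2_fun (lebesgue_on \<Omega>) f" .
 define m where "m = lebesgue_on \<Omega>"
 have f2: "L2_fun m f" using f2 by (simp add: m_def)
 have p2: "L2_fun m (\<lambda>x. \<rho>s x - \<beta>)" for \<beta> unfolding m_def
  by (rule continuous_imp_L2[OF U(2,3), of "\<lambda>x. h x - \<beta>"]) (use hs in \<open>auto intro!: smooth_continuous_on smooth_diff smooth_const h(1)\<close>)
 have r2: "L2_fun m (\<rho> t)" if "0 \<le> t" for t unfolding m_def by (rule Lspace_ge_4_imp_L2[OF U(2,3) q rho_Lq[OF that]])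
 have r02: "L2_fun m \<rho>0" unfolding m_def by (rule Lspace_ge_4_imp_L2[OF U(2,3) q initial_density])
 (* The part of the expanded square that does not contain the density. *)
 define K where "K \<gamma> \<beta> = 2 * \<gamma> * (\<integral>x. (\<rho>s x - \<beta>) * f x \<partial>m) + \<gamma>^2 * (\<integral>x. (f x)^2 \<partial>m)" for \<gamma> \<beta>
 have expand: "(L2norm \<Omega> (\<lambda>x. R x + \<rho>s x + \<gamma> * f x - \<beta>))^2 = (\<integral>x. (R x + \<rho>s x - \<beta>)^2 \<partial>m) + 2 * \<gamma> * (\<integral>x. R x * f x \<partial>m) + K \<gamma> \<beta>"
  if R: "L2_fun m R" for R \<gamma> \<beta>
 proof -
  have A: "L2_fun m (\<lambda>x. R x + (\<rho>s x - \<beta>))" by (rule L2_fun_add[OF R p2])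
  have i: "integrable m (\<lambda>x. (R x + (\<rho>s x - \<beta>))^2)" "integrable m (\<lambda>x. R x * f x)" "integrable m (\<lambda>x. (\<rho>s x - \<beta>) * f x)" "integrable m (\<lambda>x. (f x)^2)"
   using A f2 L2_mult_integrable[OF R f2] L2_mult_integrable[OF p2 f2] by (auto simp: L2_fun_def)
  have "(L2norm \<Omega> (\<lambda>x. R x + \<rho>s x + \<gamma> * f x - \<beta>))^2
   = (\<integral>x. (R x + (\<rho>s x - \<beta>))^2 + 2 * \<gamma> * (R x * f x) + 2 * \<gamma> * ((\<rho>s x - \<beta>) * f x) + \<gamma>^2 * (f x)^2 \<partial>m)"
   unfolding L2norm_sq m_def by (intro Bochner_Integration.integral_cong refl) (simp add: power2_eq_square algebra_simps)
  also have "\<dots> = (\<integral>x. (R x + (\<rho>s x - \<beta>))^2 \<partial>m) + 2 * \<gamma> * (\<integral>x. R x * f x \<partial>m) + K \<gamma> \<beta>"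
   using i by (simp add: K_def)
  finally show ?thesis by (simp add: add_diff_eq)
 qed
 define J where "J t = (\<integral>x. \<rho> t x * f x \<partial>m)" for t
 define J0 where "J0 = (\<integral>x. \<rho>0 x * f x \<partial>m)"
 define n where "n \<gamma> \<beta> t = (L2norm \<Omega> (\<lambda>x. \<rho> t x + \<rho>s x + \<gamma> * f x - \<beta>))^2" for \<gamma> \<beta> t
 define n0 where "n0 \<gamma> \<beta> = (L2norm \<Omega> (\<lambda>x. \<rho>0 x + \<rho>s x + \<gamma> * f x - \<beta>))^2" for \<gamma> \<beta>
 have key: "n0 \<gamma> \<beta> - n \<gamma> \<beta> t = 2 * \<gamma> * (J0 - J t)" if "0 \<le> t" for t \<gamma> \<beta>
  unfolding n_def n0_def expand[OF r2[OF that]] expand[OF r02] J_def J0_def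
  using cons[OF that, of \<beta>] by (simp add: m_def algebra_simps)
 have diffJ: "(\<integral>x. (\<rho>0 x - \<rho> t x) * f x \<partial>m) = J0 - J t" if "0 \<le> t" for t
  using L2_mult_integrable[OF r02 f2] L2_mult_integrable[OF r2[OF that] f2] by (simp add: J_def J0_def left_diff_distrib)
 have nt: "n \<gamma> \<beta> t = n0 \<gamma> \<beta> - 2 * \<gamma> * (J0 - J t)" if "0 \<le> t" for t \<gamma> \<beta> using key[OF that, of \<gamma> \<beta>] by linarith
 have ev: "\<forall>\<^sub>F t in at_top. (0::real) \<le> t" by (rule eventually_ge_at_top)
 have nJ: "(n \<gamma> \<beta> \<longlongrightarrow> n0 \<gamma> \<beta> - 2 * \<gamma> * J0) at_top \<longleftrightarrow> (J \<longlongrightarrow> 0) at_top" if "0 < \<gamma>" for \<gamma> \<beta>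
 proof
  assume "(J \<longlongrightarrow> 0) at_top"
  then have "((\<lambda>t. n0 \<gamma> \<beta> - 2 * \<gamma> * (J0 - J t)) \<longlongrightarrow> n0 \<gamma> \<beta> - 2 * \<gamma> * (J0 - 0)) at_top" by (intro tendsto_intros)
  then have "((\<lambda>t. n0 \<gamma> \<beta> - 2 * \<gamma> * (J0 - J t)) \<longlongrightarrow> n0 \<gamma> \<beta> - 2 * \<gamma> * J0) at_top" by simp
  then show "(n \<gamma> \<beta> \<longlongrightarrow> n0 \<gamma> \<beta> - 2 * \<gamma> * J0) at_top"
   by (rule Lim_transform_eventually) (rule eventually_mono[OF ev], simp only: nt)
 next
  assume "(n \<gamma> \<beta> \<longlongrightarrow> n0 \<gamma> \<beta> - 2 * \<gamma> * J0) at_top"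
  then have "((\<lambda>t. J0 - (n0 \<gamma> \<beta> - n \<gamma> \<beta> t) / (2 * \<gamma>)) \<longlongrightarrow> J0 - (n0 \<gamma> \<beta> - (n0 \<gamma> \<beta> - 2 * \<gamma> * J0)) / (2 * \<gamma>)) at_top"
   using that by (intro tendsto_intros) auto
  then have "((\<lambda>t. J0 - (n0 \<gamma> \<beta> - n \<gamma> \<beta> t) / (2 * \<gamma>)) \<longlongrightarrow> 0) at_top" using that by simp
  then show "(J \<longlongrightarrow> 0) at_top"
   by (rule Lim_transform_eventually) (rule eventually_mono[OF ev], use that in \<open>simp add: nt\<close>)
 qed
 have part1: "(J \<longlongrightarrow> 0) at_top \<longleftrightarrow> (\<exists>\<gamma>>0. \<exists>\<beta> L. (n \<gamma> \<beta> \<longlongrightarrow> L) at_top \<and> n0 \<gamma> \<beta> - L = 2 * \<gamma> * J0)"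
 proof
  assume "(J \<longlongrightarrow> 0) at_top"
  then have "(n 1 0 \<longlongrightarrow> n0 1 0 - 2 * 1 * J0) at_top" by (subst nJ) auto
  then show "\<exists>\<gamma>>0. \<exists>\<beta> L. (n \<gamma> \<beta> \<longlongrightarrow> L) at_top \<and> n0 \<gamma> \<beta> - L = 2 * \<gamma> * J0"
   by (intro exI[of _ 1] exI[of _ 0] exI[of _ "n0 1 0 - 2 * 1 * J0"] conjI) auto
 next
  assume "\<exists>\<gamma>>0. \<exists>\<beta> L. (n \<gamma> \<beta> \<longlongrightarrow> L) at_top \<and> n0 \<gamma> \<beta> - L = 2 * \<gamma> * J0"
  then obtain \<gamma> \<beta> L where g: "0 < \<gamma>" "(n \<gamma> \<beta> \<longlongrightarrow> L) at_top" "n0 \<gamma> \<beta> - L = 2 * \<gamma> * J0" by blast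
  then have "L = n0 \<gamma> \<beta> - 2 * \<gamma> * J0" by simp
  with g show "(J \<longlongrightarrow> 0) at_top" using nJ by blast
 qed
 have part2: "((\<lambda>t. L2norm \<Omega> (\<lambda>x. \<rho> t x + \<rho>s x - (- \<gamma> * f x + \<beta>))) \<longlongrightarrow> 0) at_top \<longleftrightarrow>
   ((\<lambda>t. 2 * \<gamma> * (\<integral>x. (\<rho>0 x - \<rho> t x) * f x \<partial>m)) \<longlongrightarrow> n0 \<gamma> \<beta>) at_top" for \<gamma> \<beta>
 proof -
  have e: "L2norm \<Omega> (\<lambda>x. \<rho> t x + \<rho>s x - (- \<gamma> * f x + \<beta>)) = sqrt (n \<gamma> \<beta> t)" for t
  proof -
   have "0 \<le> L2norm \<Omega> g" for g by (simp add: L2norm_def)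
   then show ?thesis by (simp add: n_def diff_diff_eq2 algebra_simps)
  qed
  have "((\<lambda>t. L2norm \<Omega> (\<lambda>x. \<rho> t x + \<rho>s x - (- \<gamma> * f x + \<beta>))) \<longlongrightarrow> 0) at_top \<longleftrightarrow> (n \<gamma> \<beta> \<longlongrightarrow> 0) at_top"
   unfolding e
  proof
   assume "((\<lambda>t. sqrt (n \<gamma> \<beta> t)) \<longlongrightarrow> 0) at_top"
   moreover have "(sqrt (n \<gamma> \<beta> t))^2 = n \<gamma> \<beta> t" for t by (simp add: n_def)
   ultimately show "(n \<gamma> \<beta> \<longlongrightarrow> 0) at_top" using tendsto_power[of "\<lambda>t. sqrt (n \<gamma> \<beta> t)" 0 at_top 2] by simp
  next
   assume "(n \<gamma> \<beta> \<longlongrightarrow> 0) at_top"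
   from tendsto_real_sqrt[OF this] show "((\<lambda>t. sqrt (n \<gamma> \<beta> t)) \<longlongrightarrow> 0) at_top" by simp
  qed
  also have "\<dots> \<longleftrightarrow> ((\<lambda>t. n0 \<gamma> \<beta> - n \<gamma> \<beta> t) \<longlongrightarrow> n0 \<gamma> \<beta>) at_top"
  proof
   assume "(n \<gamma> \<beta> \<longlongrightarrow> 0) at_top"
   from tendsto_diff[OF tendsto_const this, of "n0 \<gamma> \<beta>"] show "((\<lambda>t. n0 \<gamma> \<beta> - n \<gamma> \<beta> t) \<longlongrightarrow> n0 \<gamma> \<beta>) at_top" by simp
  next
   assume "((\<lambda>t. n0 \<gamma> \<beta> - n \<gamma> \<beta> t) \<longlongrightarrow> n0 \<gamma> \<beta>) at_top"
   from tendsto_diff[OF tendsto_const this, of "n0 \<gamma> \<beta>"] show "(n \<gamma> \<beta> \<longlongrightarrow> 0) at_top" by simp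
  qed
  also have "\<dots> \<longleftrightarrow> ((\<lambda>t. 2 * \<gamma> * (\<integral>x. (\<rho>0 x - \<rho> t x) * f x \<partial>m)) \<longlongrightarrow> n0 \<gamma> \<beta>) at_top"
   by (rule tendsto_cong) (use ev in \<open>eventually_elim, simp add: key diffJ\<close>)
  finally show ?thesis .
 qed
 show ?thesis
  using part1 part2 unfolding n_def[abs_def] n0_def[abs_def] J_def[abs_def] J0_def m_def by blast
qed

end
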